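(* Let $q$ be a prime power. Let $U_0=1$ and, for $n\ge 1$, let $U_n$ be the number of ordered pairs $(A,B)$ of commuting elements ($AB=BA$) of the Lie algebra of $\mathrm{GU}(n,q)$. Then \[ \sum_{n \geq 0} \frac{U_n u^n}{|\mathrm{GU}(n,q)|} = \prod_{i \geq 1} \prod_{l \geq 0} \frac{1}{1-(-1)^l u^i/q^{l-1}} .\]
   Context: For a matrix $A$ over $\mathbb{F}_{q^2}$, $\bar A$ denotes the matrix obtained by applying $y\mapsto y^q$ to every entry, and $A^{\top}$ the transpose. $\mathrm{GU}(n,q)$ is the group of $n\times n$ matrices $U$ over $\mathbb{F}_{q^2}$ with $U\bar U^{\top}=I$; its Lie algebra is the set of $n\times n$ matrices $A$ over $\mathbb{F}_{q^2}$ with $\bar A^{\top}=-A$. By convention $|\mathrm{GU}(0,q)|=1$. The identity is one of power series in $u$ with real coefficients (the infinite product converging coefficientwise). *)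

theory Defs
  imports
    "Jordan_Normal_Form.Matrix"
    "HOL-Number_Theory.Prime_Powers"
    "HOL-Computational_Algebra.Formal_Power_Series"
begin

text \<open>The field with q^2 elements is a type of class \<^class>\<open>field\<close> and \<^class>\<open>finite\<close>
  whose cardinality is assumed to be q^2 in the theorem.\<close>

definition mat_conj :: "nat \<Rightarrow> 'a::field mat \<Rightarrow> 'a mat" where
  "mat_conj q A = map_mat (\<lambda>y. y ^ q) A"

definition GU :: "nat \<Rightarrow> nat \<Rightarrow> 'a::field mat set" where
  "GU n q = {U \<in> carrier_mat n n. U * transpose_mat (mat_conj q U) = 1\<^sub>m n}"

definition GU_lie :: "nat \<Rightarrow> nat \<Rightarrow> 'a::field mat set" where
  "GU_lie n q = {A \<in> carrier_mat n n. transpose_mat (mat_conj q A) = - A}"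

definition GU_lie_commuting :: "nat \<Rightarrow> nat \<Rightarrow> ('a::field mat \<times> 'a mat) set" where
  "GU_lie_commuting n q = {(A, B). A \<in> GU_lie n q \<and> B \<in> GU_lie n q \<and> A * B = B * A}"

text \<open>Convergence of an unordered infinite product of power series, coefficient by coefficient in
  the usual topology of the reals. The topology that the library puts on \<^typ>\<open>real fps\<close> is the
  X-adic one, in which coefficients must eventually be constant; it is too fine here.\<close>

definition fps_has_prod :: "('i \<Rightarrow> real fps) \<Rightarrow> 'i set \<Rightarrow> real fps \<Rightarrow> bool" where
  "fps_has_prod f I P \<longleftrightarrow>
     (\<forall>n. ((\<lambda>F. fps_nth (\<Prod>x\<in>F. f x) n) \<longlongrightarrow> fps_nth P n) (finite_subsets_at_top I))"

text \<open>There is exactly one 0 by 0 matrix, so the conventions for n = 0 hold automatically.\<close>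

lemma carrier_mat_0_0: "carrier_mat 0 0 = {1\<^sub>m 0 :: 'a::field mat}"
  by (auto intro: eq_matI)

lemma card_GU_0: "card (GU 0 q :: 'a::field mat set) = 1"
proof -
  have "(GU 0 q :: 'a mat set) = {1\<^sub>m 0}"
    unfolding GU_def carrier_mat_0_0 by (auto simp: mat_conj_def intro!: eq_matI)
  thus ?thesis by simp
qed

lemma card_GU_lie_commuting_0:
  "card (GU_lie_commuting 0 q :: ('a::field mat \<times> 'a mat) set) = 1"
proof -
  have "(GU_lie 0 q :: 'a mat set) = {1\<^sub>m 0}"
    unfolding GU_lie_def carrier_mat_0_0 by (auto simp: mat_conj_def intro!: eq_matI)
  hence "(GU_lie_commuting 0 q :: ('a mat \<times> 'a mat) set) = {(1\<^sub>m 0, 1\<^sub>m 0)}"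
    by (auto simp: GU_lie_commuting_def)
  thus ?thesis by simp
qed

end

theory Submission
  imports
    Defs
    "HOL-Number_Theory.Residues"
    "HOL-Library.Cardinality"
    "HOL-Analysis.Analysis"
    "HOL-Computational_Algebra.Polynomial_Factorial"
begin

text \<open>
  Choose \<open>b\<close> in the large field with \<open>b\<^sup>q \<noteq> b\<close>. After scaling, the Lie algebra consists of the Hermitian
  matrices. Splitting a commuting Hermitian pair \<open>(A, B)\<close> by the Fitting decomposition of
  \<open>(A - b) (A - b\<^sup>q)\<close> factors the generating function. In the part where this is nilpotent the space
  is the sum of two dual totally isotropic subspaces, so one counts commuting pairs over the general linear
  group with a nilpotent first entry. In the part where it is invertible the Cayley transform turns \<open>A\<close>
  into a unitary \<open>X\<close> without eigenvalue 1, and such pairs \<open>(X, B)\<close> are what remains of all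
  commuting pairs of a unitary and a Hermitian matrix once \<open>X - 1\<close> nilpotent is split off.

  By Burnside's lemma the latter pairs count the orbits of the unitary group on Hermitian
  matrices. These orbits are similarity classes: if \<open>S A\<^sub>1 = A\<^sub>2 S\<close>, then \<open>h = S\<^sup>* S\<close> commutes with \<open>A\<^sub>1\<close>,
  and \<open>h = z\<^sup>* z\<close> has a solution in the bicommutant of \<open>h\<close> by a Hilbert 90 argument, so that \<open>S z\<^sup>-\<^sup>1\<close>
  is unitary. Classes correspond to chains of monic polynomials, each dividing the next, with
  coefficients in the small field.

  Nilpotent pairs are counted for an abstract ring of matrices with involution, which covers
  the unitary and the general linear case at once.
\<close>

section \<open>Infinite matrices with finite rows and columns\<close>

text \<open>Burnside needs a group action, and two commuting Hermitian matrices offer none, so one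
  entry has to move into the unitary group. The Cayley transform \<open>(A - b) / (A - b^q)\<close>
  does this with two defects: it is undefined when \<open>b^q\<close> is an eigenvalue of
  \<open>A\<close>, and it never has the eigenvalue 1. The defects are the series \<open>CN\<close>
  and \<open>DN\<close>, and \<open>CC * DN = CN * DD\<close>, where only \<open>DD\<close> involves
  similarity classes. \<open>DN\<close> is again a count of nilpotent Hermitian pairs, by a second
  Cayley transform whose constant sends 0 to 1. The nilpotent count passes from
  \<open>A = i * st i\<close> to \<open>st i * i\<close>, the restriction of \<open>A\<close> to its
  image. The size drops to the rank, and the resulting recursion in the nullity is solved by a
  product of series in \<open>X ^ i\<close>. The classes satisfy the same kind of recursion, in the
  degree of the minimal polynomial. The characteristic may be 2 and the field as small as F_4, so
  nothing divides by 2 or picks many scalars: an element of trace one replaces 1/2, and dimensions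
  are compared by counting vectors.\<close>

typedef (overloaded) 'a fmat = "{f :: nat => nat => 'a::zero. (\<forall>i. finite {j. f i j ~= 0}) \<and> (\<forall>j. finite {i. f i j ~= 0})}"
  morphisms ent Fmat
  by (rule exI[of _ "\<lambda>_ _. 0"]) simp

setup_lifting type_definition_fmat

lemma ent_finite_row [simp]: "finite {j. ent X i j ~= 0}"
  and ent_finite_col [simp]: "finite {i. ent X i j ~= 0}"
  using ent[of X] by auto

lemma fmat_eqI: "(\<And>i j. ent X i j = ent Y i j) ==> X = Y"
  by (metis ent_inject ext)

instantiation fmat :: (ring_1) ring_1
begin

lift_definition zero_fmat :: "'a fmat" is "\<lambda>_ _. 0" by simp

lift_definition one_fmat :: "'a fmat" is "\<lambda>i j. if i = j then 1 else 0" by simp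

lift_definition uminus_fmat :: "'a fmat => 'a fmat" is "\<lambda>f i j. - f i j" by simp

lift_definition plus_fmat :: "'a fmat => 'a fmat => 'a fmat" is "\<lambda>f g i j. f i j + g i j"
proof -
  fix f g :: "nat => nat => 'a"
  assume "(\<forall>i. finite {j. f i j ~= 0}) \<and> (\<forall>j. finite {i. f i j ~= 0})"
    "(\<forall>i. finite {j. g i j ~= 0}) \<and> (\<forall>j. finite {i. g i j ~= 0})"
  moreover have "{j. f i j + g i j ~= 0} \<subseteq> {j. f i j ~= 0} \<union> {j. g i j ~= 0}"
    "{i. f i j + g i j ~= 0} \<subseteq> {i. f i j ~= 0} \<union> {i. g i j ~= 0}" for i j
    by auto
  ultimately show "(\<forall>i. finite {j. f i j + g i j ~= 0}) \<and> (\<forall>j. finite {i. f i j + g i j ~= 0})"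
    by (meson finite_Un finite_subset)
qed

definition minus_fmat :: "'a fmat => 'a fmat => 'a fmat" where
  "minus_fmat X Y = X + (- Y)"

lift_definition times_fmat :: "'a fmat => 'a fmat => 'a fmat" is
  "\<lambda>f g i j. \<Sum>k\<in>{k. f i k ~= 0}. f i k * g k j"
proof (intro conjI allI, goal_cases)
  case (1 f g i)
  have "{j. (\<Sum>k\<in>{k. f i k ~= 0}. f i k * g k j) ~= 0} \<subseteq> (\<Union>k\<in>{k. f i k ~= 0}. {j. g k j ~= 0})"
  proof
    fix j assume "j \<in> {j. (\<Sum>k\<in>{k. f i k ~= 0}. f i k * g k j) ~= 0}"
    then obtain k where "f i k ~= 0" "f i k * g k j ~= 0" by (auto elim: sum.not_neutral_contains_not_neutral)
    then have "f i k ~= 0" "g k j ~= 0" by auto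
    then show "j \<in> (\<Union>k\<in>{k. f i k ~= 0}. {j. g k j ~= 0})" by blast
  qed
  with 1 show ?case by (meson finite_UN_I finite_subset)
next
  case (2 f g j)
  have "{i. (\<Sum>k\<in>{k. f i k ~= 0}. f i k * g k j) ~= 0} \<subseteq> (\<Union>k\<in>{k. g k j ~= 0}. {i. f i k ~= 0})"
  proof
    fix i assume "i \<in> {i. (\<Sum>k\<in>{k. f i k ~= 0}. f i k * g k j) ~= 0}"
    then obtain k where "f i k ~= 0" "f i k * g k j ~= 0" by (auto elim: sum.not_neutral_contains_not_neutral)
    then have "f i k ~= 0" "g k j ~= 0" by auto
    then show "i \<in> (\<Union>k\<in>{k. g k j ~= 0}. {i. f i k ~= 0})" by blast
  qed
  with 2 show ?case by (meson finite_UN_I finite_subset)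
qed

lemma ent_times: "finite S ==> {k. ent X i k ~= 0} \<subseteq> S ==> ent (X * Y) i j = (\<Sum>k\<in>S. ent X i k * ent Y k j)"
  unfolding times_fmat.rep_eq by (rule sum.mono_neutral_left) auto

lemma ent_times': "ent (X * Y) i j = (\<Sum>k\<in>{k. ent Y k j ~= 0}. ent X i k * ent Y k j)"
proof -
  have "ent (X * Y) i j = (\<Sum>k\<in>{k. ent X i k ~= 0} \<union> {k. ent Y k j ~= 0}. ent X i k * ent Y k j)"
    by (rule ent_times) auto
  also have "... = (\<Sum>k\<in>{k. ent Y k j ~= 0}. ent X i k * ent Y k j)"
    by (rule sum.mono_neutral_right) auto
  finally show ?thesis .
qed

instance
proof
  fix X Y Z :: "'a fmat"
  show "X + Y + Z = X + (Y + Z)" "X + Y = Y + X" "0 + X = X" "- X + X = 0" "X - Y = X + - Y"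
    by (auto intro!: fmat_eqI simp: plus_fmat.rep_eq zero_fmat.rep_eq uminus_fmat.rep_eq minus_fmat_def)
  show "X * Y * Z = X * (Y * Z)"
  proof (rule fmat_eqI)
    fix i j
    have "ent (X * Y * Z) i j = (\<Sum>l\<in>{l. ent Z l j ~= 0}. (\<Sum>k\<in>{k. ent X i k ~= 0}. ent X i k * ent Y k l) * ent Z l j)"
      by (simp add: ent_times'[of "X * Y"] times_fmat.rep_eq[of X])
    also have "... = (\<Sum>k\<in>{k. ent X i k ~= 0}. \<Sum>l\<in>{l. ent Z l j ~= 0}. ent X i k * (ent Y k l * ent Z l j))"
      by (subst sum.swap) (simp add: sum_distrib_right mult.assoc)
    also have "... = (\<Sum>k\<in>{k. ent X i k ~= 0}. ent X i k * ent (Y * Z) k j)"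
      by (simp add: ent_times'[of Y] sum_distrib_left)
    also have "... = ent (X * (Y * Z)) i j"
      by (simp add: times_fmat.rep_eq[of X])
    finally show "ent (X * Y * Z) i j = ent (X * (Y * Z)) i j" .
  qed
  show "(X + Y) * Z = X * Z + Y * Z"
    by (rule fmat_eqI) (simp add: ent_times' plus_fmat.rep_eq distrib_right sum.distrib)
  show "X * (Y + Z) = X * Y + X * Z"
    by (rule fmat_eqI) (simp add: times_fmat.rep_eq plus_fmat.rep_eq distrib_left sum.distrib)
  show "1 * X = X"
    by (rule fmat_eqI) (simp add: times_fmat.rep_eq one_fmat.rep_eq)
  show "X * 1 = X"
    by (rule fmat_eqI) (simp add: ent_times' one_fmat.rep_eq)
  have "ent (0::'a fmat) 0 0 ~= ent (1::'a fmat) 0 0"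
    by (simp add: one_fmat.rep_eq zero_fmat.rep_eq)
  then show "(0::'a fmat) ~= 1" by metis
qed

end

lemma ent_minus [simp]: "ent (X - Y) i j = ent X i j - ent Y i j"
  by (simp only: minus_fmat_def plus_fmat.rep_eq uminus_fmat.rep_eq diff_conv_add_uminus)

lemmas ent_simps [simp] = zero_fmat.rep_eq one_fmat.rep_eq plus_fmat.rep_eq uminus_fmat.rep_eq

lemma ent_sum [simp]: "ent (\<Sum>x\<in>A. f x) i j = (\<Sum>x\<in>A. ent (f x) i j)"
  by (induction A rule: infinite_finite_induct) auto

lift_definition sc :: "'a::ring_1 => 'a fmat" is "\<lambda>c i j. if i = j then c else 0" by simp

lift_definition eid :: "nat => 'a::ring_1 fmat" is "\<lambda>n i j. if i = j \<and> i < n then 1 else 0" by simp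

lift_definition munit :: "nat => nat => 'a::ring_1 fmat" is "\<lambda>a b i j. if i = a \<and> j = b then 1 else 0" by simp

text \<open>The guard on zero entries keeps the supports finite for every \<open>c\<close>, even one
  with \<open>c 0 ~= 0\<close>, so that the lifting goes through for an arbitrary function.\<close>

lift_definition ctrans :: "('a::zero => 'b::zero) => 'a fmat => 'b fmat"
  is "\<lambda>c f i j. if f j i = 0 then 0 else c (f j i)"
proof -
  fix c :: "'a => 'b" and f :: "nat => nat => 'a"
  assume f: "(\<forall>i. finite {j. f i j ~= 0}) \<and> (\<forall>j. finite {i. f i j ~= 0})"
  have "{i. (if f j i = 0 then 0 else c (f j i)) ~= 0} \<subseteq> {i. f j i ~= 0}"
    "{j. (if f j i = 0 then 0 else c (f j i)) ~= 0} \<subseteq> {j. f j i ~= 0}" for i j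
    by auto
  with f show "(\<forall>i. finite {j. (if f j i = 0 then 0 else c (f j i)) ~= 0}) \<and> (\<forall>j. finite {i. (if f j i = 0 then 0 else c (f j i)) ~= 0})"
    by (meson finite_subset)
qed

lemma ent_sc_mult [simp]: "ent (sc c * X) i j = c * ent X i j"
proof -
  have "ent (sc c * X) i j = (\<Sum>k\<in>{i}. ent (sc c) i k * ent X k j)"
    by (rule ent_times) (auto simp: sc.rep_eq)
  then show ?thesis by (simp add: sc.rep_eq)
qed

lemma ent_mult_sc [simp]: "ent (X * sc c) i j = ent X i j * c"
proof -
  have "ent (X * sc c) i j = (\<Sum>k\<in>{k. ent X i k ~= 0}. ent X i k * ent (sc c) k j)"
    by (rule ent_times) auto
  also have "... = (\<Sum>k\<in>{k. ent X i k ~= 0}. if k = j then ent X i k * c else 0)"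
    by (rule sum.cong) (auto simp: sc.rep_eq)
  finally show ?thesis by simp
qed

lemma ent_eid_mult [simp]: "ent (eid n * X) i j = (if i < n then ent X i j else 0)"
proof -
  have "ent (eid n * X) i j = (\<Sum>k\<in>{i}. ent (eid n) i k * ent X k j)"
    by (rule ent_times) (auto simp: eid.rep_eq)
  then show ?thesis by (simp add: eid.rep_eq)
qed

lemma ent_mult_eid [simp]: "ent (X * eid n) i j = (if j < n then ent X i j else 0)"
proof -
  have "ent (X * eid n) i j = (\<Sum>k\<in>{k. ent X i k ~= 0}. ent X i k * ent (eid n) k j)"
    by (rule ent_times) auto
  also have "... = (\<Sum>k\<in>{k. ent X i k ~= 0}. if k = j then (if j < n then ent X i j else 0) else 0)"
    by (rule sum.cong) (auto simp: eid.rep_eq)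
  finally show ?thesis by (auto simp: )
qed

lemma sc_commute: "sc (c::'a::comm_ring_1) * X = X * sc c"
  by (rule fmat_eqI) (simp add: mult.commute)

lemma sc_add: "sc (a + b) = sc a + sc b"
  and sc_0 [simp]: "sc 0 = 0" and sc_1 [simp]: "sc 1 = 1"
  and sc_minus: "sc (- a) = - sc a" and sc_diff: "sc (a' - b') = sc a' - sc b'"
  by (auto intro!: fmat_eqI simp: sc.rep_eq)

lemma sc_mult: "sc (a * b) = sc a * sc b"
  by (rule fmat_eqI) (simp add: sc.rep_eq)

lemma eid_mult: "eid n * eid m = eid (min n m)"
  by (rule fmat_eqI) (simp add: eid.rep_eq)

lemma eid_0 [simp]: "eid 0 = 0"
  by (rule fmat_eqI) (simp add: eid.rep_eq)

text \<open>Rectangular matrices are corners of one ring: an n by m matrix is an infinite matrix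
  supported in the top left block, cut out by the idempotents \<open>eid n\<close> and
  \<open>eid m\<close>. All shapes then share one type of class \<open>ring_1\<close>, and ring
  normalisation applies to products of different sizes.\<close>

definition MM :: "nat => nat => 'a::ring_1 fmat set" where
  "MM n m = {X. eid n * X = X \<and> X * eid m = X}"

lemma MM_iff: "X \<in> MM n m \<longleftrightarrow> (\<forall>i j. ent X i j ~= 0 \<longrightarrow> i < n \<and> j < m)"
proof
  assume "X \<in> MM n m"
  then have "eid n * X = X" "X * eid m = X" by (auto simp: MM_def)
  then show "\<forall>i j. ent X i j ~= 0 \<longrightarrow> i < n \<and> j < m"
    by (metis ent_eid_mult ent_mult_eid)
next
  assume *: "\<forall>i j. ent X i j ~= 0 \<longrightarrow> i < n \<and> j < m"
  show "X \<in> MM n m"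
    unfolding MM_def by (auto intro!: fmat_eqI) (use * in metis)+
qed

lemma ent_times_MM: "X \<in> MM n m ==> ent (X * Y) i j = (\<Sum>k<m. ent X i k * ent Y k j)"
  by (rule ent_times) (auto simp: MM_iff)

definition of_fun :: "nat => nat => (nat => nat => 'a::ring_1) => 'a fmat" where
  "of_fun n m f = Fmat (\<lambda>i j. if i < n \<and> j < m then f i j else 0)"

lemma ent_of_fun [simp]: "ent (of_fun n m f) i j = (if i < n \<and> j < m then f i j else 0)"
proof -
  have "{j. (if i < n \<and> j < m then f i j else 0) ~= 0} \<subseteq> {..<m}"
    "{i. (if i < n \<and> j < m then f i j else 0) ~= 0} \<subseteq> {..<n}" for i j
    by auto
  then have "(\<lambda>i j. if i < n \<and> j < m then f i j else 0) \<in> {f. (\<forall>i. finite {j. f i j ~= 0}) \<and> (\<forall>j. finite {i. f i j ~= 0})}"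
    by (auto intro: finite_subset)
  then show ?thesis by (simp add: of_fun_def Fmat_inverse)
qed

lemma of_fun_MM [simp]: "of_fun n m f \<in> MM n m"
  by (auto simp: MM_iff)

lemma of_fun_ent: "X \<in> MM n m ==> of_fun n m (ent X) = X"
  by (rule fmat_eqI) (auto simp: MM_iff)

lemma bij_betw_MM:
  "bij_betw (\<lambda>g. of_fun n m (\<lambda>i j. g (i, j))) (({..<n} \<times> {..<m}) \<rightarrow>\<^sub>E (UNIV :: 'a::ring_1 set)) (MM n m)"
proof (rule bij_betw_byWitness[where f' = "\<lambda>X. restrict (\<lambda>(i, j). ent X i j) ({..<n} \<times> {..<m})"])
  show "\<forall>a\<in>({..<n} \<times> {..<m}) \<rightarrow>\<^sub>E (UNIV :: 'a set).
     restrict (\<lambda>(i, j). ent (of_fun n m (\<lambda>i j. a (i, j))) i j) ({..<n} \<times> {..<m}) = a"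
    by (auto simp: PiE_def extensional_def restrict_def fun_eq_iff)
  show "\<forall>X\<in>MM n m. of_fun n m (\<lambda>i j. restrict (\<lambda>(i, j). ent X i j) ({..<n} \<times> {..<m}) (i, j)) = X"
    by (fastforce intro!: fmat_eqI simp: MM_iff)
qed (auto split: if_splits)

lemma finite_MM [simp, intro]: "finite (MM n m :: 'a::{ring_1,finite} fmat set)"
  and card_MM: "card (MM n m :: 'a::{ring_1,finite} fmat set) = CARD('a) ^ (n * m)"
proof -
  have "finite (({..<n} \<times> {..<m}) \<rightarrow>\<^sub>E (UNIV :: 'a set))"
    by (intro finite_PiE) auto
  then show "finite (MM n m :: 'a::{ring_1,finite} fmat set)"
    using bij_betw_finite[OF bij_betw_MM[of n m]] by metis
  show "card (MM n m :: 'a::{ring_1,finite} fmat set) = CARD('a) ^ (n * m)"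
    using bij_betw_same_card[OF bij_betw_MM[of n m], symmetric]
    by (simp add: card_PiE card_cartesian_product)
qed

lemma sum_mult_munit: "ent (X * munit a b) i j = (if j = b then ent X i a else 0)"
proof -
  have "ent (X * munit a b) i j = (\<Sum>k\<in>{k. ent X i k ~= 0}. ent X i k * ent (munit a b) k j)"
    by (rule ent_times) auto
  also have "... = (\<Sum>k\<in>{k. ent X i k ~= 0}. if k = a then (if j = b then ent X i a else 0) else 0)"
    by (rule sum.cong) (auto simp: munit.rep_eq)
  finally show ?thesis by auto
qed

lemma munit_mult: "ent (munit a b * X) i j = (if i = a then ent X b j else 0)"
proof -
  have "ent (munit a b * X) i j = (\<Sum>k\<in>{b}. ent (munit a b) i k * ent X k j)"
    by (rule ent_times) (auto simp: munit.rep_eq)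
  then show ?thesis by (auto simp: munit.rep_eq)
qed

section \<open>Products of power series\<close>

text \<open>Congruence modulo \<open>X ^ (N + 1)\<close>; identities between infinite products are
  checked for every \<open>N\<close>.\<close>

definition eqv :: "nat => 'a::zero fps => 'a fps => bool" where
  "eqv N f g \<longleftrightarrow> (\<forall>n\<le>N. fps_nth f n = fps_nth g n)"

lemma eqv_refl [simp]: "eqv N f f"
  and eqv_sym: "eqv N f g ==> eqv N g f"
  and eqv_trans [trans]: "eqv N f g ==> eqv N g h ==> eqv N f h"
  by (auto simp: eqv_def)

lemma eqv_mult:
  fixes f g :: "'a::comm_ring_1 fps"
  assumes "eqv N f f'" "eqv N g g'"
  shows "eqv N (f * g) (f' * g')"
  using assms by (auto simp: eqv_def fps_mult_nth intro!: sum.cong)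

lemma eqv_1_mult:
  fixes f g :: "'a::comm_ring_1 fps"
  assumes "eqv N g 1"
  shows "eqv N (f * g) f"
  using eqv_mult[OF eqv_refl assms, of f] by simp

lemma eqv_sum:
  fixes f g :: "'b => 'a::comm_ring_1 fps"
  assumes "\<And>x. x \<in> A ==> eqv N (f x) (g x)"
  shows "eqv N (sum f A) (sum g A)"
  using assms by (auto simp: eqv_def fps_sum_nth intro!: sum.cong)

text \<open>The product of \<open>W(X ^ i)\<close> over all \<open>i \<ge> 1\<close>. If
  \<open>W\<close> has constant term 1, the factors with \<open>i > N\<close> do not influence
  coefficient \<open>N\<close>, which is therefore read off a product that stops at
  \<open>N\<close>.\<close>

definition iprod :: "real fps => real fps" where
  "iprod W = Abs_fps (\<lambda>N. fps_nth (\<Prod>i=1..N. W oo fps_X ^ i) N)"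

lemma fps_nth_compose_X_power:
  fixes f :: "'a::comm_ring_1 fps"
  assumes "k > 0"
  shows "fps_nth (f oo fps_X ^ k) n = (if k dvd n then fps_nth f (n div k) else 0)"
proof -
  have "fps_nth (f oo fps_X ^ k) n = (\<Sum>i=0..n. if n = k * i then fps_nth f i else 0)"
    by (auto simp: fps_compose_nth power_mult[symmetric] fps_X_power_nth intro!: sum.cong)
  also have "... = (if k dvd n then fps_nth f (n div k) else 0)"
  proof (cases "k dvd n")
    case True
    then obtain m where m: "n = k * m" by blast
    have "m \<le> n" and *: "n = k * i \<longleftrightarrow> i = m" for i using m assms by auto
    have "n div k = m" using m assms by simp
    with \<open>m \<le> n\<close> True show ?thesis unfolding * by simp
  qed (auto intro!: sum.neutral)
  finally show ?thesis .
qed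

lemma eqv_compose_X_power:
  fixes W :: "'a::comm_ring_1 fps"
  assumes "fps_nth W 0 = 1" "N < i"
  shows "eqv N (W oo fps_X ^ i) 1"
  unfolding eqv_def
proof (intro allI impI)
  fix n assume "n \<le> N"
  with assms have "i dvd n \<longleftrightarrow> n = 0" "i > 0" by (auto dest: dvd_imp_le)
  then show "fps_nth (W oo fps_X ^ i) n = fps_nth 1 n"
    using assms by (simp add: fps_nth_compose_X_power)
qed

lemma eqv_iprod:
  assumes W: "fps_nth W 0 = 1" and "N \<le> M"
  shows "eqv N (iprod W) (\<Prod>i=1..M. W oo fps_X ^ i)"
proof -
  have *: "eqv n (\<Prod>i=1..n + k. W oo fps_X ^ i) (\<Prod>i=1..n. W oo fps_X ^ i)" for n k
  proof (induction k)
    case (Suc k)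
    have "eqv n ((\<Prod>i=1..n + k. W oo fps_X ^ i) * (W oo fps_X ^ (Suc (n + k)))) (\<Prod>i=1..n + k. W oo fps_X ^ i)"
      by (intro eqv_1_mult eqv_compose_X_power W) simp
    from eqv_trans[OF this Suc.IH] show ?case by simp
  qed simp
  show ?thesis
    unfolding eqv_def
  proof (intro allI impI)
    fix n assume "n \<le> N"
    then have "M = n + (M - n)" using assms by simp
    with *[of n "M - n"] show "fps_nth (iprod W) n = fps_nth (\<Prod>i=1..M. W oo fps_X ^ i) n"
      by (auto simp: iprod_def eqv_def)
  qed
qed

lemma fps_eq_eqv: "(\<And>N. eqv N f g) ==> f = g"
  by (auto simp: eqv_def fps_eq_iff)

lemma iprod_nth_0: "fps_nth (iprod W) 0 = 1"
  by (simp add: iprod_def)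

lemma iprod_mult:
  assumes "fps_nth V 0 = 1" "fps_nth W 0 = 1"
  shows "iprod (V * W) = iprod V * iprod W"
proof (rule fps_eq_eqv)
  fix N
  have "eqv N (iprod (V * W)) (\<Prod>i=1..N. (V * W) oo fps_X ^ i)"
    by (intro eqv_iprod) (use assms in auto)
  also have "(\<Prod>i=1..N. (V * W) oo fps_X ^ i) = (\<Prod>i=1..N. V oo fps_X ^ i) * (\<Prod>i=1..N. W oo fps_X ^ i)"
    by (simp add: prod.distrib[symmetric] fps_compose_mult_distrib)
  finally show "eqv N (iprod (V * W)) (iprod V * iprod W)"
    using eqv_mult[OF eqv_iprod[OF assms(1)] eqv_iprod[OF assms(2)], of N N]
    by (meson eqv_sym eqv_trans order_refl)
qed

lemma compose_X_power_swap:
  fixes f :: "'a::comm_ring_1 fps"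
  assumes "k > 0" "i > 0"
  shows "(f oo fps_X ^ i) oo fps_X ^ k = (f oo fps_X ^ k) oo fps_X ^ i"
proof (rule fps_ext)
  fix n
  have "a dvd n \<and> b dvd n div a \<longleftrightarrow> b * a dvd n" if "a > 0" for a b :: nat
    using that by (auto simp: dvd_div_iff_mult dest: dvd_mult_right)
  from this[of k i] this[of i k] have *: "k dvd n \<and> i dvd n div k \<longleftrightarrow> i dvd n \<and> k dvd n div i"
    using assms by (simp add: mult.commute)
  have "fps_nth ((f oo fps_X ^ i) oo fps_X ^ k) n
    = (if k dvd n \<and> i dvd n div k then fps_nth f (n div (k * i)) else 0)"
    using assms by (simp add: fps_nth_compose_X_power div_mult2_eq)
  also have "... = fps_nth ((f oo fps_X ^ k) oo fps_X ^ i) n"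
    unfolding * using assms by (simp add: fps_nth_compose_X_power div_mult2_eq mult.commute[of k i])
  finally show "fps_nth ((f oo fps_X ^ i) oo fps_X ^ k) n = fps_nth ((f oo fps_X ^ k) oo fps_X ^ i) n" .
qed

lemma iprod_compose:
  assumes W: "fps_nth W 0 = 1" and k: "k > 0"
  shows "iprod (W oo fps_X ^ k) = iprod W oo fps_X ^ k"
proof (rule fps_eq_eqv)
  fix N
  have *: "(\<Prod>i=1..N. V i) oo fps_X ^ k = (\<Prod>i=1..N. V i oo fps_X ^ k)" for V :: "nat => real fps" and N
    using k by (induction N) (simp_all add: fps_compose_mult_distrib)
  have "eqv N (iprod W oo fps_X ^ k) ((\<Prod>i=1..N. W oo fps_X ^ i) oo fps_X ^ k)"
    unfolding eqv_def
  proof (intro allI impI)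
    fix n assume "n \<le> N"
    then have "n div k \<le> N" by (meson div_le_dividend order_trans)
    then show "fps_nth (iprod W oo fps_X ^ k) n = fps_nth ((\<Prod>i=1..N. W oo fps_X ^ i) oo fps_X ^ k) n"
      using eqv_iprod[OF W order_refl, of N] k by (simp add: eqv_def fps_nth_compose_X_power del: One_nat_def)
  qed
  also have "(\<Prod>i=1..N. W oo fps_X ^ i) oo fps_X ^ k = (\<Prod>i=1..N. (W oo fps_X ^ k) oo fps_X ^ i)"
    unfolding * by (intro prod.cong) (use k in \<open>auto intro!: compose_X_power_swap\<close>)
  finally have "eqv N (iprod W oo fps_X ^ k) (\<Prod>i=1..N. (W oo fps_X ^ k) oo fps_X ^ i)" .
  moreover have "eqv N (iprod (W oo fps_X ^ k)) (\<Prod>i=1..N. (W oo fps_X ^ k) oo fps_X ^ i)"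
    by (rule eqv_iprod) (use W in \<open>simp_all add: fps_nth_compose_X_power\<close>)
  ultimately show "eqv N (iprod (W oo fps_X ^ k)) (iprod W oo fps_X ^ k)"
    by (meson eqv_sym eqv_trans)
qed

text \<open>With \<open>T i = \<Sum>k. c k * X ^ (i * k)\<close> the recursion says \<open>T i = W(X ^ (i + 1)) * T (i + 1)\<close>.\<close>

lemma iprod_recursion:
  fixes c :: "nat => real fps" and w :: "nat => real"
  assumes w: "w 0 = 1"
    and c: "\<And>k. k > 0 ==> c k = fps_X ^ k * (\<Sum>j\<le>k. fps_const (w (k - j)) * c j)"
    and S: "\<And>N. fps_nth S N = (\<Sum>k\<le>N. fps_nth (c k) N)"
  shows "S = c 0 * iprod (Abs_fps w)"
proof (rule fps_eq_eqv)
  fix N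
  define W where "W = Abs_fps w"
  define T where "T i = (\<Sum>k\<le>N. c k * fps_X ^ (i * k))" for i
  have c': "c k = fps_X ^ k * (\<Sum>j\<le>k. fps_const (w (k - j)) * c j)" for k
    using c[of k] w by (cases "k = 0") (auto simp: )
  have small: "eqv N (fps_X ^ k * f) 0" if "k > N" for k and f :: "real fps"
    using that by (auto simp: eqv_def fps_X_power_mult_nth)
  have S_eqv: "eqv N S (T 0)"
    unfolding eqv_def
  proof (intro allI impI)
    fix n assume n: "n \<le> N"
    have "fps_nth (T 0) n = (\<Sum>k\<le>N. fps_nth (c k) n)"
      by (simp add: T_def fps_sum_nth)
    also have "... = (\<Sum>k\<le>n. fps_nth (c k) n)"
    proof (rule sum.mono_neutral_right)
      show "\<forall>k\<in>{..N} - {..n}. fps_nth (c k) n = 0"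
        by (subst c') (auto simp: fps_X_power_mult_nth)
    qed (use n in auto)
    finally show "fps_nth S n = fps_nth (T 0) n" by (simp add: S)
  qed
  have step: "eqv N (T i) ((W oo fps_X ^ Suc i) * T (Suc i))" for i
  proof -
    define V where "V = (\<Sum>m\<le>N. fps_const (w m) * fps_X ^ (Suc i * m))"
    have "eqv N (W oo fps_X ^ Suc i) V"
      unfolding eqv_def
    proof (intro allI impI)
      fix n assume n: "n \<le> N"
      have "fps_nth V n = (\<Sum>m\<le>N. if n = Suc i * m then w m else 0)"
        by (auto simp: V_def fps_sum_nth fps_X_power_nth intro!: sum.cong)
      also have "... = (if Suc i dvd n then w (n div Suc i) else 0)"
      proof (cases "Suc i dvd n")
        case True
        then obtain m where m: "n = Suc i * m" by blast
        have "m \<le> N" using n m by (metis le_trans mult_le_mono1 nat_mult_1 One_nat_def Suc_leI zero_less_Suc)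
        have *: "(n = Suc i * m') = (m' = m)" for m' unfolding m by (metis nat_mult_eq_cancel1 zero_less_Suc)
        have "n div Suc i = m" unfolding m by (rule nonzero_mult_div_cancel_left) simp
        with True \<open>m \<le> N\<close> show ?thesis unfolding * by simp
      next
        case False
        then have "n ~= Suc i * m" for m by (metis dvd_triv_left)
        with False show ?thesis by (simp del: mult_Suc)
      qed
      finally show "fps_nth (W oo fps_X ^ Suc i) n = fps_nth V n"
        by (simp add: fps_nth_compose_X_power W_def del: power_Suc)
    qed
    then have "eqv N ((W oo fps_X ^ Suc i) * T (Suc i)) (V * T (Suc i))"
      by (intro eqv_mult) auto
    also have "V * T (Suc i) = (\<Sum>m\<le>N. \<Sum>j\<le>N. fps_X ^ (Suc i * (m + j)) * (fps_const (w m) * c j))"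
      unfolding V_def T_def sum_product by (intro sum.cong refl) (simp add: algebra_simps power_add)
    also have "... = (\<Sum>(m, j)\<in>{..N} \<times> {..N}. fps_X ^ (Suc i * (m + j)) * (fps_const (w m) * c j))"
      by (simp add: sum.cartesian_product)
    also have "... = (\<Sum>(m, j)\<in>{(m, j). m + j \<le> N}. fps_X ^ (Suc i * (m + j)) * (fps_const (w m) * c j)) +
       (\<Sum>(m, j)\<in>{..N} \<times> {..N} - {(m, j). m + j \<le> N}. fps_X ^ (Suc i * (m + j)) * (fps_const (w m) * c j))"
      by (subst sum.subset_diff[where B = "{(m, j). m + j \<le> N}" and A = "{..N} \<times> {..N}"]) (auto simp: add.commute)
    also have "eqv N ... (\<Sum>(m, j)\<in>{(m, j). m + j \<le> N}. fps_X ^ (Suc i * (m + j)) * (fps_const (w m) * c j))"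
    proof -
      have "eqv N (\<Sum>(m, j)\<in>{..N} \<times> {..N} - {(m, j). m + j \<le> N}. fps_X ^ (Suc i * (m + j)) * (fps_const (w m) * c j))
        (\<Sum>(m, j)\<in>{..N} \<times> {..N} - {(m, j). m + j \<le> N}. 0)"
      proof (rule eqv_sum)
        fix x assume x: "x \<in> {..N} \<times> {..N} - {(m, j). m + j \<le> N}"
        obtain m j where mj: "x = (m, j)" by (cases x)
        with x have "N < Suc i * (m + j)" by (simp add: trans_less_add1)
        then show "eqv N (case x of (m, j) => fps_X ^ (Suc i * (m + j)) * (fps_const (w m) * c j)) (case x of (m, j) => 0)"
          unfolding mj prod.case by (rule small)
      qed
      then show ?thesis by (auto simp: eqv_def)
    qed
    also have "(\<Sum>(m, j)\<in>{(m, j). m + j \<le> N}. fps_X ^ (Suc i * (m + j)) * (fps_const (w m) * c j))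
      = (\<Sum>(k, j)\<in>(SIGMA k:{..N}. {..k}). fps_X ^ (Suc i * k) * (fps_const (w (k - j)) * c j))"
      by (rule sum.reindex_bij_witness[where j = "\<lambda>(m, j). (m + j, j)" and i = "\<lambda>(k, j). (k - j, j)"]) auto
    also have "... = (\<Sum>k\<le>N. \<Sum>j\<le>k. fps_X ^ (Suc i * k) * (fps_const (w (k - j)) * c j))"
      by (simp add: sum.Sigma)
    also have "... = (\<Sum>k\<le>N. (fps_X ^ k * (\<Sum>j\<le>k. fps_const (w (k - j)) * c j)) * fps_X ^ (i * k))"
      by (simp add: sum_distrib_left sum_distrib_right power_add algebra_simps)
    also have "... = T i" by (simp add: c'[symmetric] T_def)
    finally show ?thesis by (rule eqv_sym)
  qed
  have "eqv N (T 0) ((\<Prod>i=1..I. W oo fps_X ^ i) * T I)" for I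
  proof (induction I)
    case (Suc I)
    have "eqv N ((\<Prod>i=1..I. W oo fps_X ^ i) * T I) ((\<Prod>i=1..I. W oo fps_X ^ i) * ((W oo fps_X ^ Suc I) * T (Suc I)))"
      by (intro eqv_mult step) simp
    with Suc show ?case by (simp add: mult.assoc del: power_Suc) (meson eqv_trans)
  qed simp
  \<comment> \<open>In \<open>T (Suc N)\<close> every term with \<open>k > 0\<close> carries a power
    of \<open>X\<close> above \<open>N\<close>, so only \<open>c 0\<close> survives up to degree
    \<open>N\<close>.\<close>
  from this[of "Suc N"] have *: "eqv N S ((\<Prod>i=1..Suc N. W oo fps_X ^ i) * T (Suc N))"
    using S_eqv eqv_trans by blast
  have "eqv N (T (Suc N)) (\<Sum>k\<le>N. if k = 0 then c 0 else 0)"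
    unfolding T_def
  proof (rule eqv_sum)
    fix k
    have "eqv N (fps_X ^ (Suc N * k) * c k) 0" if "k > 0"
      by (rule small) (use that in \<open>cases k; simp\<close>)
    then show "eqv N (c k * fps_X ^ (Suc N * k)) (if k = 0 then c 0 else 0)"
      by (auto simp: mult.commute)
  qed
  then have T: "eqv N (T (Suc N)) (c 0)" by simp
  have W0: "fps_nth W 0 = 1" by (simp add: W_def w)
  have "eqv N ((\<Prod>i=1..Suc N. W oo fps_X ^ i) * T (Suc N)) (iprod W * c 0)"
    by (intro eqv_mult T eqv_sym[OF eqv_iprod] W0) simp
  with * show "eqv N S (c 0 * iprod (Abs_fps w))"
    unfolding W_def[symmetric] by (metis eqv_trans mult.commute)
qed

text \<open>By Euler's identity this is, for \<open>p\<close> of absolute value less than 1, the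
  product of \<open>1 / (1 - p ^ j * X)\<close> over \<open>j \<ge> 0\<close>.\<close>

definition euler_fps :: "real => real fps" where
  "euler_fps p = Abs_fps (\<lambda>m. 1 / (\<Prod>i=1..m. 1 - p ^ i))"

definition fps_scale :: "real => real fps => real fps" where
  "fps_scale c f = Abs_fps (\<lambda>n. c ^ n * fps_nth f n)"

lemma fps_scale_nth [simp]: "fps_nth (fps_scale c f) n = c ^ n * fps_nth f n"
  by (simp add: fps_scale_def)

lemma euler_fps_0 [simp]: "fps_nth (euler_fps p) 0 = 1"
  by (simp add: euler_fps_def)

lemma euler_fps_Suc:
  assumes "\<bar>p\<bar> < 1"
  shows "fps_nth (euler_fps p) (Suc m) * (1 - p ^ Suc m) = fps_nth (euler_fps p) m"
proof -
  have "p ^ Suc m ~= 1"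
    using assms power_less_one_iff[of "\<bar>p\<bar>" "Suc m"] by (metis abs_ge_zero abs_one less_irrefl power_abs zero_less_Suc)
  then show ?thesis by (simp add: euler_fps_def)
qed

lemma fps_mult_linear_nth:
  fixes f :: "'a::comm_ring_1 fps"
  shows "fps_nth (f * (1 - fps_const c * fps_X)) n = fps_nth f n - (if n = 0 then 0 else c * fps_nth f (n - 1))"
proof -
  have "f * (1 - fps_const c * fps_X) = f - fps_const c * (fps_X * f)"
    by (simp add: right_diff_distrib mult_ac)
  then show ?thesis by (simp add: fps_X_mult_nth)
qed

text \<open>In the product form of the series at \<open>c * X\<close>, the factor
  \<open>1 - c * X\<close> removes the term \<open>j = 0\<close>. On coefficients this is the
  recursion \<open>euler_fps_Suc\<close>.\<close>

lemma euler_fps_scale: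
  assumes "\<bar>p\<bar> < 1"
  shows "fps_scale c (euler_fps p) * (1 - fps_const c * fps_X) = fps_scale (c * p) (euler_fps p)"
proof (rule fps_ext)
  fix n
  show "fps_nth (fps_scale c (euler_fps p) * (1 - fps_const c * fps_X)) n = fps_nth (fps_scale (c * p) (euler_fps p)) n"
  proof (cases n)
    case (Suc m)
    have "fps_nth (fps_scale c (euler_fps p) * (1 - fps_const c * fps_X)) n
      = c ^ Suc m * (fps_nth (euler_fps p) (Suc m) - fps_nth (euler_fps p) m)"
      by (simp only: Suc fps_mult_linear_nth) (simp add: right_diff_distrib)
    also have "... = c ^ Suc m * (p ^ Suc m * fps_nth (euler_fps p) (Suc m))"
    proof -
      have "fps_nth (euler_fps p) (Suc m) - fps_nth (euler_fps p) m = p ^ Suc m * fps_nth (euler_fps p) (Suc m)"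
        using euler_fps_Suc[OF assms, of m] by (simp only: right_diff_distrib mult.commute mult_1_right)
      then show ?thesis by (simp only:)
    qed
    finally show ?thesis by (simp add: Suc power_mult_distrib)
  qed (simp add: fps_mult_linear_nth)
qed

text \<open>In product form this is
  \<open>(1 - p ^ j * X) * (1 + p ^ j * X) = 1 - p ^ (2 * j) * X ^ 2\<close>. The proof compares
  recursions: the right side satisfies \<open>f(p * X) = (1 - X ^ 2) * f(X)\<close>, so on both
  sides coefficient \<open>n\<close> times \<open>1 - p ^ n\<close> is coefficient
  \<open>n - 2\<close>.\<close>

lemma euler_fps_square:
  assumes "\<bar>p\<bar> < 1"
  shows "euler_fps (p\<^sup>2) oo fps_X ^ 2 = euler_fps p * fps_scale (-1) (euler_fps p)"
proof -
  let ?f = "euler_fps p * fps_scale (-1) (euler_fps p)"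
  have p2: "\<bar>p\<^sup>2\<bar> < 1" using assms by (simp add: power_abs abs_square_less_1)
  have sc: "fps_scale p (f * g) = fps_scale p f * fps_scale p g" for f g
    by (rule fps_ext) (auto simp: fps_mult_nth sum_distrib_left algebra_simps power_add[symmetric] intro!: sum.cong)
  have sc1: "fps_scale 1 f = f" and scsc: "fps_scale a (fps_scale b f) = fps_scale (a * b) f" for a b f
    by (auto intro!: fps_ext simp: power_mult_distrib)
  have "fps_scale p ?f = (euler_fps p * (1 - fps_X)) * (fps_scale (-1) (euler_fps p) * (1 + fps_X))"
    using euler_fps_scale[OF assms, of 1] euler_fps_scale[OF assms, of "-1"]
    by (simp add: sc sc1 scsc fps_const_neg[symmetric] del: fps_const_neg)
  also have "... = ?f - fps_X ^ 2 * ?f" by (simp add: algebra_simps power2_eq_square)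
  finally have rec: "fps_scale p ?f = ?f - fps_X ^ 2 * ?f" .
  have recn: "fps_nth ?f n * (1 - p ^ n) = (if n < 2 then 0 else fps_nth ?f (n - 2))" for n
  proof -
    have "p ^ n * fps_nth ?f n = fps_nth ?f n - (if n < 2 then 0 else fps_nth ?f (n - 2))"
      using arg_cong[OF rec, of "\<lambda>f. fps_nth f n"] by (simp only: fps_scale_nth fps_sub_nth fps_X_power_mult_nth)
    then show ?thesis by (simp add: algebra_simps)
  qed
  have pn: "p ^ n ~= 1" if "n > 0" for n
    using assms that power_less_one_iff[of "\<bar>p\<bar>" n] by (metis abs_ge_zero abs_one less_irrefl power_abs)
  have "fps_nth (euler_fps (p\<^sup>2) oo fps_X ^ 2) n = fps_nth ?f n" for n
  proof (induction n rule: less_induct)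
    case (less n)
    consider "n = 0" | "n = 1" | "n \<ge> 2" by linarith
    then show ?case
    proof cases
      case 3
      have "fps_nth (euler_fps (p\<^sup>2) oo fps_X ^ 2) n * (1 - p ^ n) = fps_nth (euler_fps (p\<^sup>2) oo fps_X ^ 2) (n - 2)"
      proof (cases "even n")
        case True
        then obtain m where m: "n = 2 * Suc m" using 3 by (metis One_nat_def Suc_diff_1 dvdE nat_mult_eq_cancel1 neq0_conv mult_0_right not_numeral_le_zero)
        have "p ^ n = (p\<^sup>2) ^ Suc m" unfolding m by (rule power_mult)
        moreover have "n div 2 = Suc m" "(n - 2) div 2 = m" "even n" "even (n - 2)" using m by auto
        ultimately show ?thesis using euler_fps_Suc[OF p2, of m]
          by (simp only: fps_nth_compose_X_power[OF zero_less_numeral] if_True)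
      next
        case False
        then have "odd (n - 2)" using 3 by auto
        with False show ?thesis by (simp add: fps_nth_compose_X_power)
      qed
      with less[of "n - 2"] recn[of n] 3 have "fps_nth (euler_fps (p\<^sup>2) oo fps_X ^ 2) n * (1 - p ^ n) = fps_nth ?f n * (1 - p ^ n)"
        by simp
      then show ?thesis using pn[of n] 3 by auto
    next
      case 2
      then show ?thesis using recn[of 1] pn[of 1] by (auto simp: fps_nth_compose_X_power)
    qed (simp add: fps_nth_compose_X_power)
  qed
  then show ?thesis by (rule fps_ext)
qed

text \<open>The closing identity: \<open>E\<^sub>p(q x) (1 - q x) = E\<^sub>p(- x)\<close> since \<open>p q = -1\<close>.\<close>

lemma iprod_euler_identity:
  fixes q :: real
  assumes "q > 1" and p: "p = - 1 / q"
  shows "iprod (fps_scale q (euler_fps p)) * iprod (euler_fps p)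
    = iprod (Abs_fps (\<lambda>m. q ^ m)) * (iprod (euler_fps (p\<^sup>2)) oo fps_X ^ 2)"
proof -
  have p1: "\<bar>p\<bar> < 1" using assms by (simp add: abs_minus_commute)
  have geo: "Abs_fps (\<lambda>m. q ^ m) * (1 - fps_const q * fps_X) = 1"
  proof (rule fps_ext)
    fix n show "fps_nth (Abs_fps (\<lambda>m. q ^ m) * (1 - fps_const q * fps_X)) n = fps_nth 1 n"
      by (cases n) (simp_all add: fps_mult_linear_nth)
  qed
  have "fps_scale q (euler_fps p) = fps_scale q (euler_fps p) * (1 - fps_const q * fps_X) * Abs_fps (\<lambda>m. q ^ m)"
    using geo by (simp add: mult.assoc mult.commute)
  also have "... = fps_scale (-1) (euler_fps p) * Abs_fps (\<lambda>m. q ^ m)"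
    using euler_fps_scale[OF p1, of q] assms by simp
  finally have "fps_scale q (euler_fps p) * euler_fps p = Abs_fps (\<lambda>m. q ^ m) * (euler_fps (p\<^sup>2) oo fps_X ^ 2)"
    by (simp add: euler_fps_square[OF p1] mult_ac)
  then have "iprod (fps_scale q (euler_fps p)) * iprod (euler_fps p)
    = iprod (Abs_fps (\<lambda>m. q ^ m)) * iprod (euler_fps (p\<^sup>2) oo fps_X ^ 2)"
    by (subst (1 2) iprod_mult[symmetric]) (simp_all add: fps_nth_compose_X_power)
  then show ?thesis by (simp add: iprod_compose)
qed

section \<open>Matrices over a ring with involution\<close>

lemma card_fibres_sum:
  assumes "finite A" "finite B" "\<And>a. a \<in> A ==> f a \<in> B"
  shows "card A = (\<Sum>b\<in>B. card {a\<in>A. f a = b})"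
proof -
  have "(\<Sum>b\<in>B. card {a\<in>A. f a = b}) = (\<Sum>b\<in>B. \<Sum>a\<in>{a\<in>A. f a = b}. 1)" by simp
  also have "... = (\<Sum>a\<in>A. 1)" by (rule sum.group) (use assms in auto)
  finally show ?thesis by simp
qed

lemma card_fibres:
  assumes "finite A" "finite B" "\<And>a. a \<in> A ==> f a \<in> B" "\<And>b. b \<in> B ==> card {a\<in>A. f a = b} = c"
  shows "card A = c * card B"
  using card_fibres_sum[OF assms(1-3)] assms(4) by simp

lemma assoc_l: "a * b = c ==> a * (b * x) = c * x" for a :: "'r::semigroup_mult"
  by (metis mult.assoc)

text \<open>The common setting of the unitary and the linear count. \<open>e n\<close> is the
  identity of size \<open>n\<close>. There are \<open>w ^ (2 * n * m)\<close> matrices and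
  \<open>w ^ (n * n)\<close> Hermitian ones, so \<open>w\<close> is the size of the small field in
  the unitary instance and of the whole field in the linear one. \<open>p\<close> measures the
  number of unit vectors and is \<open>- 1 / q\<close>, respectively \<open>1 / w\<close>.
  \<open>half\<close> is a central element of trace one, the substitute for 1/2. By
  \<open>herm_vec\<close> a nonzero Hermitian form represents 1, so that forms are classified by
  rank. \<open>unit_ex\<close> is the basis vector at index \<open>r\<close>, and
  \<open>compl\<close> completes a left invertible matrix to an invertible one.\<close>

locale herm =
  fixes e :: "nat => 'r::ring_1" and st :: "'r => 'r" and w :: nat and p :: real
  assumes st_add: "st (x + y) = st x + st y"
    and st_mult: "st (x * y) = st y * st x"
    and st_st [simp]: "st (st x) = x"
    and st_e [simp]: "st (e n) = e n"
    and e_mult: "e n * e m = e (min n m)"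
    and e_0 [simp]: "e 0 = 0"
    and finite_Mat: "finite {x. e n * x = x \<and> x * e m = x}"
    and card_Mat: "card {x. e n * x = x \<and> x * e m = x} = w ^ (2 * (n * m))"
    and card_Herm: "card {x. e n * x = x \<and> x * e n = x \<and> st x = x} = w ^ (n * n)"
    and w_ge_2: "w \<ge> 2"
    and half: "\<exists>t. t + st t = 1 \<and> (\<forall>x. t * x = x * t)"
    and herm_vec: "e n * x = x ==> x * e n = x ==> st x = x ==> x ~= 0 ==> \<exists>v. e n * v = v \<and> v * e 1 = v \<and> st v * x * v = e 1"
    and unit_ex: "\<exists>E. E * e 1 = E \<and> st E * E = e 1 \<and> E * st E = e (Suc r) - e r"
    and compl: "e n * i = i ==> i * e r = i ==> e r * k = k ==> k * e n = k ==> k * i = e r ==>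
       r \<le> n \<and> (\<exists>N L. e n * N = N \<and> N * e (n - r) = N \<and> e (n - r) * L = L \<and> L * e n = L \<and> N * L = e n - i * k \<and> L * N = e (n - r))"
    and card_unit: "n > 0 ==> real (card {v. e n * v = v \<and> v * e 1 = v \<and> st v * v = e 1}) = real w ^ (2 * n - 1) * (1 - p ^ n)"
    and p_less_1: "\<bar>p\<bar> < 1"
begin

definition M :: "nat => nat => 'r set" where "M n m = {x. e n * x = x \<and> x * e m = x}"
definition H :: "nat => 'r set" where "H n = {x \<in> M n n. st x = x}"
definition U :: "nat => 'r set" where "U n = {x \<in> M n n. st x * x = e n \<and> x * st x = e n}"
text \<open>The matrices of full column rank, recognised by a left inverse. \<open>F\<close>
  collects the orthonormal frames.\<close>

definition LI :: "nat => nat => 'r set" where "LI n r = {i \<in> M n r. \<exists>k\<in>M r n. k * i = e r}"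
definition F :: "nat => nat => 'r set" where "F n r = {J \<in> M n r. st J * J = e r}"

lemma M_l: "x \<in> M n m ==> e n * x = x" and M_r: "x \<in> M n m ==> x * e m = x"
  by (auto simp: M_def)

lemma M_l': "x \<in> M n m ==> e n * (x * y) = x * y" and M_r': "x \<in> M n m ==> x * (e m * y) = x * y"
  by (metis M_l mult.assoc, metis M_r mult.assoc)

lemma st_0 [simp]: "st 0 = 0" and st_minus: "st (- x) = - st x" and st_diff: "st (x - y) = st x - st y"
proof -
  show z: "st 0 = 0" using st_add[of 0 0] by simp
  show m: "st (- x) = - st x" for x using st_add[of x "- x"] z by (simp add: eq_neg_iff_add_eq_0 add.commute)
  show "st (x - y) = st x - st y" using st_add[of x "- y"] m by simp
qed

lemma st_eq_iff: "st x = st y \<longleftrightarrow> x = y" by (metis st_st)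

lemma st_zero: "x * y = 0 ==> st y * st x = 0"
  by (metis st_0 st_mult)

lemma st_1 [simp]: "st 1 = 1"
  by (metis mult_1_left mult_1_right st_mult st_st)

lemma st_power: "st (x ^ n) = st x ^ n"
  by (induction n) (simp_all add: st_mult power_commutes)

lemma M_mult: "x \<in> M n m ==> y \<in> M m k ==> x * y \<in> M n k"
  by (auto simp: M_def) (metis mult.assoc)+

lemma M_st: "x \<in> M n m ==> st x \<in> M m n"
  by (auto simp: M_def) (metis st_e st_mult)+

lemma M_add: "x \<in> M n m ==> y \<in> M n m ==> x + y \<in> M n m"
  and M_diff: "x \<in> M n m ==> y \<in> M n m ==> x - y \<in> M n m"
  and M_0: "0 \<in> M n m"
  by (auto simp: M_def algebra_simps)

lemma e_in_M: "k \<le> n ==> k \<le> m ==> e k \<in> M n m"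
  by (auto simp: M_def e_mult min_def)

lemma M_mono: "x \<in> M n m ==> n \<le> n' ==> m \<le> m' ==> x \<in> M n' m'"
  by (auto simp: M_def) (metis e_mult min.absorb2 mult.assoc, metis e_mult min.absorb1 mult.assoc)

lemmas M_intros = M_mult M_st M_add M_diff M_0 e_in_M

lemma finite_M [simp, intro]: "finite (M n m)" and card_M: "card (M n m) = w ^ (2 * (n * m))"
  using finite_Mat card_Mat by (auto simp: M_def)

lemma finite_H [simp, intro]: "finite (H n)" and finite_U [simp, intro]: "finite (U n)"
  and finite_LI [simp, intro]: "finite (LI n r)" and finite_F [simp, intro]: "finite (F n r)"
  by (auto simp: H_def U_def LI_def F_def)

lemma card_H: "card (H n) = w ^ (n * n)"
  using card_Herm[of n] by (auto simp: H_def M_def conj_assoc cong: conj_cong)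

lemma e_U: "e n \<in> U n"
  by (auto simp: U_def e_mult e_in_M)

lemma card_U_pos: "card (U n) > 0"
  using e_U[of n] by (auto simp: card_gt_0_iff)

lemma w_pow_inject: "w ^ a = w ^ b \<longleftrightarrow> a = b"
  using w_ge_2 by (intro power_inject_exp) auto

text \<open>Mutually inverse matrices give a bijection between columns of lengths \<open>n\<close>
  and \<open>k\<close>. Counting columns replaces dimension theory.\<close>

lemma dim_unique:
  assumes "a \<in> M n k" "b \<in> M k n" "a * b = e n" "b * a = e k"
  shows "n = k"
proof -
  have "bij_betw (\<lambda>x. b * x) (M n 1) (M k 1)"
  proof (rule bij_betw_byWitness[where f' = "\<lambda>x. a * x"])
    show "\<forall>x\<in>M n 1. a * (b * x) = x" "\<forall>x\<in>M k 1. b * (a * x) = x"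
      using assms by (auto simp: assms(3,4)[THEN assoc_l] M_l)
  qed (use assms in \<open>auto intro: M_mult\<close>)
  then have "card (M n 1) = card (M k 1)" by (rule bij_betw_same_card)
  then show ?thesis by (simp add: card_M w_pow_inject)
qed

lemma e_eq_0_iff: "e n = 0 \<longleftrightarrow> n = 0"
  using dim_unique[of 0 n 0 0] by (auto simp: M_0)

text \<open>Left multiplication by \<open>x\<close> is injective on a finite set, hence onto, which
  produces a right inverse; it equals \<open>y\<close>.\<close>

lemma inverse_commute:
  assumes "x \<in> M n n" "y \<in> M n n" "y * x = e n"
  shows "x * y = e n"
proof -
  have "inj_on (\<lambda>z. x * z) (M n n)"
    by (rule inj_on_inverseI[where g = "\<lambda>z. y * z"]) (auto simp: assms(3)[THEN assoc_l] M_l)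
  moreover have "(\<lambda>z. x * z) ` M n n \<subseteq> M n n" using assms by (auto intro: M_mult)
  ultimately have "(\<lambda>z. x * z) ` M n n = M n n" by (intro endo_inj_surj) auto
  then obtain z where z: "z \<in> M n n" "x * z = e n" using e_in_M[of n n n] by force
  have "y = y * (x * z)" using assms z by (simp add: M_r)
  also have "... = z" by (simp only: assms(3)[THEN assoc_l] M_l[OF z(1)])
  finally show ?thesis using z by simp
qed

lemma in_U_I: "x \<in> M n n ==> st x * x = e n ==> x \<in> U n"
  by (auto simp: U_def intro: inverse_commute M_st)

lemma LI_le: "i \<in> LI n r ==> r \<le> n"
  unfolding LI_def M_def using compl by blast

lemma LI_compl:
  assumes "i \<in> M n r" "k \<in> M r n" "k * i = e r"
  obtains N L where "N \<in> M n (n - r)" "L \<in> M (n - r) n" "N * L = e n - i * k" "L * N = e (n - r)"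
    "L * i = 0" "k * N = 0"
proof -
  obtain N L where NL: "N \<in> M n (n - r)" "L \<in> M (n - r) n" "N * L = e n - i * k" "L * N = e (n - r)"
    using compl[of n i r k] assms unfolding M_def by blast
  have "N * L * i = 0" "k * (N * L) = 0"
    unfolding NL(3) using assms by (simp_all add: algebra_simps M_l M_r assms(3)[THEN assoc_l])
  then have "L * (N * L * i) = 0" "k * (N * L) * N = 0" by simp_all
  moreover have "L * (N * L * i) = L * i"
    by (simp only: mult.assoc NL(4)[THEN assoc_l] M_l'[OF NL(2)])
  moreover have "k * (N * L) * N = k * N"
    by (simp only: mult.assoc NL(4) M_r[OF NL(1)])
  ultimately have "L * i = 0" "k * N = 0" by simp_all
  with NL that show ?thesis by blast
qed

lemma LI_cancel: "i \<in> LI n r ==> x \<in> M r m ==> y \<in> M r m ==> i * x = i * y \<longleftrightarrow> x = y"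
  unfolding LI_def by (smt (verit, ccfv_SIG) M_l mem_Collect_eq mult.assoc)

lemma LI_cancel': "i \<in> LI n r ==> x \<in> M m r ==> y \<in> M m r ==> x * st i = y * st i \<longleftrightarrow> x = y"
  using LI_cancel[of i n r "st x" m "st y"] st_eq_iff[of "x * st i" "y * st i"]
  by (auto simp: st_mult M_st st_eq_iff)

lemma unit:
  obtains E where "E \<in> M (Suc r) 1" "st E * E = e 1" "E * st E = e (Suc r) - e r" "e r * E = 0" "st E * e r = 0"
proof -
  obtain E where E: "E * e 1 = E" "st E * E = e 1" "E * st E = e (Suc r) - e r" using unit_ex by blast
  have "E = (E * st E) * E" by (simp only: mult.assoc E(1,2))
  then have E': "E = e (Suc r) * E - e r * E" using E by (simp add: left_diff_distrib)
  have "e (Suc r) * E = e (Suc r) * (e (Suc r) * E - e r * E)" using E' by simp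
  also have "... = E" using E' by (simp add: algebra_simps e_mult[THEN assoc_l])
  finally have 1: "e (Suc r) * E = E" .
  with E' have 2: "e r * E = 0" by simp
  from st_zero[OF 2] have "st E * e r = 0" by simp
  with that E 1 2 show ?thesis by (auto simp: M_def)
qed

text \<open>Diagonalisation of a Hermitian form: if \<open>v\<close> has value 1 and
  \<open>a = x * v\<close>, then \<open>x - a * st a\<close> kills \<open>v\<close> and everything
  that \<open>x\<close> kills. So the induction runs on the number of columns that are not killed,
  and \<open>a\<close> is appended as a column to the factor of the smaller form.\<close>

lemma herm_fact:
  assumes "x \<in> H n"
  shows "\<exists>r. \<exists>i\<in>LI n r. x = i * st i"
  using assms
proof (induction "card {v \<in> M n 1. x * v ~= 0}" arbitrary: x rule: less_induct)
  case less
  then have x: "x \<in> M n n" "st x = x" by (auto simp: H_def)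
  show ?case
  proof (cases "x = 0")
    case True
    have "0 \<in> LI n 0" by (auto simp: LI_def M_0 intro: exI[of _ 0])
    with True show ?thesis by (metis mult_zero_left)
  next
    case False
    with herm_vec[of n x] x obtain v where v: "v \<in> M n 1" "st v * x * v = e 1"
      by (auto simp: M_def)
    define a where "a = x * v"
    have a: "a \<in> M n 1" using x v by (auto simp: a_def intro: M_intros)
    have sa: "st a = st v * x" by (simp add: a_def st_mult x)
    have va: "st v * a = e 1" using v by (simp add: a_def mult.assoc)
    have av: "st a * v = e 1" using v by (simp add: sa mult.assoc)
    define y where "y = x - a * st a"
    have y: "y \<in> H n" using x a by (auto simp: H_def y_def st_diff st_mult intro: M_intros)
    have yv: "y * v = 0" using a by (simp add: y_def left_diff_distrib mult.assoc av M_r) (simp add: a_def)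
    have "v \<in> {v \<in> M n 1. x * v ~= 0}"
    proof -
      have "e 1 ~= 0" by (simp add: e_eq_0_iff)
      with v have "x * v ~= 0" by (auto simp: mult.assoc)
      with v show ?thesis by simp
    qed
    moreover have "v \<notin> {v \<in> M n 1. y * v ~= 0}" using yv by simp
    moreover have "{v \<in> M n 1. y * v ~= 0} \<subseteq> {v \<in> M n 1. x * v ~= 0}"
      by (auto simp: y_def left_diff_distrib mult.assoc sa)
    ultimately have "{v \<in> M n 1. y * v ~= 0} \<subset> {v \<in> M n 1. x * v ~= 0}" by blast
    then have "card {v \<in> M n 1. y * v ~= 0} < card {v \<in> M n 1. x * v ~= 0}"
      by (intro psubset_card_mono) auto
    from less(1)[OF this y] obtain r i where i: "i \<in> LI n r" "y = i * st i" by blast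
    then obtain k where iM: "i \<in> M n r" and k: "k \<in> M r n" "k * i = e r" by (auto simp: LI_def)
    have "i * (st i * v) = i * 0" using yv i by (simp add: mult.assoc)
    then have iv: "st i * v = 0" using LI_cancel[OF i(1) M_mult[OF M_st[OF iM] v(1)] M_0] by simp
    then have vi: "st v * i = 0" using st_zero[OF iv] by simp
    obtain E where E: "E \<in> M (Suc r) 1" "st E * E = e 1" "E * st E = e (Suc r) - e r" "e r * E = 0" "st E * e r = 0"
      by (rule unit)
    have iE: "i * E = 0" using iM E(4) M_r'[OF iM, of E] by simp
    then have Ei: "st E * st i = 0" using st_zero[OF iE] by simp
    \<comment> \<open>\<open>E\<close> is the last basis vector of length \<open>r + 1\<close>, so
      \<open>i'\<close> is \<open>i\<close> bordered by the column \<open>a\<close>.\<close>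
    define i' where "i' = i + a * st E"
    have i'M: "i' \<in> M n (Suc r)" unfolding i'_def
      using M_mono[OF iM, of n "Suc r"] a E by (auto intro: M_intros)
    have "x = i' * st i'"
      using i a by (simp add: i'_def y_def st_add st_mult algebra_simps iE[THEN assoc_l] Ei E(2)[THEN assoc_l] M_l[OF M_st])
    moreover have "i' \<in> LI n (Suc r)"
    proof -
      \<comment> \<open>Left inverse of the bordered matrix: \<open>st v\<close> kills
        \<open>i\<close> and is 1 on \<open>a\<close>, so it serves as last row, and
        \<open>k\<close> is corrected by its value on \<open>a\<close>.\<close>
      define k' where "k' = k - k * a * st v + E * st v"
      have "k' \<in> M (Suc r) n" unfolding k'_def
        using M_mono[OF k(1), of "Suc r" n] a E v k by (auto intro!: M_intros intro: M_mono[of _ r n])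
      moreover have "k' * i' = e (Suc r)"
        using a E k by (simp add: k'_def i'_def algebra_simps vi va va[THEN assoc_l] vi[THEN assoc_l] M_l[OF M_st] M_r M_r')
      ultimately show ?thesis using i'M by (auto simp: LI_def)
    qed
    ultimately show ?thesis by blast
  qed
qed

text \<open>The factor of a form is unique up to a unitary on the right. The left inverses
  \<open>k\<close> and \<open>l\<close> give mutually inverse transition matrices \<open>X\<close>
  and \<open>Y\<close>, and cancelling \<open>i\<close> on both sides of
  \<open>i * st i = j * st j\<close> makes \<open>X\<close> unitary.\<close>

lemma herm_fact_rank:
  assumes "i \<in> LI n r" "j \<in> LI n s" "i * st i = j * st j"
  obtains X where "r = s" "X \<in> U r" "j = i * X"
proof -
  obtain k where iM: "i \<in> M n r" and k: "k \<in> M r n" "k * i = e r" using assms by (auto simp: LI_def)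
  obtain l where jM: "j \<in> M n s" and l: "l \<in> M s n" "l * j = e s" using assms by (auto simp: LI_def)
  have ki: "st i * st k = e r" "st j * st l = e s" using arg_cong[OF k(2), of st] arg_cong[OF l(2), of st] by (simp_all add: st_mult)
  define X where "X = st i * st l"
  define Y where "Y = st j * st k"
  have X: "X \<in> M r s" "Y \<in> M s r" using iM jM k l by (auto simp: X_def Y_def intro: M_intros)
  have j: "i * X = j" using arg_cong[OF assms(3), of "\<lambda>z. z * st l"] jM by (simp add: X_def mult.assoc ki M_r)
  have i: "j * Y = i" using arg_cong[OF assms(3), of "\<lambda>z. z * st k"] iM by (simp add: Y_def mult.assoc ki M_r)
  have "i * (X * Y) = i * e r" using i j iM by (simp add: mult.assoc[symmetric] M_r)
  then have XY: "X * Y = e r" using LI_cancel[OF assms(1) M_mult[OF X] e_in_M] by simp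
  have "j * (Y * X) = j * e s" using i j jM by (simp add: mult.assoc[symmetric] M_r)
  then have YX: "Y * X = e s" using LI_cancel[OF assms(2) M_mult[OF X(2,1)] e_in_M] by simp
  have rs: "r = s" using dim_unique[OF X XY YX] .
  have "i * (X * st X) * st i = i * e r * st i"
    using assms(3) j iM by (metis M_r mult.assoc st_mult)
  then have "i * (X * st X) = i * e r"
    using LI_cancel'[OF assms(1) M_mult[OF iM M_mult[OF X(1) M_st[OF X(1)]]] M_mult[OF iM e_in_M]] by simp
  then have "X * st X = e r" using LI_cancel[OF assms(1) M_mult[OF X(1) M_st[OF X(1)]] e_in_M] by simp
  then have "X \<in> U r" using X rs inverse_commute[of "st X" r X] in_U_I[of "st X" r]
    by (auto simp: U_def M_intros)
  with that rs j show ?thesis by blast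
qed

text \<open>From \<open>f = i * st i\<close> and \<open>f * f = f\<close>, cancelling
  \<open>i\<close> on the left and \<open>st i\<close> on the right leaves
  \<open>st i * i = e r\<close>.\<close>

lemma herm_idem:
  assumes "f \<in> H n" "f * f = f"
  obtains s d where "d \<in> F n s" "f = d * st d"
proof -
  obtain r i where i: "i \<in> LI n r" "f = i * st i" using herm_fact[OF assms(1)] by blast
  have iM: "i \<in> M n r" using i by (auto simp: LI_def)
  have "i * (st i * i * st i) = i * st i" using assms i by (simp add: mult.assoc)
  then have "st i * i * st i = e r * st i"
    using LI_cancel[OF i(1) M_mult[OF M_mult[OF M_st[OF iM] iM] M_st[OF iM]] M_st[OF iM]] by (simp add: M_l[OF M_st[OF iM]])
  then have "st i * i = e r"
    using LI_cancel'[OF i(1) M_mult[OF M_st[OF iM] iM] e_in_M] by simp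
  with that i iM show ?thesis by (auto simp: F_def)
qed

text \<open>\<open>I\<close> embeds columns of length \<open>s\<close> as the last coordinates of
  columns of length \<open>r + s\<close>. It lets the block row \<open>[J | K]\<close> be written as
  \<open>J + K * st I\<close>.\<close>

lemma incl:
  obtains I where "I \<in> F (r + s) s" "I * st I = e (r + s) - e r" "e r * I = 0" "st I * e r = 0"
proof -
  have "\<exists>I\<in>F (r + s) s. I * st I = e (r + s) - e r"
  proof (induction s)
    case 0
    then show ?case by (intro bexI[of _ 0]) (auto simp: F_def M_0)
  next
    case (Suc s)
    then obtain I where I: "I \<in> M (r + s) s" "st I * I = e s" "I * st I = e (r + s) - e r" by (auto simp: F_def)
    obtain E where E: "E \<in> M (Suc (r + s)) 1" "st E * E = e 1" "E * st E = e (Suc (r + s)) - e (r + s)" "e (r + s) * E = 0" "st E * e (r + s) = 0"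
      by (rule unit)
    obtain G where G: "G \<in> M (Suc s) 1" "st G * G = e 1" "G * st G = e (Suc s) - e s" "e s * G = 0" "st G * e s = 0"
      by (rule unit)
    have IE: "st I * E = 0" "I * G = 0"
      using M_r'[OF M_st[OF I(1)], of E] E M_r'[OF I(1), of G] G by simp_all
    have EI: "st E * I = 0" "st G * st I = 0" using IE[THEN st_zero] by simp_all
    define J where "J = I + E * st G"
    have "J \<in> M (r + Suc s) (Suc s)" unfolding J_def
      using M_mono[OF I(1), of "r + Suc s" "Suc s"] E G by (auto intro: M_intros)
    moreover have "st J * J = e (Suc s)"
      using G by (simp add: J_def st_add st_mult algebra_simps I IE EI IE[THEN assoc_l] EI[THEN assoc_l] E(2)[THEN assoc_l] M_l[OF M_st])
    moreover have "J * st J = e (r + Suc s) - e r"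
      using E by (simp add: J_def st_add st_mult algebra_simps I IE EI IE[THEN assoc_l] EI[THEN assoc_l] G(2)[THEN assoc_l] M_l[OF M_st])
    ultimately show ?case by (auto simp: F_def)
  qed
  then obtain I where I: "I \<in> F (r + s) s" "I * st I = e (r + s) - e r" by blast
  then have IM: "I \<in> M (r + s) s" "st I * I = e s" by (auto simp: F_def)
  have "e r * I = e r * (I * st I) * I" using IM by (simp add: mult.assoc M_r)
  also have "... = 0" unfolding I(2) by (simp add: algebra_simps e_mult)
  finally have 1: "e r * I = 0" .
  with that I st_zero[OF 1] show ?thesis by simp
qed

lemma F_LI: "F n r \<subseteq> LI n r"
  by (auto simp: F_def LI_def intro: M_st)

text \<open>\<open>e n - J * st J\<close> is a Hermitian idempotent and so comes from a frame
  \<open>K\<close>. The block row \<open>[J | K]\<close> is then invertible, which fixes the length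
  of \<open>K\<close>.\<close>

lemma orth_compl:
  assumes "J \<in> F n r"
  obtains K where "r \<le> n" "K \<in> F n (n - r)" "J * st J + K * st K = e n" "st J * K = 0" "st K * J = 0"
proof -
  have J: "J \<in> M n r" "st J * J = e r" using assms by (auto simp: F_def)
  have "e n - J * st J \<in> H n" "(e n - J * st J) * (e n - J * st J) = e n - J * st J"
    using J by (auto simp: H_def st_diff st_mult algebra_simps e_mult M_l M_l' J(2)[THEN assoc_l] M_r M_r[OF M_st] M_l[OF M_st] intro: M_intros)
  then obtain s K where K': "K \<in> F n s" "e n - J * st J = K * st K" by (rule herm_idem)
  then have K: "K \<in> M n s" "st K * K = e s" by (auto simp: F_def)
  have "K * (st K * J) = (e n - J * st J) * J" using K'(2) by (simp add: mult.assoc)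
  also have "... = K * 0" using J by (simp add: algebra_simps M_l M_r)
  finally have KJ: "st K * J = 0" using LI_cancel[OF _ M_mult[OF M_st[OF K(1)] J(1)] M_0] F_LI K' by blast
  then have JK: "st J * K = 0" using st_zero[OF KJ] by simp
  obtain I where I: "I \<in> M (r + s) s" "st I * I = e s" "I * st I = e (r + s) - e r" "e r * I = 0" "st I * e r = 0"
    using incl[of r s] by (auto simp: F_def)
  define P where "P = J + K * st I"
  have PM: "P \<in> M n (r + s)" unfolding P_def using M_mono[OF J(1), of n "r + s"] K I by (auto intro: M_intros)
  have JI: "J * I = 0" using M_r'[OF J(1), of I] I by simp
  have sum: "J * st J + K * st K = e n" using K'(2) by (simp add: algebra_simps)
  have "P * st P = e n"
    using K JI[THEN st_zero] sum by (simp add: P_def st_add st_mult algebra_simps JI JI[THEN assoc_l] I(2)[THEN assoc_l] M_l[OF M_st])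
  moreover have "st P * P = e (r + s)"
    using I by (simp add: P_def st_add st_mult algebra_simps J K JK KJ JK[THEN assoc_l] KJ[THEN assoc_l] K(2)[THEN assoc_l] M_l[OF M_st])
  ultimately have "n = r + s" using dim_unique[OF PM M_st[OF PM]] by simp
  with that K' sum JK KJ show ?thesis by auto
qed

end

section \<open>Orders of unitary groups, hyperbolic frames and isotropic frames\<close>

context herm begin

text \<open>A partial isometry \<open>a\<close> from the complement of \<open>K0\<close> to the
  complement of \<open>K\<close> is extended to a unitary by an isometry from the span of
  \<open>K0\<close> to that of \<open>K\<close>, which in these frames is an element of
  \<open>U s\<close>. The counts of orthonormal and of hyperbolic frames both rest on this.\<close>

lemma bij_U_fibre:
  assumes K: "K \<in> F n s" and K0: "K0 \<in> F n s" and a: "a \<in> M n n" "a * st a = e n - K * st K"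
    "st a * a = e n - K0 * st K0" "st K * a = 0" "a * K0 = 0"
  shows "card {P \<in> U n. P * (e n - K0 * st K0) = a} = card (U s)"
proof -
  have KM: "K \<in> M n s" "st K * K = e s" "K0 \<in> M n s" "st K0 * K0 = e s" using K K0 by (auto simp: F_def)
  have aK: "st a * K = 0" "st K0 * st a = 0" using st_zero[OF a(4)] st_zero[OF a(5)] by simp_all
  note eqs = a(4,5) aK KM(2,4)
  have *: "e n * e n = e n" by (simp add: e_mult)
  have "bij_betw (\<lambda>X. a + K * X * st K0) (U s) {P \<in> U n. P * (e n - K0 * st K0) = a}"
  proof (rule bij_betw_byWitness[where f' = "\<lambda>P. st K * P * K0"])
    show "\<forall>X\<in>U s. st K * (a + K * X * st K0) * K0 = X"
      by (auto simp: algebra_simps eqs eqs[THEN assoc_l] U_def M_l M_r)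
    show "\<forall>P\<in>{P \<in> U n. P * (e n - K0 * st K0) = a}. a + K * (st K * P * K0) * st K0 = P"
    proof safe
      fix P assume P: "P \<in> U n" and PK: "a = P * (e n - K0 * st K0)"
      then have PM: "P \<in> M n n" "st P * P = e n" by (auto simp: U_def)
      have "st a * P * K0 = (e n - K0 * st K0) * (st P * P) * K0"
        unfolding PK by (simp add: st_mult st_diff mult.assoc)
      also have "... = 0" unfolding PM by (simp add: algebra_simps KM M_l[OF KM(3)] M_r[OF KM(3)] *[THEN assoc_l] M_l'[OF KM(3)])
      finally have aPK: "st a * (P * K0) = 0" by (simp add: mult.assoc)
      have "K * (st K * P * K0) * st K0 = (e n - a * st a) * P * K0 * st K0"
        unfolding a(2) by (simp add: mult.assoc)
      also have "... = P * K0 * st K0"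
        by (simp add: algebra_simps aPK aPK[THEN assoc_l] M_l'[OF PM(1)])
      finally show "P * (e n - K0 * st K0) + K * (st K * P * K0) * st K0 = P"
        by (simp add: algebra_simps M_r[OF PM(1)])
    qed
    show "(\<lambda>X. a + K * X * st K0) ` U s \<subseteq> {P \<in> U n. P * (e n - K0 * st K0) = a}"
    proof safe
      fix X assume "X \<in> U s"
      then have X: "X \<in> M s s" "st X * X = e s" by (auto simp: U_def)
      have "st (a + K * X * st K0) * (a + K * X * st K0) = e n"
        by (simp add: st_add st_mult algebra_simps eqs eqs[THEN assoc_l] X(2)[THEN assoc_l] a(3) M_l'[OF X(1)] M_l[OF M_st[OF KM(3)]])
      then show "a + K * X * st K0 \<in> U n"
        using a KM X by (intro in_U_I) (auto intro: M_intros)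
      show "(a + K * X * st K0) * (e n - K0 * st K0) = a"
        by (simp add: algebra_simps eqs eqs[THEN assoc_l] M_r[OF a(1)] M_r[OF M_st[OF KM(3)]] M_l[OF M_st[OF KM(3)]])
    qed
    show "(\<lambda>P. st K * P * K0) ` {P \<in> U n. P * (e n - K0 * st K0) = a} \<subseteq> U s"
    proof safe
      fix P assume P: "P \<in> U n" and PK: "a = P * (e n - K0 * st K0)"
      then have PM: "P \<in> M n n" "st P * P = e n" by (auto simp: U_def)
      have "st a * P * K0 = (e n - K0 * st K0) * (st P * P) * K0"
        unfolding PK by (simp add: st_mult st_diff mult.assoc)
      also have "... = 0" unfolding PM by (simp add: algebra_simps KM M_l[OF KM(3)] M_r[OF KM(3)] *[THEN assoc_l] M_l'[OF KM(3)])
      finally have aPK: "st a * (P * K0) = 0" by (simp add: mult.assoc)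
      have KK: "K * st K = e n - a * st a" using a by simp
      have "st (st K * P * K0) * (st K * P * K0) = st K0 * st P * (K * st K) * P * K0"
        by (simp add: st_mult mult.assoc)
      also have "... = e s"
        unfolding KK by (simp add: algebra_simps aPK M_l'[OF PM(1)] PM(2)[THEN assoc_l] M_l[OF KM(3)] KM)
      finally show "st K * P * K0 \<in> U s" using KM PM by (intro in_U_I) (auto intro: M_intros)
    qed
  qed
  then show ?thesis by (simp add: bij_betw_same_card)
qed

text \<open>Frames are the first \<open>r\<close> columns of unitaries. Extending a given frame
  means choosing a frame of its complement, which leaves \<open>U (n - r)\<close>.\<close>

lemma card_frames:
  assumes "r \<le> n"
  shows "card (U n) = card (U (n - r)) * card (F n r)"
proof (rule card_fibres[where f = "\<lambda>P. P * e r"])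
  have er: "e r \<in> F n r" using assms by (auto simp: F_def e_in_M e_mult)
  obtain K0 where K0: "K0 \<in> F n (n - r)" "e r * st (e r) + K0 * st K0 = e n" "st (e r) * K0 = 0"
    using orth_compl[OF er] by blast
  have K0': "e n - K0 * st K0 = e r" using K0(2) by (simp add: e_mult algebra_simps)
  show "P * e r \<in> F n r" if "P \<in> U n" for P
    using that assms by (auto simp: F_def U_def st_mult mult.assoc e_mult M_def)
      (metis e_mult min.absorb1 min.idem mult.assoc)+
  show "card {P \<in> U n. P * e r = J} = card (U (n - r))" if J: "J \<in> F n r" for J
  proof -
    have JM: "J \<in> M n r" "st J * J = e r" using J by (auto simp: F_def)
    obtain K where K: "K \<in> F n (n - r)" "J * st J + K * st K = e n" "st K * J = 0"
      using orth_compl[OF J] by blast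
    have "J * K0 = J * (e r * K0)" using JM by (simp add: M_r')
    then have "J * K0 = 0" using K0 by simp
    moreover have "J * st J = e n - K * st K" using K(2) by (simp add: algebra_simps)
    ultimately have "card {P \<in> U n. P * (e n - K0 * st K0) = J} = card (U (n - r))"
      using K K0 JM K0' assms M_mono[OF JM(1), of n n] by (intro bij_U_fibre) auto
    then show ?thesis by (simp add: K0')
  qed
qed auto

lemma F_1: "F n 1 = {v. e n * v = v \<and> v * e 1 = v \<and> st v * v = e 1}"
  by (auto simp: F_def M_def)

lemma U_0: "U 0 = {0}"
  by (auto simp: U_def M_def)

lemma card_U: "real (card (U n)) = real w ^ (n * n) * (\<Prod>i=1..n. 1 - p ^ i)"
proof (induction n)
  case (Suc n)
  have "real (card (U (Suc n))) = real (card (U n)) * (real w ^ (2 * Suc n - 1) * (1 - p ^ Suc n))"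
    using card_frames[of 1 "Suc n"] card_unit[of "Suc n"] by (simp add: F_1[unfolded One_nat_def])
  also have "... = real w ^ (Suc n * Suc n) * (\<Prod>i=1..Suc n. 1 - p ^ i)"
  proof -
    have "Suc n * Suc n = n * n + (2 * Suc n - 1)" by simp
    then have *: "real w ^ (Suc n * Suc n) = real w ^ (n * n) * real w ^ (2 * Suc n - 1)" by (simp only: power_add)
    have "(\<Prod>i=1..Suc n. 1 - p ^ i) = (\<Prod>i=1..n. 1 - p ^ i) * (1 - p ^ Suc n)" by simp
    with * show ?thesis unfolding Suc by (simp only: mult_ac)
  qed
  finally show ?case .
qed (simp add: U_0)

text \<open>Hyperbolic frames: bases of two totally isotropic subspaces that are dual to each other
  under the form. \<open>IS\<close> below has the bases of a single totally isotropic
  subspace.\<close>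

definition HF :: "nat => nat => ('r \<times> 'r) set" where
  "HF n j = {(b, c). b \<in> M n j \<and> c \<in> M n j \<and> st b * b = 0 \<and> st c * c = 0 \<and> st c * b = e j}"

definition IS :: "nat => nat => 'r set" where
  "IS n j = {b \<in> LI n j. st b * b = 0}"

lemma finite_HF [simp, intro]: "finite (HF n j)"
  by (rule finite_subset[of _ "M n j \<times> M n j"]) (auto simp: HF_def)

lemma finite_IS [simp, intro]: "finite (IS n j)"
  by (auto simp: IS_def)

lemma HF_D:
  assumes "(b, c) \<in> HF n j"
  shows "b \<in> M n j" "c \<in> M n j" "st b * b = 0" "st c * c = 0" "st c * b = e j" "st b * c = e j"
  using assms st_mult[of "st c" b] by (auto simp: HF_def)

text \<open>\<open>b * st c + c * st b\<close> is the orthogonal projection onto the span of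
  \<open>b\<close> and \<open>c\<close>, so its complement is a Hermitian idempotent and has an
  orthonormal frame \<open>K\<close>. Counting columns split along \<open>b\<close>,
  \<open>c\<close> and \<open>K\<close> gives the length of \<open>K\<close>.\<close>

lemma HF_compl:
  assumes "(b, c) \<in> HF n j"
  obtains K where "2 * j \<le> n" "K \<in> F n (n - 2 * j)" "b * st c + c * st b + K * st K = e n"
    "st K * b = 0" "st K * c = 0" "st b * K = 0" "st c * K = 0"
proof -
  note h = HF_D[OF assms]
  have "e n - (b * st c + c * st b) \<in> H n"
    using h by (auto simp: H_def st_diff st_add st_mult intro!: M_intros)
  moreover have "(e n - (b * st c + c * st b)) * (e n - (b * st c + c * st b)) = e n - (b * st c + c * st b)"
    using h(1,2) by (simp add: algebra_simps h(3-) h(3-)[THEN assoc_l] e_mult M_l' M_r[OF M_st] M_l[OF M_st])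
  ultimately obtain s K where K': "K \<in> F n s" "e n - (b * st c + c * st b) = K * st K" by (rule herm_idem)
  then have K: "K \<in> M n s" "st K * K = e s" by (auto simp: F_def)
  have KL: "K \<in> LI n s" using K' F_LI by blast
  have "K * (st K * b) = (e n - (b * st c + c * st b)) * b" using K'(2) by (simp add: mult.assoc)
  also have "... = K * 0" using h by (simp add: algebra_simps M_l M_r)
  finally have Kb: "st K * b = 0" using LI_cancel[OF KL M_mult[OF M_st[OF K(1)] h(1)] M_0] by simp
  have "K * (st K * c) = (e n - (b * st c + c * st b)) * c" using K'(2) by (simp add: mult.assoc)
  also have "... = K * 0" using h by (simp add: algebra_simps M_l M_r)
  finally have Kc: "st K * c = 0" using LI_cancel[OF KL M_mult[OF M_st[OF K(1)] h(2)] M_0] by simp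
  have bK: "st b * K = 0" "st c * K = 0" using st_zero[OF Kb] st_zero[OF Kc] by simp_all
  have sum: "b * st c + c * st b + K * st K = e n" using K'(2) by (simp add: algebra_simps)
  note eqs = h(3-6) Kb Kc bK K(2)
  have "bij_betw (\<lambda>x. (st c * x, st b * x, st K * x)) (M n 1) (M j 1 \<times> M j 1 \<times> M s 1)"
  proof (rule bij_betw_byWitness[where f' = "\<lambda>(x, y, z). b * x + c * y + K * z"])
    show "\<forall>x\<in>M n 1. (case (st c * x, st b * x, st K * x) of (x, y, z) => b * x + c * y + K * z) = x"
    proof
      fix x assume "x \<in> M n 1"
      then have "(b * st c + c * st b + K * st K) * x = x" unfolding sum by (rule M_l)
      then show "(case (st c * x, st b * x, st K * x) of (x, y, z) => b * x + c * y + K * z) = x"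
        by (simp add: algebra_simps)
    qed
    show "\<forall>x\<in>M j 1 \<times> M j 1 \<times> M s 1. (st c * (case x of (x, y, z) => b * x + c * y + K * z), st b * (case x of (x, y, z) => b * x + c * y + K * z),
      st K * (case x of (x, y, z) => b * x + c * y + K * z)) = x"
      by (auto simp: algebra_simps eqs[THEN assoc_l] M_l)
  qed (use h K in \<open>auto intro!: M_intros\<close>)
  from bij_betw_same_card[OF this] have "w ^ (2 * n) = w ^ (2 * j + (2 * j + 2 * s))"
    by (simp only: card_M card_cartesian_product mult_1_right power_add)
  then have "n = 2 * j + s" unfolding w_pow_inject by simp
  with that K' sum Kb Kc bK show ?thesis by auto
qed

text \<open>Take two orthonormal frames \<open>e j\<close> and \<open>I2\<close>, orthogonal to each
  other, and the Hermitian involution \<open>h\<close> that swaps them. For the form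
  \<open>h\<close> they are isotropic and dual. Since \<open>h = i * st i\<close> with
  \<open>i\<close> invertible, \<open>st i\<close> carries them to a hyperbolic frame of the
  standard form.\<close>

lemma HF_nonempty:
  assumes "2 * j \<le> n"
  shows "HF n j ~= {}"
proof -
  have I1: "e j \<in> F n j" using assms by (auto simp: F_def e_in_M e_mult)
  obtain K where K: "K \<in> F n (n - j)" "st (e j) * K = 0" "st K * e j = 0"
    using orth_compl[OF I1] by metis
  then have KM: "K \<in> M n (n - j)" "st K * K = e (n - j)" by (auto simp: F_def)
  define I2 where "I2 = K * e j"
  have I2: "I2 \<in> M n j" "st I2 * I2 = e j" "e j * I2 = 0" "st I2 * e j = 0"
    using K KM by (auto simp: I2_def st_mult mult.assoc e_mult KM(2)[THEN assoc_l] e_mult[THEN assoc_l] K(2,3)[simplified] K(2,3)[simplified, THEN assoc_l]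
      intro!: M_intros) (use assms in \<open>simp_all add: min.absorb2\<close>)
  have I1M: "e j \<in> M n j" using assms by (auto intro: e_in_M)
  define h where "h = e j * st I2 + I2 * e j + (e n - e j - I2 * st I2)"
  have hH: "h \<in> H n"
    using I2 I1M M_st[OF I1M] assms by (auto simp: H_def h_def st_add st_diff st_mult intro!: M_intros)
  have e2: "e j * e j = e j" "e n * e j = e j" "e j * e n = e j" "e n * e n = e n" using assms by (simp_all add: e_mult)
  have "I2 * I2 = 0" using M_r'[OF I2(1), of I2] I2(3) by simp
  note eqs = this e2 I2(2-4) M_l[OF I2(1)] M_r[OF I2(1)] M_l[OF M_st[OF I2(1)]] M_r[OF M_st[OF I2(1)]]
  have hI1: "h * e j = I2" and hI2: "h * I2 = e j"
    by (simp_all add: h_def algebra_simps eqs eqs[THEN assoc_l])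
  have hsI2: "st I2 * h = e j" using arg_cong[OF hI2, of st] hH by (simp add: st_mult H_def)
  have "h * h = h * (e j * st I2 + I2 * e j + (e n - e j - I2 * st I2))" by (simp add: h_def)
  also have "... = I2 * st I2 + e j * e j + (h * e n - I2 - e j * st I2)"
    by (simp only: distrib_left right_diff_distrib mult.assoc[symmetric] hI1 hI2)
  also have "h * e n = h" using hH by (auto simp: H_def intro: M_r)
  also have "I2 * st I2 + e j * e j + (h - I2 - e j * st I2) = e n"
    by (simp add: h_def algebra_simps eqs)
  finally have hh: "h * h = e n" .
  obtain r i where i: "i \<in> LI n r" "h = i * st i" using herm_fact[OF hH] by blast
  have iM: "i \<in> M n r" using i by (auto simp: LI_def)
  have hM: "h \<in> M n n" using hH by (auto simp: H_def)
  have 1: "i * (st i * h) = e n" using hh i(2) by (simp add: mult.assoc)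
  have "i * ((st i * h) * i) = i * e r" using 1 iM by (simp add: mult.assoc[symmetric] M_l M_r)
  then have 2: "(st i * h) * i = e r"
    using LI_cancel[OF i(1) M_mult[OF M_mult[OF M_st[OF iM] hM] iM] e_in_M] by simp
  have r: "n = r" using dim_unique[OF iM M_mult[OF M_st[OF iM] hM] 1 2] .
  have "(st i * e j, st i * I2) \<in> HF n j"
  proof -
    have "st i * e j \<in> M n j" "st i * I2 \<in> M n j"
      using M_mult[OF M_st[OF iM] I1M] M_mult[OF M_st[OF iM] I2(1)] r by auto
    moreover have "st (st i * e j) * (st i * e j) = e j * (i * st i) * e j"
      "st (st i * I2) * (st i * I2) = st I2 * (i * st i) * I2" "st (st i * I2) * (st i * e j) = st I2 * (i * st i) * e j"
      by (simp_all add: st_mult mult.assoc)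
    ultimately show ?thesis
      unfolding HF_def i(2)[symmetric] by (simp add: mult.assoc hI1 hI2 I2 e_mult)
  qed
  then show ?thesis by blast
qed

text \<open>\<open>U n\<close> acts transitively on hyperbolic frames, and the stabiliser is the
  unitary group of the complement.\<close>

lemma card_HF: "card (U (2 * j + m)) = card (U m) * card (HF (2 * j + m) j)"
proof -
  let ?n = "2 * j + m"
  obtain b0 c0 where bc0: "(b0, c0) \<in> HF ?n j" using HF_nonempty[of j ?n] by fastforce
  note h0 = HF_D[OF bc0]
  obtain K0 where K0: "K0 \<in> F ?n m" "b0 * st c0 + c0 * st b0 + K0 * st K0 = e ?n"
    "st K0 * b0 = 0" "st K0 * c0 = 0" "st b0 * K0 = 0" "st c0 * K0 = 0"
    using HF_compl[OF bc0] by (metis add_diff_cancel_left')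
  have f0: "e ?n - K0 * st K0 = b0 * st c0 + c0 * st b0" using K0(2) by (simp add: algebra_simps)
  show ?thesis
  proof (rule card_fibres[where f = "\<lambda>P. (P * b0, P * c0)"])
    show "(P * b0, P * c0) \<in> HF ?n j" if "P \<in> U ?n" for P
      using that h0 by (auto simp: HF_def U_def st_mult mult.assoc assoc_l[of "st P" P] M_l intro: M_intros)
    show "card {P \<in> U ?n. (P * b0, P * c0) = bc} = card (U m)" if bc: "bc \<in> HF ?n j" for bc
    proof -
      obtain b c where bc': "bc = (b, c)" by (cases bc)
      note h = HF_D[OF bc[unfolded bc']]
      obtain K where K: "K \<in> F ?n m" "b * st c + c * st b + K * st K = e ?n"
        "st K * b = 0" "st K * c = 0" "st b * K = 0" "st c * K = 0"
        using HF_compl[OF bc[unfolded bc']] by (metis add_diff_cancel_left')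
      have f: "e ?n - K * st K = b * st c + c * st b" using K(2) by (simp add: algebra_simps)
      \<comment> \<open>The isometry between the spans that sends \<open>b0\<close> to
        \<open>b\<close> and \<open>c0\<close> to \<open>c\<close>.\<close>
      define a where "a = b * st c0 + c * st b0"
      have "card {P \<in> U ?n. P * (e ?n - K0 * st K0) = a} = card (U m)"
      proof (rule bij_U_fibre[OF K(1) K0(1)])
        show "a \<in> M ?n ?n" using h h0 by (auto simp: a_def intro!: M_intros)
        show "a * st a = e ?n - K * st K" unfolding f
          by (simp add: a_def st_add st_mult algebra_simps h0(3-)[THEN assoc_l] M_l[OF M_st[OF h(1)]] M_l[OF M_st[OF h(2)]])
        show "st a * a = e ?n - K0 * st K0" unfolding f0
          by (simp add: a_def st_add st_mult algebra_simps h(3-)[THEN assoc_l] M_l[OF M_st[OF h0(1)]] M_l[OF M_st[OF h0(2)]])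
      qed (simp_all add: a_def algebra_simps K(3-6) K(3-6)[THEN assoc_l] K0(3-6))
      moreover have "P * (e ?n - K0 * st K0) = a \<longleftrightarrow> (P * b0, P * c0) = bc" if "P \<in> U ?n" for P
      proof
        assume P: "P * (e ?n - K0 * st K0) = a"
        have "P * b0 = P * (b0 * st c0 + c0 * st b0) * b0" "P * c0 = P * (b0 * st c0 + c0 * st b0) * c0"
          by (simp_all add: algebra_simps h0(3-6) M_r[OF h0(1)] M_r[OF h0(2)])
        then have "P * b0 = a * b0" "P * c0 = a * c0" using P f0 by simp_all
        then show "(P * b0, P * c0) = bc"
          by (simp add: bc' a_def algebra_simps h0(3-6) M_r[OF h(1)] M_r[OF h(2)])
      next
        assume "(P * b0, P * c0) = bc"
        then show "P * (e ?n - K0 * st K0) = a"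
          unfolding f0 by (auto simp: bc' a_def algebra_simps)
      qed
      ultimately show ?thesis by (smt (verit, best) Collect_cong)
    qed
  qed auto
qed

text \<open>The duals \<open>c\<close> of \<open>b\<close> form an affine space of size
  \<open>w ^ (2 * j * (n - j))\<close>. Replacing \<open>c\<close> by \<open>c + b * s\<close>
  changes \<open>st c * c\<close> by \<open>s + st s\<close>, and by \<open>half\<close> every
  Hermitian matrix has this form, so all values of \<open>st c * c\<close> occur equally
  often.\<close>

lemma card_HF_fibre:
  assumes "b \<in> IS n j"
  shows "card {c \<in> M n j. st c * c = 0 \<and> st c * b = e j} * w ^ (j * j) = w ^ (2 * (j * (n - j)))"
proof -
  obtain k where b: "b \<in> M n j" "st b * b = 0" and k: "k \<in> M j n" "k * b = e j"
    using assms by (auto simp: IS_def LI_def)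
  obtain N L where NL: "N \<in> M n (n - j)" "L \<in> M (n - j) n" "N * L = e n - b * k" "L * N = e (n - j)" "L * b = 0" "k * N = 0"
    using LI_compl[OF b(1) k] by metis
  let ?A = "{c \<in> M n j. st c * b = e j}"
  let ?G = "{c \<in> M n j. st c * c = 0 \<and> st c * b = e j}"
  have "bij_betw (\<lambda>y. st (k + y * L)) (M j (n - j)) ?A"
  proof (rule bij_betw_byWitness[where f' = "\<lambda>c. st c * N"])
    show "\<forall>y\<in>M j (n - j). st (st (k + y * L)) * N = y"
      by (auto simp: algebra_simps NL M_r)
    show "\<forall>c\<in>?A. st (k + st c * N * L) = c"
    proof safe
      fix c assume c: "c \<in> M n j" "st c * b = e j"
      have "k + st c * N * L = k + st c * (N * L)" by (simp add: mult.assoc)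
      also have "... = st c" unfolding NL using c k by (simp add: algebra_simps M_r[OF M_st[OF c(1)]] c(2)[THEN assoc_l] M_l)
      finally show "st (k + st c * N * L) = c" by simp
    qed
    show "(\<lambda>y. st (k + y * L)) ` M j (n - j) \<subseteq> ?A"
      using k NL by (auto simp: algebra_simps intro!: M_intros)
  qed (use NL in \<open>auto intro!: M_intros\<close>)
  then have cA: "card ?A = w ^ (2 * (j * (n - j)))" by (simp add: bij_betw_same_card[symmetric] card_M)
  have "card ?A = card ?G * card (H j)"
  proof (rule card_fibres[where f = "\<lambda>c. st c * c"])
    show "st c * c \<in> H j" if "c \<in> ?A" for c using that by (auto simp: H_def st_mult intro: M_intros)
    fix h assume h: "h \<in> H j"
    obtain t where t: "t + st t = 1" "\<And>x. t * x = x * t" using half by metis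
    have t': "st t * x = x * st t" for x using arg_cong[OF t(2)[of "st x"], of st] by (simp add: st_mult)
    define s where "s = t * h"
    have "e j * (t * h) = t * (e j * h)" by (metis mult.assoc t(2))
    then have s: "s \<in> M j j" using h by (auto simp: H_def M_def s_def mult.assoc)
    have "s + st s = (t + st t) * h" using h by (simp add: s_def st_mult H_def algebra_simps t')
    then have ss: "s + st s = h" by (simp add: t)
    have bc: "st b * c = e j" if "st c * b = e j" for c using arg_cong[OF that, of st] by (simp add: st_mult)
    have "bij_betw (\<lambda>c. c + b * s) ?G {c \<in> ?A. st c * c = h}"
    proof (rule bij_betw_byWitness[where f' = "\<lambda>c. c - b * s"])
      show "(\<lambda>c. c + b * s) ` ?G \<subseteq> {c \<in> ?A. st c * c = h}"
        using b s ss by (auto simp: st_add st_mult algebra_simps bc b(2)[THEN assoc_l] assoc_l[of _ b] M_l M_r[OF M_st] intro!: M_intros)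
      show "(\<lambda>c. c - b * s) ` {c \<in> ?A. st c * c = h} \<subseteq> ?G"
      proof safe
        fix c assume c: "c \<in> M n j" "st c * b = e j" and h: "h = st c * c"
        show "c - b * s \<in> M n j" using b c s by (auto intro!: M_intros)
        show "st (c - b * s) * b = e j" using c b by (simp add: st_diff st_mult algebra_simps)
        have "st (c - b * s) * (c - b * s) = st c * c - (s + st s)"
          using b s c by (simp add: st_diff st_mult algebra_simps bc b(2)[THEN assoc_l] c(2)[THEN assoc_l] M_l M_r[OF M_st])
        then show "st (c - b * s) * (c - b * s) = 0" using ss h by simp
      qed
    qed auto
    then show "card {c \<in> ?A. st c * c = h} = card ?G" by (simp add: bij_betw_same_card)
  qed auto
  then show ?thesis using cA by (simp add: card_H)
qed

text \<open>The count \<open>card_HF_fibre\<close> of isotropic duals is not zero, so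
  \<open>b\<close> extends to a hyperbolic frame, which takes up \<open>2 * j\<close>
  dimensions.\<close>

lemma IS_D:
  assumes "b \<in> IS n j"
  shows "2 * j \<le> n"
proof -
  have "card {c \<in> M n j. st c * c = 0 \<and> st c * b = e j} > 0"
  proof (rule ccontr)
    assume "\<not> ?thesis"
    then have "card {c \<in> M n j. st c * c = 0 \<and> st c * b = e j} = 0" by simp
    then have "w ^ (2 * (j * (n - j))) = 0" by (metis card_HF_fibre[OF assms] mult_0)
    moreover have "w ^ (2 * (j * (n - j))) > 0" using w_ge_2 by simp
    ultimately show False by simp
  qed
  then obtain c where "c \<in> M n j" "st c * c = 0" "st c * b = e j" by (force simp: card_gt_0_iff)
  then have "(b, c) \<in> HF n j" using assms by (auto simp: HF_def IS_def LI_def)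
  then show ?thesis using HF_compl by blast
qed

text \<open>Each \<open>b\<close> has \<open>w ^ (2 * j * (n - j) - j * j)\<close> isotropic duals;
  for \<open>n = 2 * j + m\<close> the exponent is \<open>j * j + 2 * j * m\<close>.\<close>

lemma card_IS: "card (U (2 * j + m)) = card (U m) * w ^ (j * j + 2 * j * m) * card (IS (2 * j + m) j)"
proof -
  let ?n = "2 * j + m"
  have "card (HF ?n j) = w ^ (j * j + 2 * j * m) * card (IS ?n j)"
  proof (rule card_fibres[where f = fst])
    show "fst x \<in> IS ?n j" if "x \<in> HF ?n j" for x
      using that by (auto simp: HF_def IS_def LI_def intro: M_st)
    fix b assume b: "b \<in> IS ?n j"
    then have bM: "b \<in> M ?n j" "st b * b = 0" by (auto simp: IS_def LI_def)
    have "bij_betw (Pair b) {c \<in> M ?n j. st c * c = 0 \<and> st c * b = e j} {x \<in> HF ?n j. fst x = b}"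
      by (rule bij_betw_byWitness[where f' = snd]) (use bM in \<open>auto simp: HF_def\<close>)
    then have "card {x \<in> HF ?n j. fst x = b} = card {c \<in> M ?n j. st c * c = 0 \<and> st c * b = e j}"
      by (simp add: bij_betw_same_card)
    moreover have "2 * (j * (?n - j)) = (j * j + 2 * j * m) + j * j" by (simp add: algebra_simps)
    ultimately have "card {x \<in> HF ?n j. fst x = b} * w ^ (j * j) = w ^ (j * j + 2 * j * m) * w ^ (j * j)"
      using card_HF_fibre[OF b] by (simp only: power_add)
    then show "card {x \<in> HF ?n j. fst x = b} = w ^ (j * j + 2 * j * m)"
      using w_ge_2 by simp
  qed auto
  then show ?thesis using card_HF[of j m] by simp
qed

end

section \<open>Commuting Hermitian pairs with nilpotent first entry\<close>

context herm begin

lemma LI_I: "i \<in> M n r ==> k \<in> M r n ==> k * i = e r ==> i \<in> LI n r"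
  by (auto simp: LI_def)

text \<open>These are the embeddings under which the standard form pulls back to the form
  \<open>nu * st nu\<close> of rank \<open>r'\<close>. The source splits into the columns of
  \<open>st mu\<close>, where that form is standard, and those of \<open>st L\<close>, its radical.
  The first go to an orthonormal frame, the second to an isotropic frame in its complement.\<close>

lemma card_EMB:
  assumes "nu \<in> LI r r'"
  shows "card {i \<in> LI n r. st i * i = nu * st nu} = card (IS (n - r') (r - r')) * card (F n r')"
proof -
  define j where "j = r - r'"
  obtain mu where nu: "nu \<in> M r r'" and mu: "mu \<in> M r' r" "mu * nu = e r'" using assms by (auto simp: LI_def)
  obtain N L where NL: "N \<in> M r j" "L \<in> M j r" "N * L = e r - nu * mu" "L * N = e j" "L * nu = 0" "mu * N = 0"
    using LI_compl[OF nu mu] unfolding j_def by metis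
  have NL': "st nu * st mu = e r'" "st L * st N = e r - st mu * st nu" "st N * st L = e j" "st nu * st L = 0" "st N * st mu = 0"
    using NL(3-) mu(2) by (simp_all add: st_mult[symmetric] st_diff)
  define D where "D = {(a, b). a \<in> F n r' \<and> b \<in> LI n j \<and> st b * b = 0 \<and> st a * b = 0}"
  have finD: "finite D" by (rule finite_subset[of _ "F n r' \<times> LI n j"]) (auto simp: D_def)
  have "bij_betw (\<lambda>i. (i * st mu, i * st L)) {i \<in> LI n r. st i * i = nu * st nu} D"
  proof (rule bij_betw_byWitness[where f' = "\<lambda>(a, b). a * st nu + b * st N"])
    show "\<forall>i\<in>{i \<in> LI n r. st i * i = nu * st nu}. (case (i * st mu, i * st L) of (a, b) => a * st nu + b * st N) = i"
      by (auto simp: mult.assoc NL' algebra_simps LI_def M_r)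
    show "\<forall>x\<in>D. ((case x of (a, b) => a * st nu + b * st N) * st mu, (case x of (a, b) => a * st nu + b * st N) * st L) = x"
      by (auto simp: D_def F_def LI_def mult.assoc NL' distrib_right M_r)
    show "(\<lambda>i. (i * st mu, i * st L)) ` {i \<in> LI n r. st i * i = nu * st nu} \<subseteq> D"
    proof clarify
      fix i assume i: "i \<in> LI n r" and ii: "st i * i = nu * st nu"
      then obtain k where iM: "i \<in> M n r" and k: "k \<in> M r n" "k * i = e r" by (auto simp: LI_def)
      have 1: "i * st mu \<in> F n r'"
        using iM mu nu by (auto simp: F_def st_mult mult.assoc assoc_l[OF ii] NL' mu(2)[THEN assoc_l] e_mult intro!: M_intros)
      have "(st N * k) * (i * st L) = e j"
        using NL NL' by (simp add: mult.assoc k(2)[THEN assoc_l] M_l[OF M_st[OF NL(2)]])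
      then have 2: "i * st L \<in> LI n j"
        using iM k NL by (intro LI_I[of _ _ _ "st N * k"]) (auto intro: M_intros)
      show "(i * st mu, i * st L) \<in> D"
        using 1 2 by (simp add: D_def st_mult mult.assoc assoc_l[OF ii] NL')
    qed
    show "(\<lambda>(a, b). a * st nu + b * st N) ` D \<subseteq> {i \<in> LI n r. st i * i = nu * st nu}"
    proof clarify
      fix a b assume "(a, b) \<in> D"
      then have a: "a \<in> M n r'" "st a * a = e r'" and b: "b \<in> LI n j" "st b * b = 0" and ab: "st a * b = 0"
        by (auto simp: D_def F_def)
      obtain k where bM: "b \<in> M n j" and k: "k \<in> M j n" "k * b = e j" using b by (auto simp: LI_def)
      have ba: "st b * a = 0" using st_zero[OF ab] by simp
      define i where "i = a * st nu + b * st N"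
      have iM: "i \<in> M n r" using a bM nu NL by (auto simp: i_def intro!: M_intros)
      have "(st mu * st a + st L * k - st L * k * a * st a) * i = st mu * st nu + st L * st N"
        by (simp add: i_def algebra_simps a(2) ab k(2) a(2)[THEN assoc_l] ab[THEN assoc_l] k(2)[THEN assoc_l]
            M_l[OF M_st[OF nu]] M_l[OF M_st[OF NL(1)]])
      also have "... = e r" by (simp add: NL')
      finally have "i \<in> LI n r"
        using iM mu a NL k by (intro LI_I) (auto intro!: M_intros)
      moreover have "st i * i = nu * st nu"
        by (simp add: i_def st_add st_mult algebra_simps a(2)[THEN assoc_l] ab[THEN assoc_l] ba[THEN assoc_l] b(2)[THEN assoc_l] M_l[OF M_st[OF nu]])
      ultimately show "a * st nu + b * st N \<in> LI n r \<and> st (a * st nu + b * st N) * (a * st nu + b * st N) = nu * st nu"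
        unfolding i_def by blast
    qed
  qed
  then have "card {i \<in> LI n r. st i * i = nu * st nu} = card D" by (rule bij_betw_same_card)
  also have "... = card (IS (n - r') j) * card (F n r')"
  proof (rule card_fibres[where f = fst])
    fix a assume a: "a \<in> F n r'"
    then have aM: "a \<in> M n r'" by (auto simp: F_def)
    obtain K where K: "K \<in> F n (n - r')" "a * st a + K * st K = e n" "st a * K = 0" using orth_compl[OF a] by blast
    then have KM: "K \<in> M n (n - r')" "st K * K = e (n - r')" by (auto simp: F_def)
    have KK: "K * st K = e n - a * st a" using K(2) by (simp add: algebra_simps)
    have "bij_betw (\<lambda>b. (a, K * b)) (IS (n - r') j) {x \<in> D. fst x = a}"
    proof (rule bij_betw_byWitness[where f' = "\<lambda>x. st K * snd x"])
      show "\<forall>b\<in>IS (n - r') j. st K * snd (a, K * b) = b"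
        by (auto simp: IS_def LI_def KM(2)[THEN assoc_l] M_l)
      show "\<forall>x\<in>{x \<in> D. fst x = a}. (a, K * (st K * snd x)) = x"
        by (auto simp: D_def LI_def mult.assoc[symmetric] KK left_diff_distrib M_l) (simp add: mult.assoc)
      show "(\<lambda>b. (a, K * b)) ` IS (n - r') j \<subseteq> {x \<in> D. fst x = a}"
      proof (clarsimp simp: D_def a)
        fix b assume "b \<in> IS (n - r') j"
        then obtain k where b: "b \<in> M (n - r') j" "st b * b = 0" and k: "k \<in> M j (n - r')" "k * b = e j"
          by (auto simp: IS_def LI_def)
        have "(k * st K) * (K * b) = e j" by (simp add: mult.assoc KM(2)[THEN assoc_l] M_l[OF b(1)] k)
        then have "K * b \<in> LI n j" using KM k b by (intro LI_I[of _ _ _ "k * st K"]) (auto intro: M_intros)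
        then show "K * b \<in> LI n j \<and> st (K * b) * (K * b) = 0 \<and> st a * (K * b) = 0"
          by (simp add: st_mult mult.assoc KM(2)[THEN assoc_l] M_l[OF b(1)] b K(3)[THEN assoc_l])
      qed
      show "(\<lambda>x. st K * snd x) ` {x \<in> D. fst x = a} \<subseteq> IS (n - r') j"
      proof clarsimp
        fix b assume "(a, b) \<in> D"
        then obtain k where b: "b \<in> M n j" "st b * b = 0" "st a * b = 0" and k: "k \<in> M j n" "k * b = e j"
          by (auto simp: D_def LI_def)
        have *: "K * (st K * b) = b" using b by (simp add: mult.assoc[symmetric] KK left_diff_distrib M_l) (simp add: mult.assoc)
        have "st (st K * b) * (st K * b) = 0" by (simp add: st_mult mult.assoc * b)
        moreover have "st K * b \<in> LI (n - r') j"
          using KM k b by (intro LI_I[of _ _ _ "k * K"]) (auto intro: M_intros simp: mult.assoc *)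
        ultimately show "st K * b \<in> IS (n - r') j" by (simp add: IS_def)
      qed
    qed
    then show "card {x \<in> D. fst x = a} = card (IS (n - r') j)" by (simp add: bij_betw_same_card)
  qed (use finD in \<open>auto simp: D_def\<close>)
  finally show ?thesis by (simp add: j_def)
qed

text \<open>\<open>B\<close> is prescribed on the image of \<open>i\<close> and, being Hermitian, so
  are its rows along that image; what stays free is a Hermitian form on the cokernel, of size
  \<open>n - r\<close>. The commutation hypothesis makes the two prescriptions compatible.\<close>

lemma card_lifts:
  assumes i: "i \<in> LI n r" and B': "B' \<in> H r" and comm: "st i * i * B' = B' * (st i * i)"
  shows "card {B \<in> H n. B * i = i * B'} = w ^ ((n - r) * (n - r))"
proof -
  obtain k where iM: "i \<in> M n r" and k: "k \<in> M r n" "k * i = e r" using i by (auto simp: LI_def)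
  obtain N L where NL: "N \<in> M n (n - r)" "L \<in> M (n - r) n" "N * L = e n - i * k" "L * N = e (n - r)" "L * i = 0" "k * N = 0"
    using LI_compl[OF iM k] by metis
  have BM: "B' \<in> M r r" "st B' = B'" using B' by (auto simp: H_def)
  have NL': "st N * st L = e (n - r)" "st L * st N = e n - st k * st i"
    using NL(3-) by (simp_all add: st_mult[symmetric] st_diff)
  have comm': "st i * (i * B') = B' * (st i * i)" using comm by (simp add: mult.assoc)
  \<comment> \<open>One solution. On \<open>i\<close> the second term, added for symmetry, leaves
    the excess \<open>st k * B' * st i * i\<close>, which the third term cancels by
    commutation.\<close>
  define B0 where "B0 = i * B' * k + st k * B' * st i - st k * (st i * i * B') * k"
  have B0: "B0 \<in> H n"
    using iM k BM comm by (auto simp: H_def B0_def st_add st_diff st_mult mult.assoc comm' intro!: M_intros)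
  have B0i: "B0 * i = i * B'"
    by (simp add: B0_def algebra_simps k(2) M_r[OF iM] M_r[OF BM(1)] M_r'[OF BM(1)] comm')
  have "bij_betw (\<lambda>C. B0 + st L * C * L) (H (n - r)) {B \<in> H n. B * i = i * B'}"
  proof (rule bij_betw_byWitness[where f' = "\<lambda>B. st N * (B - B0) * N"])
    show "\<forall>C\<in>H (n - r). st N * (B0 + st L * C * L - B0) * N = C"
      by (auto simp: mult.assoc NL NL'(1)[THEN assoc_l] H_def M_l M_r)
    show "\<forall>B\<in>{B \<in> H n. B * i = i * B'}. B0 + st L * (st N * (B - B0) * N) * L = B"
    proof safe
      fix B assume B: "B \<in> H n" "B * i = i * B'"
      define X where "X = B - B0"
      have X: "X \<in> M n n" "st X = X" "X * i = 0" using B B0 B0i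
        by (auto simp: X_def H_def st_diff left_diff_distrib intro!: M_intros)
      have iX: "st i * X = 0" using st_zero[OF X(3)] X(2) by simp
      have "st L * (st N * X * N) * L = (st L * st N) * X * (N * L)" by (simp add: mult.assoc)
      also have "... = X" unfolding NL' NL
        by (simp add: algebra_simps X(3) iX X(3)[THEN assoc_l] M_l[OF X(1)] M_r[OF X(1)])
      finally show "B0 + st L * (st N * (B - B0) * N) * L = B" by (simp add: X_def)
    qed
    show "(\<lambda>C. B0 + st L * C * L) ` H (n - r) \<subseteq> {B \<in> H n. B * i = i * B'}"
      using B0 NL by (auto simp: H_def st_add st_mult algebra_simps B0i intro!: M_intros)
    show "(\<lambda>B. st N * (B - B0) * N) ` {B \<in> H n. B * i = i * B'} \<subseteq> H (n - r)"
      using B0 NL by (auto simp: H_def st_diff st_mult mult.assoc intro!: M_intros)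
  qed
  from bij_betw_same_card[OF this] show ?thesis by (simp add: card_H)
qed

definition NP :: "nat => ('r \<times> 'r) set" where
  "NP n = {(A, B). A \<in> H n \<and> B \<in> H n \<and> A * B = B * A \<and> (\<exists>m. A ^ m = 0)}"

text \<open>The stratum of pairs whose first entry has rank \<open>r\<close>.\<close>

definition CP :: "nat => nat => ('r \<times> 'r) set" where
  "CP n r = {x \<in> NP n. \<exists>i\<in>LI n r. fst x = i * st i}"

lemma finite_NP [simp, intro]: "finite (NP n)" and finite_CP [simp, intro]: "finite (CP n r)"
proof -
  show "finite (NP n)" by (rule finite_subset[of _ "H n \<times> H n"]) (auto simp: NP_def)
  then show "finite (CP n r)" by (auto simp: CP_def)
qed

lemma power_rotate: "(x * y) ^ Suc m = x * (y * x) ^ m * y" for x y :: 'r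
  by (induction m) (simp_all add: mult.assoc)

lemma card_NP_CP: "card (NP n) = (\<Sum>r\<le>n. card (CP n r))"
proof -
  have "NP n = (\<Union>r\<in>{..n}. CP n r)"
  proof safe
    fix A B assume "(A, B) \<in> NP n"
    moreover from this obtain r i where "i \<in> LI n r" "A = i * st i" using herm_fact[of A n] by (auto simp: NP_def)
    ultimately show "(A, B) \<in> (\<Union>r\<in>{..n}. CP n r)" using LI_le[of i n r] by (auto simp: CP_def)
  qed (auto simp: CP_def)
  moreover have "card (\<Union>r\<in>{..n}. CP n r) = (\<Sum>r\<le>n. card (CP n r))"
  proof (rule card_UN_disjoint)
    show "\<forall>r\<in>{..n}. \<forall>s\<in>{..n}. r ~= s \<longrightarrow> CP n r \<inter> CP n s = {}"
      by (auto simp: CP_def) (metis herm_fact_rank)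
  qed auto
  ultimately show ?thesis by simp
qed

text \<open>Two counts of the pairs \<open>(i, B)\<close> with \<open>(i * st i, B)\<close> in
  \<open>NP n\<close>. Over a fixed \<open>(A, B)\<close> the factors \<open>i\<close> form a torsor
  of \<open>U r\<close>. On the other hand \<open>st i * i\<close> is Hermitian and nilpotent of the
  smaller size \<open>r\<close>, and \<open>B\<close> induces some \<open>B'\<close> commuting with
  it. Over such a pair of rank \<open>r'\<close>, \<open>card_EMB\<close> counts the choices of
  \<open>i\<close> and \<open>card_lifts\<close> those of \<open>B\<close>.\<close>

lemma CP_recursion:
  "card (U r) * card (CP n r) = (\<Sum>r'\<le>r. card (CP r r') * (w ^ ((n - r) * (n - r)) * (card (IS (n - r') (r - r')) * card (F n r'))))"
proof -
  define Om where "Om = {(i, B). i \<in> LI n r \<and> (i * st i, B) \<in> NP n}"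
  have finOm: "finite Om" by (rule finite_subset[of _ "LI n r \<times> H n"]) (auto simp: Om_def NP_def)
  have "card Om = card (U r) * card (CP n r)"
  proof (rule card_fibres[where f = "\<lambda>(i, B). (i * st i, B)"])
    fix x assume "x \<in> CP n r"
    then obtain i B where x: "x = (i * st i, B)" "i \<in> LI n r" "(i * st i, B) \<in> NP n" by (cases x) (auto simp: CP_def)
    obtain k where iM: "i \<in> M n r" and k: "k \<in> M r n" "k * i = e r" using x by (auto simp: LI_def)
    have "bij_betw (\<lambda>X. (i * X, B)) (U r) {om \<in> Om. (case om of (i, B) => (i * st i, B)) = x}"
    proof (rule bij_betw_byWitness[where f' = "\<lambda>om. k * fst om"])
      show "\<forall>X\<in>U r. k * fst (i * X, B) = X" by (auto simp: k(2)[THEN assoc_l] U_def M_l)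
      have *: "om = (i * (k * fst om), B) \<and> k * fst om \<in> U r" if h: "om \<in> Om" "(case om of (i, B) => (i * st i, B)) = x" for om
      proof -
        obtain i' where om: "om = (i', B)" using h x by (cases om) auto
        with h have i': "i' \<in> LI n r" "i' * st i' = i * st i" using x by (auto simp: Om_def)
        then obtain X where "X \<in> U r" "i' = i * X" using herm_fact_rank[OF x(2) i'(1)] by metis
        then show ?thesis by (auto simp: om k(2)[THEN assoc_l] U_def M_l)
      qed
      then show "\<forall>om\<in>{om \<in> Om. (case om of (i, B) => (i * st i, B)) = x}. (i * (k * fst om), B) = om" by auto
      show "(\<lambda>om. k * fst om) ` {om \<in> Om. (case om of (i, B) => (i * st i, B)) = x} \<subseteq> U r" using * by auto
      show "(\<lambda>X. (i * X, B)) ` U r \<subseteq> {om \<in> Om. (case om of (i, B) => (i * st i, B)) = x}"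
      proof (rule image_subsetI)
        fix X assume "X \<in> U r"
        then have X: "X \<in> M r r" "st X * X = e r" "X * st X = e r" by (auto simp: U_def)
        have "(st X * k) * (i * X) = e r" by (simp add: mult.assoc k(2)[THEN assoc_l] M_l[OF X(1)] X)
        then have "i * X \<in> LI n r" using X k iM by (intro LI_I[of _ _ _ "st X * k"]) (auto intro: M_intros)
        moreover have "i * X * st (i * X) = i * st i"
          by (simp add: st_mult mult.assoc X(3)[THEN assoc_l] M_l[OF M_st[OF iM]])
        ultimately show "(i * X, B) \<in> {om \<in> Om. (case om of (i, B) => (i * st i, B)) = x}"
          using x by (auto simp: Om_def)
      qed
    qed
    then show "card {om \<in> Om. (case om of (i, B) => (i * st i, B)) = x} = card (U r)" by (simp add: bij_betw_same_card)
  qed (use finOm in \<open>auto simp: Om_def CP_def\<close>)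
  moreover have "card Om = (\<Sum>r'\<le>r. card (CP r r') * (w ^ ((n - r) * (n - r)) * (card (IS (n - r') (r - r')) * card (F n r'))))"
  proof -
    define ka where "ka i = (SOME k. k \<in> M r n \<and> k * i = e r)" for i
    have ka: "ka i \<in> M r n" "ka i * i = e r" if "i \<in> LI n r" for i
      using someI_ex[of "\<lambda>k. k \<in> M r n \<and> k * i = e r"] that by (auto simp: ka_def LI_def)
    \<comment> \<open>\<open>ka i * B * i\<close> is the matrix of \<open>B\<close> on the image of
      \<open>A\<close>, in the basis given by the columns of \<open>i\<close>.\<close>
    define g where "g = (\<lambda>(i, B). (st i * i, ka i * B * i))"
    have gNP: "g om \<in> NP r \<and> (\<exists>i B. om = (i, B) \<and> B * i = i * snd (g om))" if "om \<in> Om" for om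
    proof -
      obtain i B where om: "om = (i, B)" by (cases om)
      have i: "i \<in> LI n r" and B: "B \<in> M n n" "st B = B" "i * st i * B = B * (i * st i)" and nil: "\<exists>m. (i * st i) ^ m = 0"
        using that by (auto simp: om Om_def NP_def H_def)
      have iM: "i \<in> M n r" using i by (auto simp: LI_def)
      have kst: "st i * st (ka i) = e r" using ka[OF i] by (simp add: st_mult[symmetric])
      define Y where "Y = st i * B * st (ka i)"
      have YM: "Y \<in> M r r" using iM B ka[OF i] by (auto simp: Y_def intro!: M_intros)
      have Bi: "B * i = i * Y"
        using arg_cong[OF B(3), of "\<lambda>z. z * st (ka i)"] iM by (simp add: Y_def mult.assoc kst M_r)
      have Y: "ka i * B * i = Y" by (simp add: mult.assoc Bi ka[OF i] ka(2)[OF i, THEN assoc_l] M_l[OF YM])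
      have "i * (st i * B) = i * (Y * st i)" using B(3) Bi by (simp add: mult.assoc[symmetric])
      then have iB: "st i * B = Y * st i"
        using LI_cancel[OF i M_mult[OF M_st[OF iM] B(1)] M_mult[OF YM M_st[OF iM]]] by simp
      then have "i * st Y = i * Y" using arg_cong[OF iB, of st, unfolded st_mult st_st] Bi B(2) YM by simp
      then have stY: "st Y = Y" using LI_cancel[OF i M_st[OF YM] YM] by simp
      have comm: "st i * i * Y = Y * (st i * i)"
        using iB Bi by (metis mult.assoc)
      have "\<exists>m. (st i * i) ^ m = 0"
        using nil power_rotate[of "st i" i] by (metis mult_zero_left mult_zero_right)
      then have "g om \<in> NP r" using YM stY comm iM
        by (auto simp: g_def om Y NP_def H_def st_mult intro: M_intros)
      then show ?thesis using Bi by (auto simp: om g_def Y)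
    qed
    have fib: "card {om \<in> Om. g om = x} = w ^ ((n - r) * (n - r)) * (card (IS (n - r') (r - r')) * card (F n r'))"
      if x: "x \<in> CP r r'" for x r'
    proof -
      obtain A' B' nu where x': "x = (A', B')" "nu \<in> LI r r'" "A' = nu * st nu" using x by (cases x) (auto simp: CP_def)
      have NP: "A' \<in> H r" "B' \<in> H r" "A' * B' = B' * A'" "\<exists>m. A' ^ m = 0" using x by (auto simp: CP_def NP_def x')
      let ?E = "{i \<in> LI n r. st i * i = nu * st nu}"
      let ?S = "{(i, B). i \<in> LI n r \<and> st i * i = A' \<and> B \<in> H n \<and> B * i = i * B'}"
      have "{om \<in> Om. g om = x} = ?S"
      proof (intro equalityI subsetI)
        fix om assume "om \<in> {om \<in> Om. g om = x}"
        then obtain i B where o: "om = (i, B)" and om: "(i, B) \<in> Om" and g: "g (i, B) = x" by (cases om) auto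
        have "i \<in> LI n r" "B \<in> H n" using om by (auto simp: Om_def NP_def)
        moreover have "st i * i = A'" using g by (simp add: g_def x')
        moreover have "B * i = i * B'" using gNP[OF om] g by (auto simp: x')
        ultimately show "om \<in> ?S" by (simp add: o)
      next
        fix om assume "om \<in> ?S"
        then obtain i B where o: "om = (i, B)" and i: "i \<in> LI n r" and A': "A' = st i * i" and B: "B \<in> H n" and Bi: "B * i = i * B'"
          by (cases om) auto
        have iM: "i \<in> M n r" using i by (auto simp: LI_def)
        have iB: "st i * B = B' * st i" using arg_cong[OF Bi, of st, unfolded st_mult st_st] B NP by (simp add: H_def)
        have "i * st i * B = B * (i * st i)" using iB Bi by (metis mult.assoc)
        moreover have "\<exists>m. (i * st i) ^ m = 0"
          using NP(4) power_rotate[of i "st i"] unfolding A' by (metis mult_zero_left mult_zero_right)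
        ultimately have "(i, B) \<in> Om" using i iM B by (auto simp: Om_def NP_def H_def st_mult intro: M_intros)
        have "ka i * B * i = B'" using Bi NP ka[OF i] by (simp add: mult.assoc ka(2)[OF i, THEN assoc_l] H_def M_l[of B' r r])
        then have "g (i, B) = x" by (simp add: g_def x'(1) A')
        with \<open>(i, B) \<in> Om\<close> show "om \<in> {om \<in> Om. g om = x}" by (simp add: o)
      qed
      moreover have "card ?S = w ^ ((n - r) * (n - r)) * card ?E"
      proof (rule card_fibres[where f = fst])
        show "finite ?S" by (rule finite_subset[of _ "LI n r \<times> H n"]) auto
        fix i assume i: "i \<in> ?E"
        then have "bij_betw (Pair i) {B \<in> H n. B * i = i * B'} {a \<in> ?S. fst a = i}"
          by (intro bij_betw_byWitness[where f' = snd]) (auto simp: x')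
        then have "card {a \<in> ?S. fst a = i} = card {B \<in> H n. B * i = i * B'}" by (simp add: bij_betw_same_card)
        also have "... = w ^ ((n - r) * (n - r))" using i NP by (intro card_lifts) (auto simp: x')
        finally show "card {a \<in> ?S. fst a = i} = w ^ ((n - r) * (n - r))" .
      qed (auto simp: x')
      ultimately show ?thesis using card_EMB[OF x'(2), of n] by simp
    qed
    have NP: "NP r = (\<Union>r'\<in>{..r}. CP r r')"
    proof safe
      fix A B assume "(A, B) \<in> NP r"
      moreover from this obtain r' i where "i \<in> LI r r'" "A = i * st i" using herm_fact[of A r] by (auto simp: NP_def)
      ultimately show "(A, B) \<in> (\<Union>r'\<in>{..r}. CP r r')" using LI_le[of i r r'] by (auto simp: CP_def)
    qed (auto simp: CP_def)
    have "card Om = (\<Sum>x\<in>NP r. card {om \<in> Om. g om = x})"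
      using finOm gNP by (intro card_fibres_sum) auto
    also have "... = (\<Sum>r'\<le>r. \<Sum>x\<in>CP r r'. card {om \<in> Om. g om = x})"
      unfolding NP
    proof (rule sum.UNION_disjoint)
      show "\<forall>a\<in>{..r}. \<forall>s\<in>{..r}. a ~= s \<longrightarrow> CP r a \<inter> CP r s = {}"
        by (auto simp: CP_def) (metis herm_fact_rank)
    qed auto
    also have "... = (\<Sum>r'\<le>r. card (CP r r') * (w ^ ((n - r) * (n - r)) * (card (IS (n - r') (r - r')) * card (F n r'))))"
      by (simp add: fib)
    finally show ?thesis .
  qed
  ultimately show ?thesis by simp
qed

text \<open>After division by the group orders the frame counts in \<open>CP_recursion\<close>
  cancel against \<open>card_frames\<close> and \<open>card_IS\<close>, and the weight that remains
  is \<open>om m = w ^ (m * m) / card (U m)\<close> with \<open>m = n + r' - 2 * r\<close>. By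
  \<open>card_U\<close> it is coefficient \<open>m\<close> of \<open>euler_fps p\<close>. In terms
  of nullities this is the recursion solved by \<open>iprod_recursion\<close>.\<close>

lemma nilp_series:
  "Abs_fps (\<lambda>n. real (card (NP n)) / real (card (U n))) = iprod (euler_fps p)"
proof -
  define x where "x n r = real (card (CP n r)) / real (card (U n))" for n r
  define om where "om m = real w ^ (m * m) / real (card (U m))" for m
  have U0: "real (card (U n)) ~= 0" for n using card_U_pos[of n] unfolding of_nat_eq_0_iff by linarith
  have w0: "real w > 0" using w_ge_2 by simp
  have x_rec: "x n r = (\<Sum>r'\<le>r. if 2 * r \<le> n + r' then x r r' * om (n + r' - 2 * r) else 0)" if rn: "r \<le> n" for n r
  proof -
    have "real (card (U r)) * real (card (CP n r)) =
      (\<Sum>r'\<le>r. real (card (CP r r')) * (real w ^ ((n - r) * (n - r)) * (real (card (IS (n - r') (r - r'))) * real (card (F n r')))))"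
      using arg_cong[OF CP_recursion[of r n], of real] by simp
    also have "... = (\<Sum>r'\<le>r. real (card (U r)) * real (card (U n)) * (if 2 * r \<le> n + r' then x r r' * om (n + r' - 2 * r) else 0))"
    proof (rule sum.cong)
      fix r' assume "r' \<in> {..r}"
      then have r': "r' \<le> r" by simp
      define j where "j = r - r'"
      show "real (card (CP r r')) * (real w ^ ((n - r) * (n - r)) * (real (card (IS (n - r') (r - r'))) * real (card (F n r')))) =
         real (card (U r)) * real (card (U n)) * (if 2 * r \<le> n + r' then x r r' * om (n + r' - 2 * r) else 0)"
      proof (cases "2 * r \<le> n + r'")
        case True
        define m where "m = n + r' - 2 * r"
        have n: "n - r' = 2 * j + m" "n - r = j + m" using True r' rn by (auto simp: m_def j_def)
        have "card (U n) = card (U (2 * j + m)) * card (F n r')"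
          using card_frames[of r' n] r' rn n by simp
        then have un: "real (card (U n)) = real (card (U m)) * real w ^ (j * j + 2 * j * m) * real (card (IS (2 * j + m) j)) * real (card (F n r'))"
          using card_IS[of j m] by simp
        have "(n - r) * (n - r) = m * m + (j * j + 2 * j * m)" unfolding n by (simp add: algebra_simps)
        then have wn: "real w ^ ((n - r) * (n - r)) = real w ^ (m * m) * real w ^ (j * j + 2 * j * m)" by (simp only: power_add)
        show ?thesis
          using True U0[of r] U0[of m] unfolding wn un m_def[symmetric] j_def[symmetric] n(1) x_def om_def
          by simp
      next
        case False
        then have "IS (n - r') (r - r') = {}" using IS_D[of _ "n - r'" "r - r'"] r' rn by fastforce
        with False show ?thesis by simp
      qed
    qed simp
    finally show ?thesis
      using U0[of r] U0[of n] by (simp add: sum_distrib_left[symmetric] x_def field_simps)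
  qed
  \<comment> \<open>Indexing by the nullity \<open>k = n - r\<close> instead of the rank: if
    \<open>j = r - r'\<close> is the nullity of the restriction, then
    \<open>n + r' - 2 * r = k - j\<close>.\<close>
  define c where "c k = Abs_fps (\<lambda>n. if k \<le> n then x n (n - k) else 0)" for k
  define S where "S = Abs_fps (\<lambda>n. real (card (NP n)) / real (card (U n)))"
  have om0: "om 0 = 1" by (simp add: om_def U_0)
  have "S = c 0 * iprod (Abs_fps om)"
  proof (rule iprod_recursion[where w = om and c = c])
    show "om 0 = 1" by (rule om0)
    show "fps_nth S N = (\<Sum>k\<le>N. fps_nth (c k) N)" for N
    proof -
      have "fps_nth S N = (\<Sum>r\<le>N. x N r)"
        by (simp add: S_def card_NP_CP x_def sum_divide_distrib)
      also have "... = (\<Sum>k\<le>N. x N (N - k))"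
        by (rule sum.reindex_bij_witness[where i = "\<lambda>k. N - k" and j = "\<lambda>k. N - k"]) auto
      finally show ?thesis by (simp add: c_def)
    qed
    show "c k = fps_X ^ k * (\<Sum>j\<le>k. fps_const (om (k - j)) * c j)" if "k > 0" for k
    proof (rule fps_ext)
      fix n
      show "fps_nth (c k) n = fps_nth (fps_X ^ k * (\<Sum>j\<le>k. fps_const (om (k - j)) * c j)) n"
      proof (cases "k \<le> n")
        case True
        define r where "r = n - k"
        have "fps_nth (c k) n = (\<Sum>r'\<le>r. if 2 * r \<le> n + r' then x r r' * om (n + r' - 2 * r) else 0)"
          using True x_rec[of r n] by (simp add: c_def r_def)
        also have "... = (\<Sum>r'\<in>{r'. r' \<le> r \<and> 2 * r \<le> n + r'}. x r r' * om (n + r' - 2 * r))"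
          by (rule sum.mono_neutral_cong_right) auto
        also have "... = (\<Sum>j\<in>{j. j \<le> k \<and> j \<le> r}. om (k - j) * x r (r - j))"
        proof (rule sum.reindex_bij_witness[where i = "\<lambda>j. r - j" and j = "\<lambda>r'. r - r'"])
          fix r' assume "r' \<in> {r'. r' \<le> r \<and> 2 * r \<le> n + r'}"
          then have "r' \<le> r" "2 * r \<le> n + r'" by auto
          then have "n + r' - 2 * r = k - (r - r')" using True unfolding r_def by arith
          then show "om (k - (r - r')) * x r (r - (r - r')) = x r r' * om (n + r' - 2 * r)"
            using \<open>r' \<le> r\<close> by simp
        qed (use True in \<open>auto simp: r_def\<close>)
        also have "... = (\<Sum>j\<le>k. om (k - j) * (if j \<le> r then x r (r - j) else 0))"
          by (rule sum.mono_neutral_cong_left) auto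
        also have "... = fps_nth (fps_X ^ k * (\<Sum>j\<le>k. fps_const (om (k - j)) * c j)) n"
          using True by (simp add: fps_X_power_mult_nth fps_sum_nth c_def r_def[symmetric])
        finally show ?thesis .
      qed (simp add: c_def fps_X_power_mult_nth)
    qed
  qed
  \<comment> \<open>Nullity 0 makes the nilpotent \<open>A\<close> invertible, which happens only in
    size 0.\<close>
  moreover have "c 0 = 1"
  proof (rule fps_ext)
    fix n
    show "fps_nth (c 0) n = fps_nth 1 n"
    proof (cases "n = 0")
      case True
      have "0 \<in> LI 0 0" by (rule LI_I[of _ _ _ 0]) (auto simp: M_0)
      moreover have "(0::'r) ^ 1 = 0" by simp
      moreover have "H 0 = {0}" by (auto simp: H_def M_def)
      ultimately have "CP 0 0 = {(0, 0)}" by (auto simp: CP_def NP_def intro: exI[of _ 1] bexI[of _ 0])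
      then show ?thesis using True by (simp add: c_def x_def U_0)
    next
      case False
      have "CP n n = {}"
      proof (rule ccontr)
        assume "CP n n ~= {}"
        then obtain i B where i: "i \<in> LI n n" and "(i * st i, B) \<in> NP n" by (force simp: CP_def)
        then obtain m where m: "(i * st i) ^ m = 0" by (auto simp: NP_def)
        obtain k where iM: "i \<in> M n n" and k: "k \<in> M n n" "k * i = e n" using i by (auto simp: LI_def)
        have ik: "i * k = e n" using inverse_commute[OF iM k] .
        have kst: "st i * st k = e n" using k by (simp add: st_mult[symmetric])
        have inv: "i * st i * (st k * k) = e n" by (simp add: mult.assoc kst[THEN assoc_l] M_l[OF k(1)] ik)
        have "(i * st i) ^ m * e n = 0 ==> e n = 0" for m
        proof (induction m)
          case (Suc m)
          have "(i * st i) ^ Suc m * e n = (i * st i) ^ m * (i * st i)"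
            by (simp only: power_Suc2 mult.assoc M_r[OF M_st[OF iM]])
          then have "(i * st i) ^ m * (i * st i) * (st k * k) = 0" using Suc.prems by simp
          then have "(i * st i) ^ m * e n = 0" using inv by (simp only: mult.assoc)
          then show ?case by (rule Suc.IH)
        qed simp
        from this[of m] m have "e n = 0" by simp
        then show False using False e_eq_0_iff by simp
      qed
      then show ?thesis using False by (simp add: c_def x_def)
    qed
  qed
  moreover have "Abs_fps om = euler_fps p"
    using w0 by (auto intro!: fps_ext simp: om_def card_U euler_fps_def)
  ultimately show ?thesis by (simp add: S_def)
qed

text \<open>Counting objects that split orthogonally into two parts without common constituents.\<close>

definition FF :: "nat => nat => ('r \<times> 'r) set" where
  "FF n k = {(J, K). J \<in> F n k \<and> K \<in> F n (n - k) \<and> J * st J + K * st K = e n}"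

definition blk :: "'r => 'r => 'r \<times> 'r => 'r \<times> 'r => 'r \<times> 'r" where
  "blk J K y z = (J * fst y * st J + K * fst z * st K, J * snd y * st J + K * snd z * st K)"

lemma FF_D:
  assumes "(J, K) \<in> FF n k"
  shows "J \<in> M n k" "K \<in> M n (n - k)" "st J * J = e k" "st K * K = e (n - k)" "J * st J + K * st K = e n"
    "st J * K = 0" "st K * J = 0"
proof -
  show *: "J \<in> M n k" "K \<in> M n (n - k)" "st J * J = e k" "st K * K = e (n - k)" "J * st J + K * st K = e n"
    using assms by (auto simp: FF_def F_def)
  have "J * (st J * K) + K * st K * K = K" using *(2,5) by (metis M_l distrib_right mult.assoc)
  then have "J * (st J * K) = 0" using *(2,4) by (simp add: mult.assoc M_r)
  then have "st J * (J * (st J * K)) = 0" by simp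
  then show "st J * K = 0" by (simp add: *(3)[THEN assoc_l] M_l'[OF M_st[OF *(1)]])
  then show "st K * J = 0" using st_zero by fastforce
qed

lemma finite_FF [simp, intro]: "finite (FF n k)"
  by (rule finite_subset[of _ "F n k \<times> F n (n - k)"]) (auto simp: FF_def)

text \<open>\<open>(J, K)\<close> corresponds to the unitary block row \<open>[J | K]\<close>. The
  frames, and not only the subspaces, are part of the data so that all choices are counted by group
  orders.\<close>

lemma card_FF:
  assumes "k \<le> n"
  shows "card (FF n k) = card (U n)"
proof -
  have ek: "e k \<in> F n k" using assms by (auto simp: F_def e_in_M e_mult)
  obtain I where "I \<in> F n (n - k)" "e k * st (e k) + I * st I = e n" using orth_compl[OF ek] by blast
  with ek have "(e k, I) \<in> FF n k" by (auto simp: FF_def)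
  note I = FF_D[OF this, simplified]
  have ee: "e k * e k = e k" by (simp add: e_mult)
  have "bij_betw (\<lambda>P. (P * e k, P * I)) (U n) (FF n k)"
  proof (rule bij_betw_byWitness[where f' = "\<lambda>(J, K). J * e k + K * st I"])
    show "\<forall>P\<in>U n. (case (P * e k, P * I) of (J, K) => J * e k + K * st I) = P"
      using I(5) by (auto simp: mult.assoc distrib_left[symmetric] U_def M_r)
    show "\<forall>x\<in>FF n k. ((case x of (J, K) => J * e k + K * st I) * e k, (case x of (J, K) => J * e k + K * st I) * I) = x"
    proof
      fix x assume "x \<in> FF n k"
      then obtain J K where x: "x = (J, K)" "(J, K) \<in> FF n k" by (cases x) auto
      note JK = FF_D[OF x(2)]
      have "J * I = 0" using M_r'[OF JK(1), of I] I by simp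
      then show "((case x of (J, K) => J * e k + K * st I) * e k, (case x of (J, K) => J * e k + K * st I) * I) = x"
        unfolding x(1) prod.case using I ee by (simp add: distrib_right mult.assoc M_r[OF JK(1)] M_r[OF JK(2)])
    qed
    show "(\<lambda>P. (P * e k, P * I)) ` U n \<subseteq> FF n k"
    proof clarify
      fix P assume "P \<in> U n"
      then have P: "P \<in> M n n" "st P * P = e n" "P * st P = e n" by (auto simp: U_def)
      have "P * e k * st (P * e k) + P * I * st (P * I) = P * (e k * e k + I * st I) * st P"
        by (simp add: st_mult algebra_simps)
      also have "... = e n" unfolding I(5) using P by (simp add: M_r)
      finally show "(P * e k, P * I) \<in> FF n k"
        using I ee P M_mult[OF P(1) I(1)]
        by (auto simp: FF_def F_def st_mult mult.assoc P(2)[THEN assoc_l] M_l M_l' intro: M_intros)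
    qed
    show "(\<lambda>(J, K). J * e k + K * st I) ` FF n k \<subseteq> U n"
    proof clarify
      fix J K assume "(J, K) \<in> FF n k"
      note JK = FF_D[OF this]
      have "st (J * e k + K * st I) * (J * e k + K * st I) = e n"
        using I(5) by (simp add: st_add st_mult algebra_simps JK(3,4,6,7) JK(3,4,6,7)[THEN assoc_l] ee M_l[OF M_st[OF I(2)]])
      then show "J * e k + K * st I \<in> U n"
        using JK I assms by (intro in_U_I) (auto intro!: M_intros)
    qed
  qed
  then show ?thesis by (simp add: bij_betw_same_card)
qed

text \<open>Over a given \<open>x\<close> the data \<open>(J, K, y, z)\<close> form a torsor of the
  product of \<open>U k\<close> and \<open>U (n - k)\<close>. This needs the splitting to be unique:
  for two splittings of \<open>x\<close> the mixed products \<open>st K0 * J\<close> and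
  \<open>st J0 * K\<close> intertwine first entries of different types and vanish by
  \<open>disj\<close> and \<open>disj'\<close>, so \<open>st J0 * J\<close> and
  \<open>st K0 * K\<close> are unitary.\<close>

lemma block_count:
  fixes X Y Z :: "nat => ('r \<times> 'r) set"
  assumes fin: "\<And>k. Y k \<subseteq> M k k \<times> M k k" "\<And>k. Z k \<subseteq> M k k \<times> M k k"
    and split: "\<And>x. x \<in> X n ==> \<exists>k\<le>n. \<exists>(J, K)\<in>FF n k. \<exists>y\<in>Y k. \<exists>z\<in>Z (n - k). x = blk J K y z"
    and build: "\<And>k J K y z. k \<le> n ==> (J, K) \<in> FF n k ==> y \<in> Y k ==> z \<in> Z (n - k) ==> blk J K y z \<in> X n"
    and conjY: "\<And>k Q y. Q \<in> U k ==> y \<in> Y k ==> (st Q * fst y * Q, st Q * snd y * Q) \<in> Y k"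
    and conjZ: "\<And>k Q y. Q \<in> U k ==> y \<in> Z k ==> (st Q * fst y * Q, st Q * snd y * Q) \<in> Z k"
    and disj: "\<And>k l y z S. y \<in> Y k ==> z \<in> Z l ==> S \<in> M l k ==> fst z * S = S * fst y ==> S = 0"
    and disj': "\<And>k l y z S. y \<in> Y k ==> z \<in> Z l ==> S \<in> M k l ==> fst y * S = S * fst z ==> S = 0"
  shows "real (card (X n)) / real (card (U n)) =
    (\<Sum>k\<le>n. real (card (Y k)) / real (card (U k)) * (real (card (Z (n - k))) / real (card (U (n - k)))))"
proof -
  have finY: "finite (Y k)" "finite (Z k)" for k
    using finite_subset[OF fin(1)[of k]] finite_subset[OF fin(2)[of k]] by auto
  define Om where "Om k = {((J, K), (y, z)). (J, K) \<in> FF n k \<and> y \<in> Y k \<and> z \<in> Z (n - k)}" for k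
  define f where "f = (\<lambda>((J, K), (y, z)). blk J K y z)"
  have OmX: "Om k = FF n k \<times> (Y k \<times> Z (n - k))" for k by (auto simp: Om_def)
  have YM: "fst y \<in> M k k" "snd y \<in> M k k" if "y \<in> Y k" for y k using that fin(1)[of k] by auto
  have ZM: "fst y \<in> M k k" "snd y \<in> M k k" if "y \<in> Z k" for y k using that fin(2)[of k] by auto
  have cmp: "k = k0 \<and> st J0 * J \<in> U k \<and> st K0 * K \<in> U (n - k) \<and> J = J0 * (st J0 * J) \<and> K = K0 * (st K0 * K)
      \<and> y = (st (st J0 * J) * fst y0 * (st J0 * J), st (st J0 * J) * snd y0 * (st J0 * J))
      \<and> z = (st (st K0 * K) * fst z0 * (st K0 * K), st (st K0 * K) * snd z0 * (st K0 * K))"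
    if kn: "k \<le> n" "k0 \<le> n" and 1: "(J, K) \<in> FF n k" "y \<in> Y k" "z \<in> Z (n - k)"
      and 0: "(J0, K0) \<in> FF n k0" "y0 \<in> Y k0" "z0 \<in> Z (n - k0)" and eq: "blk J K y z = blk J0 K0 y0 z0"
    for k k0 J K y z J0 K0 y0 z0
  proof -
    note J = FF_D[OF 1(1)] and J0 = FF_D[OF 0(1)]
    note y = YM[OF 1(2)] and z = ZM[OF 1(3)] and y0 = YM[OF 0(2)] and z0 = ZM[OF 0(3)]
    define x where "x = fst (blk J K y z)"
    have xJ: "x * J = J * fst y" "x * K = K * fst z"
      by (simp_all add: x_def blk_def distrib_right mult.assoc J(3-7) M_r[OF y(1)] M_r[OF z(1)])
    have x': "x = fst (blk J0 K0 y0 z0)" by (simp only: x_def eq)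
    have x0: "st J0 * x = fst y0 * st J0" "st K0 * x = fst z0 * st K0"
      by (simp_all add: x' blk_def distrib_left mult.assoc[symmetric] J0(3-7) M_l[OF y0(1)] M_l[OF z0(1)])
    have "fst z0 * (st K0 * J) = (st K0 * J) * fst y" using x0 xJ by (metis mult.assoc)
    then have S: "st K0 * J = 0" using disj[OF 1(2) 0(3)] M_mult[OF M_st[OF J0(2)] J(1)] by blast
    have "fst y0 * (st J0 * K) = (st J0 * K) * fst z" using x0 xJ by (metis mult.assoc)
    then have S': "st J0 * K = 0" using disj'[OF 0(2) 1(3)] M_mult[OF M_st[OF J0(1)] J(2)] by blast
    have T: "st J * K0 = 0" "st K * J0 = 0" using st_zero[OF S] st_zero[OF S'] by simp_all
    have JJ: "J = J0 * (st J0 * J)"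
    proof -
      have "(J0 * st J0 + K0 * st K0) * J = J" using J J0 by (simp add: M_l)
      then show ?thesis by (simp add: distrib_right mult.assoc S)
    qed
    have KK: "K = K0 * (st K0 * K)"
    proof -
      have "(J0 * st J0 + K0 * st K0) * K = K" using J J0 by (simp add: M_l)
      then show ?thesis by (simp add: distrib_right mult.assoc S')
    qed
    have JJ0: "J * (st J * J0) = J0"
    proof -
      have "(J * st J + K * st K) * J0 = J0" using J J0 by (simp add: M_l)
      then show ?thesis by (simp add: distrib_right mult.assoc T)
    qed
    have Q: "st J0 * J \<in> M k0 k" "st J * J0 \<in> M k k0" using J J0 by (auto intro: M_intros)
    have q: "(st J0 * J) * (st J * J0) = e k0" "(st J * J0) * (st J0 * J) = e k"
      using JJ JJ0 J(3) J0(3) by (simp_all add: mult.assoc)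
    have k: "k0 = k" using dim_unique[OF Q q] .
    have Q1: "st J0 * J \<in> U k" using q Q by (auto simp: U_def st_mult k)
    have R: "st K0 * K \<in> M (n - k) (n - k)" using J J0 k by (auto intro: M_intros)
    have "st (st K0 * K) * (st K0 * K) = e (n - k)" using KK J(4) by (simp add: st_mult mult.assoc)
    then have Q2: "st K0 * K \<in> U (n - k)" using R by (intro in_U_I)
    have "fst y = st J * x * J" "fst z = st K * x * K"
      using xJ by (simp_all add: mult.assoc J(3-4)[THEN assoc_l] M_l[OF y(1)] M_l[OF z(1)])
    then have f: "fst y = st (st J0 * J) * fst y0 * (st J0 * J)" "fst z = st (st K0 * K) * fst z0 * (st K0 * K)"
      by (simp_all add: x' blk_def algebra_simps st_mult S S' T T[THEN assoc_l])
    have g1: "snd y = st J * snd (blk J K y z) * J" "snd z = st K * snd (blk J K y z) * K"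
      by (simp_all add: blk_def algebra_simps J(3,4,6,7) J(3,4,6,7)[THEN assoc_l] M_l[OF y(2)] M_l[OF z(2)] M_r[OF y(2)] M_r[OF z(2)])
    then have g: "snd y = st (st J0 * J) * snd y0 * (st J0 * J)" "snd z = st (st K0 * K) * snd z0 * (st K0 * K)"
      by (simp_all add: eq) (simp_all add: blk_def algebra_simps st_mult S S' T T[THEN assoc_l])
    from k Q1 Q2 JJ KK f g show ?thesis by (simp add: prod_eq_iff)
  qed
  have fX: "card (f ` Om k) * (card (U k) * card (U (n - k))) = card (U n) * card (Y k) * card (Z (n - k))" if k: "k \<le> n" for k
  proof -
    have "card (Om k) = (card (U k) * card (U (n - k))) * card (f ` Om k)"
    proof (rule card_fibres[where f = f])
      fix x assume "x \<in> f ` Om k"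
      then obtain J0 K0 y0 z0 where x: "x = blk J0 K0 y0 z0" and 0: "(J0, K0) \<in> FF n k" "y0 \<in> Y k" "z0 \<in> Z (n - k)"
        by (auto simp: f_def Om_def)
      note J0 = FF_D[OF 0(1)]
      define g where "g = (\<lambda>(Q1, Q2). ((J0 * Q1, K0 * Q2), ((st Q1 * fst y0 * Q1, st Q1 * snd y0 * Q1), (st Q2 * fst z0 * Q2, st Q2 * snd z0 * Q2))))"
      define h where "h = (\<lambda>a :: ('r \<times> 'r) \<times> ('r \<times> 'r) \<times> ('r \<times> 'r). (st J0 * fst (fst a), st K0 * snd (fst a)))"
      have "bij_betw g (U k \<times> U (n - k)) {a \<in> Om k. f a = x}"
      proof (rule bij_betw_byWitness[where f' = h])
        show "\<forall>a\<in>U k \<times> U (n - k). h (g a) = a"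
          by (auto simp: g_def h_def J0(3-4)[THEN assoc_l] U_def M_l)
        have *: "g (h a) = a \<and> h a \<in> U k \<times> U (n - k)"
          if "a \<in> Om k" "f a = x" for a
        proof -
          obtain J K y z where a: "a = ((J, K), (y, z))" by (metis surj_pair)
          have "(J, K) \<in> FF n k" "y \<in> Y k" "z \<in> Z (n - k)" "blk J K y z = blk J0 K0 y0 z0"
            using that by (auto simp: a Om_def f_def x)
          from cmp[OF k k this(1-3) 0 this(4)] show ?thesis by (auto simp: a g_def h_def)
        qed
        show "\<forall>a\<in>{a \<in> Om k. f a = x}. g (h a) = a" using * by blast
        show "h ` {a \<in> Om k. f a = x} \<subseteq> U k \<times> U (n - k)" using * by blast
        show "g ` (U k \<times> U (n - k)) \<subseteq> {a \<in> Om k. f a = x}"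
        proof (rule image_subsetI)
          fix q assume "q \<in> U k \<times> U (n - k)"
          then obtain Q1 Q2 where q: "q = (Q1, Q2)" and Q: "Q1 \<in> U k" "Q2 \<in> U (n - k)" by auto
          then have Q1: "Q1 \<in> M k k" "st Q1 * Q1 = e k" "Q1 * st Q1 = e k" and Q2: "Q2 \<in> M (n - k) (n - k)" "st Q2 * Q2 = e (n - k)" "Q2 * st Q2 = e (n - k)"
            by (auto simp: U_def)
          have JQ: "(J0 * Q1, K0 * Q2) \<in> FF n k"
            using J0 Q1 Q2 by (auto simp: FF_def F_def st_mult mult.assoc J0(3,4)[THEN assoc_l] Q1(3)[THEN assoc_l] Q2(3)[THEN assoc_l] M_l M_l[OF M_st] intro: M_intros)
          have "f (g (Q1, Q2)) = x"
            by (simp add: f_def g_def blk_def x st_mult mult.assoc Q1(3)[THEN assoc_l] Q2(3)[THEN assoc_l] M_l[OF M_st[OF J0(1)]] M_l[OF M_st[OF J0(2)]]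
                M_l'[OF YM(1)[OF 0(2)]] M_l'[OF YM(2)[OF 0(2)]] M_l'[OF ZM(1)[OF 0(3)]] M_l'[OF ZM(2)[OF 0(3)]])
          then show "g q \<in> {a \<in> Om k. f a = x}"
            unfolding q using JQ conjY[OF Q(1) 0(2)] conjZ[OF Q(2) 0(3)] by (auto simp: Om_def g_def)
        qed
      qed
      then show "card {a \<in> Om k. f a = x} = card (U k) * card (U (n - k))"
        by (simp add: bij_betw_same_card[symmetric] card_cartesian_product)
    qed (use finY in \<open>auto simp: OmX\<close>)
    moreover have "card (Om k) = card (U n) * (card (Y k) * card (Z (n - k)))"
      by (simp add: OmX card_cartesian_product card_FF[OF k])
    ultimately show ?thesis by (simp add: mult_ac)
  qed
  have "X n = (\<Union>k\<in>{..n}. f ` Om k)"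
  proof (intro equalityI subsetI)
    fix x assume "x \<in> X n"
    from split[OF this] show "x \<in> (\<Union>k\<in>{..n}. f ` Om k)"
      by (force simp: f_def Om_def)
  next
    fix x assume "x \<in> (\<Union>k\<in>{..n}. f ` Om k)"
    then show "x \<in> X n" using build by (auto simp: f_def Om_def)
  qed
  moreover have "card (\<Union>k\<in>{..n}. f ` Om k) = (\<Sum>k\<le>n. card (f ` Om k))"
  proof (rule card_UN_disjoint)
    show "\<forall>k\<in>{..n}. finite (f ` Om k)" using finY by (auto simp: OmX)
    show "\<forall>k\<in>{..n}. \<forall>l\<in>{..n}. k ~= l \<longrightarrow> f ` Om k \<inter> f ` Om l = {}"
    proof (intro ballI impI, rule ccontr)
      fix k l assume kl: "k \<in> {..n}" "l \<in> {..n}" "k ~= l" "f ` Om k \<inter> f ` Om l ~= {}"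
      then obtain a b where ab: "a \<in> Om k" "b \<in> Om l" "f a = f b" by blast
      obtain J K y z where a: "a = ((J, K), (y, z))" by (metis surj_pair)
      obtain J0 K0 y0 z0 where b: "b = ((J0, K0), (y0, z0))" by (metis surj_pair)
      show False using cmp[of k l J K y z J0 K0 y0 z0] ab kl by (auto simp: a b Om_def f_def)
    qed
  qed simp
  ultimately have "real (card (X n)) = (\<Sum>k\<le>n. real (card (f ` Om k)))" by simp
  also have "... = (\<Sum>k\<le>n. real (card (U n)) * (real (card (Y k)) / real (card (U k)) * (real (card (Z (n - k))) / real (card (U (n - k))))))"
  proof (rule sum.cong)
    fix k assume "k \<in> {..n}"
    then have "real (card (f ` Om k)) * (real (card (U k)) * real (card (U (n - k)))) = real (card (U n)) * real (card (Y k)) * real (card (Z (n - k)))"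
      using fX[of k] by (metis atMost_iff of_nat_mult)
    moreover have "a = d * (y / b * (z / c))" if "a * (b * c) = d * y * z" "b > 0" "c > 0" for a b c d y z :: real
      using that by (simp add: field_simps)
    ultimately show "real (card (f ` Om k)) = real (card (U n)) * (real (card (Y k)) / real (card (U k)) * (real (card (Z (n - k))) / real (card (U (n - k)))))"
      using card_U_pos[of k] card_U_pos[of "n - k"] of_nat_0_less_iff by blast
  qed simp
  finally have "real (card (X n)) = real (card (U n)) * (\<Sum>k\<le>n. real (card (Y k)) / real (card (U k)) * (real (card (Z (n - k))) / real (card (U (n - k)))))"
    by (simp only: sum_distrib_left)
  moreover have "a / b = c" if "a = b * c" "b > 0" for a b c :: real using that by simp
  ultimately show ?thesis using card_U_pos[of n] of_nat_0_less_iff by blast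
qed

end

section \<open>Linear algebra over a finite field\<close>

lemma MM_mult: "X \<in> MM n m ==> Y \<in> MM m k ==> X * Y \<in> MM n k"
  by (auto simp: MM_def) (metis mult.assoc)+

lemma MM_l: "X \<in> MM n m ==> eid n * X = X" and MM_r: "X \<in> MM n m ==> X * eid m = X"
  by (auto simp: MM_def)

lemma MM_diff: "X \<in> MM n m ==> Y \<in> MM n m ==> X - Y \<in> MM n m"
  and MM_add: "X \<in> MM n m ==> Y \<in> MM n m ==> X + Y \<in> MM n m"
  and MM_0: "0 \<in> MM n m"
  by (auto simp: MM_def algebra_simps)

lemma MM_eid: "eid n \<in> MM n n" by (auto simp: MM_def eid_mult)

lemma MM_sc: "X \<in> MM n m ==> sc c * X \<in> MM n m" for c :: "'a::comm_ring_1"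
  unfolding MM_iff by (metis ent_sc_mult mult_zero_right)

lemma munit_MM: "a < n ==> b < m ==> munit a b \<in> MM n m"
  by (auto simp: MM_iff munit.rep_eq)

abbreviation tp :: "'a::comm_ring_1 fmat => 'a fmat" where "tp \<equiv> ctrans (\<lambda>x. x)"

lemma ent_ctrans: "c 0 = 0 ==> ent (ctrans c X) i j = c (ent X j i)"
  by (simp add: ctrans.rep_eq)

lemma ctrans_mult:
  fixes c :: "'a::comm_ring_1 => 'a"
  assumes "c 0 = 0" "\<And>x y. c (x + y) = c x + c y" "\<And>x y. c (x * y) = c x * c y"
  shows "ctrans c (X * Y) = ctrans c Y * ctrans c X"
proof (rule fmat_eqI)
  fix i j
  have s: "c (sum f A) = (\<Sum>x\<in>A. c (f x))" for f and A :: "nat set"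
    by (induction A rule: infinite_finite_induct) (simp_all add: assms)
  have "ent (ctrans c X) k j = 0" if "ent X j k = 0" for k using that assms by (simp add: ent_ctrans)
  then have "{k. ent (ctrans c X) k j ~= 0} \<subseteq> {k. ent X j k ~= 0}" by blast
  then have "ent (ctrans c Y * ctrans c X) i j = (\<Sum>k\<in>{k. ent X j k ~= 0}. ent (ctrans c Y) i k * ent (ctrans c X) k j)"
    unfolding ent_times' by (intro sum.mono_neutral_left) auto
  then show "ent (ctrans c (X * Y)) i j = ent (ctrans c Y * ctrans c X) i j"
    by (simp add: ent_ctrans assms s times_fmat.rep_eq[of X] mult.commute)
qed

lemma tp_mult: "tp (X * Y) = tp Y * tp X" and tp_tp [simp]: "tp (tp X) = X"
  and tp_eid [simp]: "tp (eid n) = eid n" and tp_add: "tp (X + Y) = tp X + tp Y"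
  and tp_0 [simp]: "tp 0 = 0"
  by (simp add: ctrans_mult) (auto intro!: fmat_eqI simp: ent_ctrans eid.rep_eq)

lemma MM_tp: "tp X \<in> MM m n \<longleftrightarrow> X \<in> MM n m"
  by (auto simp: MM_iff ent_ctrans)

lemma MM_1_eqI: "X \<in> MM 1 1 ==> Y \<in> MM 1 1 ==> ent X 0 0 = ent Y 0 0 ==> X = Y"
  by (rule fmat_eqI) (metis MM_iff less_one)

lemma card_field_gt_1: "CARD('a::{field,finite}) > 1"
proof -
  have "card {0, 1 :: 'a} \<le> CARD('a)" by (rule card_mono) auto
  then show ?thesis by simp
qed

text \<open>Pigeonhole: there are more columns of length \<open>r\<close> than of length
  \<open>d\<close>, so \<open>v\<close> is the difference of two columns with the same
  image.\<close>

lemma kernel_ex: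
  fixes J :: "'a::{field,finite} fmat"
  assumes "J \<in> MM d r" "d < r"
  obtains v where "v \<in> MM r 1" "v ~= 0" "J * v = 0"
proof -
  have "\<not> inj_on (\<lambda>v. J * v) (MM r 1)"
  proof
    assume "inj_on (\<lambda>v. J * v) (MM r 1)"
    then have "card (MM r 1 :: 'a fmat set) \<le> card (MM d 1 :: 'a fmat set)"
      by (rule card_inj_on_le) (use assms in \<open>auto intro: MM_mult\<close>)
    then have "CARD('a) ^ r \<le> CARD('a) ^ d" by (simp add: card_MM)
    then have "r \<le> d" using card_field_gt_1[where 'a = 'a] by (metis power_increasing_iff)
    then show False using assms by simp
  qed
  then obtain v1 v2 where "v1 \<in> MM r 1" "v2 \<in> MM r 1" "v1 ~= v2" "J * v1 = J * v2" by (auto simp: inj_on_def)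
  then show ?thesis by (intro that[of "v1 - v2"]) (auto simp: right_diff_distrib intro: MM_diff)
qed

lemma left_kernel_ex:
  fixes J :: "'a::{field,finite} fmat"
  assumes "J \<in> MM r d" "d < r"
  obtains v where "v \<in> MM 1 r" "v ~= 0" "v * J = 0"
proof -
  have "tp J \<in> MM d r" using assms by (simp add: MM_tp)
  from kernel_ex[OF this assms(2)] obtain v where v: "v \<in> MM r 1" "v ~= 0" "tp J * v = 0" by blast
  have "tp (tp J * v) = 0" using v(3) by simp
  then have "tp v * J = 0" by (simp add: tp_mult)
  moreover have "tp v ~= 0" using v(2) tp_tp[of v] tp_0 by metis
  ultimately show ?thesis using that[of "tp v"] v(1) by (simp add: MM_tp)
qed

lemma reduce_factor:
  fixes J :: "'a::{field,finite} fmat"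
  assumes J: "J \<in> MM n r" and v: "v \<in> MM r 1" "v ~= 0" "J * v = 0"
  obtains s J' G where "r = Suc s" "J' \<in> MM n s" "G \<in> MM s r" "J = J' * G"
proof -
  have "\<exists>i. ent v i 0 ~= 0" using v fmat_eqI[of v 0] by (metis MM_iff less_one zero_fmat.rep_eq)
  then obtain i where i: "ent v i 0 ~= 0" by blast
  then have ir: "i < r" using v by (simp add: MM_iff)
  then obtain s where s: "r = Suc s" by (cases r) auto
  \<comment> \<open>Enumerates the indices other than \<open>i\<close> in increasing order.\<close>
  define sk where "sk a = (if a < i then a else Suc a)" for a
  have bij: "bij_betw sk {..<s} ({..<r} - {i})"
    by (rule bij_betw_byWitness[where f' = "\<lambda>a. if a < i then a else a - 1"]) (use ir s in \<open>auto simp: sk_def\<close>)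
  define J' where "J' = of_fun n s (\<lambda>a b. ent J a (sk b))"
  define G where "G = of_fun s r (\<lambda>a b. (if sk a = b then 1 else 0) - (if b = i then ent v (sk a) 0 / ent v i 0 else 0))"
  have "J = J' * G"
  proof (rule fmat_eqI)
    fix a b
    show "ent J a b = ent (J' * G) a b"
    proof (cases "a < n \<and> b < r")
      case True
      have "ent (J' * G) a b = (\<Sum>k<s. ent J' a k * ent G k b)" by (rule ent_times_MM[of _ n]) (simp add: J'_def)
      also have "... = (\<Sum>k<s. ent J a (sk k) * ((if sk k = b then 1 else 0) - (if b = i then ent v (sk k) 0 / ent v i 0 else 0)))"
        by (rule sum.cong) (use True in \<open>auto simp: J'_def G_def\<close>)
      also have "... = (\<Sum>l\<in>{..<r} - {i}. ent J a l * ((if l = b then 1 else 0) - (if b = i then ent v l 0 / ent v i 0 else 0)))"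
        by (rule sum.reindex_bij_betw[OF bij])
      also have "... = (\<Sum>l<r. ent J a l * ((if l = b then 1 else 0) - (if b = i then ent v l 0 / ent v i 0 else 0)))"
        by (rule sum.mono_neutral_left) (use i in auto)
      also have "... = (\<Sum>l<r. if l = b then ent J a l else 0) - (\<Sum>l<r. ent J a l * ent v l 0) * (if b = i then 1 / ent v i 0 else 0)"
        by (auto simp: right_diff_distrib sum_subtractf sum_divide_distrib if_distrib[where f = "\<lambda>x. _ * x"] cong: if_cong)
      also have "(\<Sum>l<r. ent J a l * ent v l 0) = ent (J * v) a 0" by (rule ent_times_MM[OF J, symmetric])
      finally show ?thesis using True v by simp
    next
      case False
      then have "ent J a b = 0" using J by (auto simp: MM_iff)
      moreover have "J' * G \<in> MM n r" by (rule MM_mult[of _ n s]) (simp_all add: J'_def G_def)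
      then have "ent (J' * G) a b = 0" using False by (auto simp: MM_iff)
      ultimately show ?thesis by simp
    qed
  qed
  with s show ?thesis by (intro that[of s J' G]) (simp_all add: J'_def G_def)
qed

lemma reduce_factor_left:
  fixes P :: "'a::{field,finite} fmat"
  assumes P: "P \<in> MM r m" and v: "v \<in> MM 1 r" "v ~= 0" "v * P = 0"
  obtains s P' G where "r = Suc s" "P' \<in> MM s m" "G \<in> MM r s" "P = G * P'"
proof -
  have "tp v ~= 0" using v(2) tp_tp[of v] tp_0 by metis
  moreover have "tp P * tp v = 0" using v(3) by (metis tp_0 tp_mult)
  ultimately obtain s J' G where "r = Suc s" "J' \<in> MM m s" "G \<in> MM s r" "tp P = J' * G"
    using reduce_factor[of "tp P" m r "tp v"] P v by (auto simp: MM_tp)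
  then show ?thesis using that[of s "tp J'" "tp G"] by (metis MM_tp tp_mult tp_tp)
qed

text \<open>Take the least \<open>d\<close> such that \<open>J\<close> factors through some
  \<open>D * J\<close> with \<open>d\<close> rows. A left kernel vector of \<open>D * J\<close>
  would allow a row to be dropped, and a right kernel vector would be one of \<open>J\<close>. So
  \<open>d = r\<close>, and the square matrix \<open>D * J\<close> is invertible because an
  injective self-map of a finite set is onto.\<close>

lemma left_inverse_ex:
  fixes J :: "'a::{field,finite} fmat"
  assumes J: "J \<in> MM n r" and inj: "\<And>v. v \<in> MM r 1 ==> J * v = 0 ==> v = 0"
  obtains L where "L \<in> MM r n" "L * J = eid r"
proof -
  define P where "P d \<longleftrightarrow> (\<exists>C\<in>MM n d. \<exists>D\<in>MM d n. J = C * (D * J))" for d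
  have "P n" unfolding P_def by (rule bexI[of _ "eid n"], rule bexI[of _ "eid n"]) (use J in \<open>auto simp: MM_l MM_eid\<close>)
  then have "P (LEAST d. P d)" by (rule LeastI)
  define d where "d = (LEAST d. P d)"
  obtain C D where C: "C \<in> MM n d" and D: "D \<in> MM d n" and CD: "J = C * (D * J)"
    using \<open>P (LEAST d. P d)\<close> unfolding d_def[symmetric] by (auto simp: P_def)
  have DJ: "D * J \<in> MM d r" using D J by (rule MM_mult)
  have inj': "v = 0" if "v \<in> MM r 1" "D * J * v = 0" for v
    using inj[OF that(1)] that(2) CD by (metis mult.assoc mult_zero_right)
  have left: "v = 0" if v: "v \<in> MM 1 d" "v * (D * J) = 0" for v
  proof (rule ccontr)
    assume "v ~= 0"
    then obtain i where i: "ent v 0 i ~= 0" using fmat_eqI[of v 0] v by (metis MM_iff less_one zero_fmat.rep_eq)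
    then have id: "i < d" using v by (auto simp: MM_iff)
    define u where "u = sc (inverse (ent v 0 i)) * munit i 0"
    have u: "u \<in> MM d 1" using id by (auto simp: u_def intro!: MM_sc munit_MM)
    have vu: "v * u = eid 1"
    proof (rule MM_1_eqI)
      show "v * u \<in> MM 1 1" using v u by (auto intro: MM_mult)
      have "ent (v * u) 0 0 = inverse (ent v 0 i) * ent (v * munit i 0) 0 0"
        unfolding u_def by (metis ent_sc_mult mult.assoc sc_commute)
      then show "ent (v * u) 0 0 = ent (eid 1) 0 0" using i by (simp add: sum_mult_munit eid.rep_eq)
    qed (rule MM_eid)
    \<comment> \<open>The projection along \<open>u\<close> onto the kernel of \<open>v\<close>. It
      fixes \<open>D * J\<close> and factors through one dimension less.\<close>
    define p where "p = eid d - u * v"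
    have p: "p \<in> MM d d" using u v by (auto simp: p_def intro!: MM_diff MM_eid MM_mult)
    have "v * p = 0" using vu v by (simp add: p_def right_diff_distrib MM_r mult.assoc[symmetric] MM_l)
    then obtain t P' G where t: "d = Suc t" "P' \<in> MM t d" "G \<in> MM d t" "p = G * P'"
      using reduce_factor_left[OF p v(1) \<open>v ~= 0\<close>] by metis
    have "p * (D * J) = D * J" using v(2) DJ by (simp add: p_def left_diff_distrib MM_l mult.assoc)
    then have "J = (C * G) * ((P' * D) * J)" using CD t(4) by (metis mult.assoc)
    moreover have "C * G \<in> MM n t" "P' * D \<in> MM t n" using C D t by (auto intro: MM_mult)
    ultimately have "P t" unfolding P_def by blast
    then have "d \<le> t" unfolding d_def by (rule Least_le)
    with t(1) show False by simp
  qed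
  have "r \<le> d" using kernel_ex[OF DJ] inj' by (metis not_le_imp_less)
  moreover have "d \<le> r" using left_kernel_ex[OF DJ] left by (metis not_le_imp_less)
  ultimately have dr: "d = r" by simp
  have injX: "X = 0" if X: "X \<in> MM r r" "D * J * X = 0" for X
  proof (rule fmat_eqI)
    fix i j
    have "X * munit j 0 \<in> MM r 1"
      unfolding MM_iff by (auto simp: sum_mult_munit split: if_splits) (use X(1) in \<open>auto simp: MM_iff\<close>)
    moreover have "D * J * (X * munit j 0) = 0" using X(2) by (metis mult.assoc mult_zero_left)
    ultimately have "X * munit j 0 = 0" by (rule inj')
    then have "ent (X * munit j 0) i 0 = 0" by simp
    then show "ent X i j = ent 0 i j" by (simp add: sum_mult_munit)
  qed
  have DJ': "D * J \<in> MM r r" using DJ dr by simp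
  have "inj_on (\<lambda>X. D * J * X) (MM r r)"
  proof (rule inj_onI)
    fix X Y assume XY: "X \<in> MM r r" "Y \<in> MM r r" "D * J * X = D * J * Y"
    have "X - Y = 0" by (rule injX[OF MM_diff[OF XY(1,2)]]) (simp only: right_diff_distrib XY(3) diff_self)
    then show "X = Y" by simp
  qed
  then have "(\<lambda>X. D * J * X) ` MM r r = MM r r"
    by (intro endo_inj_surj) (use DJ' in \<open>auto intro: MM_mult\<close>)
  then obtain X where X: "X \<in> MM r r" "D * J * X = eid r" using MM_eid[of r] by (metis imageE)
  have "D * J * (X * (D * J) - eid r) = D * J * X * (D * J) - D * J * eid r"
    by (simp only: right_diff_distrib mult.assoc)
  also have "... = 0" by (simp only: X(2) MM_l[OF DJ'] MM_r[OF DJ'] diff_self)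
  finally have "D * J * (X * (D * J) - eid r) = 0" .
  then have "X * (D * J) - eid r = 0" by (rule injX[OF MM_diff[OF MM_mult[OF X(1) DJ'] MM_eid]])
  then have "(X * D) * J = eid r" by (simp add: mult.assoc)
  then show ?thesis using that[of "X * D"] MM_mult[OF X(1)] D dr by simp
qed

text \<open>With the inner dimension minimal, a kernel vector of either factor could be used to
  lower it, so both factors have one-sided inverses.\<close>

lemma rank_fact:
  fixes X :: "'a::{field,finite} fmat"
  assumes X: "X \<in> MM n m"
  obtains r J P L R where "J \<in> MM n r" "P \<in> MM r m" "X = J * P" "L \<in> MM r n" "L * J = eid r" "R \<in> MM m r" "P * R = eid r"
proof -
  define Q where "Q r \<longleftrightarrow> (\<exists>J\<in>MM n r. \<exists>P\<in>MM r m. X = J * P)" for r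
  have "Q n" unfolding Q_def by (rule bexI[of _ "eid n"], rule bexI[of _ X]) (use X in \<open>auto simp: MM_l MM_eid\<close>)
  then have "Q (LEAST r. Q r)" by (rule LeastI)
  define r where "r = (LEAST r. Q r)"
  obtain J P where J: "J \<in> MM n r" and P: "P \<in> MM r m" and JP: "X = J * P"
    using \<open>Q (LEAST r. Q r)\<close> unfolding r_def[symmetric] by (auto simp: Q_def)
  have min: "\<not> Q s" if "r = Suc s" for s
    using not_less_Least[of s Q] that by (simp add: r_def)
  obtain L where L: "L \<in> MM r n" "L * J = eid r"
  proof (rule left_inverse_ex[OF J])
    fix v assume v: "v \<in> MM r 1" "J * v = 0"
    show "v = 0"
    proof (rule ccontr)
      assume "v ~= 0"
      then obtain s J' G where s: "r = Suc s" "J' \<in> MM n s" "G \<in> MM s r" "J = J' * G"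
        using reduce_factor[OF J v(1) _ v(2)] by blast
      then have "X = J' * (G * P)" "G * P \<in> MM s m" using JP P by (auto simp: mult.assoc intro: MM_mult)
      then show False using min[OF s(1)] s(2) unfolding Q_def by blast
    qed
  qed blast
  obtain R' where R: "R' \<in> MM r m" "R' * tp P = eid r"
  proof (rule left_inverse_ex[of "tp P" m r])
    show "tp P \<in> MM m r" using P by (simp add: MM_tp)
    fix v assume v: "v \<in> MM r 1" "tp P * v = 0"
    have v': "tp v \<in> MM 1 r" "tp v * P = 0" using v by (simp add: MM_tp, metis tp_0 tp_mult tp_tp)
    show "v = 0"
    proof (rule ccontr)
      assume "v ~= 0"
      then have "tp v ~= 0" by (metis tp_0 tp_tp)
      then obtain s P' G where s: "r = Suc s" "P' \<in> MM s m" "G \<in> MM r s" "P = G * P'"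
        using reduce_factor_left[OF P v'(1) _ v'(2)] by blast
      then have "X = (J * G) * P'" "J * G \<in> MM n s" using JP J by (auto simp: mult.assoc intro: MM_mult)
      then show False using min[OF s(1)] s(2) unfolding Q_def by blast
    qed
  qed blast
  have "tp (R' * tp P) = eid r" using R by simp
  then have "P * tp R' = eid r" by (simp add: tp_mult)
  then show ?thesis using that[OF J P JP L] R by (metis MM_tp)
qed

text \<open>The complement is the image of the idempotent \<open>eid n - i * k\<close>. In its rank
  factorisation \<open>J * P\<close>, idempotence gives \<open>P * J = eid s\<close>, and counting
  columns gives \<open>s = n - r\<close>.\<close>

lemma fmat_compl:
  fixes i :: "'a::{field,finite} fmat"
  assumes i: "i \<in> MM n r" and k: "k \<in> MM r n" "k * i = eid r"
  shows "r \<le> n \<and> (\<exists>N\<in>MM n (n - r). \<exists>L\<in>MM (n - r) n. N * L = eid n - i * k \<and> L * N = eid (n - r))"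
proof -
  have "eid n - i * k \<in> MM n n" using i k by (auto intro!: MM_diff MM_eid MM_mult)
  then obtain s J P L R where J: "J \<in> MM n s" and P: "P \<in> MM s n" and f: "eid n - i * k = J * P"
    and L: "L \<in> MM s n" "L * J = eid s" and R: "R \<in> MM n s" "P * R = eid s" by (rule rank_fact)
  have ff: "(eid n - i * k) * (eid n - i * k) = eid n - i * k"
    by (simp add: algebra_simps eid_mult MM_l[OF MM_mult[OF i k(1)]] MM_r[OF k(1)] MM_l[OF k(1)] assoc_l[OF k(2)])
  have fi: "(eid n - i * k) * i = 0" "k * (eid n - i * k) = 0"
    using i k by (simp_all add: algebra_simps MM_l MM_r assoc_l[OF k(2)])
  have "L * (J * P * (J * P)) * R = L * (J * P) * R" using ff f by simp
  moreover have "L * (J * P * (J * P)) * R = P * J"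
    using L R by (simp add: mult.assoc assoc_l[OF L(2)] MM_l[OF MM_mult[OF P J]] MM_r[OF J] MM_l[OF P] )
  moreover have "L * (J * P) * R = eid s"
    using L R by (simp add: mult.assoc eid_mult MM_r[OF J])
  ultimately have PJ: "P * J = eid s" by simp
  have Pi: "P * i = 0" using arg_cong[OF fi(1), of "\<lambda>z. L * z"] P unfolding f by (simp add: mult.assoc assoc_l[OF L(2)]) (metis MM_l mult.assoc)
  have kJ: "k * J = 0" using arg_cong[OF fi(2), of "\<lambda>z. z * R"] J R unfolding f by (simp add: mult.assoc MM_r)
  have sum: "i * k + J * P = eid n" using f by (simp add: algebra_simps)
  have "bij_betw (\<lambda>x. (k * x, P * x)) (MM n 1) (MM r 1 \<times> MM s 1)"
  proof (rule bij_betw_byWitness[where f' = "\<lambda>(y, z). i * y + J * z"])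
    show "\<forall>x\<in>MM n 1. (case (k * x, P * x) of (y, z) => i * y + J * z) = x"
    proof
      fix x :: "'a fmat" assume "x \<in> MM n 1"
      then have "(i * k + J * P) * x = x" unfolding sum by (rule MM_l)
      then show "(case (k * x, P * x) of (y, z) => i * y + J * z) = x" by (simp add: distrib_right mult.assoc)
    qed
    show "\<forall>x\<in>MM r 1 \<times> MM s 1. (k * (case x of (y, z) => i * y + J * z), P * (case x of (y, z) => i * y + J * z)) = x"
      by (auto simp: distrib_left assoc_l[OF k(2)] assoc_l[OF PJ] assoc_l[OF Pi] assoc_l[OF kJ] MM_l)
  qed (use i k J P in \<open>auto intro!: MM_add intro: MM_mult\<close>)
  from bij_betw_same_card[OF this] have "CARD('a) ^ n = CARD('a) ^ (r + s)"
    by (simp add: card_MM card_cartesian_product power_add)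
  then have "n = r + s" using card_field_gt_1[where 'a = 'a] by (metis power_inject_exp)
  then show ?thesis using J P f PJ by auto
qed

text \<open>In both instances of \<^locale>\<open>herm\<close> the values of the form on vectors are sums of values of
  \<open>N\<close> on the coordinates.\<close>

lemma card_sum_eq:
  fixes N :: "'b::finite => 'c::ab_group_add" and w n1 :: nat and p :: real
  assumes F0: "0 \<in> F0" "\<And>x y. x \<in> F0 ==> y \<in> F0 ==> x - y \<in> F0" "card F0 = w" "w > 0"
    and N: "\<And>y. N y \<in> F0" and cardb: "CARD('b) = w ^ 2"
    and fib: "\<And>t. t \<in> F0 ==> t ~= 0 ==> card {y. N y = t} = n1" and n1: "real n1 = real w * (1 - p)"
    and t: "t \<in> F0" "t ~= 0"
  shows "real (card {xs. length xs = n \<and> sum_list (map N xs) = t}) = real w ^ (2 * n) / real w * (1 - p ^ n)"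
proof (induction n)
  case 0
  then show ?case using t by simp
next
  case (Suc n)
  define A where "A n s = {xs :: 'b list. length xs = n \<and> sum_list (map N xs) = s}" for n s
  have finF: "finite F0" using F0 by (metis card.infinite less_irrefl)
  have finA: "finite (A n s)" for n s
    by (rule finite_subset[OF _ finite_lists_length_eq[of UNIV n]]) (auto simp: A_def)
  have add: "x + y \<in> F0" if "x \<in> F0" "y \<in> F0" for x y
    using F0(2)[OF that(1) F0(2)[OF F0(1) that(2)]] by simp
  have sumF: "sum_list (map N xs) \<in> F0" for xs by (induction xs) (use F0 N add in auto)
  have tot: "(\<Sum>s\<in>F0. card (A n s)) = w ^ (2 * n)" for n
  proof -
    have "card {xs :: 'b list. length xs = n} = (\<Sum>s\<in>F0. card {xs \<in> {xs. length xs = n}. sum_list (map N xs) = s})"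
      by (rule card_fibres_sum) (use sumF finF finite_lists_length_eq[of "UNIV :: 'b set" n] in auto)
    then show ?thesis using card_lists_length_eq[of "UNIV :: 'b set" n] cardb by (simp add: A_def power_mult)
  qed
  have tF: "(\<lambda>s. t - s) ` F0 = F0"
    using F0(2) t(1) by (force simp: image_iff intro: bexI[of _ "t - _"])
  have "card (A (Suc n) t) = (\<Sum>y\<in>UNIV. card {xs \<in> A (Suc n) t. hd xs = y})"
    by (rule card_fibres_sum) (use finA in auto)
  also have "... = (\<Sum>y\<in>UNIV. card (A n (t - N y)))"
  proof (rule sum.cong)
    fix y
    have "bij_betw (Cons y) (A n (t - N y)) {xs \<in> A (Suc n) t. hd xs = y}"
      by (rule bij_betw_byWitness[where f' = tl]) (auto simp: A_def length_Suc_conv algebra_simps)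
    then show "card {xs \<in> A (Suc n) t. hd xs = y} = card (A n (t - N y))" by (simp add: bij_betw_same_card)
  qed simp
  also have "... = (\<Sum>s\<in>F0. \<Sum>y\<in>{y\<in>UNIV. N y = s}. card (A n (t - N y)))"
    by (rule sum.group[symmetric]) (use finF N in auto)
  also have "... = (\<Sum>s\<in>F0. card {y. N y = s} * card (A n (t - s)))"
    by (rule sum.cong) auto
  also have "... = card {y. N y = 0} * card (A n t) + (\<Sum>s\<in>F0 - {0}. n1 * card (A n (t - s)))"
    using F0 finF by (subst sum.remove[of F0 0]) (auto simp: fib intro!: sum.cong)
  finally have 1: "card (A (Suc n) t) = card {y. N y = 0} * card (A n t) + n1 * (\<Sum>s\<in>F0 - {0}. card (A n (t - s)))"
    by (simp add: sum_distrib_left)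
  have "(\<Sum>s\<in>F0. card (A n (t - s))) = (\<Sum>s\<in>(\<lambda>s. t - s) ` F0. card (A n s))"
    by (subst sum.reindex) (auto simp: inj_on_def)
  then have 2: "card (A n t) + (\<Sum>s\<in>F0 - {0}. card (A n (t - s))) = w ^ (2 * n)"
    unfolding tF tot using F0 finF by (subst (asm) sum.remove[of F0 0]) auto
  have "CARD('b) = (\<Sum>s\<in>F0. card {y\<in>UNIV. N y = s})"
    by (rule card_fibres_sum) (use N finF in auto)
  also have "... = card {y. N y = 0} + (w - 1) * n1"
    using F0 finF by (subst sum.remove[of F0 0]) (auto simp: fib)
  finally have 3: "real w ^ 2 = real (card {y. N y = 0}) + (real w - 1) * real n1"
    using cardb F0 by (metis (no_types, lifting) One_nat_def Suc_leI of_nat_1 of_nat_add of_nat_diff of_nat_mult of_nat_power)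
  \<comment> \<open>Appending a coordinate multiplies the deviation from equidistribution by the
    difference between the fibre of \<open>N\<close> over 0 and any other fibre, which is
    \<open>w ^ 2 * p\<close>.\<close>
  have n0: "real (card {y. N y = 0}) - real n1 = real w ^ 2 * p"
    using 3 n1 by (simp add: algebra_simps power2_eq_square)
  have "real (\<Sum>s\<in>F0 - {0}. card (A n (t - s))) = real w ^ (2 * n) - real (card (A n t))"
    using arg_cong[OF 2, of real] by simp
  then have "real (card (A (Suc n) t)) = real (card {y. N y = 0}) * real (card (A n t)) + real n1 * (real w ^ (2 * n) - real (card (A n t)))"
    unfolding 1 by (simp only: of_nat_add of_nat_mult)
  also have "... = (real (card {y. N y = 0}) - real n1) * real (card (A n t)) + real n1 * real w ^ (2 * n)"
    by (simp add: algebra_simps)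
  also have "... = real w ^ (2 * Suc n) / real w * (1 - p ^ Suc n)"
    unfolding n0 unfolding n1 A_def Suc using F0(4) by (simp add: field_simps power2_eq_square)
  finally show ?case by (simp add: A_def)
qed

section \<open>The unitary instance\<close>

lemma power_card_eq_same:
  fixes x :: "'a::{field,finite}"
  shows "x ^ CARD('a) = x"
proof (cases "x = 0")
  case False
  have fin: "finite (UNIV - {0 :: 'a})" by simp
  have "bij_betw (\<lambda>y. x * y) (UNIV - {0}) (UNIV - {0})"
    by (rule bij_betw_byWitness[where f' = "\<lambda>y. y / x"]) (use False in auto)
  then have "(\<Prod>y\<in>UNIV - {0}. x * y) = (\<Prod>y\<in>UNIV - {0}. y)"
    by (rule prod.reindex_bij_betw)
  then have "x ^ card (UNIV - {0 :: 'a}) * (\<Prod>y\<in>UNIV - {0}. y) = (\<Prod>y\<in>UNIV - {0}. y)"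
    by (simp add: prod.distrib)
  then have "x ^ card (UNIV - {0 :: 'a}) = 1" using fin by simp
  moreover have "CARD('a) = Suc (card (UNIV - {0 :: 'a}))"
    by (metis card.remove finite_UNIV iso_tuple_UNIV_I finite)
  ultimately show ?thesis by (metis mult.right_neutral power_Suc)
qed (simp add: zero_power)

locale quad_field =
  fixes q :: nat and ty :: "'a::{field,finite} itself"
  assumes q: "primepow q" and card_a: "card (UNIV :: 'a set) = q ^ 2"
begin

lemma q_gt_1: "q > 1" using q by (simp add: primepow_gt_Suc_0)

lemma q_pos [simp]: "q > 0" and q_neq_0 [simp]: "q ~= 0" using q_gt_1 by simp_all

lemma cj_add: "(x + y :: 'a) ^ q = x ^ q + y ^ q"
proof -
  have pr: "prime CHAR('a)" by (intro prime_CHAR_semidom finite_imp_CHAR_pos) simp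
  obtain r k where r: "prime r" "k > 0" "q = r ^ k" using q by (auto simp: primepow_def)
  have "CHAR('a) dvd q ^ 2" using CHAR_dvd_CARD[where 'a = 'a] card_a by simp
  then have "CHAR('a) dvd r ^ (k * 2)" unfolding r(3) power_mult[symmetric] .
  then have "CHAR('a) = r" using pr r(1) by (metis prime_dvd_power primes_dvd_imp_eq)
  then show ?thesis using freshmans_dream'[OF pr, of q k] r by simp
qed

lemma cj_cj [simp]: "((x :: 'a) ^ q) ^ q = x"
  using power_card_eq_same[of x] card_a by (simp add: power_mult[symmetric] power2_eq_square)

lemma cj_0 [simp]: "(0 :: 'a) ^ q = 0" by (simp add: zero_power)

lemma cj_minus: "(- x :: 'a) ^ q = - (x ^ q)"
  using cj_add[of x "- x"] by (simp add: eq_neg_iff_add_eq_0 add.commute)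

lemma cj_diff: "(x - y :: 'a) ^ q = x ^ q - y ^ q"
  using cj_add[of x "- y"] by (simp add: cj_minus)

text \<open>The subfield with \<open>q\<close> elements.\<close>

definition F0 :: "'a set" where "F0 = {x. x ^ q = x}"

lemma F0_diff: "x \<in> F0 ==> y \<in> F0 ==> x - y \<in> F0" by (simp add: F0_def cj_diff)

lemma card_roots_le:
  fixes a b :: 'a
  assumes "n > 1"
  shows "card {y :: 'a. y ^ n + a * y + b = 0} \<le> n"
proof -
  define P where "P = monom 1 n + [:b, a:]"
  have "degree [:b, a:] < degree (monom (1::'a) n)" using assms by (auto simp: degree_monom_eq degree_pCons_eq_if)
  then have "degree P = n" unfolding P_def by (subst degree_add_eq_left) (auto simp: degree_monom_eq)
  then have "P ~= 0" using assms by auto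
  have "{y. y ^ n + a * y + b = 0} = {y. poly P y = 0}"
    by (simp add: P_def poly_monom algebra_simps)
  then show ?thesis using card_poly_roots_bound[OF \<open>P ~= 0\<close>] \<open>degree P = n\<close> by simp
qed

lemma tr_fibre_le: "card {y :: 'a. y ^ q + y = b} \<le> q"
  using card_roots_le[of q 1 "- b"] q_gt_1 by simp

lemma tr_F0: "y ^ q + y \<in> F0" by (simp add: F0_def cj_add add.commute)

text \<open>The trace \<open>y ^ q + y\<close> has values in \<open>F0\<close>, each taken at most
  \<open>q\<close> times, and \<open>F0\<close> has at most \<open>q\<close> elements. As there are
  \<open>q ^ 2\<close> arguments, both bounds are attained.\<close>

lemma card_F0: "card F0 = q"
  and card_tr_fibre: "b \<in> F0 ==> card {y :: 'a. y ^ q + y = b} = q"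
proof -
  have le: "card F0 \<le> q" using card_roots_le[of q "- 1" 0] q_gt_1 by (simp add: F0_def)
  have sum: "q ^ 2 = (\<Sum>b\<in>F0. card {y \<in> UNIV. y ^ q + y = b})"
    unfolding card_a[symmetric] by (rule card_fibres_sum) (auto simp: tr_F0)
  also have "... \<le> (\<Sum>b\<in>F0. q)" using tr_fibre_le by (intro sum_mono) simp
  finally have "q ^ 2 \<le> card F0 * q" by simp
  then have "q \<le> card F0" by (simp add: power2_eq_square)
  with le show F0: "card F0 = q" by simp
  have "(\<Sum>b\<in>F0. card {y \<in> UNIV. y ^ q + y = b}) = (\<Sum>b\<in>F0. q)"
    using sum F0 by (simp add: power2_eq_square)
  then show "card {y :: 'a. y ^ q + y = b} = q" if "b \<in> F0" for b
    using that tr_fibre_le sum_mono_inv[of "\<lambda>b. card {y \<in> UNIV. y ^ q + y = b}" F0 "\<lambda>b. q" b] by simp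
qed

lemma half_ex: obtains c :: 'a where "c ^ q + c = 1"
proof -
  have "1 \<in> F0" by (simp add: F0_def)
  then have "card {y :: 'a. y ^ q + y = 1} = q" by (rule card_tr_fibre)
  then have "{y :: 'a. y ^ q + y = 1} ~= {}" using q_gt_1 by (metis card.empty less_nat_zero_code)
  with that show ?thesis by blast
qed

lemma skew_ex: obtains c :: 'a where "c ~= 0" "c ^ q = - c"
proof -
  have "0 \<in> F0" by (simp add: F0_def)
  then have c: "card {y :: 'a. y ^ q + y = 0} = q" by (rule card_tr_fibre)
  have "\<exists>y. y ^ q + y = 0 \<and> y ~= (0::'a)"
  proof (rule ccontr)
    assume "\<not> ?thesis"
    then have "{y :: 'a. y ^ q + y = 0} \<subseteq> {0}" by blast
    then have "card {y :: 'a. y ^ q + y = 0} \<le> card {0 :: 'a}" by (rule card_mono[rotated]) simp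
    then show False using c q_gt_1 by simp
  qed
  with that show ?thesis by (metis eq_neg_iff_add_eq_0)
qed

lemma nonreal_ex: obtains b :: 'a where "b ^ q ~= b"
proof -
  have "card F0 < CARD('a)" unfolding card_F0 card_a using q_gt_1 by (simp add: power2_eq_square)
  then have "F0 ~= UNIV" by auto
  with that show ?thesis by (auto simp: F0_def)
qed

lemma norm_F0: "y * y ^ q \<in> F0" by (simp add: F0_def power_mult_distrib mult.commute)

text \<open>The same squeeze for the norm: \<open>q - 1\<close> nonzero values, at most
  \<open>q + 1\<close> preimages of each, and \<open>q ^ 2 - 1\<close> nonzero arguments.\<close>

lemma card_norm_fibre:
  assumes t: "t \<in> F0" "t ~= 0"
  shows "card {y :: 'a. y * y ^ q = t} = q + 1"
proof -
  have le: "card {y :: 'a. y * y ^ q = t} \<le> q + 1" for t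
    using card_roots_le[of "q + 1" 0 "- t"] q_gt_1 by (simp add: mult.commute)
  have fin: "finite F0" by simp
  have 0: "0 \<in> F0" by (simp add: F0_def)
  have "card (UNIV - {0 :: 'a}) = (\<Sum>t\<in>F0 - {0}. card {y \<in> UNIV - {0}. y * y ^ q = t})"
    by (rule card_fibres_sum) (use norm_F0 in auto)
  also have "... = (\<Sum>t\<in>F0 - {0}. card {y. y * y ^ q = t})"
  proof (rule sum.cong)
    fix t assume "t \<in> F0 - {0}"
    then have "{y \<in> UNIV - {0}. y * y ^ q = t} = {y. y * y ^ q = t}" by auto
    then show "card {y \<in> UNIV - {0}. y * y ^ q = t} = card {y. y * y ^ q = t}" by simp
  qed simp
  finally have s: "(\<Sum>t\<in>F0 - {0}. card {y. y * y ^ q = t}) = q ^ 2 - 1"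
    by (simp add: card_Diff_subset card_a)
  have "(\<Sum>t\<in>F0 - {0}. q + 1) = (q - 1) * (q + 1)"
    using 0 by (simp add: card_Diff_subset card_F0)
  also have "... = q ^ 2 - 1" by (simp add: algebra_simps power2_eq_square)
  finally have "(\<Sum>t\<in>F0 - {0}. card {y. y * y ^ q = t}) = (\<Sum>t\<in>F0 - {0}. q + 1)" using s by simp
  then show ?thesis
    using t le sum_mono_inv[of "\<lambda>t. card {y. y * y ^ q = t}" "F0 - {0}" "\<lambda>_. q + 1" t] by simp
qed

lemma norm_surj:
  assumes "t \<in> F0" "t ~= 0"
  obtains y where "y * y ^ q = t"
proof -
  have "{y :: 'a. y * y ^ q = t} ~= {}" using card_norm_fibre[OF assms] by (metis Suc_eq_plus1 card.empty nat.distinct(1))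
  with that show ?thesis by blast
qed

definition star :: "'a fmat => 'a fmat" where "star = ctrans (\<lambda>x. x ^ q)"

lemma ent_star [simp]: "ent (star X) i j = ent X j i ^ q"
  by (simp add: star_def ent_ctrans)

lemma star_mult: "star (X * Y) = star Y * star X"
  unfolding star_def by (rule ctrans_mult) (simp_all add: cj_add power_mult_distrib)

lemma star_add: "star (X + Y) = star X + star Y"
  by (rule fmat_eqI) (simp add: cj_add)

lemma star_star [simp]: "star (star X) = X"
  by (rule fmat_eqI) simp

lemma star_eid [simp]: "star (eid n) = eid n"
  by (rule fmat_eqI) (simp add: eid.rep_eq)

lemma star_sc: "star (sc c) = sc (c ^ q)"
  by (rule fmat_eqI) (simp add: sc.rep_eq)

lemma star_munit: "star (munit i j) = munit j i"
  by (rule fmat_eqI) (simp add: munit.rep_eq)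

lemma MM_star: "X \<in> MM n m ==> star X \<in> MM m n"
  by (auto simp: MM_iff zero_power)

text \<open>Polarisation without dividing by 2: if all \<open>star v * x * v\<close> vanish, then
  \<open>c * s + c ^ q * t = 0\<close> for every scalar \<open>c\<close>, with mixed values
  \<open>s\<close> and \<open>t\<close>. The choices \<open>c = 1\<close> and \<open>c\<close>
  outside \<open>F0\<close> force \<open>s = 0\<close>. A nonzero value of the form lies in
  \<open>F0\<close>, and surjectivity of the norm scales it to 1.\<close>

lemma herm_vec_ex:
  assumes x: "x \<in> MM n n" "star x = x" "x ~= 0"
  shows "\<exists>v\<in>MM n 1. star v * x * v = eid 1"
proof -
  have "\<exists>v\<in>MM n 1. star v * x * v ~= 0"
  proof (rule ccontr)
    assume "\<not> ?thesis"
    then have z: "star v * x * v = 0" if "v \<in> MM n 1" for v using that by blast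
    obtain b :: 'a where b: "b ^ q ~= b" by (rule nonreal_ex)
    have "ent x i j = 0" for i j
    proof (cases "i < n \<and> j < n")
      case True
      define u where "u = (munit i (0::nat) :: 'a fmat)" define v where "v = (munit j (0::nat) :: 'a fmat)"
      have uv: "u \<in> MM n 1" "v \<in> MM n 1" using True by (auto simp: u_def v_def intro: munit_MM)
      have e: "sc c * (star u * x * v) + sc (c ^ q) * (star v * x * u) = 0" for c
      proof -
        have "star (u + sc c * v) * x * (u + sc c * v) = star u * x * u + sc c * (star u * x * v) + sc (c ^ q) * (star v * x * u) + sc (c ^ q) * sc c * (star v * x * v)"
        proof -
          have c: "X * (sc a * Y) = sc a * (X * Y)" for X Y :: "'a fmat" and a by (metis mult.assoc sc_commute)
          have "star (u + sc c * v) = star u + sc (c ^ q) * star v"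
            by (simp add: star_add star_mult star_sc sc_commute)
          then show ?thesis
            by (simp add: distrib_left distrib_right mult.assoc c[of x] c[of "star u"] c[of "star v"] add.assoc)
        qed
        moreover have "u + sc c * v \<in> MM n 1" using uv by (intro MM_add MM_sc)
        ultimately show ?thesis using z uv by simp
      qed
      define s where "s = ent (star u * x * v) 0 0" define t where "t = ent (star v * x * u) 0 0"
      have "c * s + c ^ q * t = 0" for c
        using arg_cong[OF e[of c], of "\<lambda>z. ent z 0 0"] by (simp add: s_def t_def)
      note e = this
      have "t = - s" using e[of 1] by (simp add: eq_neg_iff_add_eq_0 add.commute)
      then have "(b - b ^ q) * s = b * s + b ^ q * t" by (simp add: left_diff_distrib)
      then have "(b - b ^ q) * s = 0" using e[of b] by simp
      then have "s = 0" using b by auto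
      then show ?thesis by (simp add: s_def u_def v_def star_munit sum_mult_munit munit_mult)
    next
      case False
      then show ?thesis using x(1) by (auto simp: MM_iff)
    qed
    then have "x = 0" by (intro fmat_eqI) simp
    with x(3) show False by simp
  qed
  then obtain v where v: "v \<in> MM n 1" "star v * x * v ~= 0" by blast
  define s where "s = ent (star v * x * v) 0 0"
  have M1: "star v * x * v \<in> MM 1 1" using v x by (auto intro: MM_mult MM_star)
  then have "s ~= 0" using v(2) MM_1_eqI[OF M1 MM_0] by (auto simp: s_def)
  have "star (star v * x * v) = star v * x * v" using x by (simp add: star_mult mult.assoc)
  then have "s ^ q = s" unfolding s_def by (metis ent_star)
  then have "inverse s \<in> F0" "inverse s ~= 0" using \<open>s ~= 0\<close> by (auto simp: F0_def power_inverse)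
  then obtain c where c: "c * c ^ q = inverse s" by (rule norm_surj)
  define v' where "v' = sc c * v"
  have v': "v' \<in> MM n 1" using v by (auto simp: v'_def intro: MM_sc)
  have "star v' * x * v' = sc (c * c ^ q) * (star v * x * v)"
    by (simp add: v'_def star_mult star_sc sc_mult mult.assoc) (metis (no_types, opaque_lifting) mult.assoc sc_commute)
  moreover have "... = eid 1"
    by (rule MM_1_eqI[OF MM_sc[OF M1] MM_eid]) (use \<open>s ~= 0\<close> in \<open>simp add: c s_def eid.rep_eq\<close>)
  ultimately show ?thesis using v' by metis
qed

text \<open>\<open>X + star X\<close> maps all matrices onto the Hermitian ones, a preimage of
  \<open>h\<close> being \<open>c * h\<close> for \<open>c\<close> of trace one. A scalar
  \<open>d\<close> with \<open>d ^ q = - d\<close> puts the kernel in bijection with the Hermitian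
  matrices, so the square of their number is \<open>q ^ (2 * n * n)\<close>.\<close>

lemma card_herm: "card {X \<in> MM n n. star X = X} = q ^ (n * n)"
proof -
  let ?H = "{X \<in> MM n n. star X = X}" and ?S = "{X \<in> MM n n. X + star X = 0}"
  obtain c :: 'a where c: "c ^ q + c = 1" by (rule half_ex)
  obtain d :: 'a where d: "d ~= 0" "d ^ q = - d" by (rule skew_ex)
  have "card (MM n n :: 'a fmat set) = card ?S * card ?H"
  proof (rule card_fibres[where f = "\<lambda>X. X + star X"])
    fix h assume h: "h \<in> ?H"
    have ch: "sc c * h + star (sc c * h) = h"
    proof -
      have "sc c * h + star (sc c * h) = sc (c ^ q + c) * h" using h
        by (simp add: star_mult star_sc sc_add distrib_right sc_commute[of "c ^ q"] add.commute)
      then show ?thesis using c by simp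
    qed
    define T where "T = sc c * h"
    have ch: "T + star T = h" using ch by (simp only: T_def)
    have chM: "T \<in> MM n n" using h by (auto simp: T_def intro: MM_sc)
    have "bij_betw (\<lambda>X. X + T) ?S {X \<in> MM n n. X + star X = h}"
    proof (rule bij_betw_byWitness[where f' = "\<lambda>X. X - T"])
      show "(\<lambda>X. X + T) ` ?S \<subseteq> {X \<in> MM n n. X + star X = h}"
      proof clarify
        fix X assume X: "X \<in> MM n n" "X + star X = 0"
        have "X + T + star (X + T) = (X + star X) + (T + star T)"
          by (simp add: star_add algebra_simps)
        then show "X + T \<in> MM n n \<and> X + T + star (X + T) = h"
          using X ch chM by (auto intro: MM_add)
      qed
      show "(\<lambda>X. X - T) ` {X \<in> MM n n. X + star X = h} \<subseteq> ?S"
      proof clarify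
        fix X assume X: "X \<in> MM n n" and h: "h = X + star X"
        have "star (X - T) + star T = star X" by (simp add: star_add[symmetric])
        then have "X - T + star (X - T) = X + star X - (T + star T)"
          by (simp add: algebra_simps)
        then show "X - T \<in> MM n n \<and> X - T + star (X - T) = 0"
          using X ch chM h by (simp add: MM_diff)
      qed
    qed auto
    then show "card {X \<in> MM n n. X + star X = h} = card ?S" by (simp add: bij_betw_same_card)
  qed (auto simp: star_add add.commute intro: MM_add MM_star)
  moreover have "card ?S = card ?H"
  proof (rule bij_betw_same_card[of "\<lambda>X. sc d * X"], rule bij_betw_byWitness[where f' = "\<lambda>X. sc (inverse d) * X"])
    have *: "star (sc a * X) = sc (a ^ q) * star X" for a X by (simp add: star_mult star_sc sc_commute)
    have i: "inverse d ^ q = - inverse d" using d by (metis inverse_minus_eq power_inverse)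
    show "(\<lambda>X. sc d * X) ` ?S \<subseteq> ?H"
    proof (rule image_subsetI)
      fix X assume "X \<in> ?S"
      then have "X \<in> MM n n" "star X = - X" by (simp_all add: eq_neg_iff_add_eq_0 add.commute)
      then show "sc d * X \<in> ?H" by (simp add: * d sc_minus MM_sc)
    qed
    show "(\<lambda>X. sc (inverse d) * X) ` ?H \<subseteq> ?S"
      by (auto simp: * i sc_minus intro: MM_sc)
  qed (use d in \<open>auto simp: mult.assoc[symmetric] sc_mult[symmetric]\<close>)
  ultimately have "card ?H * card ?H = (q ^ 2) ^ (n * n)" by (simp add: card_MM card_a)
  also have "... = q ^ (n * n) * q ^ (n * n)" by (simp add: power2_eq_square power_mult_distrib)
  finally have "(card ?H)\<^sup>2 = (q ^ (n * n))\<^sup>2" by (simp only: power2_eq_square)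
  then show ?thesis by (subst (asm) power2_eq_iff_nonneg) simp_all
qed

end

lemma bij_lists_vec:
  "bij_betw (\<lambda>xs. of_fun n 1 (\<lambda>i j. xs ! i)) {xs :: 'a::ring_1 list. length xs = n} (MM n 1)"
proof (rule bij_betw_byWitness[where f' = "\<lambda>v. map (\<lambda>i. ent v i 0) [0..<n]"])
  show "\<forall>xs\<in>{xs :: 'a list. length xs = n}. map (\<lambda>i. ent (of_fun n 1 (\<lambda>i j. xs ! i)) i 0) [0..<n] = xs"
    by (auto intro!: nth_equalityI)
  show "\<forall>v\<in>MM n 1 :: 'a fmat set. of_fun n 1 (\<lambda>i j. map (\<lambda>i. ent v i 0) [0..<n] ! i) = v"
  proof
    fix v :: "'a fmat" assume v: "v \<in> MM n 1"
    have "of_fun n 1 (\<lambda>i j. map (\<lambda>i. ent v i 0) [0..<n] ! i) = of_fun n 1 (ent v)"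
      by (rule fmat_eqI) simp
    with of_fun_ent[OF v] show "of_fun n 1 (\<lambda>i j. map (\<lambda>i. ent v i 0) [0..<n] ! i) = v" by simp
  qed
qed auto

lemma bij_betw_restrict:
  assumes "bij_betw f A B" "\<And>x. x \<in> A ==> P x \<longleftrightarrow> Q (f x)"
  shows "bij_betw f {x \<in> A. P x} {y \<in> B. Q y}"
proof -
  have "inj_on f {x \<in> A. P x}" using assms(1) by (auto simp: bij_betw_def inj_on_def)
  moreover have "f ` {x \<in> A. P x} = {y \<in> B. Q y}" using assms by (auto simp: bij_betw_def)
  ultimately show ?thesis by (simp add: bij_betw_def)
qed

text \<open>\<open>p = - 1 / q\<close> because a nonzero element of \<open>F0\<close> has
  \<open>q + 1 = q * (1 - p)\<close> preimages under the norm.\<close>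

sublocale quad_field \<subseteq> hu: herm "eid :: nat => 'a fmat" star q "- 1 / real q"
proof
  show "star (x + y) = star x + star y" for x y by (rule star_add)
  show "star (x * y) = star y * star x" for x y by (rule star_mult)
  show "eid n * eid m = (eid (min n m) :: 'a fmat)" for n m by (rule eid_mult)
  show "finite {x :: 'a fmat. eid n * x = x \<and> x * eid m = x}" for n m
    using finite_MM[of n m, where 'a = 'a] by (simp add: MM_def)
  show "card {x :: 'a fmat. eid n * x = x \<and> x * eid m = x} = q ^ (2 * (n * m))" for n m
    using card_MM[of n m, where 'a = 'a] by (simp add: MM_def card_a power_mult)
  show "card {x :: 'a fmat. eid n * x = x \<and> x * eid n = x \<and> star x = x} = q ^ (n * n)" for n
    using card_herm[of n] by (simp add: MM_def conj_assoc)
  show "2 \<le> q" using q_gt_1 by simp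
  show "\<exists>t::'a fmat. t + star t = 1 \<and> (\<forall>x. t * x = x * t)"
  proof -
    obtain c :: 'a where "c ^ q + c = 1" by (rule half_ex)
    then show ?thesis by (intro exI[of _ "sc c"]) (metis add.commute sc_1 sc_add sc_commute star_sc)
  qed
  show "\<exists>v. eid n * v = v \<and> v * eid 1 = v \<and> star v * x * v = eid 1"
    if "eid n * x = x" "x * eid n = x" "star x = x" "x ~= 0" for n and x :: "'a fmat"
    using herm_vec_ex[of x n] that by (auto simp: MM_def)
  show "\<exists>E::'a fmat. E * eid 1 = E \<and> star E * E = eid 1 \<and> E * star E = eid (Suc r) - eid r" for r
    by (intro exI[of _ "munit r 0"])
      (auto intro!: fmat_eqI simp: star_munit sum_mult_munit munit.rep_eq eid.rep_eq)
  show "r \<le> n \<and> (\<exists>N L. eid n * N = N \<and> N * eid (n - r) = N \<and> eid (n - r) * L = L \<and> L * eid n = L \<and> N * L = eid n - i * k \<and> L * N = eid (n - r))"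
    if "eid n * i = i" "i * eid r = i" "eid r * k = k" "k * eid n = k" "k * i = eid r" for n r and i k :: "'a fmat"
    using fmat_compl[of i n r k] that unfolding MM_def by blast
  show "\<bar>- 1 / real q\<bar> < 1" using q_gt_1 by simp
  show "real (card {v :: 'a fmat. eid n * v = v \<and> v * eid 1 = v \<and> star v * v = eid 1}) = real q ^ (2 * n - 1) * (1 - (- 1 / real q) ^ n)"
    if n: "n > 0" for n
  proof -
    let ?A = "{xs :: 'a list. length xs = n \<and> sum_list (map (\<lambda>y. y * y ^ q) xs) = 1}"
    have *: "star (of_fun n 1 (\<lambda>i j. xs ! i)) * of_fun n 1 (\<lambda>i j. xs ! i) = eid 1 \<longleftrightarrow> sum_list (map (\<lambda>y. y * y ^ q) xs) = 1"
      if "length xs = n" for xs :: "'a list"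
    proof -
      define v where "v = of_fun n 1 (\<lambda>i j. xs ! i)"
      have v: "v \<in> MM n 1" by (simp add: v_def)
      then have sv: "star v \<in> MM 1 n" by (rule MM_star)
      have "ent (star v * v) 0 0 = (\<Sum>k<n. (xs ! k) ^ q * xs ! k)"
        unfolding ent_times_MM[OF sv] by (simp add: v_def)
      also have "... = sum_list (map (\<lambda>y. y * y ^ q) xs)"
        using that by (simp add: sum_list_sum_nth atLeast0LessThan mult.commute)
      finally have e: "ent (star v * v) 0 0 = sum_list (map (\<lambda>y. y * y ^ q) xs)" .
      have "star v * v = eid 1 \<longleftrightarrow> ent (star v * v) 0 0 = 1"
        using MM_1_eqI[OF MM_mult[OF sv v] MM_eid] by (auto simp: eid.rep_eq)
      then show ?thesis unfolding e by (simp only: v_def)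
    qed
    have "bij_betw (\<lambda>xs. of_fun n 1 (\<lambda>i j. xs ! i)) {xs \<in> {xs. length xs = n}. sum_list (map (\<lambda>y. y * y ^ q) xs) = 1}
      {v \<in> MM n 1. star v * v = eid 1}"
      by (rule bij_betw_restrict[OF bij_lists_vec]) (use * in simp)
    then have "card {v \<in> MM n 1. star v * v = eid 1} = card ?A" by (simp add: bij_betw_same_card)
    moreover have "real (card ?A) = real q ^ (2 * n) / real q * (1 - (- 1 / real q) ^ n)"
    proof (rule card_sum_eq[where ?F0.0 = F0 and ?n1.0 = "q + 1"])
      show "real (q + 1) = real q * (1 - - 1 / real q)" by (simp add: field_simps)
    qed (use F0_diff card_F0 norm_F0 card_a card_norm_fibre in \<open>auto simp: F0_def\<close>)
    moreover have "real q ^ (2 * n) / real q = real q ^ (2 * n - 1)"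
      using n by (simp add: power_diff)
    ultimately show ?thesis by (simp add: MM_def conj_assoc)
  qed
qed auto

section \<open>The general linear instance\<close>

text \<open>The general linear group is the unitary group of the split algebra \<open>K \<times> K\<close> with the swap
  involution; a pair \<open>Dbl X Y\<close> is a matrix over that algebra.\<close>

declare [[typedef_overloaded]]

datatype 'a dbl = Dbl (dfst: "'a fmat") (dsnd: "'a fmat")

instantiation dbl :: (ring_1) ring_1
begin

definition zero_dbl :: "'a dbl" where "0 = Dbl 0 0"
definition one_dbl :: "'a dbl" where "1 = Dbl 1 1"
definition plus_dbl :: "'a dbl => 'a dbl => 'a dbl" where "x + y = Dbl (dfst x + dfst y) (dsnd x + dsnd y)"
definition times_dbl :: "'a dbl => 'a dbl => 'a dbl" where "x * y = Dbl (dfst x * dfst y) (dsnd x * dsnd y)"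
definition minus_dbl :: "'a dbl => 'a dbl => 'a dbl" where "x - y = Dbl (dfst x - dfst y) (dsnd x - dsnd y)"
definition uminus_dbl :: "'a dbl => 'a dbl" where "- x = Dbl (- dfst x) (- dsnd x)"

instance
  by standard (simp_all add: zero_dbl_def one_dbl_def plus_dbl_def times_dbl_def minus_dbl_def uminus_dbl_def
    algebra_simps dbl.expand)

end

lemma dbl_simps [simp]:
  "dfst 0 = 0" "dsnd 0 = 0" "dfst 1 = 1" "dsnd 1 = 1"
  "dfst (x + y) = dfst x + dfst y" "dsnd (x + y) = dsnd x + dsnd y"
  "dfst (x * y) = dfst x * dfst y" "dsnd (x * y) = dsnd x * dsnd y"
  "dfst (x - y) = dfst x - dfst y" "dsnd (x - y) = dsnd x - dsnd y"
  by (simp_all add: zero_dbl_def one_dbl_def plus_dbl_def times_dbl_def minus_dbl_def)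

lemma dbl_eq_iff: "x = y \<longleftrightarrow> dfst x = dfst y \<and> dsnd x = dsnd y"
  by (auto simp: dbl.expand)

lemma dbl_power [simp]: "dfst (x ^ n) = dfst x ^ n" "dsnd (x ^ n) = dsnd x ^ n"
  by (induction n) simp_all

definition deid :: "nat => 'a::comm_ring_1 dbl" where "deid n = Dbl (eid n) (eid n)"
definition dst :: "'a::comm_ring_1 dbl => 'a dbl" where "dst x = Dbl (tp (dsnd x)) (tp (dfst x))"

lemma deid_simps [simp]: "dfst (deid n) = eid n" "dsnd (deid n) = eid n"
  and dst_simps [simp]: "dfst (dst x) = tp (dsnd x)" "dsnd (dst x) = tp (dfst x)"
  by (simp_all add: deid_def dst_def)

lemma dbl_MM: "{x. deid n * x = x \<and> x * deid m = x} = (\<lambda>(X, Y). Dbl X Y) ` (MM n m \<times> MM n m)"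
proof (intro equalityI subsetI)
  fix x assume "x \<in> {x. deid n * x = x \<and> x * deid m = x}"
  then have "x = (\<lambda>(X, Y). Dbl X Y) (dfst x, dsnd x)" "(dfst x, dsnd x) \<in> MM n m \<times> MM n m"
    by (auto simp: dbl_eq_iff MM_def)
  then show "x \<in> (\<lambda>(X, Y). Dbl X Y) ` (MM n m \<times> MM n m)" by (rule image_eqI)
qed (auto simp: dbl_eq_iff MM_def)

lemma inj_Dbl: "inj_on (\<lambda>(X, Y). Dbl X Y) A"
  by (auto simp: inj_on_def)

lemma tp_munit: "tp (munit i j) = munit j i"
  by (rule fmat_eqI) (simp add: ent_ctrans munit.rep_eq)

lemma MM_1_iff: "X \<in> MM 1 1 ==> X = eid 1 \<longleftrightarrow> ent X 0 0 = 1"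
proof
  assume "X \<in> MM 1 1" "ent X 0 0 = 1"
  then show "X = eid 1" by (intro MM_1_eqI MM_eid) (simp_all add: eid.rep_eq)
qed (simp add: eid.rep_eq)

text \<open>A Hermitian element is a pair \<open>(X, tp X)\<close>, so \<open>w\<close> is the size
  of the field. \<open>p = 1 / w\<close> because a nonzero \<open>t\<close> is a product
  \<open>x * y\<close> in \<open>w - 1 = w * (1 - p)\<close> ways. For \<open>herm_vec\<close> a
  nonzero entry of \<open>X\<close> suffices, and the central element of trace one is
  \<open>(1, 0)\<close>.\<close>

interpretation hg: herm "deid :: nat => 'a::{field,finite} dbl" dst "CARD('a)" "1 / real CARD('a)"
proof
  have gt: "CARD('a) > 1" by (rule card_field_gt_1)
  show "dst (x + y) = dst x + dst y" "dst (x * y) = dst y * dst x" "dst (dst x) = x" for x y :: "'a dbl"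
    by (simp_all add: dbl_eq_iff tp_add tp_mult)
  show "dst (deid n) = (deid n :: 'a dbl)" "deid n * deid m = (deid (min n m) :: 'a dbl)" "deid 0 = (0 :: 'a dbl)" for n m
    by (simp_all add: dbl_eq_iff eid_mult)
  show "finite {x :: 'a dbl. deid n * x = x \<and> x * deid m = x}" for n m
    unfolding dbl_MM by simp
  show "card {x :: 'a dbl. deid n * x = x \<and> x * deid m = x} = CARD('a) ^ (2 * (n * m))" for n m
    unfolding dbl_MM by (simp add: card_image[OF inj_Dbl] card_MM card_cartesian_product mult_2 power_add)
  show "card {x :: 'a dbl. deid n * x = x \<and> x * deid n = x \<and> dst x = x} = CARD('a) ^ (n * n)" for n
  proof -
    have *: "{x :: 'a dbl. deid n * x = x \<and> x * deid n = x \<and> dst x = x} = {x. dfst x \<in> MM n n \<and> dsnd x \<in> MM n n \<and> dst x = x}"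
      by (auto simp: dbl_eq_iff MM_def)
    have "bij_betw (\<lambda>X. Dbl X (tp X)) (MM n n) {x :: 'a dbl. dfst x \<in> MM n n \<and> dsnd x \<in> MM n n \<and> dst x = x}"
      by (rule bij_betw_byWitness[where f' = dfst]) (auto simp: dbl_eq_iff MM_tp)
    then show ?thesis unfolding * by (simp add: bij_betw_same_card[symmetric] card_MM)
  qed
  show "2 \<le> CARD('a)" using gt by simp
  show "\<exists>t::'a dbl. t + dst t = 1 \<and> (\<forall>x. t * x = x * t)"
  proof (intro exI[of _ "Dbl 1 0 :: 'a dbl"])
    have "tp 1 = (1 :: 'a fmat)" by (rule fmat_eqI) (simp add: ent_ctrans)
    then show "Dbl 1 0 + dst (Dbl 1 0) = (1 :: 'a dbl) \<and> (\<forall>x :: 'a dbl. Dbl 1 0 * x = x * Dbl 1 0)"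
      by (simp add: dbl_eq_iff)
  qed
  show "\<exists>v. deid n * v = v \<and> v * deid 1 = v \<and> dst v * x * v = deid 1"
    if x: "deid n * x = x" "x * deid n = x" "dst x = x" "x ~= 0" for n and x :: "'a dbl"
  proof -
    define X where "X = dfst x"
    have X: "X \<in> MM n n" using x by (auto simp: X_def dbl_eq_iff MM_def)
    have xX: "x = Dbl X (tp X)" using x by (auto simp: X_def dbl_eq_iff)
    have "X ~= 0" using x xX by (auto simp: dbl_eq_iff)
    then obtain i j where ij: "ent X i j ~= 0" using fmat_eqI[of X 0] by auto
    then have le: "i < n" "j < n" using X by (auto simp: MM_iff)
    define b where "b = sc (inverse (ent X i j)) * munit j 0"
    have b: "b \<in> MM n 1" using le by (auto simp: b_def intro!: MM_sc munit_MM)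
    have a: "(munit i 0 :: 'a fmat) \<in> MM n 1" "(munit 0 i :: 'a fmat) \<in> MM 1 n" using le by (auto intro: munit_MM)
    have 1: "munit 0 i * X * b = eid 1"
    proof (rule MM_1_eqI[OF MM_mult[OF MM_mult[OF a(2) X] b] MM_eid])
      have "munit 0 i * X * b = sc (inverse (ent X i j)) * (munit 0 i * X * munit j 0)"
        unfolding b_def by (metis mult.assoc sc_commute)
      then show "ent (munit 0 i * X * b) 0 0 = ent (eid 1) 0 0"
        using ij by (simp add: sum_mult_munit munit_mult eid.rep_eq)
    qed
    have "tp (munit 0 i * X * b) = tp b * (tp X * munit i 0)" by (simp add: tp_mult tp_munit mult.assoc)
    then have 2: "tp b * (tp X * munit i 0) = eid 1" by (simp add: 1)
    show ?thesis
      by (intro exI[of _ "Dbl b (munit i 0)"])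
        (use 1 2 a b in \<open>simp add: dbl_eq_iff xX tp_munit mult.assoc MM_l[OF a(1)] MM_r[OF a(1), unfolded One_nat_def] MM_l[OF b] MM_r[OF b, unfolded One_nat_def]\<close>)
  qed
  show "\<exists>E::'a dbl. E * deid 1 = E \<and> dst E * E = deid 1 \<and> E * dst E = deid (Suc r) - deid r" for r
    by (intro exI[of _ "Dbl (munit r 0) (munit r 0)"])
      (auto intro!: fmat_eqI simp: dbl_eq_iff tp_munit sum_mult_munit munit.rep_eq eid.rep_eq)
  show "r \<le> n \<and> (\<exists>N L. deid n * N = N \<and> N * deid (n - r) = N \<and> deid (n - r) * L = L \<and> L * deid n = L \<and> N * L = deid n - i * k \<and> L * N = deid (n - r))"
    if "deid n * i = i" "i * deid r = i" "deid r * k = k" "k * deid n = k" "k * i = deid r" for n r and i k :: "'a dbl"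
  proof -
    have i: "dfst i \<in> MM n r" "dsnd i \<in> MM n r" "dfst k \<in> MM r n" "dsnd k \<in> MM r n"
      and k: "dfst k * dfst i = eid r" "dsnd k * dsnd i = eid r"
      using that by (auto simp: dbl_eq_iff MM_def)
    obtain N L where 1: "r \<le> n" "N \<in> MM n (n - r)" "L \<in> MM (n - r) n" "N * L = eid n - dfst i * dfst k" "L * N = eid (n - r)"
      using fmat_compl[OF i(1,3) k(1)] by blast
    obtain N' L' where 2: "N' \<in> MM n (n - r)" "L' \<in> MM (n - r) n" "N' * L' = eid n - dsnd i * dsnd k" "L' * N' = eid (n - r)"
      using fmat_compl[OF i(2,4) k(2)] by blast
    show ?thesis
      by (intro conjI exI[of _ "Dbl N N'"] exI[of _ "Dbl L L'"]) (use 1 2 in \<open>simp_all add: dbl_eq_iff MM_def\<close>)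
  qed
  show "\<bar>1 / real CARD('a)\<bar> < 1" using gt by simp
  show "real (card {v :: 'a dbl. deid n * v = v \<and> v * deid 1 = v \<and> dst v * v = deid 1}) = real CARD('a) ^ (2 * n - 1) * (1 - (1 / real CARD('a)) ^ n)"
    if n: "n > 0" for n
  proof -
    let ?N = "\<lambda>(x, y). x * y :: 'a"
    let ?A = "{xs :: ('a \<times> 'a) list. length xs = n \<and> sum_list (map ?N xs) = 1}"
    let ?f = "\<lambda>xs :: ('a \<times> 'a) list. Dbl (of_fun n 1 (\<lambda>i j. fst (xs ! i))) (of_fun n 1 (\<lambda>i j. snd (xs ! i)))"
    have bij: "bij_betw ?f {xs. length xs = n} {v :: 'a dbl. deid n * v = v \<and> v * deid 1 = v}"
    proof (rule bij_betw_byWitness[where f' = "\<lambda>v. map (\<lambda>i. (ent (dfst v) i 0, ent (dsnd v) i 0)) [0..<n]"])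
      show "\<forall>xs\<in>{xs. length xs = n}. map (\<lambda>i. (ent (dfst (?f xs)) i 0, ent (dsnd (?f xs)) i 0)) [0..<n] = xs"
        by (auto intro!: nth_equalityI)
      show "\<forall>v\<in>{v :: 'a dbl. deid n * v = v \<and> v * deid 1 = v}. ?f (map (\<lambda>i. (ent (dfst v) i 0, ent (dsnd v) i 0)) [0..<n]) = v"
      proof
        fix v :: "'a dbl" assume "v \<in> {v. deid n * v = v \<and> v * deid 1 = v}"
        then have v: "dfst v \<in> MM n 1" "dsnd v \<in> MM n 1" by (auto simp: dbl_eq_iff MM_def)
        have "?f (map (\<lambda>i. (ent (dfst v) i 0, ent (dsnd v) i 0)) [0..<n]) = Dbl (of_fun n 1 (ent (dfst v))) (of_fun n 1 (ent (dsnd v)))"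
          by (auto intro!: fmat_eqI)
        then show "?f (map (\<lambda>i. (ent (dfst v) i 0, ent (dsnd v) i 0)) [0..<n]) = v"
          using of_fun_ent[OF v(1)] of_fun_ent[OF v(2)] by simp
      qed
      show "?f ` {xs. length xs = n} \<subseteq> {v :: 'a dbl. deid n * v = v \<and> v * deid 1 = v}"
        using of_fun_MM[of n 1, where 'a = 'a] unfolding MM_def by (auto simp: dbl_eq_iff)
    qed auto
    have *: "sum_list (map ?N xs) = 1 \<longleftrightarrow> dst (?f xs) * ?f xs = deid 1" if "xs \<in> {xs. length xs = n}" for xs
    proof -
      define X where "X = of_fun n 1 (\<lambda>i j. fst (xs ! i))" define Y where "Y = of_fun n 1 (\<lambda>i j. snd (xs ! i))"
      have X: "X \<in> MM n 1" "Y \<in> MM n 1" by (simp_all add: X_def Y_def)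
      then have sX: "tp X \<in> MM 1 n" "tp Y \<in> MM 1 n" by (simp_all add: MM_tp)
      have "ent (tp Y * X) 0 0 = (\<Sum>k<n. fst (xs ! k) * snd (xs ! k))" "ent (tp X * Y) 0 0 = (\<Sum>k<n. fst (xs ! k) * snd (xs ! k))"
        unfolding ent_times_MM[OF sX(2)] ent_times_MM[OF sX(1)] by (simp_all add: X_def Y_def ent_ctrans mult.commute)
      moreover have "(\<Sum>k<n. fst (xs ! k) * snd (xs ! k)) = sum_list (map ?N xs)"
        using that by (simp add: sum_list_sum_nth atLeast0LessThan case_prod_beta)
      ultimately have e: "ent (tp Y * X) 0 0 = sum_list (map ?N xs)" "ent (tp X * Y) 0 0 = sum_list (map ?N xs)" by simp_all
      have "tp Y * X = eid 1 \<longleftrightarrow> ent (tp Y * X) 0 0 = 1" "tp X * Y = eid 1 \<longleftrightarrow> ent (tp X * Y) 0 0 = 1"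
        by (intro MM_1_iff MM_mult[OF sX(2) X(1)] MM_mult[OF sX(1) X(2)])+
      then have "sum_list (map ?N xs) = 1 \<longleftrightarrow> dst (Dbl X Y) * Dbl X Y = deid 1" by (simp add: dbl_eq_iff e)
      then show ?thesis by (simp only: X_def Y_def)
    qed
    have "bij_betw ?f {xs \<in> {xs. length xs = n}. sum_list (map ?N xs) = 1} {v \<in> {v :: 'a dbl. deid n * v = v \<and> v * deid 1 = v}. dst v * v = deid 1}"
      by (rule bij_betw_restrict[OF bij]) (rule *)
    then have "card {xs \<in> {xs. length xs = n}. sum_list (map ?N xs) = 1} = card {v \<in> {v :: 'a dbl. deid n * v = v \<and> v * deid 1 = v}. dst v * v = deid 1}"
      by (rule bij_betw_same_card)
    then have "card {v :: 'a dbl. deid n * v = v \<and> v * deid 1 = v \<and> dst v * v = deid 1} = card ?A"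
      by (simp add: conj_assoc)
    moreover have "real (card ?A) = real CARD('a) ^ (2 * n) / real CARD('a) * (1 - (1 / real CARD('a)) ^ n)"
    proof (rule card_sum_eq[where ?F0.0 = UNIV and ?n1.0 = "CARD('a) - 1"])
      show "card {y. ?N y = t} = CARD('a) - 1" if "t ~= 0" for t
      proof -
        have "bij_betw (\<lambda>x. (x, t / x)) (UNIV - {0}) {y. ?N y = t}"
          by (rule bij_betw_byWitness[where f' = fst]) (use that in auto)
        then show ?thesis by (simp add: bij_betw_same_card[symmetric] card_Diff_subset)
      qed
      show "CARD('a \<times> 'a) = CARD('a)\<^sup>2" by (simp add: power2_eq_square)
      show "real (CARD('a) - 1) = real CARD('a) * (1 - 1 / real CARD('a))" using gt by (simp add: field_simps of_nat_diff)
    qed (use gt in auto)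
    moreover have "real CARD('a) ^ (2 * n) / real CARD('a) = real CARD('a) ^ (2 * n - 1)"
      using n gt by (simp add: power_diff)
    ultimately show ?thesis by simp
  qed
qed

section \<open>Nilpotent commuting pairs over the general linear group\<close>

definition GLm :: "nat => 'a::{field,finite} fmat set" where
  "GLm n = {X \<in> MM n n. \<exists>Y\<in>MM n n. X * Y = eid n \<and> Y * X = eid n}"

definition GNP :: "nat => ('a::{field,finite} fmat \<times> 'a fmat) set" where
  "GNP n = {(A, B). A \<in> MM n n \<and> B \<in> MM n n \<and> A * B = B * A \<and> (\<exists>m. A ^ m = 0)}"

lemma hg_M: "x \<in> hg.M n m \<longleftrightarrow> dfst x \<in> MM n m \<and> dsnd x \<in> MM n m"
  by (auto simp: hg.M_def MM_def dbl_eq_iff)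

text \<open>A unitary element of the split algebra is an invertible \<open>X\<close> together with
  its inverse transpose.\<close>

lemma card_hg_U: "card (hg.U n :: 'a::{field,finite} dbl set) = card (GLm n :: 'a fmat set)"
proof (rule bij_betw_same_card[of dfst])
  have *: "Y = Z" if "X * Y = eid n" "Z * X = eid n" "Y \<in> MM n n" "Z \<in> MM n n" for X Y Z :: "'a fmat"
    using that by (metis MM_l MM_r mult.assoc)
  show "bij_betw dfst (hg.U n :: 'a dbl set) (GLm n)"
    unfolding bij_betw_def
  proof
    show "inj_on dfst (hg.U n :: 'a dbl set)"
    proof (rule inj_onI)
      fix x y :: "'a dbl" assume x: "x \<in> hg.U n" and y: "y \<in> hg.U n" and xy: "dfst x = dfst y"
      have "dfst x * tp (dsnd x) = eid n" "tp (dsnd y) * dfst x = eid n" "tp (dsnd x) \<in> MM n n" "tp (dsnd y) \<in> MM n n"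
        using x y xy by (auto simp: hg.U_def hg_M dbl_eq_iff MM_tp)
      then have "tp (dsnd x) = tp (dsnd y)" by (rule *)
      then have "dsnd x = dsnd y" by (metis tp_tp)
      with xy show "x = y" by (simp add: dbl_eq_iff)
    qed
    show "dfst ` (hg.U n :: 'a dbl set) = GLm n"
    proof (intro equalityI subsetI)
      fix X :: "'a fmat" assume "X \<in> dfst ` hg.U n"
      then obtain x where "x \<in> hg.U n" "X = dfst x" by blast
      then show "X \<in> GLm n" by (auto simp: hg.U_def GLm_def hg_M dbl_eq_iff MM_tp intro!: bexI[of _ "tp (dsnd x)"])
    next
      fix X :: "'a fmat" assume "X \<in> GLm n"
      then obtain Y where Y: "X \<in> MM n n" "Y \<in> MM n n" "X * Y = eid n" "Y * X = eid n" by (auto simp: GLm_def)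
      have "tp X * tp Y = eid n" "tp Y * tp X = eid n" using Y tp_mult tp_eid by metis+
      with Y have "Dbl X (tp Y) \<in> hg.U n" by (auto simp: hg.U_def hg_M dbl_eq_iff MM_tp)
      then show "X \<in> dfst ` hg.U n" by force
    qed
  qed
qed

lemma card_hg_NP: "card (hg.NP n :: ('a::{field,finite} dbl \<times> 'a dbl) set) = card (GNP n :: ('a fmat \<times> 'a fmat) set)"
proof (rule bij_betw_same_card[symmetric])
  have tpow: "tp (X ^ m) = tp X ^ m" if "X ^ m = 0" for X :: "'a fmat" and m
  proof -
    have "tp 1 = (1 :: 'a fmat)" by (rule fmat_eqI) (simp add: ent_ctrans)
    then show ?thesis by (induction m) (simp_all add: tp_mult power_commutes)
  qed
  show "bij_betw (\<lambda>(A, B). (Dbl A (tp A), Dbl B (tp B))) (GNP n) (hg.NP n :: ('a dbl \<times> 'a dbl) set)"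
  proof (rule bij_betw_byWitness[where f' = "\<lambda>(A, B). (dfst A, dfst B)"])
    show "(\<lambda>(A, B). (Dbl A (tp A), Dbl B (tp B))) ` GNP n \<subseteq> (hg.NP n :: ('a dbl \<times> 'a dbl) set)"
    proof clarify
      fix A B :: "'a fmat" assume "(A, B) \<in> GNP n"
      then obtain m where AB: "A \<in> MM n n" "B \<in> MM n n" "A * B = B * A" "A ^ m = 0" by (auto simp: GNP_def)
      have "tp A * tp B = tp B * tp A" using AB(3) tp_mult by metis
      moreover have "Dbl A (tp A) ^ m = 0" using AB tpow[OF AB(4)] by (simp add: dbl_eq_iff)
      ultimately show "(Dbl A (tp A), Dbl B (tp B)) \<in> hg.NP n"
        using AB by (auto simp: hg.NP_def hg.H_def hg_M dbl_eq_iff MM_tp)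
    qed
    show "(\<lambda>(A, B). (dfst A, dfst B)) ` hg.NP n \<subseteq> (GNP n :: ('a fmat \<times> 'a fmat) set)"
      by (auto simp: hg.NP_def hg.H_def hg_M GNP_def dbl_eq_iff)
  qed (auto simp: hg.NP_def hg.H_def dbl_eq_iff)
qed

lemma GL_nilp_series:
  "Abs_fps (\<lambda>n. real (card (GNP n :: ('a::{field,finite} fmat \<times> 'a fmat) set)) / real (card (GLm n :: 'a fmat set)))
    = iprod (euler_fps (1 / real CARD('a)))"
  using hg.nilp_series[where 'a = 'a] by (simp add: card_hg_U card_hg_NP)

section \<open>Fitting decomposition\<close>

context herm begin

lemma M_power: "x \<in> M n n ==> m > 0 ==> x ^ m \<in> M n n"
proof (induction m)
  case (Suc m)
  then show ?case by (cases "m = 0") (auto intro: M_mult)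
qed simp

lemma commute_power: "x * y = y * x ==> x ^ m * y = y * x ^ m" for x y :: 'r
  by (induction m) (simp_all add: mult.assoc, metis mult.assoc)

lemma intertwine_power: "x * s = s * y ==> x ^ m * s = s * y ^ m" for x y s :: 'r
  by (induction m) (simp_all add: mult.assoc, metis mult.assoc)

lemma power_idem:
  assumes "t \<in> M n n"
  obtains N where "N > 0" "t ^ N * t ^ N = t ^ N"
proof -
  have "\<not> inj_on (\<lambda>i. t ^ Suc i) UNIV"
  proof
    assume "inj_on (\<lambda>i. t ^ Suc i) UNIV"
    moreover have "(\<lambda>i. t ^ Suc i) ` UNIV \<subseteq> M n n" using M_power[OF assms] by blast
    ultimately have "finite (UNIV :: nat set)" by (meson finite_M finite_imageD finite_subset)
    then show False by simp
  qed
  then obtain i j where "t ^ Suc i = t ^ Suc j" "i < j"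
    unfolding inj_on_def by (metis linorder_neqE_nat)
  then obtain a d where ad: "a > 0" "d > 0" "t ^ a = t ^ (a + d)"
    by (metis add_Suc less_imp_Suc_add zero_less_Suc add_Suc_right)
  have 1: "t ^ k = t ^ (k + d)" if "k \<ge> a" for k
    using that ad(3) by (metis add.commute add.left_commute le_add_diff_inverse power_add)
  have 2: "t ^ k = t ^ (k + d * l)" if "k \<ge> a" for k l
  proof (induction l)
    case (Suc l)
    then show ?case using 1[of "k + d * l"] that by (simp add: add_ac)
  qed simp
  \<comment> \<open>From exponent \<open>a\<close> on, \<open>d\<close> is a period. The exponent
    \<open>d * a\<close> is a multiple of \<open>d\<close> that is at least \<open>a\<close>, so
    doubling it does not change the power.\<close>
  show ?thesis
    by (rule that[of "d * a"]) (use 2[of "d * a" a] ad in \<open>simp_all add: power_add\<close>)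
qed

text \<open>The hypothesis covers both Hermitian \<open>t\<close> and \<open>t = x - 1\<close> with \<open>x\<close> unitary.\<close>

lemma fitting:
  assumes t: "t \<in> M n n" and u: "u \<in> M n n" "st t = u * t" "u * t = t * u" and v: "v \<in> M n n" "v * u = e n"
  obtains N k J K where "N > 0" "k \<le> n" "(J, K) \<in> FF n k" "K * st K = t ^ N" "t ^ N * t ^ N = t ^ N"
proof -
  obtain N where N: "N > 0" "t ^ N * t ^ N = t ^ N" using power_idem[OF t] .
  define f where "f = t ^ N"
  have fM: "f \<in> M n n" using M_power[OF t N(1)] by (simp add: f_def)
  have ff: "f * f = f" using N by (simp add: f_def)
  have ut: "(u * t) ^ m = u ^ m * t ^ m" for m
  proof (induction m)
    case (Suc m)
    then show ?case using commute_power[OF u(3)[symmetric], of m] by (simp add: mult.assoc) (metis mult.assoc commute_power u(3))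
  qed simp
  define c where "c = u ^ N"
  have cM: "c \<in> M n n" using M_power[OF u(1) N(1)] by (simp add: c_def)
  have stf: "st f = c * f" by (simp add: f_def st_power u(2) ut c_def)
  have cf: "c * f = f * c" unfolding c_def f_def by (metis commute_power u(3))
  have uv: "u * v = e n" using inverse_commute[OF u(1) v] .
  have vc: "v ^ m * u ^ m * e n = e n" for m
  proof (induction m)
    case (Suc m)
    have "v ^ Suc m * u ^ Suc m * e n = v ^ m * (v * u) * u ^ m * e n"
      by (simp only: power_Suc2[of v] power_Suc[of u] mult.assoc)
    also have "... = v ^ m * u ^ m * e n"
      unfolding v(2) using u(1) by (cases "m = 0") (simp_all add: e_mult mult.assoc M_l'[OF M_power[OF u(1)]])
    finally show ?case using Suc by simp
  qed simp
  \<comment> \<open>\<open>st f = c * f\<close> is idempotent like \<open>f\<close>, and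
    \<open>c\<close> commutes with \<open>f\<close>; so \<open>c * (c * f) = c * f\<close>, and
    cancelling the invertible \<open>c\<close> shows that \<open>f\<close> is Hermitian.\<close>
  have "c * f * (c * f) = c * f" using arg_cong[OF ff, of st] by (simp add: st_mult stf)
  then have "c * (c * f) = c * f" using cf ff by (metis mult.assoc)
  then have "v ^ N * (c * (c * f)) = v ^ N * (c * f)" by simp
  moreover have "v ^ N * (c * z) = z" if "z \<in> M n n" for z
    using vc[of N] M_l[OF that] unfolding c_def by (metis mult.assoc)
  ultimately have "c * f = f" using M_mult[OF cM fM] fM by metis
  then have "f \<in> H n" using fM stf by (simp add: H_def)
  then have "e n - f \<in> H n" "(e n - f) * (e n - f) = e n - f"
    using fM ff by (auto simp: H_def st_diff algebra_simps e_mult M_l M_r intro!: M_intros)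
  then obtain k J where J: "J \<in> F n k" "e n - f = J * st J" by (rule herm_idem)
  obtain K where K: "k \<le> n" "K \<in> F n (n - k)" "J * st J + K * st K = e n" using orth_compl[OF J(1)] by metis
  then have "K * st K = f" using J(2) by (simp add: algebra_simps)
  then show ?thesis using that[OF N(1) K(1), of J K] J K N(2) by (simp add: FF_def f_def)
qed

text \<open>Splits the pairs along the Fitting decomposition of \<open>T\<close>. The intertwining
  hypothesis \<open>Ti\<close> serves three times: \<open>T\<close> commutes with whatever commutes
  with the first entry, so both entries respect the splitting; \<open>T\<close> restricts to the
  blocks; and a map between a block with \<open>T\<close> nilpotent and one with \<open>T\<close>
  invertible is zero, which is the disjointness asked for by \<open>block_count\<close>.\<close>

lemma fitting_count:
  fixes X :: "nat => ('r \<times> 'r) set" and T :: "nat => 'r => 'r"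
  assumes XM: "\<And>n. X n \<subseteq> M n n \<times> M n n" and comm: "\<And>n x. x \<in> X n ==> fst x * snd x = snd x * fst x"
    and X1: "\<And>n k x J. x \<in> X n ==> J \<in> F n k ==> fst x * (J * st J) = J * st J * fst x ==> snd x * (J * st J) = J * st J * snd x
        ==> (st J * fst x * J, st J * snd x * J) \<in> X k"
    and X2: "\<And>n k y z J K. k \<le> n ==> (J, K) \<in> FF n k ==> y \<in> X k ==> z \<in> X (n - k) ==> blk J K y z \<in> X n"
    and TM: "\<And>n x. x \<in> X n ==> T n (fst x) \<in> M n n"
    and Tst: "\<And>n x. x \<in> X n ==> \<exists>u\<in>M n n. \<exists>v\<in>M n n. st (T n (fst x)) = u * T n (fst x) \<and> u * T n (fst x) = T n (fst x) * u \<and> v * u = e n"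
    and Ti: "\<And>k l A B S. A \<in> M k k ==> B \<in> M l l ==> S \<in> M l k ==> B * S = S * A ==> T l B * S = S * T k A"
  defines "Y \<equiv> \<lambda>n. {x \<in> X n. \<exists>m. T n (fst x) ^ m = 0}"
    and "Z \<equiv> \<lambda>n. {x \<in> X n. \<exists>y\<in>M n n. y * T n (fst x) = e n}"
  shows "Abs_fps (\<lambda>n. real (card (X n)) / real (card (U n))) =
    Abs_fps (\<lambda>n. real (card (Y n)) / real (card (U n))) * Abs_fps (\<lambda>n. real (card (Z n)) / real (card (U n)))"
proof -
  have XM': "fst x \<in> M n n" "snd x \<in> M n n" if "x \<in> X n" for x n using that XM[of n] by auto
  have U1: "(st Q * fst x * Q, st Q * snd x * Q) \<in> X k \<and> T k (st Q * fst x * Q) * st Q = st Q * T k (fst x)" if Q: "Q \<in> U k" and x: "x \<in> X k" for Q x k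
  proof
    have Q': "Q \<in> M k k" "Q \<in> F k k" "Q * st Q = e k" using Q by (auto simp: U_def F_def)
    note xM = XM'[OF x]
    show "(st Q * fst x * Q, st Q * snd x * Q) \<in> X k"
      using X1[OF x Q'(2)] xM by (simp add: Q' M_l M_r)
    show "T k (st Q * fst x * Q) * st Q = st Q * T k (fst x)"
      using xM Q' by (intro Ti) (auto simp: mult.assoc M_r intro: M_intros)
  qed
  have split: "\<exists>k\<le>n. \<exists>(J, K)\<in>FF n k. \<exists>y\<in>Y k. \<exists>z\<in>Z (n - k). x = blk J K y z" if x: "x \<in> X n" for x n
  proof -
    define A where "A = fst x" define B where "B = snd x" define t where "t = T n A"
    have AB: "A \<in> M n n" "B \<in> M n n" "A * B = B * A" using XM'[OF x] comm[OF x] by (simp_all add: A_def B_def)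
    have tM: "t \<in> M n n" using TM[OF x] by (simp add: t_def A_def)
    obtain u v where uv: "u \<in> M n n" "v \<in> M n n" "st t = u * t" "u * t = t * u" "v * u = e n"
      using Tst[OF x] by (auto simp: t_def A_def)
    obtain N k J K where N: "N > 0" "k \<le> n" and JK: "(J, K) \<in> FF n k" and f: "K * st K = t ^ N" "t ^ N * t ^ N = t ^ N"
      by (rule fitting[OF tM uv(1,3,4,2,5)])
    note jk = FF_D[OF JK]
    have "t * A = A * t" "t * B = B * t" using Ti[of A n A n A] Ti[of A n A n B] AB by (simp_all add: t_def)
    then have cK: "A * (K * st K) = K * st K * A" "B * (K * st K) = K * st K * B" "t * (K * st K) = K * st K * t"
      unfolding f by (simp_all add: commute_power power_commutes)
    have JJ: "J * st J = e n - K * st K" using jk(5) by (simp add: algebra_simps)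
    have cJ: "A * (J * st J) = J * st J * A" "B * (J * st J) = J * st J * B" "t * (J * st J) = J * st J * t"
      unfolding JJ by (simp_all add: right_diff_distrib left_diff_distrib cK M_l[OF AB(1)] M_r[OF AB(1)] M_l[OF AB(2)] M_r[OF AB(2)] M_l[OF tM] M_r[OF tM])
    define y where "y = (st J * A * J, st J * B * J)"
    define z where "z = (st K * A * K, st K * B * K)"
    have JF: "J \<in> F n k" "K \<in> F n (n - k)" using JK by (auto simp: FF_def)
    have y: "y \<in> X k" and z: "z \<in> X (n - k)"
      using X1[OF x JF(1)] X1[OF x JF(2)] cJ cK by (simp_all add: y_def z_def A_def B_def)
    have dec: "C = J * (st J * C * J) * st J + K * (st K * C * K) * st K" if C: "C \<in> M n n" "C * (K * st K) = K * st K * C" for C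
    proof -
      have J': "C * (J * st J) = J * st J * C" unfolding JJ by (simp add: right_diff_distrib left_diff_distrib C M_l[OF C(1)] M_r[OF C(1)])
      have "J * (st J * C * J) * st J = J * st J * (C * (J * st J))" by (simp add: mult.assoc)
      also have "... = J * (st J * J) * st J * C" unfolding J' by (simp add: mult.assoc)
      finally have 1: "J * (st J * C * J) * st J = J * st J * C" by (simp add: jk mult.assoc M_l'[OF M_st[OF jk(1)]])
      have "K * (st K * C * K) * st K = K * st K * (C * (K * st K))" by (simp add: mult.assoc)
      also have "... = K * (st K * K) * st K * C" unfolding C(2) by (simp add: mult.assoc)
      finally have 2: "K * (st K * C * K) * st K = K * st K * C" by (simp add: jk mult.assoc M_l'[OF M_st[OF jk(2)]])
      show ?thesis unfolding 1 2 distrib_right[symmetric] jk(5) using C by (simp add: M_l)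
    qed
    have xb: "x = blk J K y z" using dec[OF AB(1) cK(1)] dec[OF AB(2) cK(2)] by (simp add: blk_def y_def z_def A_def B_def prod_eq_iff)
    have AJ: "A * J = J * fst y"
    proof -
      have "J * fst y = (J * st J * A) * J" by (simp add: y_def mult.assoc)
      also have "... = A * (J * (st J * J))" unfolding cJ(1)[symmetric] by (simp add: mult.assoc)
      finally show ?thesis using jk by (simp add: M_r)
    qed
    have AK: "A * K = K * fst z"
    proof -
      have "K * fst z = (K * st K * A) * K" by (simp add: z_def mult.assoc)
      also have "... = A * (K * (st K * K))" unfolding cK(1)[symmetric] by (simp add: mult.assoc)
      finally show ?thesis using jk by (simp add: M_r)
    qed
    have tJ: "t * J = J * T k (fst y)" unfolding t_def using Ti[OF _ AB(1) jk(1) AJ] XM'[OF y] by simp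
    have tK: "t * K = K * T (n - k) (fst z)" unfolding t_def using Ti[OF _ AB(1) jk(2) AK] XM'[OF z] by simp
    have tyM: "T k (fst y) \<in> M k k" and tzM: "T (n - k) (fst z) \<in> M (n - k) (n - k)" using TM y z by auto
    have "T k (fst y) ^ N = st J * (J * T k (fst y) ^ N)"
      using M_power[OF tyM N(1)] by (simp add: jk(3)[THEN assoc_l] M_l)
    also have "... = st J * (t ^ N * J)" by (simp add: intertwine_power[OF tJ])
    also have "... = 0" unfolding f(1)[symmetric] by (simp add: mult.assoc jk)
    finally have yY: "y \<in> Y k" using y by (auto simp: Y_def)
    have "T (n - k) (fst z) ^ N = st K * (K * T (n - k) (fst z) ^ N)"
      using M_power[OF tzM N(1)] by (simp add: jk(4)[THEN assoc_l] M_l)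
    also have "... = st K * (t ^ N * K)" by (simp add: intertwine_power[OF tK])
    also have "... = e (n - k)" unfolding f(1)[symmetric] by (simp add: mult.assoc jk e_mult M_r M_l[OF M_st[OF jk(2)]] M_l'[OF M_st[OF jk(2)]] assoc_l[OF jk(4)])
    finally have tN: "T (n - k) (fst z) ^ N = e (n - k)" .
    have "\<exists>w\<in>M (n - k) (n - k). w * T (n - k) (fst z) = e (n - k)"
    proof (intro bexI[of _ "e (n - k) * T (n - k) (fst z) ^ (N - 1)"])
      have "T (n - k) (fst z) ^ (N - 1) * T (n - k) (fst z) = T (n - k) (fst z) ^ N"
        using N(1) by (metis Suc_diff_1 power_Suc2)
      then show "e (n - k) * T (n - k) (fst z) ^ (N - 1) * T (n - k) (fst z) = e (n - k)"
        by (simp add: mult.assoc tN e_mult)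
      show "e (n - k) * T (n - k) (fst z) ^ (N - 1) \<in> M (n - k) (n - k)"
        by (cases "N - 1 = 0") (auto intro!: M_intros M_power tzM)
    qed
    then have zZ: "z \<in> Z (n - k)" using z by (auto simp: Z_def)
    show ?thesis using N(2) JK yY zZ xb by blast
  qed
  have Yconj: "(st Q * fst y * Q, st Q * snd y * Q) \<in> Y k" if Q: "Q \<in> U k" and y: "y \<in> Y k" for Q y k
  proof -
    have yX: "y \<in> X k" using y by (simp add: Y_def)
    have Q': "Q \<in> M k k" "Q * st Q = e k" "st Q * Q = e k" using Q by (auto simp: U_def)
    note u1 = U1[OF Q yX]
    then have tM: "T k (st Q * fst y * Q) \<in> M k k" using TM by fastforce
    obtain m where m: "T k (fst y) ^ m = 0" using y by (auto simp: Y_def)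
    then have m0: "m > 0" by (cases m) auto
    have "T k (st Q * fst y * Q) ^ m * st Q = st Q * T k (fst y) ^ m" using u1 by (intro intertwine_power) simp
    then have "T k (st Q * fst y * Q) ^ m * st Q * Q = 0" using m by simp
    then have "T k (st Q * fst y * Q) ^ m = 0" using Q' M_r[OF M_power[OF tM m0]] by (simp add: mult.assoc)
    then show ?thesis using u1 by (auto simp: Y_def)
  qed
  have Zconj: "(st Q * fst y * Q, st Q * snd y * Q) \<in> Z k" if Q: "Q \<in> U k" and y: "y \<in> Z k" for Q y k
  proof -
    have yX: "y \<in> X k" using y by (simp add: Z_def)
    have Q': "Q \<in> M k k" "Q * st Q = e k" "st Q * Q = e k" using Q by (auto simp: U_def)
    note u1 = U1[OF Q yX]
    then have tM: "T k (st Q * fst y * Q) \<in> M k k" using TM by fastforce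
    obtain w where w: "w \<in> M k k" "w * T k (fst y) = e k" using y by (auto simp: Z_def)
    have "T k (st Q * fst y * Q) = T k (st Q * fst y * Q) * (st Q * Q)" using Q' M_r[OF tM] by simp
    also have "... = st Q * T k (fst y) * Q" using u1 by (simp add: mult.assoc[symmetric])
    finally have "st Q * w * Q * T k (st Q * fst y * Q) = st Q * w * (Q * st Q) * T k (fst y) * Q"
      by (simp add: mult.assoc)
    also have "... = e k" using Q' w by (simp add: mult.assoc M_r' w(2)[THEN assoc_l] M_l)
    finally have "st Q * w * Q * T k (st Q * fst y * Q) = e k" .
    moreover have "st Q * w * Q \<in> M k k" using Q' w by (auto intro: M_intros)
    ultimately show ?thesis using u1 by (auto simp: Z_def)
  qed
  have zero: "S = 0" if "w * t = e l" "t' ^ m = 0" "t * S = S * t'" "S \<in> M l k" "w \<in> M l l" "t \<in> M l l" for w t t' m S k l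
  proof -
    have tm: "t ^ m * S = 0" using intertwine_power[OF that(3), of m] that(2) by simp
    have "t ^ j * S = 0 ==> S = 0" for j
    proof (induction j)
      case (Suc j)
      have "w * (t ^ Suc j * S) = e l * (t ^ j * S)" by (simp add: mult.assoc[symmetric] that(1))
      also have "... = t ^ j * S"
        using that M_l'[OF M_power[OF that(6)], of j S] by (cases "j = 0") (simp_all add: M_l)
      finally show ?case using Suc by simp
    qed simp
    then show ?thesis using tm by blast
  qed
  have zero': "S = 0" if "w * t = e l" "t' ^ m = 0" "t' * S = S * t" "S \<in> M k l" "w \<in> M l l" "t \<in> M l l" for w t t' m S k l
  proof -
    have tw: "t * w = e l" using inverse_commute[OF that(6,5,1)] .
    have tm: "S * t ^ m = 0" using intertwine_power[OF that(3), of m] that(2) by simp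
    have "S * t ^ j = 0 ==> S = 0" for j
    proof (induction j)
      case (Suc j)
      have "S * t ^ Suc j * w = S * t ^ j * e l" by (simp only: power_Suc2 mult.assoc tw)
      also have "... = S * t ^ j"
        using that M_r[OF M_power[OF that(6)], of j] by (cases "j = 0") (simp_all add: M_r mult.assoc)
      finally show ?case using Suc by simp
    qed simp
    then show ?thesis using tm by blast
  qed
  have "real (card (X n)) / real (card (U n)) =
    (\<Sum>k\<le>n. real (card (Y k)) / real (card (U k)) * (real (card (Z (n - k))) / real (card (U (n - k)))))" for n
  proof (rule block_count)
    show "Y k \<subseteq> M k k \<times> M k k" "Z k \<subseteq> M k k \<times> M k k" for k using XM[of k] by (auto simp: Y_def Z_def)
    show "blk J K y z \<in> X n" if "k \<le> n" "(J, K) \<in> FF n k" "y \<in> Y k" "z \<in> Z (n - k)" for k J K y z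
      using X2 that by (simp add: Y_def Z_def)
    fix k l y z S assume y: "y \<in> Y k" and z: "z \<in> Z l"
    have yX: "y \<in> X k" and zX: "z \<in> X l" using y z by (simp_all add: Y_def Z_def)
    obtain m w where m: "T k (fst y) ^ m = 0" and w: "w \<in> M l l" "w * T l (fst z) = e l" using y z by (auto simp: Y_def Z_def)
    show "S = 0" if "S \<in> M l k" "fst z * S = S * fst y"
      using zero[OF w(2) m Ti[OF XM'(1)[OF yX] XM'(1)[OF zX] that] that(1) w(1) TM[OF zX]] .
    show "S = 0" if "S \<in> M k l" "fst y * S = S * fst z"
      using zero'[OF w(2) m Ti[OF XM'(1)[OF zX] XM'(1)[OF yX] that] that(1) w(1) TM[OF zX]] .
  qed (use split Yconj Zconj in auto)
  then show ?thesis
    by (intro fps_ext) (simp add: fps_mult_nth atLeast0AtMost)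
qed

end

section \<open>Reduction to the number of orbits\<close>

definition sm :: "'a::comm_ring_1 => 'a fmat => 'a fmat" where "sm c X = sc c * X"

lemma sm_mult_left: "sm c X * Y = sm c (X * Y)"
  and sm_mult_right: "X * sm c Y = sm c (X * Y)"
  and sm_sm: "sm a (sm b X) = sm (a * b) X"
  and sm_add: "sm c (X + Y) = sm c X + sm c Y"
  and sm_diff: "sm c (X - Y) = sm c X - sm c Y"
  and sm_minus: "sm c (- X) = - sm c X"
  and sm_0 [simp]: "sm c 0 = 0"
  and sm_1 [simp]: "sm 1 X = X"
  unfolding sm_def by (simp_all add: mult.assoc sc_mult algebra_simps) (metis mult.assoc sc_commute)

lemmas sm_simps = sm_mult_left sm_mult_right sm_sm sm_add sm_diff sm_minus

lemma sm_left_add: "sm (a + b) X = sm a X + sm b X"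
  and sm_left_diff: "sm (a' - b') X = sm a' X - sm b' X"
  and sm_left_minus: "sm (- a) X = - sm a X"
  and sm_left_0 [simp]: "sm 0 X = 0"
  unfolding sm_def by (simp_all add: sc_add sc_diff sc_minus algebra_simps)

lemma sm_power: "sm c X ^ m = sm (c ^ m) (X ^ m)"
  by (induction m) (simp_all add: sm_simps mult.commute[of _ c])

lemma sm_eq_0_iff: "sm c X = 0 \<longleftrightarrow> c = 0 \<or> X = 0" for c :: "'a::field"
proof
  assume "sm c X = 0"
  then have "sm (inverse c) (sm c X) = 0" by simp
  then show "c = 0 \<or> X = 0" by (cases "c = 0") (simp_all add: sm_sm)
qed auto

context quad_field begin

lemma hu_M: "hu.M n m = MM n m"
  by (simp add: hu.M_def MM_def)

lemma star_sm: "star (sm c X) = sm (c ^ q) (star X)"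
  by (simp add: sm_def star_mult star_sc sc_commute)

lemma M_sm: "X \<in> hu.M n m ==> sm c X \<in> hu.M n m"
  by (simp add: hu_M sm_def MM_sc)

definition CC :: "nat => ('a fmat \<times> 'a fmat) set" where
  "CC n = {(A, B). A \<in> hu.H n \<and> B \<in> hu.H n \<and> A * B = B * A}"

definition DD :: "nat => ('a fmat \<times> 'a fmat) set" where
  "DD n = {(X, B). X \<in> hu.U n \<and> B \<in> hu.H n \<and> X * B = B * X}"

definition sh :: "'a => nat => 'a fmat => 'a fmat" where "sh b n A = A - sm b (eid n)"

lemma sh_M: "A \<in> hu.M n n ==> sh b n A \<in> hu.M n n"
  unfolding sh_def by (intro hu.M_diff M_sm hu.e_in_M) auto

lemma sh_st: "star (sh b n A) = sh (b ^ q) n (star A)"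
  by (simp add: sh_def hu.st_diff star_mult star_sm sm_simps)

lemma sh_intertwine:
  assumes "A \<in> hu.M k k" "B \<in> hu.M l l" "S \<in> hu.M l k" "B * S = S * A"
  shows "sh b l B * S = S * sh b k A"
  using assms by (simp add: sh_def algebra_simps sm_simps hu.M_l hu.M_r)

lemma sh_commute:
  assumes "A \<in> hu.M n n"
  shows "sh a n A * sh b n A = sh b n A * sh a n A"
proof -
  have "A * sh b n A = sh b n A * A" using sh_intertwine[OF assms assms assms refl] by simp
  then show ?thesis using sh_intertwine[OF assms assms sh_M[OF assms, of b], where b = a] by simp
qed

lemma CC_X1:
  assumes x: "x \<in> CC n" and J: "J \<in> hu.F n k" and c: "fst x * (J * star J) = J * star J * fst x" "snd x * (J * star J) = J * star J * snd x"
  shows "(star J * fst x * J, star J * snd x * J) \<in> CC k"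
proof -
  have JM: "J \<in> hu.M n k" "star J * J = eid k" using J by (auto simp: hu.F_def)
  have H: "fst x \<in> hu.M n n" "snd x \<in> hu.M n n" "star (fst x) = fst x" "star (snd x) = snd x" "fst x * snd x = snd x * fst x"
    using x by (auto simp: CC_def hu.H_def)
  have e: "star J * C * J * (star J * D * J) = star J * (C * D) * J" if "C \<in> hu.M n n" "D \<in> hu.M n n" "D * (J * star J) = J * star J * D" for C D
  proof -
    have "star J * C * J * (star J * D * J) = star J * C * (J * star J * D) * J" by (simp add: mult.assoc)
    also have "... = star J * C * D * (J * (star J * J))" unfolding that(3)[symmetric] by (simp add: mult.assoc)
    finally show ?thesis using JM by (simp add: hu.M_r mult.assoc)
  qed
  show ?thesis
    using H JM e[OF H(1,2) c(2)] e[OF H(2,1) c(1)]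
    by (auto simp: CC_def hu.H_def star_mult mult.assoc intro!: hu.M_intros)
qed

lemma DD_X1:
  assumes x: "x \<in> DD n" and J: "J \<in> hu.F n k" and c: "fst x * (J * star J) = J * star J * fst x" "snd x * (J * star J) = J * star J * snd x"
  shows "(star J * fst x * J, star J * snd x * J) \<in> DD k"
proof -
  have JM: "J \<in> hu.M n k" "star J * J = eid k" using J by (auto simp: hu.F_def)
  have H: "fst x \<in> hu.M n n" "snd x \<in> hu.M n n" "star (fst x) * fst x = eid n" "star (snd x) = snd x" "fst x * snd x = snd x * fst x"
    using x by (auto simp: DD_def hu.H_def hu.U_def)
  have e: "star J * C * J * (star J * D * J) = star J * (C * D) * J" if "C \<in> hu.M n n" "D \<in> hu.M n n" "D * (J * star J) = J * star J * D" for C D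
  proof -
    have "star J * C * J * (star J * D * J) = star J * C * (J * star J * D) * J" by (simp add: mult.assoc)
    also have "... = star J * C * D * (J * (star J * J))" unfolding that(3)[symmetric] by (simp add: mult.assoc)
    finally show ?thesis using JM by (simp add: hu.M_r mult.assoc)
  qed
  have "star (star J * fst x * J) * (star J * fst x * J) = star J * (star (fst x) * fst x) * J"
    using e[OF hu.M_st[OF H(1)] H(1) c(1)] by (simp add: star_mult mult.assoc)
  also have "... = eid k" using H JM by (simp add: mult.assoc hu.M_l)
  finally have "star J * fst x * J \<in> hu.U k"
    using JM H by (intro hu.in_U_I) (auto intro!: hu.M_intros)
  then show ?thesis
    using H JM e[OF H(1,2) c(2)] e[OF H(2,1) c(1)]
    by (auto simp: DD_def hu.H_def star_mult mult.assoc intro!: hu.M_intros)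
qed

lemma blk_mult:
  assumes "(J, K) \<in> hu.FF n k" "a \<in> hu.M k k" "b \<in> hu.M k k" "c \<in> hu.M (n - k) (n - k)" "d \<in> hu.M (n - k) (n - k)"
  shows "(J * a * star J + K * c * star K) * (J * b * star J + K * d * star K) = J * (a * b) * star J + K * (c * d) * star K"
proof -
  note jk = hu.FF_D[OF assms(1)]
  show ?thesis
    by (simp add: algebra_simps jk(3,4,6,7)[THEN assoc_l] hu.M_l'[OF assms(3)] hu.M_l'[OF assms(5)])
qed

lemma CC_X2:
  assumes "k \<le> n" and JK: "(J, K) \<in> hu.FF n k" and y: "y \<in> CC k" and z: "z \<in> CC (n - k)"
  shows "hu.blk J K y z \<in> CC n"
proof -
  note jk = hu.FF_D[OF JK]
  have H: "fst y \<in> hu.M k k" "snd y \<in> hu.M k k" "fst z \<in> hu.M (n - k) (n - k)" "snd z \<in> hu.M (n - k) (n - k)"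
    using y z by (auto simp: CC_def hu.H_def)
  have "fst y * snd y = snd y * fst y" "fst z * snd z = snd z * fst z" using y z by (auto simp: CC_def)
  then have com: "(J * fst y * star J + K * fst z * star K) * (J * snd y * star J + K * snd z * star K)
    = (J * snd y * star J + K * snd z * star K) * (J * fst y * star J + K * fst z * star K)"
    using blk_mult[OF JK H(1,2,3,4)] blk_mult[OF JK H(2,1,4,3)] by simp
  show ?thesis
    using y z jk H com
    by (auto simp: hu.blk_def CC_def hu.H_def star_add star_mult mult.assoc intro!: hu.M_intros)
qed

lemma DD_X2:
  assumes "k \<le> n" and JK: "(J, K) \<in> hu.FF n k" and y: "y \<in> DD k" and z: "z \<in> DD (n - k)"
  shows "hu.blk J K y z \<in> DD n"
proof -
  note jk = hu.FF_D[OF JK]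
  have H: "fst y \<in> hu.M k k" "snd y \<in> hu.M k k" "fst z \<in> hu.M (n - k) (n - k)" "snd z \<in> hu.M (n - k) (n - k)"
    "star (fst y) * fst y = eid k" "star (fst z) * fst z = eid (n - k)"
    using y z by (auto simp: DD_def hu.H_def hu.U_def)
  have "fst y * snd y = snd y * fst y" "fst z * snd z = snd z * fst z" using y z by (auto simp: DD_def)
  then have com: "(J * fst y * star J + K * fst z * star K) * (J * snd y * star J + K * snd z * star K)
    = (J * snd y * star J + K * snd z * star K) * (J * fst y * star J + K * fst z * star K)"
    using blk_mult[OF JK H(1,2,3,4)] blk_mult[OF JK H(2,1,4,3)] by simp
  have "star (J * fst y * star J + K * fst z * star K) * (J * fst y * star J + K * fst z * star K)
    = (J * star (fst y) * star J + K * star (fst z) * star K) * (J * fst y * star J + K * fst z * star K)"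
    by (simp add: star_add star_mult mult.assoc)
  also have "... = J * (star (fst y) * fst y) * star J + K * (star (fst z) * fst z) * star K"
    using H by (intro blk_mult[OF JK]) (auto intro: hu.M_intros)
  also have "... = eid n" using jk by (simp add: H hu.M_r)
  finally have "J * fst y * star J + K * fst z * star K \<in> hu.U n"
    using H jk by (intro hu.in_U_I) (auto intro!: hu.M_intros)
  then show ?thesis
    using y z jk H com
    by (auto simp: hu.blk_def DD_def hu.H_def star_add star_mult mult.assoc intro!: hu.M_intros)
qed

definition tau :: "'a => nat => 'a fmat => 'a fmat" where
  "tau b n A = sh b n A * sh (b ^ q) n A"

text \<open>The pairs in which \<open>A\<close> has only the eigenvalues \<open>b\<close> and
  \<open>b ^ q\<close>. In \<open>CI\<close> neither of the two occurs.\<close>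

definition CN :: "'a => nat => ('a fmat \<times> 'a fmat) set" where
  "CN b n = {x \<in> CC n. \<exists>m. tau b n (fst x) ^ m = 0}"

definition CI :: "'a => nat => ('a fmat \<times> 'a fmat) set" where
  "CI b n = {x \<in> CC n. \<exists>y\<in>hu.M n n. y * tau b n (fst x) = eid n}"

definition DN :: "nat => ('a fmat \<times> 'a fmat) set" where
  "DN n = {x \<in> DD n. \<exists>m. sh 1 n (fst x) ^ m = 0}"

definition DI :: "nat => ('a fmat \<times> 'a fmat) set" where
  "DI n = {x \<in> DD n. \<exists>y\<in>hu.M n n. y * sh 1 n (fst x) = eid n}"

definition ser :: "(nat => ('a fmat \<times> 'a fmat) set) => real fps" where
  "ser S = Abs_fps (\<lambda>n. real (card (S n)) / real (card (hu.U n)))"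

lemma ser_CC: "ser CC = ser (CN b) * ser (CI b)"
  unfolding ser_def CN_def CI_def
proof (rule hu.fitting_count)
  show "CC n \<subseteq> hu.M n n \<times> hu.M n n" for n by (auto simp: CC_def hu.H_def)
  show "fst x * snd x = snd x * fst x" if "x \<in> CC n" for n x using that by (auto simp: CC_def)
  show "tau b n (fst x) \<in> hu.M n n" if "x \<in> CC n" for n x
    using that by (auto simp: CC_def hu.H_def tau_def intro!: hu.M_mult sh_M)
  show "\<exists>u\<in>hu.M n n. \<exists>v\<in>hu.M n n. star (tau b n (fst x)) = u * tau b n (fst x) \<and> u * tau b n (fst x) = tau b n (fst x) * u \<and> v * u = eid n"
    if x: "x \<in> CC n" for n x
  proof -
    have A: "fst x \<in> hu.M n n" "star (fst x) = fst x" using x by (auto simp: CC_def hu.H_def)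
    have "star (tau b n (fst x)) = tau b n (fst x)"
      using A by (simp add: tau_def star_mult sh_st)
    moreover have "tau b n (fst x) \<in> hu.M n n" using A by (auto simp: tau_def intro!: hu.M_mult sh_M)
    ultimately show ?thesis by (intro bexI[of _ "eid n"]) (auto simp: hu.M_l hu.M_r eid_mult intro: hu.e_in_M)
  qed
  show "tau b l B * S = S * tau b k A" if "A \<in> hu.M k k" "B \<in> hu.M l l" "S \<in> hu.M l k" "B * S = S * A" for k l A B S
    using sh_intertwine[OF that] by (simp add: tau_def mult.assoc) (metis mult.assoc)
qed (use CC_X1 CC_X2 in auto)

lemma ser_DD: "ser DD = ser DN * ser DI"
  unfolding ser_def DN_def DI_def
proof (rule hu.fitting_count)
  show "DD n \<subseteq> hu.M n n \<times> hu.M n n" for n by (auto simp: DD_def hu.H_def hu.U_def)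
  show "fst x * snd x = snd x * fst x" if "x \<in> DD n" for n x using that by (auto simp: DD_def)
  show "sh 1 n (fst x) \<in> hu.M n n" if "x \<in> DD n" for n x
    using that by (auto simp: DD_def hu.U_def intro!: sh_M)
  show "\<exists>u\<in>hu.M n n. \<exists>v\<in>hu.M n n. star (sh 1 n (fst x)) = u * sh 1 n (fst x) \<and> u * sh 1 n (fst x) = sh 1 n (fst x) * u \<and> v * u = eid n"
    if x: "x \<in> DD n" for n x
  proof -
    have A: "fst x \<in> hu.M n n" "star (fst x) * fst x = eid n" "fst x * star (fst x) = eid n" using x by (auto simp: DD_def hu.U_def)
    have M: "- star (fst x) \<in> hu.M n n" "- fst x \<in> hu.M n n"
      using hu.M_diff[OF hu.M_0 A(1)] hu.M_diff[OF hu.M_0 hu.M_st[OF A(1)]] by simp_all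
    \<comment> \<open>For unitary \<open>X\<close> one has
      \<open>star X - 1 = - star X * (X - 1)\<close>, so \<open>u = - star X\<close> with inverse
      \<open>- X\<close>.\<close>
    have "star (sh 1 n (fst x)) = - star (fst x) * sh 1 n (fst x)" "- star (fst x) * sh 1 n (fst x) = sh 1 n (fst x) * - star (fst x)"
      "- fst x * - star (fst x) = eid n"
      using A by (simp_all add: sh_def hu.st_diff algebra_simps hu.M_r[OF hu.M_st[OF A(1)]] hu.M_l[OF hu.M_st[OF A(1)]])
    with M show ?thesis by blast
  qed
  show "sh 1 l B * S = S * sh 1 k A" if "A \<in> hu.M k k" "B \<in> hu.M l l" "S \<in> hu.M l k" "B * S = S * A" for k l A B S
    using sh_intertwine[OF that] .
qed (use DD_X1 DD_X2 in auto)

subsection \<open>The Cayley transform\<close>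

lemma card_rel:
  assumes "\<And>a. a \<in> A ==> \<exists>!b. b \<in> B \<and> R a b" "\<And>b. b \<in> B ==> \<exists>!a. a \<in> A \<and> R a b"
  shows "card A = card B"
proof (rule bij_betw_same_card)
  show "bij_betw (\<lambda>a. THE b. b \<in> B \<and> R a b) A B"
  proof (rule bij_betw_byWitness[where f' = "\<lambda>b. THE a. a \<in> A \<and> R a b"])
    have 1: "(THE b. b \<in> B \<and> R a b) \<in> B \<and> R a (THE b. b \<in> B \<and> R a b)" if "a \<in> A" for a
      using theI'[OF assms(1)[OF that]] .
    have 2: "(THE a. a \<in> A \<and> R a b) \<in> A \<and> R (THE a. a \<in> A \<and> R a b) b" if "b \<in> B" for b
      using theI'[OF assms(2)[OF that]] .
    show "\<forall>a\<in>A. (THE a'. a' \<in> A \<and> R a' (THE b. b \<in> B \<and> R a b)) = a"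
      using 1 2 assms by metis
    show "\<forall>b\<in>B. (THE b'. b' \<in> B \<and> R (THE a. a \<in> A \<and> R a b) b') = b"
      using 1 2 assms by metis
    show "(\<lambda>a. THE b. b \<in> B \<and> R a b) ` A \<subseteq> B" "(\<lambda>b. THE a. a \<in> A \<and> R a b) ` B \<subseteq> A"
      using 1 2 by blast+
  qed
qed

definition CA :: "'a => nat => ('a fmat \<times> 'a fmat) set" where
  "CA b n = {x \<in> CC n. \<exists>G\<in>hu.M n n. G * sh (b ^ q) n (fst x) = eid n}"

definition DA :: "'a => nat => ('a fmat \<times> 'a fmat) set" where
  "DA c n = {x \<in> DD n. \<exists>G\<in>hu.M n n. G * sh c n (fst x) = eid n}"

text \<open>The graph of the Cayley transform \<open>X = c * (A - b) / (A - b ^ q)\<close>, cleared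
  of its denominator so that it can be read in both directions. \<open>CA\<close> and
  \<open>DA\<close> are the pairs for which the transform, respectively its inverse, is
  defined.\<close>

definition cay :: "'a => 'a => nat => 'a fmat \<times> 'a fmat => 'a fmat \<times> 'a fmat => bool" where
  "cay b c n x y \<longleftrightarrow> fst y * sh (b ^ q) n (fst x) = sm c (sh b n (fst x)) \<and> snd y = snd x"

lemma sh_sc: "sm a (sh b n A) - sm c (sh d n A) = sm (a - c) A - sm (a * b - c * d) (eid n)"
  by (simp add: sh_def algebra_simps sm_left_diff sm_simps)

text \<open>For Hermitian \<open>A\<close> the matrices \<open>A - b\<close> and
  \<open>A - b ^ q\<close> are adjoint to each other and commute, so \<open>X\<close> is unitary
  when \<open>c\<close> has norm 1. \<open>X - c\<close> is the nonzero scalar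
  \<open>c * (b ^ q - b)\<close> divided by \<open>A - b ^ q\<close>, hence invertible.\<close>

lemma cay_forward:
  assumes b: "b ^ q ~= b" and c: "c * c ^ q = 1" and x: "x \<in> CA b n"
  shows "\<exists>!y. y \<in> DA c n \<and> cay b c n x y"
proof -
  define A where "A = fst x" define B where "B = snd x"
  have A: "A \<in> hu.M n n" "star A = A" and B: "B \<in> hu.M n n" "star B = B" and AB: "A * B = B * A"
    using x by (auto simp: CA_def CC_def hu.H_def A_def B_def)
  obtain G where G: "G \<in> hu.M n n" "G * sh (b ^ q) n A = eid n" using x by (auto simp: CA_def A_def)
  note sM = sh_M[OF A(1)]
  have G': "sh (b ^ q) n A * G = eid n" using hu.inverse_commute[OF sM G] .
  have comG: "G * Y = Y * G" if "Y \<in> hu.M n n" "sh (b ^ q) n A * Y = Y * sh (b ^ q) n A" for Y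
  proof -
    have "G * Y = G * (Y * (sh (b ^ q) n A * G))" using that G' by (simp add: hu.M_r)
    also have "... = G * sh (b ^ q) n A * Y * G" by (simp add: mult.assoc[symmetric]) (simp add: mult.assoc that)
    also have "... = Y * G" using G that by (simp add: hu.M_l)
    finally show ?thesis .
  qed
  define X where "X = sm c (sh b n A * G)"
  have XM: "X \<in> hu.M n n" unfolding X_def using sM G by (intro M_sm hu.M_mult)
  have R: "X * sh (b ^ q) n A = sm c (sh b n A)"
    using G by (simp add: X_def mult.assoc hu.M_r[OF sM] sm_simps)
  have com: "G * sh b n A = sh b n A * G" by (rule comG[OF sM sh_commute[OF A(1)]])
  have stG: "star G * sh b n A = eid n"
    using arg_cong[OF G', of star] by (simp add: star_mult sh_st A(2))
  have stX: "star X = sm (c ^ q) (star G * sh (b ^ q) n A)"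
    by (simp add: X_def star_mult star_sm sh_st A(2) sm_simps)
  have "star X * X = sm (c ^ q * c) (star G * (sh (b ^ q) n A * sh b n A) * G)"
    unfolding stX unfolding X_def by (simp add: mult.assoc sm_simps sm_simps mult.commute)
  also have "... = star G * sh b n A * (sh (b ^ q) n A * G)"
    using c by (simp add: mult.commute sh_commute[OF A(1), of "b ^ q"] mult.assoc)
  also have "... = eid n" by (simp add: stG G' eid_mult)
  finally have XU: "X \<in> hu.U n" using XM by (intro hu.in_U_I)
  have sB: "sh d n A * B = B * sh d n A" for d using sh_intertwine[OF A(1) A(1) B(1) AB] .
  have XB: "X * B = B * X"
    using comG[OF B(1) sB] by (simp add: X_def mult.assoc sm_simps) (simp add: mult.assoc[symmetric] sB)
  define d where "d = c * (b ^ q - b)"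
  have d: "d ~= 0" using b c by (auto simp: d_def)
  have "sh c n X * sh (b ^ q) n A = sm d (eid n)"
  proof -
    have "sh c n X * sh (b ^ q) n A = sm c (sh b n A) - sm c (sh (b ^ q) n A)"
      by (simp add: sh_def[of c] left_diff_distrib R mult.assoc hu.M_l[OF sM] sm_simps)
    also have "... = sm d (eid n)" unfolding sh_sc by (simp add: d_def algebra_simps sm_left_diff sm_simps)
    finally show ?thesis .
  qed
  then have 1: "sh c n X * sm (inverse d) (sh (b ^ q) n A) = eid n"
    using d by (simp add: sm_simps)
  have "sm (inverse d) (sh (b ^ q) n A) * sh c n X = eid n"
    by (rule hu.inverse_commute[OF M_sm[OF sM] sh_M[OF XM] 1])
  then have "(X, B) \<in> DA c n"
    using XU XB B M_sm[OF sM] by (auto simp: DA_def DD_def hu.H_def intro!: bexI[of _ "sm (inverse d) (sh (b ^ q) n A)"])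
  moreover have "cay b c n x (X, B)" by (simp add: cay_def A_def[symmetric] B_def R)
  moreover have "y = (X, B)" if "y \<in> DA c n \<and> cay b c n x y" for y
  proof -
    have yM: "fst y \<in> hu.M n n" using that by (auto simp: DA_def DD_def hu.U_def)
    have "fst y * sh (b ^ q) n A = X * sh (b ^ q) n A" using that R by (simp add: cay_def A_def)
    then have "fst y * (sh (b ^ q) n A * G) = X * (sh (b ^ q) n A * G)" by (simp add: mult.assoc[symmetric])
    then have "fst y = X" using yM XM by (simp add: G' hu.M_r)
    then show ?thesis using that by (simp add: cay_def B_def prod_eq_iff)
  qed
  ultimately show ?thesis by blast
qed

lemma cay_backward:
  assumes b: "b ^ q ~= b" and c: "c * c ^ q = 1" and y: "y \<in> DA c n"
  shows "\<exists>!x. x \<in> CA b n \<and> cay b c n x y"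
proof -
  define X where "X = fst y" define B where "B = snd y"
  have X: "X \<in> hu.M n n" "star X * X = eid n" "X * star X = eid n" and B: "B \<in> hu.M n n" "star B = B" and XB: "X * B = B * X"
    using y by (auto simp: DA_def DD_def hu.H_def hu.U_def X_def B_def)
  obtain W where W: "W \<in> hu.M n n" "W * sh c n X = eid n" using y by (auto simp: DA_def X_def)
  note sM = sh_M[OF X(1)]
  have W': "sh c n X * W = eid n" using hu.inverse_commute[OF sM W] .
  have comW: "W * Y = Y * W" if "Y \<in> hu.M n n" "X * Y = Y * X" for Y
  proof -
    have sY: "sh c n X * Y = Y * sh c n X" using sh_intertwine[OF X(1) X(1) that] .
    have "W * Y = W * (Y * (sh c n X * W))" using that W' by (simp add: hu.M_r)
    also have "... = W * sh c n X * Y * W" by (simp add: mult.assoc[symmetric]) (simp add: mult.assoc sY)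
    also have "... = Y * W" using W that by (simp add: hu.M_l)
    finally show ?thesis .
  qed
  define b' where "b' = b ^ q"
  have b'q: "b' ^ q = b" by (simp add: b'_def)
  have c0: "c ~= 0" using c by auto
  \<comment> \<open>Solving \<open>X * (A - b ^ q) = c * (A - b)\<close> for \<open>A\<close> gives
    \<open>(X - c) * A = V\<close>.\<close>
  define V where "V = sm b' X - sm (c * b) (eid n)"
  have VM: "V \<in> hu.M n n" unfolding V_def using X by (intro hu.M_diff M_sm hu.e_in_M) auto
  have XV: "X * V = V * X" using X by (simp add: V_def algebra_simps sm_simps hu.M_l hu.M_r)
  define A where "A = W * V"
  have AM: "A \<in> hu.M n n" using W VM by (simp add: A_def hu.M_mult)
  have AVW: "A = V * W" unfolding A_def by (rule comW[OF VM XV])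
  have sV: "sh c n X * A = V" unfolding A_def using W' VM by (simp add: assoc_l[OF W'] hu.M_l)
  have ee: "eid n * eid n = (eid n :: 'a fmat)" by (simp add: eid_mult)
  have stA: "star A = A"
  proof -
    have "sh c n X * star X = - sm c (star (sh c n X))"
      using X c by (simp add: sh_def hu.st_diff star_mult star_sm sm_simps algebra_simps sm_simps sm_simps
          hu.M_r[OF hu.M_st[OF X(1)]] hu.M_l[OF hu.M_st[OF X(1)]] )
    moreover have "star (sh c n X) * star W = eid n" using arg_cong[OF W(2), of star] W' by (metis star_eid star_mult W'(1))
    ultimately have sW: "sh c n X * star X * star W = - sm c (eid n)" by (simp only: sm_mult_left mult_minus_left)
    have stV: "star V = sm b (star X) - sm (c ^ q * b') (eid n)"
      by (simp add: V_def hu.st_diff star_mult star_sm sm_simps b'q power_mult_distrib) (simp add: b'_def)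
    \<comment> \<open>The reason why \<open>A\<close> is Hermitian: the unitary \<open>X\<close>
      carries \<open>star V\<close> to a scalar multiple of \<open>V\<close>.\<close>
    have XstV: "X * star V = - sm (c ^ q) V"
    proof -
      have "c ^ q * (c * b) = (c * c ^ q) * b" by (simp add: mult_ac)
      then have cb: "c ^ q * (c * b) = b" unfolding c by simp
      have "X * star V = sm b (eid n) - sm (c ^ q * b') X"
        unfolding stV by (simp add: right_diff_distrib sm_simps X(3) hu.M_r[OF X(1)])
      moreover have "sm (c ^ q) V = sm (c ^ q * b') X - sm b (eid n)"
        by (simp only: V_def sm_diff sm_sm cb)
      ultimately show ?thesis by simp
    qed
    have "star V = star X * (X * star V)" using X(2) VM by (simp add: assoc_l hu.M_l[OF hu.M_st])
    then have stV': "star V = - sm (c ^ q) (star X * V)" by (simp add: XstV sm_simps)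
    have stXV: "star X * V = V * star X"
    proof -
      have "star X * V = star X * (V * (X * star X))" using X(3) VM by (simp add: hu.M_r)
      also have "... = star X * X * V * star X" by (simp add: mult.assoc[symmetric]) (simp add: mult.assoc XV)
      also have "... = V * star X" using X(2) VM by (simp add: hu.M_l)
      finally show ?thesis .
    qed
    have "star A = star V * star W" by (simp add: A_def) (metis AVW A_def star_mult comW VM XV)
    also have "... = - sm (c ^ q) (V * (star X * star W))" by (simp add: stV' stXV mult.assoc sm_simps)
    finally have stA: "star A = - sm (c ^ q) (V * (star X * star W))" .
    have sVc: "sh c n X * V = V * sh c n X" using sh_intertwine[OF X(1) X(1) VM XV] .
    have "sh c n X * star A = - sm (c ^ q) (sh c n X * V * (star X * star W))"
      unfolding stA by (simp add: sm_simps mult.assoc)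
    also have "... = - sm (c ^ q) (V * (sh c n X * star X * star W))"
      unfolding sVc by (simp add: mult.assoc)
    also have "... = V" unfolding sW using c VM by (simp add: sm_simps sm_simps hu.M_r mult.commute)
    finally have "sh c n X * star A = sh c n X * A" by (simp add: sV)
    then have "W * sh c n X * star A = W * sh c n X * A" by (simp add: mult.assoc)
    then show ?thesis using W AM by (simp add: hu.M_l hu.M_l[OF hu.M_st])
  qed
  have AB: "A * B = B * A"
  proof -
    have "V * B = B * V" using B XB by (simp add: V_def algebra_simps sm_simps hu.M_l hu.M_r)
    moreover have "W * B = B * W" by (rule comW[OF B(1) XB])
    ultimately show ?thesis by (simp add: A_def mult.assoc) (metis mult.assoc)
  qed
  have key: "sh c n X * sh b' n A = sm (c * (b' - b)) (eid n)"
  proof -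
    have "sh c n X * sh b' n A = V - sm b' (sh c n X)"
      by (simp add: sh_def[of b'] right_diff_distrib sV sm_simps hu.M_r[OF sM])
    also have "... = sm (c * (b' - b)) (eid n)" by (simp add: V_def sh_def algebra_simps sm_left_diff sm_simps)
    finally show ?thesis .
  qed
  define d where "d = c * (b' - b)"
  have d: "d ~= 0" using b c0 by (simp add: d_def b'_def)
  have "sm (inverse d) (sh c n X) * sh b' n A = eid n"
    using key d by (simp add: mult.assoc d_def[symmetric] sm_simps)
  then have CA: "(A, B) \<in> CA b n"
    using AM stA B AB M_sm[OF sM] by (auto simp: CA_def CC_def hu.H_def b'_def[symmetric])
  have R: "X * sh b' n A = sm c (sh b n A)"
  proof -
    have "X * sh b' n A = sh c n X * sh b' n A + sm c (sh b' n A)"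
      by (simp add: sh_def[of c] left_diff_distrib sm_simps hu.M_l[OF sh_M[OF AM]])
    also have "... = sm c (sh b n A)" unfolding key by (simp add: sh_def algebra_simps sm_left_diff sm_simps)
    finally show ?thesis .
  qed
  have "cay b c n (A, B) y" using R by (simp add: cay_def X_def B_def b'_def)
  moreover have "x = (A, B)" if "x \<in> CA b n \<and> cay b c n x y" for x
  proof -
    have xM: "fst x \<in> hu.M n n" using that by (auto simp: CA_def CC_def hu.H_def)
    have "X * sh b' n (fst x) = sm c (sh b n (fst x))" using that by (simp add: cay_def X_def b'_def)
    then have "sh c n X * fst x = V"
      using xM X by (simp add: sh_def V_def algebra_simps sm_simps hu.M_l hu.M_r sm_simps)
    then have "W * sh c n X * fst x = W * sh c n X * A" using sV by (simp add: mult.assoc)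
    then have "fst x = A" using W xM AM by (simp add: hu.M_l)
    then show ?thesis using that by (simp add: cay_def B_def prod_eq_iff)
  qed
  ultimately show ?thesis using CA by blast
qed

end

section \<open>Invertible and unipotent parts under the Cayley transform\<close>

context quad_field begin

lemma left_inverse_if_inj:
  assumes t: "t \<in> hu.M n n" and inj: "\<And>S. S \<in> hu.M n n ==> t * S = 0 ==> S = 0"
  obtains y where "y \<in> hu.M n n" "y * t = eid n"
proof -
  have "inj_on (\<lambda>S. t * S) (hu.M n n)"
  proof (rule inj_onI)
    fix S S' assume S: "S \<in> hu.M n n" "S' \<in> hu.M n n" "t * S = t * S'"
    have "S - S' = 0" by (rule inj[OF hu.M_diff[OF S(1,2)]]) (simp add: right_diff_distrib S(3))
    then show "S = S'" by simp
  qed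
  then have "(\<lambda>S. t * S) ` hu.M n n = hu.M n n"
    by (rule endo_inj_surj[rotated 2]) (use t in \<open>auto intro: hu.M_mult\<close>)
  then obtain y where "y \<in> hu.M n n" "t * y = eid n" using hu.e_in_M[of n n n] by (metis imageE order_refl)
  then show ?thesis using that hu.inverse_commute[of y n t] t by blast
qed

text \<open>A nilpotent matrix has no eigenvalue \<open>d ~= 0\<close>: from
  \<open>A * S = d * S\<close> follows \<open>d ^ m * S = 0\<close>.\<close>

lemma sh_nilp_inverse:
  assumes A: "A \<in> hu.M n n" "A ^ m = 0" and d: "d ~= 0"
  obtains y where "y \<in> hu.M n n" "y * sh d n A = eid n"
proof (rule left_inverse_if_inj[OF sh_M[OF A(1), of d]])
  fix S assume S: "S \<in> hu.M n n" "sh d n A * S = 0"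
  then have AS: "A * S = sm d S" by (simp add: sh_def left_diff_distrib sm_simps hu.M_l)
  have "A ^ j * S = sm (d ^ j) S" for j
    by (induction j) (simp_all add: mult.assoc sm_simps AS mult.commute[of d])
  from this[of m] have "sm (d ^ m) S = 0" using A(2) by simp
  then show "S = 0" using d by (simp add: sm_eq_0_iff)
qed (use that in blast)

text \<open>\<open>A - b\<close> and \<open>A - b ^ q\<close> are adjoint, so one is invertible
  exactly when the other is, and then so is their product \<open>tau\<close>.\<close>

lemma CI_eq_CA: "CI b n = CA b n"
proof -
  have *: "(\<exists>y\<in>hu.M n n. y * tau b n A = eid n) \<longleftrightarrow> (\<exists>G\<in>hu.M n n. G * sh (b ^ q) n A = eid n)"
    if A: "A \<in> hu.M n n" "star A = A" for A
  proof
    assume "\<exists>y\<in>hu.M n n. y * tau b n A = eid n"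
    then obtain y where "y \<in> hu.M n n" "y * tau b n A = eid n" by blast
    then show "\<exists>G\<in>hu.M n n. G * sh (b ^ q) n A = eid n"
      by (intro bexI[of _ "y * sh b n A"]) (auto simp: tau_def mult.assoc intro: hu.M_mult sh_M A)
  next
    assume "\<exists>G\<in>hu.M n n. G * sh (b ^ q) n A = eid n"
    then obtain G where G: "G \<in> hu.M n n" "G * sh (b ^ q) n A = eid n" by blast
    have "sh b n A * star G = eid n" using arg_cong[OF G(2), of star] A by (simp add: star_mult sh_st)
    then have sG: "star G * sh b n A = eid n" using hu.inverse_commute[OF hu.M_st[OF G(1)] sh_M[OF A(1)]] by simp
    show "\<exists>y\<in>hu.M n n. y * tau b n A = eid n"
      by (intro bexI[of _ "G * star G"])
        (use G in \<open>auto simp: tau_def mult.assoc assoc_l[OF sG] hu.M_l[OF sh_M[OF A(1)]] intro: hu.M_intros\<close>)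
  qed
  show ?thesis
    unfolding CI_def CA_def
  proof (rule Collect_cong, rule conj_cong[OF refl])
    fix x assume "x \<in> CC n"
    then have "fst x \<in> hu.M n n" "star (fst x) = fst x" by (auto simp: CC_def hu.H_def)
    then show "(\<exists>y\<in>hu.M n n. y * tau b n (fst x) = eid n) \<longleftrightarrow> (\<exists>G\<in>hu.M n n. G * sh (b ^ q) n (fst x) = eid n)"
      by (rule *)
  qed
qed

lemma ser_CI_DI:
  assumes b: "b ^ q ~= b"
  shows "ser (CI b) = ser DI"
proof -
  have "card (CI b n) = card (DI n)" for n
  proof -
    have "DI n = DA 1 n" by (simp add: DI_def DA_def)
    moreover have "card (CA b n) = card (DA 1 n)"
      using card_rel[of "CA b n" "DA 1 n" "cay b 1 n"] cay_forward[OF b, of 1] cay_backward[OF b, of 1] by simp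
    ultimately show ?thesis by (simp add: CI_eq_CA)
  qed
  then show ?thesis by (simp add: ser_def)
qed

text \<open>\<open>c = b ^ q / b\<close> is the constant for which the transform sends 0 to 1. Then
  \<open>(X - 1) * (A - b ^ q) = (c - 1) * A\<close> with commuting factors on the left, so
  \<open>X - 1\<close> and \<open>A\<close> are nilpotent together.\<close>

lemma nilp_unipotent:
  assumes b: "b ^ q ~= b" and c: "c = b ^ q / b" and x: "x \<in> CA b n" and y: "y \<in> DA c n" and R: "cay b c n x y"
  shows "(\<exists>m. fst x ^ m = 0) \<longleftrightarrow> (\<exists>m. sh 1 n (fst y) ^ m = 0)"
proof -
  have b0: "b ~= 0" using b by auto
  define A where "A = fst x" define X where "X = fst y" define b' where "b' = b ^ q"
  have A: "A \<in> hu.M n n" using x by (auto simp: A_def CA_def CC_def hu.H_def)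
  have X: "X \<in> hu.M n n" using y by (auto simp: X_def DA_def DD_def hu.U_def)
  obtain G where G: "G \<in> hu.M n n" "G * sh b' n A = eid n" using x by (auto simp: CA_def A_def b'_def)
  have G': "sh b' n A * G = eid n" using hu.inverse_commute[OF sh_M[OF A] G] .
  have R': "X * sh b' n A = sm c (sh b n A)" using R by (simp add: cay_def X_def A_def b'_def)
  define N where "N = sh 1 n X"
  have NM: "N \<in> hu.M n n" using X by (simp add: N_def sh_M)
  have cancel: "Y = 0" if "Y * sh b' n A = 0" "Y \<in> hu.M n n" for Y
  proof -
    have "Y * (sh b' n A * G) = 0" using that by (simp add: mult.assoc[symmetric])
    then show ?thesis using that by (simp add: G' hu.M_r)
  qed
  have key: "N * sh b' n A = sm (c - 1) A"
  proof -
    have "N * sh b' n A = sm c (sh b n A) - sh b' n A"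
      using sh_M[OF A, of b'] by (simp add: N_def sh_def[of 1] left_diff_distrib R' hu.M_l)
    moreover have "c * b = b'" using b0 by (simp add: c b'_def)
    ultimately show ?thesis by (simp add: sh_def sm_simps sm_left_diff algebra_simps)
  qed
  have sA: "sh d n A * A = A * sh d n A" for d using sh_intertwine[OF A A A refl] .
  have "X * A * sh b' n A = X * sh b' n A * A" by (simp only: mult.assoc sA)
  also have "... = sm c (A * sh b n A)" by (simp only: R' sm_mult_left sA)
  finally have "(X * A - A * X) * sh b' n A = 0"
    by (simp only: left_diff_distrib mult.assoc R' sm_mult_right diff_self)
  then have XA: "X * A = A * X" using cancel hu.M_diff[OF hu.M_mult[OF X A] hu.M_mult[OF A X]] by fastforce
  have NA: "N * sh b' n A = sh b' n A * N"
  proof -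
    have "X * sh b' n A = sh b' n A * X" using sh_intertwine[OF A A X XA[symmetric]] by simp
    then show ?thesis using sh_intertwine[OF X X sh_M[OF A], of b' 1] by (simp add: N_def)
  qed
  have pow: "N ^ m * sh b' n A ^ m = sm ((c - 1) ^ m) (A ^ m)" for m
  proof -
    have "(N * sh b' n A) ^ m = N ^ m * sh b' n A ^ m"
    proof (induction m)
      case (Suc m)
      have "sh b' n A * N ^ m = N ^ m * sh b' n A" using hu.commute_power[OF NA, of m] by simp
      then show ?case using Suc by (simp add: mult.assoc) (metis mult.assoc)
    qed simp
    then show ?thesis by (simp add: key sm_power)
  qed
  have c1: "c - 1 ~= 0" using b b0 by (simp add: c)
  show ?thesis
    unfolding A_def[symmetric] X_def[symmetric] N_def[symmetric]
  proof
    assume "\<exists>m. A ^ m = 0"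
    then obtain m where "A ^ m = 0" by blast
    then have m: "N ^ m * sh b' n A ^ m = 0" using pow[of m] by simp
    have *: "Z * sh b' n A ^ j = 0 ==> Z = 0" if "Z \<in> hu.M n n" for Z j
    proof (induction j)
      case (Suc j)
      show ?case
      proof (rule Suc.IH)
        have "Z * sh b' n A ^ j * sh b' n A = 0" using Suc.prems by (simp only: power_Suc2 mult.assoc)
        moreover have "Z * sh b' n A ^ j \<in> hu.M n n" using that hu.M_power[OF sh_M[OF A], of j] by (cases "j = 0") (auto intro: hu.M_mult)
        ultimately show "Z * sh b' n A ^ j = 0" by (rule cancel)
      qed
    qed simp
    have "N ^ Suc m * sh b' n A ^ m = 0" using m by (simp add: mult.assoc)
    then have "N ^ Suc m = 0" using *[OF hu.M_power[OF NM]] by blast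
    then show "\<exists>m. N ^ m = 0" by blast
  next
    assume "\<exists>m. N ^ m = 0"
    then obtain m where "N ^ m = 0" by blast
    then have "sm ((c - 1) ^ m) (A ^ m) = 0" using pow[of m] by simp
    then show "\<exists>m. A ^ m = 0" using c1 by (auto simp: sm_eq_0_iff)
  qed
qed

text \<open>A nilpotent \<open>A\<close> does not have the eigenvalue \<open>b ^ q ~= 0\<close>, and
  a unipotent \<open>X\<close> does not have the eigenvalue \<open>c ~= 1\<close>. So the transform
  matches nilpotent Hermitian pairs with unipotent unitary ones, and \<open>nilp_series\<close>
  counts the former.\<close>

lemma ser_DN: "ser DN = iprod (euler_fps (- 1 / real q))"
proof -
  obtain b :: 'a where b: "b ^ q ~= b" by (rule nonreal_ex)
  then have b0: "b ~= 0" by auto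
  define c where "c = b ^ q / b"
  have c: "c * c ^ q = 1" using b0 by (simp add: c_def power_divide)
  have c1: "c ~= 1" using b b0 by (simp add: c_def)
  have "card (hu.NP n) = card (DN n)" for n
  proof (rule card_rel[where R = "cay b c n"])
    have NPA: "x \<in> CA b n \<and> (\<exists>m. fst x ^ m = 0)" if "x \<in> hu.NP n" for x
    proof -
      have "x \<in> CC n" "\<exists>m. fst x ^ m = 0" using that by (cases x, auto simp: hu.NP_def CC_def)+
      then obtain m where m: "fst x ^ m = 0" and x: "x \<in> CC n" by blast
      then have "fst x \<in> hu.M n n" by (auto simp: CC_def hu.H_def)
      moreover have "b ^ q ~= 0" using b0 by simp
      ultimately obtain y where "y \<in> hu.M n n" "y * sh (b ^ q) n (fst x) = eid n" using sh_nilp_inverse m by metis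
      then show ?thesis using x m by (auto simp: CA_def)
    qed
    have DNA: "y \<in> DA c n \<and> (\<exists>m. sh 1 n (fst y) ^ m = 0)" if "y \<in> DN n" for y
    proof -
      have "y \<in> DD n" "\<exists>m. sh 1 n (fst y) ^ m = 0" using that unfolding DN_def by blast+
      then obtain m where m: "sh 1 n (fst y) ^ m = 0" and y: "y \<in> DD n" by blast
      then have yM: "fst y \<in> hu.M n n" by (auto simp: DD_def hu.U_def)
      obtain G where "G \<in> hu.M n n" "G * sh (c - 1) n (sh 1 n (fst y)) = eid n"
        using sh_nilp_inverse[OF sh_M[OF yM] m, of "c - 1"] c1 by auto
      moreover have "sh (c - 1) n (sh 1 n (fst y)) = sh c n (fst y)" by (simp add: sh_def sm_left_diff)
      ultimately show ?thesis using y m by (auto simp: DA_def)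
    qed
    show "\<exists>!y. y \<in> DN n \<and> cay b c n x y" if "x \<in> hu.NP n" for x
    proof -
      note x = NPA[OF that]
      obtain y where y: "y \<in> DA c n" "cay b c n x y" using cay_forward[OF b c] x by blast
      then have "y \<in> DN n" using nilp_unipotent[OF b c_def _ y] x by (auto simp: DN_def DA_def)
      with y show ?thesis using cay_forward[OF b c] x DNA by metis
    qed
    show "\<exists>!x. x \<in> hu.NP n \<and> cay b c n x y" if "y \<in> DN n" for y
    proof -
      note y = DNA[OF that]
      obtain x where x: "x \<in> CA b n" "cay b c n x y" using cay_backward[OF b c] y by blast
      then have "\<exists>m. fst x ^ m = 0" using nilp_unipotent[OF b c_def x(1) _ x(2)] y by auto
      then have "x \<in> hu.NP n" using x(1) by (auto simp: hu.NP_def CA_def CC_def)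
      with x show ?thesis using cay_backward[OF b c] y NPA by metis
    qed
  qed
  then show ?thesis using hu.nilp_series by (simp add: ser_def)
qed

subsection \<open>The part at a pair of conjugate eigenvalues\<close>

definition GP :: "nat => ('a fmat \<times> 'a fmat) set" where
  "GP m = {(Q, R). Q \<in> hu.M m m \<and> R \<in> hu.M m m \<and> Q * R = eid m \<and> R * Q = eid m}"

lemma card_GP: "card (GP m) = card (GLm m :: 'a fmat set)"
proof (rule bij_betw_same_card[of fst])
  have "inj_on fst (GP m)"
  proof (rule inj_onI)
    fix x y assume "x \<in> GP m" "y \<in> GP m" "fst x = fst y"
    then have "snd x = snd x * (fst y * snd y)" "snd x * fst y = eid m" "eid m * snd y = snd y"
      by (auto simp: GP_def hu.M_r hu.M_l)
    then have "snd x = snd y" by (metis mult.assoc)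
    with \<open>fst x = fst y\<close> show "x = y" by (simp add: prod_eq_iff)
  qed
  moreover have "fst ` GP m = GLm m"
    by (force simp: GP_def GLm_def hu_M)
  ultimately show "bij_betw fst (GP m) (GLm m :: 'a fmat set)" by (simp add: bij_betw_def)
qed

text \<open>In the hyperbolic frame \<open>(u, v)\<close> this acts on \<open>u\<close> as
  \<open>A + b\<close> and on \<open>v\<close> as the adjoint of \<open>A + b\<close>, which makes
  it Hermitian. Note that \<open>sh (- b)\<close> adds \<open>b\<close>.\<close>

definition hyp :: "'a => nat => 'a fmat => 'a fmat => 'a fmat => 'a fmat" where
  "hyp b m u v A = u * sh (- b) m A * star v + v * star (sh (- b) m A) * star u"

lemma hyp_mult:
  assumes uv: "(u, v) \<in> hu.HF n m" and A: "A \<in> hu.M m m" and B: "B \<in> hu.M m m" and AB: "A * B = B * A"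
  shows "hyp b m u v A * hyp d m u v B = hyp d m u v B * hyp b m u v A"
proof -
  note h = hu.HF_D[OF uv]
  have *: "hyp b m u v A * hyp d m u v B = u * (sh (- b) m A * sh (- d) m B) * star v + v * (star (sh (- d) m B * sh (- b) m A)) * star u"
    if "A \<in> hu.M m m" "B \<in> hu.M m m" for A B b d
    using hu.M_l'[OF sh_M[OF that(2)]] hu.M_l'[OF hu.M_st[OF sh_M[OF that(2)]]]
    by (simp add: hyp_def algebra_simps h(3-) h(3-)[THEN assoc_l] star_mult)
  have "B * sh (- b) m A = sh (- b) m A * B" using sh_intertwine[OF A A B AB] by simp
  then have "sh (- d) m B * sh (- b) m A = sh (- b) m A * sh (- d) m B"
    using sh_intertwine[OF B B sh_M[OF A]] by simp
  then show ?thesis unfolding *[OF A B] *[OF B A] by simp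
qed

lemma hyp_intertwine:
  assumes uv: "(u, v) \<in> hu.HF n m" and A: "A \<in> hu.M m m"
  shows "hyp b m u v A * u = u * sh (- b) m A" "hyp b m u v A * v = v * star (sh (- b) m A)"
    "star v * hyp b m u v A = sh (- b) m A * star v" "star u * hyp b m u v A = star (sh (- b) m A) * star u"
proof -
  note h = hu.HF_D[OF uv]
  note M = sh_M[OF A, of "- b"]
  show "hyp b m u v A * u = u * sh (- b) m A" "hyp b m u v A * v = v * star (sh (- b) m A)"
    "star v * hyp b m u v A = sh (- b) m A * star v" "star u * hyp b m u v A = star (sh (- b) m A) * star u"
    by (simp_all add: hyp_def distrib_left distrib_right mult.assoc h(3-) h(3-)[THEN assoc_l] hu.M_r[OF M] hu.M_r[OF hu.M_st[OF M]]
        hu.M_l'[OF M] hu.M_l'[OF hu.M_st[OF M]])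
qed

lemma HF_full:
  assumes "(u, v) \<in> hu.HF (2 * m) m"
  shows "u * star v + v * star u = eid (2 * m)"
proof -
  obtain K where K: "K \<in> hu.F (2 * m) (2 * m - 2 * m)" "u * star v + v * star u + K * star K = eid (2 * m)"
    using hu.HF_compl[OF assms] by metis
  then have "K = 0" by (auto simp: hu.F_def hu.M_def)
  with K show ?thesis by simp
qed

lemma sh_sh: "sh a n (sh b n A) = sh (a + b) n A"
  by (simp add: sh_def sm_left_add)

lemma sh_0 [simp]: "sh 0 n A = A"
  by (simp add: sh_def)

text \<open>\<open>S\<close> intertwines a nilpotent matrix with \<open>B - d\<close>, which is
  invertible, so \<open>S\<close> is killed by a power of an invertible matrix.\<close>

lemma sm_inverse_nilp:
  assumes "A \<in> hu.M m m" "A ^ k = 0" "B \<in> hu.M m m" "B ^ l = 0" "S \<in> hu.M m m" "d ~= 0" "A * S = S * sh d m B"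
  shows "S = 0"
proof -
  obtain y where y: "y \<in> hu.M m m" "y * sh d m B = eid m" using sh_nilp_inverse[OF assms(3,4,6)] .
  have y': "sh d m B * y = eid m" using hu.inverse_commute[OF sh_M[OF assms(3)] y] .
  have "S * sh d m B ^ k = 0" using hu.intertwine_power[OF assms(7), of k] assms(2) by simp
  moreover have "S * sh d m B ^ j = 0 ==> S = 0" for j
  proof (induction j)
    case (Suc j)
    have "S * sh d m B ^ Suc j * y = S * sh d m B ^ j * eid m" by (simp only: power_Suc2 mult.assoc y')
    also have "... = S * sh d m B ^ j"
      using assms(5) hu.M_r[OF hu.M_power[OF sh_M[OF assms(3)]], of j d] by (cases "j = 0") (simp_all add: hu.M_r mult.assoc)
    finally show ?case using Suc by simp
  qed simp
  ultimately show ?thesis by blast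
qed

lemma idem_fact:
  assumes f: "f \<in> hu.M n n" "f * f = f"
  obtains m J P where "J \<in> hu.M n m" "P \<in> hu.M m n" "f = J * P" "P * J = eid m"
proof -
  have "f \<in> MM n n" using f by (simp add: hu_M)
  then obtain m J P L R where JP: "J \<in> MM n m" "P \<in> MM m n" "f = J * P"
    and L: "L \<in> MM m n" "L * J = eid m" and R: "R \<in> MM n m" "P * R = eid m" by (rule rank_fact)
  have "L * (J * P * (J * P)) * R = L * (J * P) * R" using f(2) unfolding JP(3) by simp
  then have "P * J = eid m"
    using MM_l[OF JP(2)] MM_r[OF JP(1)] by (simp add: mult.assoc assoc_l[OF L(2)] R(2) eid_mult L(2)) (metis MM_l[OF JP(2)] mult.assoc)
  with that JP show ?thesis by (simp add: hu_M)
qed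

text \<open>For \<open>f = J * P\<close> with \<open>P * J = eid m\<close>, the relations
  \<open>f * star f = 0\<close> and \<open>star f * f = 0\<close> say that \<open>star P\<close> and
  \<open>J\<close> are isotropic, and \<open>P * J = eid m\<close> says that they are dual. As
  \<open>f + star f = eid n\<close> leaves no complement, \<open>n = 2 * m\<close>.\<close>

lemma HF_if_idem:
  assumes f: "f \<in> hu.M n n" "f * f = f" "f + star f = eid n" "f * star f = 0" "star f * f = 0"
  obtains m u v where "n = 2 * m" "(u, v) \<in> hu.HF n m" "f = v * star u" "star f = u * star v"
proof -
  obtain m J P where JP: "J \<in> hu.M n m" "P \<in> hu.M m n" "f = J * P" "P * J = eid m"
    by (rule idem_fact[OF f(1,2)])
  have s: "star f = star P * star J" by (simp add: JP(3) star_mult)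
  have sPJ: "star J * star P = eid m" using arg_cong[OF JP(4), of star] by (simp add: star_mult)
  have "P * (f * star f) * star P = P * J * (P * star P) * (star J * star P)" unfolding s unfolding JP(3) by (simp add: mult.assoc)
  then have 1: "P * star P = 0" using f(4) JP hu.M_mult[OF JP(2) hu.M_st[OF JP(2)]] by (simp add: sPJ hu.M_l hu.M_r)
  have "star J * (star f * f) * J = star J * star P * (star J * J) * (P * J)" unfolding s unfolding JP(3) by (simp add: mult.assoc)
  then have 2: "star J * J = 0" using f(5) JP hu.M_mult[OF hu.M_st[OF JP(1)] JP(1)] by (simp add: sPJ hu.M_l hu.M_r)
  have uv: "(star P, J) \<in> hu.HF n m"
    using JP 1 2 sPJ by (auto simp: hu.HF_def intro: hu.M_st)
  obtain K where K: "2 * m \<le> n" "K \<in> hu.F n (n - 2 * m)" "star P * star J + J * star (star P) + K * star K = eid n"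
    using hu.HF_compl[OF uv] by metis
  have "K * star K = 0" using K(3) f(3) by (simp add: s[symmetric] JP(3)[symmetric] add.commute)
  then have "star K * (K * star K) * K = 0" by simp
  then have K0: "star K * K * (star K * K) = 0" by (simp add: mult.assoc)
  have "star K * K = eid (n - 2 * m)" using K(2) by (auto simp: hu.F_def)
  with K0 have "eid (n - 2 * m) = (0 :: 'a fmat)" by (simp add: eid_mult)
  then have "n = 2 * m" using K(1) hu.e_eq_0_iff by simp
  with that[OF this uv] s JP(3) show ?thesis by simp
qed

text \<open>For \<open>t = A - b\<close> the idempotent power \<open>f\<close> of \<open>t\<close>
  projects onto the part where \<open>t\<close> is invertible, the generalised eigenspace of
  \<open>b ^ q\<close>. Nilpotency of \<open>t * star t\<close> makes \<open>f\<close> and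
  \<open>star f\<close> complementary, and \<open>HF_if_idem\<close> applies. So \<open>u\<close>
  spans the part of \<open>b\<close> and \<open>v\<close> that of \<open>b ^ q\<close>.\<close>

lemma CN_split:
  assumes b: "b ^ q ~= b" and x: "x \<in> CN b n"
  obtains m u v A B where "n = 2 * m" "(u, v) \<in> hu.HF n m" "(A, B) \<in> GNP m" "x = (hyp b m u v A, hyp 0 m u v B)"
proof -
  define A0 where "A0 = fst x" define B0 where "B0 = snd x" define b' where "b' = b ^ q"
  have A0: "A0 \<in> hu.M n n" "star A0 = A0" and B0: "B0 \<in> hu.M n n" "star B0 = B0" and AB: "A0 * B0 = B0 * A0"
    using x by (auto simp: CN_def CC_def hu.H_def A0_def B0_def)
  define t where "t = sh b n A0"
  have tM: "t \<in> hu.M n n" using A0 by (simp add: t_def sh_M)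
  have st: "star t = sh b' n A0" unfolding t_def sh_st A0(2) b'_def ..
  have st': "star t = sh (b' - b) n t" unfolding st unfolding t_def by (simp add: sh_sh)
  have ct: "t * star t = star t * t" unfolding t_def sh_st A0(2) by (rule sh_commute[OF A0(1)])
  obtain k where "tau b n A0 ^ k = 0" using x by (auto simp: CN_def A0_def)
  then have k: "(t * star t) ^ k = 0" by (simp add: tau_def t_def st[unfolded t_def] b'_def)
  have tk: "(t * star t) ^ j = t ^ j * star t ^ j" for j
  proof (induction j)
    case (Suc j)
    have "star t * t ^ j = t ^ j * star t" using hu.commute_power[OF ct, of j] by simp
    then show ?case using Suc by (simp add: mult.assoc) (metis mult.assoc)
  qed simp
  obtain N where N: "N > 0" "t ^ N * t ^ N = t ^ N" by (rule hu.power_idem[OF tM])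
  define f where "f = t ^ N"
  have fM: "f \<in> hu.M n n" unfolding f_def by (rule hu.M_power[OF tM N(1)])
  have ff: "f * f = f" using N by (simp add: f_def)
  have stf: "star f = star t ^ N" by (simp add: f_def hu.st_power)
  have sff: "star f * star f = star f" using arg_cong[OF ff, of star] by (simp add: star_mult)
  have fj: "f ^ Suc j = f" and sfj: "star f ^ Suc j = star f" for j
    by (induction j) (simp_all add: ff sff)
  have cf: "f * star f = star f * f"
    unfolding stf unfolding f_def using hu.commute_power[of t "star t ^ N" N] hu.commute_power[OF ct[symmetric], of N] by simp
  have fsf: "f * star f = 0"
  proof -
    have "f * star f = f ^ Suc k * star f ^ Suc k" by (simp only: fj sfj)
    also have "... = t ^ (Suc k * N) * star t ^ (Suc k * N)" unfolding stf unfolding f_def by (simp only: power_mult[symmetric] mult.commute[of N])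
    also have "... = ((t * star t) ^ (Suc k * N))" by (simp only: tk)
    also have "... = 0"
    proof -
      have "Suc k * N = k + (Suc k * N - k)" using N(1) by (cases N) auto
      then show ?thesis using k by (metis mult_zero_left power_add)
    qed
    finally show ?thesis .
  qed
  \<comment> \<open>On the kernel of \<open>t\<close> the matrix \<open>star t\<close> is the
    nonzero scalar \<open>b - b ^ q\<close>, so nothing but 0 is killed by powers of both.\<close>
  have kill: "t ^ i * h = 0 ==> star t ^ j * h = 0 ==> h = 0" if "h \<in> hu.M n n" for i j h
  proof (induction i)
    case (Suc i)
    define h1 where "h1 = t ^ i * h"
    have h1M: "h1 \<in> hu.M n n" unfolding h1_def using that hu.M_power[OF tM, of i] by (cases "i = 0") (auto intro: hu.M_mult)
    have "t * h1 = 0" using Suc.prems(1) by (simp add: h1_def mult.assoc)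
    then have s1: "star t * h1 = sm (b - b') h1" unfolding st' using h1M
      by (simp add: sh_def left_diff_distrib sm_simps hu.M_l sm_left_diff)
    have "star t ^ l * h1 = sm ((b - b') ^ l) h1" for l
      by (induction l) (simp_all add: mult.assoc sm_simps s1 mult.commute[of "b - b'"])
    moreover have "star t ^ j * h1 = 0"
    proof -
      have tt: "star t ^ j * t ^ i = t ^ i * star t ^ j"
        using hu.commute_power[OF hu.commute_power[OF ct[symmetric], of j, symmetric], of i] by simp
      then have "star t ^ j * h1 = t ^ i * (star t ^ j * h)" by (simp only: h1_def mult.assoc[symmetric] tt)
      then show ?thesis using Suc.prems(2) by simp
    qed
    ultimately have "sm ((b - b') ^ j) h1 = 0" by metis
    then have "h1 = 0" using b by (simp add: sm_eq_0_iff b'_def)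
    then show ?case using Suc by (simp add: h1_def)
  qed simp
  have ee: "eid n * eid n = (eid n :: 'a fmat)" by (simp add: eid_mult)
  have sM: "star f \<in> hu.M n n" using fM by (rule hu.M_st)
  have "(eid n - f) * (eid n - star f) = 0"
  proof (rule kill[of _ N N])
    show "(eid n - f) * (eid n - star f) \<in> hu.M n n" using fM by (auto intro!: hu.M_intros)
    show "t ^ N * ((eid n - f) * (eid n - star f)) = 0"
      unfolding f_def[symmetric] by (simp add: mult.assoc[symmetric] right_diff_distrib ff hu.M_r[OF fM])
    have "(eid n - f) * (eid n - star f) = (eid n - star f) * (eid n - f)"
      by (simp add: left_diff_distrib right_diff_distrib ee hu.M_l[OF fM] hu.M_r[OF fM] hu.M_l[OF sM] hu.M_r[OF sM] cf)
    then show "star t ^ N * ((eid n - f) * (eid n - star f)) = 0"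
      unfolding stf[symmetric] by (simp add: mult.assoc[symmetric] right_diff_distrib sff hu.M_r[OF sM])
  qed
  then have sum: "f + star f = eid n"
    by (simp add: left_diff_distrib right_diff_distrib ee hu.M_l[OF fM] hu.M_r[OF fM] hu.M_l[OF sM] hu.M_r[OF sM] fsf algebra_simps)
  obtain m u v where n: "n = 2 * m" and uv: "(u, v) \<in> hu.HF n m" and fv: "f = v * star u" and fu: "star f = u * star v"
    using HF_if_idem[OF fM ff sum fsf] fsf cf by metis
  note h = hu.HF_D[OF uv]
  have tA: "t * A0 = A0 * t" "t * B0 = B0 * t"
    unfolding t_def using sh_intertwine[OF A0(1) A0(1) A0(1) refl] sh_intertwine[OF A0(1) A0(1) B0(1) AB] by auto
  have fC: "f * C = C * f" "star f * C = C * star f" if "C \<in> {A0, B0}" for C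
  proof -
    show "f * C = C * f" unfolding f_def using that tA hu.commute_power[of t C N] by auto
    from arg_cong[OF this, of star] show "star f * C = C * star f" using that A0 B0 by (auto simp: star_mult)
  qed
  have dec: "C * u = u * (star v * C * u) \<and> C = hyp 0 m u v (star v * C * u)" if C: "C \<in> {A0, B0}" for C
  proof -
    have CM: "C \<in> hu.M n n" "star C = C" using C A0 B0 by auto
    have "C * u = C * (u * star v) * u" using h by (simp add: mult.assoc hu.M_r)
    also have "... = u * (star v * C * u)" unfolding fu[symmetric] fC(2)[OF C, symmetric] unfolding fu by (simp add: mult.assoc)
    finally have 1: "C * u = u * (star v * C * u)" .
    have "C * v = C * (v * star u) * v" using h by (simp add: mult.assoc hu.M_r)
    also have "... = v * (star u * C * v)" unfolding fv[symmetric] fC(1)[OF C, symmetric] unfolding fv by (simp add: mult.assoc)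
    finally have 2: "C * v = v * (star u * C * v)" .
    have "C = C * (f + star f)" unfolding sum using CM by (simp add: hu.M_r)
    also have "... = C * u * star v + C * v * star u" unfolding fu unfolding fv by (simp add: distrib_left mult.assoc add.commute)
    also have "... = hyp 0 m u v (star v * C * u)"
      using 1 2 CM by (simp add: hyp_def star_mult mult.assoc)
    finally show ?thesis using 1 by blast
  qed
  define A1 where "A1 = star v * A0 * u" define B1 where "B1 = star v * B0 * u"
  define A where "A = sh b m A1"
  have M1: "A1 \<in> hu.M m m" "B1 \<in> hu.M m m" using h A0 B0 by (auto simp: A1_def B1_def intro: hu.M_intros)
  have du: "A0 * u = u * A1" "B0 * u = u * B1" using dec[of A0] dec[of B0] by (auto simp: A1_def B1_def)
  have "A1 * B1 = B1 * A1"
  proof -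
    have "A1 * B1 = star v * (A0 * (u * B1))" unfolding A1_def by (simp add: mult.assoc)
    also have "... = star v * (B0 * (u * A1))" unfolding du[symmetric] by (simp add: mult.assoc[symmetric]) (simp add: mult.assoc AB)
    also have "... = B1 * A1" unfolding B1_def by (simp add: mult.assoc)
    finally show ?thesis .
  qed
  then have cAB: "A * B1 = B1 * A" unfolding A_def using sh_intertwine[OF M1(1) M1(1) M1(2)] by simp
  have tu: "t * u = u * A" unfolding t_def A_def by (rule sh_intertwine[OF M1(1) A0(1) h(1) du(1)])
  have AM: "A \<in> hu.M m m" using M1 by (simp add: A_def sh_M)
  have "u * A ^ N = f * u" unfolding f_def using hu.intertwine_power[OF tu] by simp
  also have "... = 0" unfolding fv by (simp add: mult.assoc h)
  finally have "star v * (u * A ^ N) = 0" by simp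
  then have "A ^ N = 0" using h(5) hu.M_power[OF AM N(1)] by (simp add: assoc_l hu.M_l)
  then have "(A, B1) \<in> GNP m" using cAB AM M1 by (auto simp: GNP_def hu_M)
  moreover have "x = (hyp b m u v A, hyp 0 m u v B1)"
  proof -
    have "hyp b m u v A = hyp 0 m u v A1" by (simp add: hyp_def A_def sh_sh)
    then show ?thesis using dec[of A0] dec[of B0] by (simp add: A1_def B1_def A0_def B0_def prod_eq_iff)
  qed
  ultimately show ?thesis using that[OF n uv] by blast
qed

lemma hyp_in_CN:
  assumes uv: "(u, v) \<in> hu.HF (2 * m) m" and AB: "(A, B) \<in> GNP m"
  shows "(hyp b m u v A, hyp 0 m u v B) \<in> CN b (2 * m)"
proof -
  note h = hu.HF_D[OF uv]
  obtain k where A: "A \<in> hu.M m m" and B: "B \<in> hu.M m m" and ab: "A * B = B * A" and k: "A ^ k = 0"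
    using AB by (auto simp: GNP_def hu_M)
  define X where "X = hyp b m u v A"
  have XM: "X \<in> hu.M (2 * m) (2 * m)" "star X = X" "hyp 0 m u v B \<in> hu.M (2 * m) (2 * m)" "star (hyp 0 m u v B) = hyp 0 m u v B"
    using h sh_M[OF A] B by (auto simp: X_def hyp_def star_add star_mult mult.assoc add.commute intro!: hu.M_intros)
  have sAM: "star A \<in> hu.M m m" using A by (rule hu.M_st)
  have Xu: "sh d (2 * m) X * u = u * sh (d - b) m A" for d
    using sh_intertwine[OF sh_M[OF A, of "- b"] XM(1) h(1) hyp_intertwine(1)[OF uv A, of b, folded X_def], of d] by (simp add: sh_sh)
  have Xv: "sh d (2 * m) X * v = v * sh (d - b ^ q) m (star A)" for d
    using sh_intertwine[OF hu.M_st[OF sh_M[OF A, of "- b"]] XM(1) h(2) hyp_intertwine(2)[OF uv A, of b, folded X_def], of d]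
    by (simp add: sh_sh sh_st cj_minus)
  have pw: "(C * sh d m C) ^ k = 0" "(sh d m C * C) ^ k = 0" if "C \<in> hu.M m m" "C ^ k = 0" for C d
  proof -
    have c: "C * sh d m C = sh d m C * C" using sh_intertwine[OF that(1,1,1) refl] by simp
    have "(C * sh d m C) ^ j = C ^ j * sh d m C ^ j" for j
    proof (induction j)
      case (Suc j)
      have "sh d m C * C ^ j = C ^ j * sh d m C" using hu.commute_power[OF c, of j] by simp
      then show ?case using Suc by (simp add: mult.assoc) (metis mult.assoc)
    qed simp
    then show "(C * sh d m C) ^ k = 0" using that by simp
    then show "(sh d m C * C) ^ k = 0" by (simp add: c)
  qed
  define T where "T = tau b (2 * m) X"
  have "T * u = u * (A * sh (b ^ q - b) m A)"
    unfolding T_def tau_def by (simp add: mult.assoc Xu) (simp add: mult.assoc[symmetric] Xu)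
  then have Tu: "T ^ k * u = 0" using hu.intertwine_power[of T u _ k] pw(1)[OF A k] by simp
  have "T * v = v * (sh (b - b ^ q) m (star A) * star A)"
    unfolding T_def tau_def by (simp add: mult.assoc Xv) (simp add: mult.assoc[symmetric] Xv)
  moreover have "star A ^ k = 0" using k hu.st_power[of A k] by simp
  ultimately have Tv: "T ^ k * v = 0" using hu.intertwine_power[of T v _ k] pw(2)[OF sAM] by simp
  have "T ^ Suc k = T ^ Suc k * (u * star v + v * star u)"
  proof -
    have "T \<in> hu.M (2 * m) (2 * m)" unfolding T_def tau_def by (rule hu.M_mult[OF sh_M[OF XM(1)] sh_M[OF XM(1)]])
    then show ?thesis unfolding HF_full[OF uv] by (simp only: hu.M_r[OF hu.M_power] zero_less_Suc)
  qed
  also have "... = T * (T ^ k * u) * star v + T * (T ^ k * v) * star u" by (simp add: distrib_left mult.assoc)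
  also have "... = 0" by (simp add: Tu Tv)
  finally have "T ^ Suc k = 0" .
  moreover have "X * hyp 0 m u v B = hyp 0 m u v B * X" unfolding X_def by (rule hyp_mult[OF uv A B ab])
  ultimately show ?thesis using XM unfolding CN_def CC_def hu.H_def T_def X_def[symmetric]
    by (auto intro!: exI[of _ "Suc k"])
qed

text \<open>Every pair arises from a hyperbolic frame and a nilpotent pair of size \<open>m\<close>.
  GL permutes the presentations of one pair simply transitively: \<open>Q\<close> takes
  \<open>u\<close> to \<open>u * Q\<close>, acts on \<open>v\<close> contragrediently and conjugates
  \<open>(A, B)\<close>. The frames fill the space, so their number is the order of
  \<open>U (2 * m)\<close>.\<close>

lemma card_CN:
  assumes b: "b ^ q ~= b"
  shows "card (hu.U (2 * m)) * card (GNP m :: ('a fmat \<times> 'a fmat) set) = card (GLm m :: 'a fmat set) * card (CN b (2 * m))"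
proof -
  let ?n = "2 * m"
  define f where "f = (\<lambda>((u, v), (A, B)). (hyp b m u v A, hyp 0 m u v B))"
  have finG: "finite (GNP m :: ('a fmat \<times> 'a fmat) set)"
    by (rule finite_subset[of _ "MM m m \<times> MM m m"]) (auto simp: GNP_def)
  have finC: "finite (CN b n)" for n
    by (rule finite_subset[of _ "hu.M n n \<times> hu.M n n"]) (auto simp: CN_def CC_def hu.H_def)
  have "card (hu.HF ?n m \<times> (GNP m :: ('a fmat \<times> 'a fmat) set)) = card (GLm m :: 'a fmat set) * card (CN b ?n)"
  proof (rule card_fibres[where f = f])
    show "f a \<in> CN b ?n" if "a \<in> hu.HF ?n m \<times> GNP m" for a
      using that hyp_in_CN by (auto simp: f_def)
    fix x assume x: "x \<in> CN b ?n"
    obtain m' u0 v0 A0 B0 where "?n = 2 * m'" and 1: "(u0, v0) \<in> hu.HF ?n m'" "(A0, B0) \<in> GNP m'" "x = (hyp b m' u0 v0 A0, hyp 0 m' u0 v0 B0)"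
      by (rule CN_split[OF b x])
    then have "m' = m" by simp
    note 1 = 1[unfolded this]
    note h0 = hu.HF_D[OF 1(1)]
    obtain k0 where A0: "A0 \<in> hu.M m m" and B0: "B0 \<in> hu.M m m" and ab0: "A0 * B0 = B0 * A0" and k0: "A0 ^ k0 = 0"
      using 1(2) by (auto simp: GNP_def hu_M)
    define g where "g = (\<lambda>(Q, R). ((u0 * Q, v0 * star R), (R * A0 * Q, R * B0 * Q)))"
    define g' where "g' = (\<lambda>a :: ('a fmat \<times> 'a fmat) \<times> ('a fmat \<times> 'a fmat). (star v0 * fst (fst a), star (snd (fst a)) * u0))"
    have "bij_betw g (GP m) {a \<in> hu.HF ?n m \<times> GNP m. f a = x}"
    proof (rule bij_betw_byWitness[where f' = g'])
      show "\<forall>a\<in>GP m. g' (g a) = a"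
        using h0 by (auto simp: g_def g'_def GP_def star_mult mult.assoc assoc_l[OF h0(5)] hu.M_l hu.M_r)
      show "g ` GP m \<subseteq> {a \<in> hu.HF ?n m \<times> GNP m. f a = x}"
      proof (rule image_subsetI)
        fix a assume "a \<in> GP m"
        then obtain Q R where a: "a = (Q, R)" and Q: "Q \<in> hu.M m m" "R \<in> hu.M m m" "Q * R = eid m" "R * Q = eid m"
          by (auto simp: GP_def)
        have hf: "(u0 * Q, v0 * star R) \<in> hu.HF ?n m"
          using h0 Q by (auto simp: hu.HF_def star_mult mult.assoc h0(3-)[THEN assoc_l] hu.M_l intro: hu.M_intros)
        have pw: "(R * C * Q) ^ j * R = R * C ^ j" if "C \<in> hu.M m m" for C j
          by (rule hu.intertwine_power) (use that Q in \<open>simp add: mult.assoc hu.M_r\<close>)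
        have "(R * A0 * Q) ^ k0 * R = 0" using pw[OF A0, of k0] k0 by simp
        then have "(R * A0 * Q) ^ k0 * R * (A0 * Q) = 0" by simp
        then have z: "(R * A0 * Q) ^ Suc k0 = 0" by (simp only: power_Suc2 mult.assoc)
        have "R * A0 * Q * (R * B0 * Q) = R * B0 * Q * (R * A0 * Q)"
        proof -
          have "R * A0 * Q * (R * B0 * Q) = R * (A0 * B0) * Q" using Q A0 B0 by (simp add: mult.assoc assoc_l[OF Q(3)] hu.M_l')
          moreover have "R * B0 * Q * (R * A0 * Q) = R * (B0 * A0) * Q" using Q A0 B0 by (simp add: mult.assoc assoc_l[OF Q(3)] hu.M_l')
          ultimately show ?thesis by (simp add: ab0)
        qed
        with z have gn: "(R * A0 * Q, R * B0 * Q) \<in> GNP m"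
          using Q A0 B0 unfolding GNP_def by (auto simp: hu_M[symmetric] simp del: power_Suc intro!: hu.M_mult exI[of _ "Suc k0"])
        have hy: "hyp d m (u0 * Q) (v0 * star R) (R * C * Q) = hyp d m u0 v0 C" if "C \<in> hu.M m m" for C d
        proof -
          have "sh (- d) m (R * C * Q) = R * sh (- d) m C * Q"
            using Q by (simp add: sh_def left_diff_distrib right_diff_distrib sm_simps hu.M_r mult.assoc)
          then have *: "Q * sh (- d) m (R * C * Q) * R = sh (- d) m C"
            using Q sh_M[OF that, of "- d"] by (simp add: mult.assoc Q(3) assoc_l[OF Q(3)] hu.M_l hu.M_r)
          have "hyp d m (u0 * Q) (v0 * star R) (R * C * Q) = u0 * (Q * sh (- d) m (R * C * Q) * R) * star v0
             + v0 * star (Q * sh (- d) m (R * C * Q) * R) * star u0"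
            by (simp add: hyp_def star_mult mult.assoc)
          then show ?thesis unfolding * by (simp add: hyp_def)
        qed
        show "g a \<in> {a \<in> hu.HF ?n m \<times> GNP m. f a = x}"
          using hf gn hy[OF A0] hy[OF B0] by (simp add: a g_def f_def 1(3))
      qed
      have *: "g' a \<in> GP m \<and> g (g' a) = a" if a: "a \<in> hu.HF ?n m \<times> GNP m" and fa: "f a = x" for a
      proof -
        obtain u v A B where av: "a = ((u, v), (A, B))" by (metis surj_pair)
        have uv: "(u, v) \<in> hu.HF ?n m" and AB: "(A, B) \<in> GNP m" using a by (auto simp: av)
        note h = hu.HF_D[OF uv]
        obtain k where A: "A \<in> hu.M m m" and B: "B \<in> hu.M m m" and k: "A ^ k = 0"
          using AB by (auto simp: GNP_def hu_M)
        have eq: "hyp b m u v A = hyp b m u0 v0 A0" "hyp 0 m u v B = hyp 0 m u0 v0 B0" using fa by (auto simp: f_def av 1(3))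
        define X where "X = hyp b m u v A"
        note hi = hyp_intertwine[OF uv A, of b, folded X_def]
        note hi0 = hyp_intertwine[OF 1(1) A0, of b, folded eq(1) X_def]
        \<comment> \<open>\<open>star v0 * v\<close> intertwines nilpotent shifts of the different
          scalars \<open>b\<close> and \<open>b ^ q\<close>.\<close>
        have S1: "star v0 * v = 0"
        proof -
          have "sh (- b) m A0 * (star v0 * v) = (star v0 * v) * star (sh (- b) m A)"
            using hi0(3) hi(2) by (metis mult.assoc)
          from sh_intertwine[OF hu.M_st[OF sh_M[OF A]] sh_M[OF A0] hu.M_mult[OF hu.M_st[OF h0(2)] h(2)] this, of b]
          have "A0 * (star v0 * v) = (star v0 * v) * sh (b - b ^ q) m (star A)"
            by (simp add: sh_sh sh_st cj_minus)
          moreover have "star A ^ k = 0" using k hu.st_power[of A k] by simp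
          ultimately show ?thesis
            using sm_inverse_nilp[OF A0 k0 hu.M_st[OF A], of k "star v0 * v" "b - b ^ q"] b hu.M_mult[OF hu.M_st[OF h0(2)] h(2)] by simp
        qed
        have S2: "star u0 * u = 0"
        proof -
          have "star (sh (- b) m A0) * (star u0 * u) = (star u0 * u) * sh (- b) m A"
            using hi0(4) hi(1) by (metis mult.assoc)
          from sh_intertwine[OF sh_M[OF A] hu.M_st[OF sh_M[OF A0]] hu.M_mult[OF hu.M_st[OF h0(1)] h(1)] this, of "b ^ q"]
          have "star A0 * (star u0 * u) = (star u0 * u) * sh (b ^ q - b) m A"
            by (simp add: sh_sh sh_st cj_minus)
          moreover have "star A0 ^ k0 = 0" using k0 hu.st_power[of A0 k0] by simp
          ultimately show ?thesis
            using sm_inverse_nilp[OF hu.M_st[OF A0] _ A k, of k0 "star u0 * u" "b ^ q - b"] b hu.M_mult[OF hu.M_st[OF h0(1)] h(1)] by simp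
        qed
        define Q where "Q = star v0 * u" define R where "R = star v * u0"
        have QR: "Q \<in> hu.M m m" "R \<in> hu.M m m" using h h0 by (auto simp: Q_def R_def intro: hu.M_intros)
        have u: "u = u0 * Q"
        proof -
          have "(u0 * star v0 + v0 * star u0) * u = u" unfolding HF_full[OF 1(1)] using h by (simp add: hu.M_l)
          then show ?thesis by (simp add: distrib_right mult.assoc S2 Q_def)
        qed
        have v: "v = v0 * star R"
        proof -
          have "(u0 * star v0 + v0 * star u0) * v = v" unfolding HF_full[OF 1(1)] using h by (simp add: hu.M_l)
          then show ?thesis by (simp add: distrib_right mult.assoc S1 R_def star_mult)
        qed
        have RQ: "R * Q = eid m" using u h(5) by (simp add: R_def mult.assoc)
        have gp: "(Q, R) \<in> GP m" using QR RQ hu.inverse_commute[OF QR RQ] by (simp add: GP_def)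
        have conj: "C = R * C0 * Q" if C: "C \<in> hu.M m m" "C0 \<in> hu.M m m" "hyp d m u v C = hyp d m u0 v0 C0" for C C0 d
        proof -
          have "sh (- d) m C = star v * hyp d m u v C * u"
            using hu.M_r[OF sh_M[OF C(1), of "- d"]] by (simp add: hyp_intertwine(3)[OF uv C(1)] mult.assoc h)
          also have "... = R * sh (- d) m C0 * Q"
            unfolding C(3) by (simp add: hyp_def distrib_left distrib_right mult.assoc S2 R_def Q_def)
          also have "... = sh (- d) m (R * C0 * Q)"
            using QR by (simp add: sh_def left_diff_distrib right_diff_distrib sm_simps hu.M_r mult.assoc RQ)
          finally show ?thesis by (simp add: sh_def)
        qed
        have "g' a = (Q, R)" by (simp add: g'_def av Q_def R_def)
        moreover have "g (Q, R) = a"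
          using u v conj[OF A A0 eq(1)] conj[OF B B0 eq(2)] by (simp add: g_def av)
        ultimately show ?thesis using gp by simp
      qed
      show "\<forall>a\<in>{a \<in> hu.HF ?n m \<times> GNP m. f a = x}. g (g' a) = a" "g' ` {a \<in> hu.HF ?n m \<times> GNP m. f a = x} \<subseteq> GP m"
        using * by blast+
    qed
    then show "card {a \<in> hu.HF ?n m \<times> GNP m. f a = x} = card (GLm m :: 'a fmat set)"
      by (simp add: bij_betw_same_card[symmetric] card_GP)
  qed (use finG finC in auto)
  moreover have "card (hu.HF ?n m) = card (hu.U ?n)"
    using hu.card_HF[of m 0] by (simp add: hu.U_0)
  ultimately show ?thesis by (simp add: card_cartesian_product)
qed

text \<open>The linear count takes place over the field with \<open>q ^ 2\<close> elements, whence
  the parameter \<open>1 / q ^ 2\<close>. The substitution of \<open>X ^ 2\<close> reflects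
  \<open>n = 2 * m\<close>.\<close>

lemma ser_CN:
  assumes b: "b ^ q ~= b"
  shows "ser (CN b) = iprod (euler_fps (1 / real q ^ 2)) oo fps_X ^ 2"
proof (rule fps_ext)
  fix n
  have F: "iprod (euler_fps (1 / real q ^ 2)) = Abs_fps (\<lambda>m. real (card (GNP m :: ('a fmat \<times> 'a fmat) set)) / real (card (GLm m :: 'a fmat set)))"
    using GL_nilp_series[where 'a = 'a] card_a by simp
  show "fps_nth (ser (CN b)) n = fps_nth (iprod (euler_fps (1 / real q ^ 2)) oo fps_X ^ 2) n"
  proof (cases "even n")
    case True
    then obtain m where m: "n = 2 * m" by blast
    have "real (card (hu.U n)) * real (card (GNP m :: ('a fmat \<times> 'a fmat) set)) = real (card (GLm m :: 'a fmat set)) * real (card (CN b n))"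
      using arg_cong[OF card_CN[OF b, of m], of real] m by simp
    moreover have "real (card (hu.U n)) > 0" "real (card (GLm m :: 'a fmat set)) > 0"
      using hu.card_U_pos[of n] hg.card_U_pos[of m, where 'a = 'a] by (simp_all only: card_hg_U of_nat_0_less_iff)
    moreover have "c / u = g / l" if "u * g = l * c" "u > 0" "l > 0" for u g l c :: real
      using that by (simp add: field_simps)
    ultimately have "real (card (CN b n)) / real (card (hu.U n)) = real (card (GNP m :: ('a fmat \<times> 'a fmat) set)) / real (card (GLm m :: 'a fmat set))"
      by blast
    then show ?thesis unfolding F by (simp add: ser_def fps_nth_compose_X_power m)
  next
    case False
    have "CN b n = {}"
    proof (rule ccontr)
      assume "CN b n ~= {}"
      then obtain x where "x \<in> CN b n" by blast
      then show False by (rule CN_split[OF b]) (use False in simp)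
    qed
    with False show ?thesis by (simp add: ser_def fps_nth_compose_X_power)
  qed
qed

end

section \<open>Cyclic decomposition\<close>

text \<open>The constant term is a multiple of the infinite identity, which makes \<open>pev\<close>
  multiplicative. The value of \<open>f\<close> at an n by n matrix is therefore
  \<open>pev f A * eid n\<close>.\<close>

definition pev :: "'a::comm_ring_1 poly => 'a fmat => 'a fmat" where
  "pev f A = fold_coeffs (\<lambda>a X. sm a 1 + A * X) f 0"

lemma pev_0 [simp]: "pev 0 A = 0"
  and pev_pCons [simp]: "pev (pCons a f) A = sm a 1 + A * pev f A"
  by (simp add: pev_def) (cases "f = 0 \<and> a = 0"; auto simp: pev_def)

lemma pev_1 [simp]: "pev 1 A = 1"
  by (simp add: one_pCons)

lemma pev_add: "pev (f + g) A = pev f A + pev g A"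
  by (induction f g rule: poly_induct2) (simp_all add: sm_left_add algebra_simps)

lemma pev_smult: "pev (smult c f) A = sm c (pev f A)"
  by (induction f) (simp_all add: sm_simps)

lemma pev_minus: "pev (- f) A = - pev f A"
  using pev_smult[of "- 1" f A] by (simp add: sm_left_minus)

lemma pev_diff: "pev (f - g) A = pev f A - pev g A"
  using pev_add[of f "- g" A] by (simp add: pev_minus)

lemma pev_mult: "pev (f * g) A = pev f A * pev g A"
  by (induction f) (simp_all add: pev_add pev_smult sm_simps algebra_simps)

lemma pev_monom: "pev (monom c k) A = sm c (A ^ k)"
  by (induction k) (simp_all add: monom_0 monom_Suc sm_simps)

lemma pev_mult_commute: "pev (f * g) A = pev g A * pev f A"
  by (simp add: pev_mult[symmetric] mult.commute)

lemma pev_intertwine: "B * S = S * A ==> pev f B * S = S * pev f A"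
proof (induction f)
  case (pCons a f)
  have "B * (pev f B * S) = S * (A * pev f A)"
    using pCons by (simp add: mult.assoc[symmetric])
  then show ?case by (simp add: distrib_left distrib_right sm_simps mult.assoc)
qed simp

lemma pev_sum: "pev (\<Sum>i\<in>I. f i) A = (\<Sum>i\<in>I. pev (f i) A)"
  by (induction I rule: infinite_finite_induct) (simp_all add: pev_add)

lemma pev_eq_sum: "degree f < r ==> pev f A = (\<Sum>k<r. sm (coeff f k) (A ^ k))"
proof -
  assume "degree f < r"
  then have "f = (\<Sum>k<r. monom (coeff f k) k)"
    by (intro poly_eqI) (auto simp: coeff_sum coeff_eq_0)
  then show ?thesis using pev_sum[of "\<lambda>k. monom (coeff f k) k" "{..<r}" A] by (simp add: pev_monom)
qed

lemma poly_ideal: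
  fixes I :: "'a::field poly set"
  assumes add: "\<And>f g. f \<in> I ==> g \<in> I ==> f + g \<in> I" and mult: "\<And>f g. f \<in> I ==> g * f \<in> I"
    and ex: "g \<in> I" "g ~= 0"
  obtains d where "lead_coeff d = 1" "\<And>f. f \<in> I \<longleftrightarrow> d dvd f"
proof -
  define P where "P m \<longleftrightarrow> (\<exists>f\<in>I. f ~= 0 \<and> degree f = m)" for m
  have "P (LEAST m. P m)" by (rule LeastI[of P "degree g"]) (use ex in \<open>auto simp: P_def\<close>)
  then obtain f0 where f0: "f0 \<in> I" "f0 ~= 0" "degree f0 = (LEAST m. P m)" by (auto simp: P_def)
  have least: "degree f0 \<le> degree f" if "f \<in> I" "f ~= 0" for f
    unfolding f0(3) by (rule Least_le) (use that in \<open>auto simp: P_def\<close>)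
  define d where "d = smult (inverse (lead_coeff f0)) f0"
  have d: "lead_coeff d = 1" "degree d = degree f0" "d ~= 0" using f0(1,2) by (simp_all add: d_def)
  have dI: "d \<in> I" using mult[OF f0(1), of "[:inverse (lead_coeff f0):]"] by (simp add: d_def)
  have "f \<in> I \<longleftrightarrow> d dvd f" for f
  proof
    assume f: "f \<in> I"
    have "f mod d = f + (- (f div d)) * d" by (simp add: minus_mult_div_eq_mod[symmetric] mult.commute)
    then have "f mod d \<in> I" using add[OF f mult[OF dI]] by metis
    then have "f mod d = 0" using least[of "f mod d"] degree_mod_less[OF d(3), of f] d(2) by force
    then show "d dvd f" by (simp add: dvd_eq_mod_eq_0)
  next
    assume "d dvd f"
    then show "f \<in> I" using mult[OF dI] by (auto elim!: dvdE simp: mult.commute)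
  qed
  with d(1) that show ?thesis by blast
qed

lemma poly_irreducible_factor:
  fixes b :: "'a::field poly"
  assumes "degree b > 0"
  obtains p where "irreducible p" "p dvd b" "degree p > 0"
proof -
  define P where "P m \<longleftrightarrow> (\<exists>f. f dvd b \<and> degree f > 0 \<and> degree f = m)" for m
  have "P (LEAST m. P m)" by (rule LeastI[of P "degree b"]) (unfold P_def, rule exI[of _ b], use assms in simp)
  then obtain p where p: "p dvd b" "degree p > 0" "degree p = (LEAST m. P m)" by (auto simp: P_def)
  have least: "degree p \<le> degree f" if "f dvd b" "degree f > 0" for f
    unfolding p(3) by (rule Least_le) (use that in \<open>auto simp: P_def\<close>)
  have "irreducible p"
  proof (rule irreducibleI)
    show "p ~= 0" using p by auto
    show "\<not> p dvd 1" using p(2) \<open>p ~= 0\<close> is_unit_iff_degree by (metis less_irrefl)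
    fix f g assume fg: "p = f * g"
    then have nz: "f ~= 0" "g ~= 0" using p by auto
    have deg: "degree p = degree f + degree g" using fg nz by (simp add: degree_mult_eq)
    have "f dvd b" "g dvd b" using p(1) fg by (auto intro: dvd_trans)
    then have "degree f = 0 \<or> degree p \<le> degree f" "degree g = 0 \<or> degree p \<le> degree g" using least by auto
    then have "degree f = 0 \<or> degree g = 0" using deg p(2) by auto
    then show "f dvd 1 \<or> g dvd 1" using nz by (auto simp: is_unit_iff_degree)
  qed
  with p that show ?thesis by blast
qed

text \<open>Let \<open>p\<close> be an irreducible factor of \<open>b\<close>. If it does not divide
  \<open>a\<close>, it separates. Otherwise cancel it from both and use induction; when the prime
  found is associated to \<open>p\<close>, its exponent goes up by one.\<close>

lemma prime_power_separates:
  fixes a b :: "'a::field poly"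
  assumes "b ~= 0" "\<not> b dvd a"
  obtains p k where "irreducible p" "p ^ k dvd b" "\<not> p ^ k dvd a"
proof -
  have "\<exists>p k. irreducible p \<and> p ^ k dvd b \<and> \<not> p ^ k dvd a"
    using assms
  proof (induction "degree b" arbitrary: a b rule: less_induct)
    case less
    have "degree b > 0"
    proof (rule ccontr)
      assume "\<not> degree b > 0"
      then have "b dvd 1" using less.prems by (simp add: is_unit_iff_degree)
      then show False using less.prems by (meson dvd_trans one_dvd)
    qed
    then obtain p where p: "irreducible p" "p dvd b" "degree p > 0" by (rule poly_irreducible_factor)
    show ?case
    proof (cases "p dvd a")
      case False
      then show ?thesis using p by (intro exI[of _ p] exI[of _ 1]) simp
    next
      case True
      then obtain a1 where a1: "a = p * a1" by (rule dvdE)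
      from p(2) obtain b1 where b1: "b = p * b1" by (rule dvdE)
      have nz: "b1 ~= 0" "p ~= 0" using less.prems(1) b1 by auto
      have "degree b1 < degree b" using b1 nz p(3) by (simp add: degree_mult_eq)
      moreover have "\<not> b1 dvd a1" using less.prems(2) a1 b1 by auto
      ultimately obtain p' k where p': "irreducible p'" "p' ^ k dvd b1" "\<not> p' ^ k dvd a1"
        using less.hyps[of b1 a1] nz by blast
      show ?thesis
      proof (cases "p' dvd p")
        case False
        have pr: "prime_elem p'" using p'(1) by (rule field_poly_irreducible_imp_prime)
        have "k > 0" using p'(3) by (cases k) auto
        have "\<not> p' ^ k dvd a"
          unfolding a1 using prime_power_dvd_multD[OF pr _ \<open>k > 0\<close> False, of a1] p'(3) by blast
        then show ?thesis using p' b1 by (intro exI[of _ p'] exI[of _ k]) auto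
      next
        case True
        then obtain c where c: "p = p' * c" by (rule dvdE)
        have "\<not> p' dvd 1" using p'(1) by (rule irreducible_not_unit)
        then have cu: "c dvd 1" using irreducibleD[OF p(1) c] by blast
        then obtain c' where c': "1 = c * c'" by (rule dvdE)
        have "p' ^ Suc k dvd b" using p'(2) by (simp add: b1 c mult.assoc mult_dvd_mono)
        moreover have "\<not> p' ^ Suc k dvd a"
        proof
          assume "p' ^ Suc k dvd a"
          then have "p' * p' ^ k dvd p' * (c * a1)" by (simp add: a1 c mult.assoc)
          then have "p' ^ k dvd c * a1" using p'(1) by (simp add: irreducible_def)
          then have "p' ^ k dvd c' * (c * a1)" by (rule dvd_mult)
          then have "p' ^ k dvd (c * c') * a1" by (simp add: ac_simps)
          then show False using p'(3) by (simp add: c'[symmetric])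
        qed
        ultimately show ?thesis using p'(1) by blast
      qed
    qed
  qed
  with that show ?thesis by blast
qed

lemma irreducible_power_split:
  fixes a p :: "'a::field poly"
  assumes "irreducible p" "a ~= 0"
  obtains i a' where "a = p ^ i * a'" "\<not> p dvd a'"
proof -
  have "\<exists>i a'. a = p ^ i * a' \<and> \<not> p dvd a'"
    using assms(2)
  proof (induction "degree a" arbitrary: a rule: less_induct)
    case less
    show ?case
    proof (cases "p dvd a")
      case True
      then obtain b where b: "a = p * b" by (rule dvdE)
      have nz: "p ~= 0" "b ~= 0" using b less.prems by auto
      have "degree p > 0" using assms(1) nz by (metis irreducible_not_unit is_unit_iff_degree neq0_conv)
      then have "degree b < degree a" using b nz by (simp add: degree_mult_eq)
      then obtain i a' where "b = p ^ i * a'" "\<not> p dvd a'" using less.hyps nz(2) by blast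
      then show ?thesis using b by (intro exI[of _ "Suc i"] exI[of _ a']) (simp add: mult.assoc)
    next
      case False
      then show ?thesis by (intro exI[of _ 0] exI[of _ a]) simp
    qed
  qed
  with that show ?thesis by blast
qed

section \<open>Annihilating polynomials of vectors\<close>

context quad_field begin

lemma pev_mult_M:
  assumes A: "A \<in> hu.M n n" and v: "v \<in> hu.M n m"
  shows "pev f A * v \<in> hu.M n m"
proof (induction f)
  case (pCons a f)
  then have "sm a v + A * (pev f A * v) \<in> hu.M n m" using hu.M_add[OF M_sm[OF v] hu.M_mult[OF A]] by blast
  then show ?case by (simp add: distrib_right sm_simps mult.assoc)
qed (simp add: hu.M_0)

lemma order_ex:
  assumes A: "A \<in> hu.M n n" and v: "v \<in> hu.M n m"
  obtains d where "lead_coeff d = 1" "\<And>f. pev f A * v = 0 \<longleftrightarrow> d dvd f"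
proof -
  \<comment> \<open>An idempotent power of \<open>A\<close> provides a nonzero annihilating
    polynomial, \<open>X ^ (2 * N) - X ^ N\<close>.\<close>
  obtain N where N: "N > 0" "A ^ N * A ^ N = A ^ N" by (rule hu.power_idem[OF A])
  define g where "g = monom (1::'a) (N + N) - monom 1 N"
  have "coeff g (N + N) = 1" using N by (simp add: g_def)
  then have g0: "g ~= 0" by auto
  have gI: "g \<in> {f. pev f A * v = 0}" using N by (simp add: g_def pev_diff pev_monom power_add)
  show ?thesis
  proof (rule poly_ideal[OF _ _ gI g0])
    show "lead_coeff d = 1 ==> (\<And>f. f \<in> {f. pev f A * v = 0} \<longleftrightarrow> d dvd f) ==> thesis" for d
      using that[of d] by simp
  qed (auto simp: pev_add pev_mult distrib_right mult.assoc)
qed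

text \<open>Take \<open>v\<close> with annihilator \<open>od v\<close> of largest degree. If some
  \<open>od w\<close> did not divide it, a prime power \<open>p ^ k\<close> would divide
  \<open>od w\<close> but not \<open>od v = p ^ i * a\<close> with \<open>a\<close> prime to
  \<open>p\<close>. Then \<open>p ^ i\<close> applied to \<open>v\<close> has annihilator
  \<open>a\<close>, \<open>od w / p ^ k\<close> applied to \<open>w\<close> has annihilator
  \<open>p ^ k\<close>, and the annihilator of their sum is divisible by \<open>p ^ k * a\<close>,
  of larger degree.\<close>

lemma maximal_order_vector:
  assumes A: "A \<in> hu.M n n"
  obtains v where "v \<in> hu.M n 1" "\<And>f. pev f A * v = 0 \<longleftrightarrow> pev f A * eid n = 0"
proof -
  define od where "od v = (SOME d. lead_coeff d = 1 \<and> (\<forall>f. pev f A * v = 0 \<longleftrightarrow> d dvd f))" for v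
  have od: "lead_coeff (od v) = 1" "pev f A * v = 0 \<longleftrightarrow> od v dvd f" if v: "v \<in> hu.M n 1" for v f
  proof -
    have "\<exists>d. lead_coeff d = 1 \<and> (\<forall>f. pev f A * v = 0 \<longleftrightarrow> d dvd f)" using order_ex[OF A v] by metis
    then have "lead_coeff (od v) = 1 \<and> (\<forall>f. pev f A * v = 0 \<longleftrightarrow> od v dvd f)" unfolding od_def by (rule someI_ex)
    then show "lead_coeff (od v) = 1" "pev f A * v = 0 \<longleftrightarrow> od v dvd f" by blast+
  qed
  define D where "D = (\<lambda>v. degree (od v)) ` hu.M n 1"
  have "finite D" "D ~= {}" using hu.M_0[of n 1] by (auto simp: D_def)
  then have "Max D \<in> D" by (rule Max_in)
  then obtain v where v: "v \<in> hu.M n 1" "degree (od v) = Max D" by (auto simp: D_def)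
  have max: "degree (od w) \<le> degree (od v)" if "w \<in> hu.M n 1" for w
    unfolding v(2) by (rule Max_ge[OF \<open>finite D\<close>]) (use that in \<open>auto simp: D_def\<close>)
  have dvd: "od w dvd od v" if w: "w \<in> hu.M n 1" for w
  proof (rule ccontr)
    assume n: "\<not> od w dvd od v"
    have nz: "od w ~= 0" "od v ~= 0" using od(1)[OF w] od(1)[OF v(1)] by auto
    obtain p k where p: "irreducible p" "p ^ k dvd od w" "\<not> p ^ k dvd od v" by (rule prime_power_separates[OF nz(1) n])
    obtain i a where a: "od v = p ^ i * a" "\<not> p dvd a" by (rule irreducible_power_split[OF p(1) nz(2)])
    obtain c where c: "od w = p ^ k * c" using p(2) by (rule dvdE)
    have pr: "prime_elem p" using p(1) by (rule field_poly_irreducible_imp_prime)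
    have p0: "p ~= 0" "a ~= 0" "c ~= 0" using pr a c nz unfolding prime_elem_def by auto
    have dp: "degree p > 0" using p(1) p0 by (metis irreducible_not_unit is_unit_iff_degree neq0_conv)
    have ik: "i < k" using a(1) p(3) by (metis dvd_triv_left le_imp_power_dvd dvd_trans not_less)
    define u where "u = pev (p ^ i) A * v + pev c A * w"
    have uM: "u \<in> hu.M n 1" unfolding u_def by (intro hu.M_add pev_mult_M A v w)
    have "p ^ k * a dvd od u"
    proof -
      have u0: "pev (od u) A * u = 0" using od(2)[OF uM] by simp
      have e: "pev f A * u = pev (f * p ^ i) A * v + pev (f * c) A * w" for f
        by (simp add: u_def distrib_left pev_mult mult.assoc)
      have "pev (od u * a) A * u = 0" unfolding pev_mult_commute by (simp add: u0 mult.assoc)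
      moreover have "pev (od u * a * p ^ i) A * v = 0" using od(2)[OF v(1)] by (simp add: a(1) mult.assoc mult.commute[of a])
      ultimately have "pev (od u * a * c) A * w = 0" using e[of "od u * a"] by simp
      then have "p ^ k * c dvd (od u * a) * c" using od(2)[OF w] c by simp
      then have "p ^ k dvd a * od u" using p0(3) by (simp add: mult.commute)
      then have 1: "p ^ k dvd od u" using prime_power_dvd_multD[OF pr _ _ a(2)] ik by blast
      have "pev (od u * p ^ k) A * u = 0" unfolding pev_mult_commute by (simp add: u0 mult.assoc)
      moreover have "pev (od u * p ^ k * c) A * w = 0" using od(2)[OF w] by (simp add: c mult.assoc)
      ultimately have "pev (od u * p ^ k * p ^ i) A * v = 0" using e[of "od u * p ^ k"] by simp
      then have "p ^ i * a dvd p ^ i * (od u * p ^ k)" using od(2)[OF v(1)] a(1) by (simp add: ac_simps)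
      then have 2: "a dvd od u * p ^ k" using p0 by simp
      obtain g where g: "od u = p ^ k * g" using 1 by (rule dvdE)
      have "a dvd g"
      proof -
        have "a dvd x" if "a dvd p ^ j * x" for j x
          using that
        proof (induction j arbitrary: x)
          case (Suc j)
          then have "a dvd p ^ j * (p * x)" by (simp only: power_Suc2 mult.assoc)
          then have "a dvd p * x" by (rule Suc.IH)
          then obtain y where y: "p * x = a * y" by (rule dvdE)
          then have "p dvd a * y" by (metis dvd_triv_left)
          then have "p dvd y" using prime_elem_dvd_mult_iff[OF pr] a(2) by blast
          then obtain z where "y = p * z" by (rule dvdE)
          then have "p * x = p * (a * z)" using y by (simp add: ac_simps)
          then show ?case using p0 by simp
        qed simp
        then show ?thesis using 2 g by (metis mult.assoc mult.commute)
      qed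
      then show ?thesis using g by simp
    qed
    moreover have "od u ~= 0" using od(1)[OF uM] by auto
    ultimately have "degree (p ^ k * a) \<le> degree (od u)" by (rule dvd_imp_degree_le)
    then have "degree (p ^ k * a) \<le> degree (p ^ i * a)" using max[OF uM] a(1) by simp
    then show False using ik dp p0 by (simp add: degree_mult_eq degree_power_eq)
  qed
  have "pev f A * eid n = 0" if f: "pev f A * v = 0" for f
  proof -
    have fw: "pev f A * w = 0" if w: "w \<in> hu.M n 1" for w
      using od(2)[OF w] od(2)[OF v(1)] dvd[OF w] f by (meson dvd_trans)
    have "pev f A * eid n * munit j (0::nat) = 0" if "j < n" for j
    proof -
      have "(munit j 0 :: 'a fmat) \<in> hu.M n 1" using that by (auto simp: hu_M MM_iff munit.rep_eq split: if_splits)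
      then show ?thesis using fw[of "munit j 0"] by (simp add: mult.assoc hu.M_l)
    qed
    moreover have "pev f A * eid n * munit j (0::nat) = 0" if "\<not> j < n" for j
    proof -
      have "eid n * munit j (0::nat) = (0 :: 'a fmat)" using that by (intro fmat_eqI) (auto simp: ent_eid_mult munit.rep_eq)
      then show ?thesis by (simp add: mult.assoc)
    qed
    ultimately have z: "pev f A * eid n * munit j (0::nat) = 0" for j by blast
    show ?thesis
    proof (rule fmat_eqI)
      fix i j
      have "ent (pev f A * eid n * munit j 0) i 0 = ent (pev f A * eid n) i j"
        by (subst ent_times'[where Y = "munit j 0"]) (simp add: munit.rep_eq)
      then show "ent (pev f A * eid n) i j = ent 0 i j" using z[of j] by simp
    qed
  qed
  moreover have "pev f A * v = 0" if "pev f A * eid n = 0" for f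
  proof -
    have "pev f A * eid n * v = 0" using that by simp
    then show ?thesis using v(1) by (simp add: mult.assoc hu.M_l)
  qed
  ultimately show ?thesis using that v(1) by blast
qed

end

section \<open>Companion matrices, Krylov matrices and cyclic splitting\<close>

lemma fmat_col_eqI:
  assumes "X \<in> MM n r" "Y \<in> MM n r" "\<And>k. k < r ==> X * munit k 0 = Y * munit k 0"
  shows "X = Y"
proof (rule fmat_eqI)
  fix i j
  show "ent X i j = ent Y i j"
  proof (cases "j < r")
    case True
    from arg_cong[OF assms(3)[OF this], of "\<lambda>Z. ent Z i 0"] show ?thesis by (simp add: sum_mult_munit)
  next
    case False
    then have "ent X i j = 0" "ent Y i j = 0" using assms(1,2) by (auto simp: MM_iff)
    then show ?thesis by simp
  qed
qed

lemma col_eq_0I: "(\<And>k. ent x k 0 = 0) ==> x \<in> MM r 1 ==> x = 0"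
  by (rule fmat_eqI) (metis MM_iff less_one zero_fmat.rep_eq)

lemma monic_dvd_antisym:
  fixes d d' :: "'a::field poly"
  assumes "lead_coeff d = 1" "lead_coeff d' = 1" "d dvd d'" "d' dvd d"
  shows "d = d'"
proof -
  have nz: "d ~= 0" "d' ~= 0" using assms by auto
  obtain c where c: "d' = d * c" using assms(3) by (rule dvdE)
  have "degree d' \<le> degree d" by (rule dvd_imp_degree_le[OF assms(4) nz(1)])
  then have "degree c = 0" using c nz by (auto simp: degree_mult_eq)
  then obtain k where k: "c = [:k:]" by (rule degree_eq_zeroE)
  have "lead_coeff c = 1" using lead_coeff_mult[of d c, folded c] unfolding assms(1,2) by simp
  then have "k = 1" using k by simp
  then show ?thesis using c k by simp
qed

lemma munit_munit: "munit a b * munit c d = (if b = c then munit a d else 0)"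
  by (rule fmat_eqI) (auto simp: munit_mult munit.rep_eq)

text \<open>For monic \<open>d\<close>, multiplication by \<open>X\<close> on polynomials modulo
  \<open>d\<close>, in the basis of powers of \<open>X\<close>.\<close>

definition companion :: "'a::comm_ring_1 poly => 'a fmat" where
  "companion d = of_fun (degree d) (degree d)
     (\<lambda>i j. (if i = Suc j then 1 else 0) - (if Suc j = degree d then coeff d i else 0))"

lemma companion_col:
  assumes "k < degree d"
  shows "Suc k < degree d ==> companion d * munit k 0 = munit (Suc k) 0"
    and "Suc k = degree d ==> companion d * munit k 0 = - (\<Sum>i<degree d. sm (coeff d i) (munit i 0))"
proof -
  have e: "ent (sm c (munit i 0)) a b = (if i = a then if b = 0 then c else 0 else 0)" for i a b and c :: 'a
    by (auto simp: sm_def ent_sc_mult munit.rep_eq)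
  show "companion d * munit k 0 = munit (Suc k) 0" if "Suc k < degree d"
    using that assms by (intro fmat_eqI) (auto simp: companion_def sum_mult_munit munit.rep_eq)
  show "companion d * munit k 0 = - (\<Sum>i<degree d. sm (coeff d i) (munit i 0))" if "Suc k = degree d"
    using that assms by (intro fmat_eqI) (auto simp: companion_def sum_mult_munit munit.rep_eq e)
qed

context quad_field begin

lemma companion_M: "companion d \<in> hu.M (degree d) (degree d)"
  by (auto simp: hu_M MM_iff companion_def)

text \<open>The Krylov matrix with columns \<open>v\<close>, \<open>A * v\<close>, up to
  \<open>A ^ (r - 1) * v\<close>.\<close>

definition kry :: "'a fmat => 'a fmat => nat => 'a fmat" where
  "kry A v r = (\<Sum>k<r. A ^ k * v * munit 0 k)"

lemma power_mult_M: "A \<in> hu.M n n ==> v \<in> hu.M n m ==> A ^ k * v \<in> hu.M n m"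
  by (induction k) (auto simp: mult.assoc intro: hu.M_mult)

lemma M_sum: "(\<And>i. i \<in> I ==> f i \<in> hu.M n m) ==> (\<Sum>i\<in>I. f i) \<in> hu.M n m"
  by (induction I rule: infinite_finite_induct) (auto intro: hu.M_add hu.M_0)

lemma munit_M: "i < n ==> j < m ==> munit i j \<in> hu.M n m"
  by (simp add: hu_M munit_MM)

lemma kry_M: "A \<in> hu.M n n ==> v \<in> hu.M n 1 ==> kry A v r \<in> hu.M n r"
  unfolding kry_def by (intro M_sum hu.M_mult[OF power_mult_M] munit_M) auto

lemma M_1_munit: "v \<in> hu.M n 1 ==> v * munit 0 0 = v"
proof -
  assume "v \<in> hu.M n 1"
  moreover have "(munit 0 0 :: 'a fmat) = eid 1" by (rule fmat_eqI) (simp add: munit.rep_eq eid.rep_eq)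
  ultimately show ?thesis by (simp add: hu.M_r)
qed

lemma kry_col: "v \<in> hu.M n 1 ==> k < r ==> kry A v r * munit k 0 = A ^ k * v"
proof -
  assume v: "v \<in> hu.M n 1" and k: "k < r"
  have "kry A v r * munit k 0 = (\<Sum>i<r. if i = k then A ^ i * v else 0)"
    unfolding kry_def sum_distrib_right by (rule sum.cong) (auto simp: mult.assoc munit_munit M_1_munit[OF v])
  then show ?thesis using k by simp
qed

lemma pev_annihil_top:
  assumes "lead_coeff d = 1"
  shows "pev d A = A ^ degree d + (\<Sum>k<degree d. sm (coeff d k) (A ^ k))"
  using pev_eq_sum[of d "Suc (degree d)" A] assms by (simp add: add.commute)

lemma kry_companion:
  assumes A: "A \<in> hu.M n n" and v: "v \<in> hu.M n 1" and d: "lead_coeff d = 1" and z: "pev d A * v = 0"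
  shows "A * kry A v (degree d) = kry A v (degree d) * companion d"
proof (rule fmat_col_eqI)
  let ?J = "kry A v (degree d)"
  note J = kry_M[OF A v, of "degree d"]
  show "A * ?J \<in> MM n (degree d)" "?J * companion d \<in> MM n (degree d)"
    using hu.M_mult[OF A J] hu.M_mult[OF J companion_M] by (simp_all add: hu_M)
  fix k assume k: "k < degree d"
  have l: "A * ?J * munit k 0 = A ^ Suc k * v" using kry_col[OF v k] by (simp add: mult.assoc)
  show "A * ?J * munit k 0 = ?J * companion d * munit k 0"
  proof (cases "Suc k = degree d")
    case False
    then show ?thesis unfolding l using k by (simp add: mult.assoc companion_col kry_col[OF v] del: power_Suc)
  next
    case True
    have "?J * companion d * munit k 0 = - (\<Sum>i<degree d. sm (coeff d i) (?J * munit i 0))"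
      using True k by (simp add: mult.assoc companion_col sum_distrib_left sm_simps)
    also have "... = - (\<Sum>i<degree d. sm (coeff d i) (A ^ i * v))"
      using kry_col[OF v] by (intro arg_cong[of _ _ uminus] sum.cong) auto
    also have "... = A ^ degree d * v - pev d A * v"
      unfolding pev_annihil_top[OF d] by (simp add: distrib_right sum_distrib_right sm_simps)
    finally show ?thesis unfolding l True by (simp add: z)
  qed
qed

lemma tp_sm: "tp (sm c X) = sm c (tp X)"
  by (rule fmat_eqI) (simp add: ent_ctrans sm_def ent_sc_mult)

lemma tp_power: "tp (X ^ k) = tp X ^ k"
proof (induction k)
  case 0
  show ?case by (rule fmat_eqI) (simp add: ent_ctrans one_fmat.rep_eq)
qed (simp_all add: tp_mult power_commutes)

lemma tp_pev: "tp (pev f X) = pev f (tp X)" for X :: "'b::comm_ring_1 fmat"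
proof (induction f)
  case (pCons a f)
  have 1: "tp (1 :: 'b fmat) = 1" by (rule fmat_eqI) (simp add: ent_ctrans one_fmat.rep_eq)
  show ?case using pCons pev_intertwine[of "tp X" "tp X" "tp X" f, OF refl]
    by (simp add: tp_add tp_sm 1 tp_mult)
qed simp

lemma kry_eval:
  assumes v: "v \<in> hu.M n 1" and x: "x \<in> hu.M r 1"
  defines "f \<equiv> \<Sum>k<r. monom (ent x k 0) k"
  shows "kry A v r * x = pev f A * v" "coeff f k = ent x k 0"
proof -
  have "munit 0 k * x = sm (ent x k 0) (munit 0 0)" for k
    using x by (intro fmat_eqI) (auto simp: munit_mult sm_def ent_sc_mult munit.rep_eq hu_M MM_iff)
  then show "kry A v r * x = pev f A * v"
    by (simp add: kry_def f_def pev_sum pev_monom sum_distrib_right mult.assoc sm_simps M_1_munit[OF v])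
  show "coeff f k = ent x k 0"
    using x by (auto simp: f_def coeff_sum hu_M MM_iff)
qed

text \<open>\<open>L\<close> has the rows \<open>w * A ^ j\<close> and \<open>J\<close> the columns
  \<open>A ^ k * v\<close>, so \<open>L * J\<close> is the Hankel matrix of the numbers
  \<open>w * A ^ (j + k) * v\<close>. By \<open>wv\<close> it has 1 on the antidiagonal and 0 before
  it, and so it is invertible.\<close>

lemma kry_pairing:
  assumes A: "A \<in> hu.M n n" and v: "v \<in> hu.M n 1" and w: "w \<in> hu.M 1 n"
    and d: "lead_coeff d = 1" "pev d A * eid n = 0"
    and wv: "\<And>k. k < degree d ==> w * (A ^ k * v) = (if Suc k = degree d then munit 0 0 else 0)"
  defines "L \<equiv> tp (kry (tp A) (tp w) (degree d))" and "J \<equiv> kry A v (degree d)"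
  obtains G where "L \<in> hu.M (degree d) n" "J \<in> hu.M n (degree d)" "A * J = J * companion d" "L * A = tp (companion d) * L"
    "G \<in> hu.M (degree d) (degree d)" "G * (L * J) = eid (degree d)"
proof -
  let ?r = "degree d"
  have tM: "tp X \<in> hu.M m k" if "X \<in> hu.M k m" for X k m using that by (simp add: hu_M MM_tp)
  have LM: "L \<in> hu.M ?r n" unfolding L_def by (intro tM kry_M A w)
  have JM: "J \<in> hu.M n ?r" unfolding J_def by (intro kry_M A v)
  have "pev d A * eid n * v = 0" using d by simp
  then have dv: "pev d A * v = 0" using v by (simp add: mult.assoc hu.M_l)
  have AJ: "A * J = J * companion d" unfolding J_def by (rule kry_companion[OF A v d(1) dv])
  have "w * (pev d A * eid n) = 0" using d(2) by simp
  moreover have "A * eid n = eid n * A" using A by (simp add: hu.M_l hu.M_r)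
  ultimately have "w * pev d A = 0" using pev_intertwine[of A "eid n" A d] w by (simp add: mult.assoc[symmetric] hu.M_r)
  then have "tp (w * pev d A) = 0" by simp
  then have "pev d (tp A) * tp w = 0" by (simp add: tp_mult tp_pev)
  from arg_cong[OF kry_companion[OF tM[OF A] tM[OF w] d(1) this], of tp]
  have LA: "L * A = tp (companion d) * L" by (simp add: L_def tp_mult)
  have row: "munit 0 j * L = w * A ^ j" if "j < ?r" for j
    using arg_cong[OF kry_col[OF tM[OF w] that, of "tp A"], of tp] by (simp add: L_def tp_mult tp_munit tp_power)
  have inj: "x = 0" if x: "x \<in> MM ?r 1" and z: "L * J * x = 0" for x
  proof (rule ccontr)
    assume "x ~= 0"
    define f where "f = (\<Sum>k<?r. monom (ent x k 0) k)"
    have xM: "x \<in> hu.M ?r 1" using x by (simp add: hu_M)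
    note f = kry_eval[OF v xM, folded f_def]
    have "f ~= 0"
    proof
      assume "f = 0"
      then have "ent x k 0 = 0" for k using f(2)[of k] by simp
      then have "x = 0" using x by (rule col_eq_0I)
      then show False using \<open>x ~= 0\<close> by simp
    qed
    have df: "degree f < ?r"
    proof (rule ccontr)
      assume "\<not> degree f < ?r"
      then have "ent x (degree f) 0 = 0" using x by (auto simp: MM_iff)
      then show False using f(2)[of "degree f"] \<open>f ~= 0\<close> by simp
    qed
    \<comment> \<open>With this row, \<open>X ^ j * f\<close> has degree
      \<open>degree d - 1\<close>, and \<open>w\<close> returns the leading coefficient of
      \<open>f\<close>.\<close>
    define j where "j = ?r - 1 - degree f"
    have j: "j < ?r" "j + degree f = ?r - 1" using df by (auto simp: j_def)
    have "munit 0 j * (L * J * x) = 0" using z by simp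
    then have "w * A ^ j * (J * x) = 0" using row[OF j(1)] by (simp add: mult.assoc[symmetric])
    then have "w * (pev (monom 1 j * f) A * v) = 0"
      using f(1)[of A] by (simp add: J_def pev_mult pev_monom mult.assoc)
    moreover have dg: "degree (monom 1 j * f) < ?r" using \<open>f ~= 0\<close> j df by (simp add: degree_mult_eq degree_monom_eq monom_eq_0_iff)
    ultimately have "(\<Sum>k<?r. sm (coeff (monom 1 j * f) k) (w * (A ^ k * v))) = 0"
      unfolding pev_eq_sum[OF dg] by (simp add: sum_distrib_left sum_distrib_right sm_simps)
    moreover have "(\<Sum>k<?r. sm (coeff (monom 1 j * f) k) (w * (A ^ k * v)))
      = (\<Sum>k<?r. if k = ?r - 1 then sm (lead_coeff f) (munit 0 0) else 0)"
    proof (rule sum.cong[OF refl])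
      fix k assume k: "k \<in> {..<?r}"
      have "coeff (monom 1 j * f) (?r - 1) = lead_coeff f" unfolding j(2)[symmetric] by (simp add: coeff_monom_mult)
      then show "sm (coeff (monom 1 j * f) k) (w * (A ^ k * v)) = (if k = ?r - 1 then sm (lead_coeff f) (munit 0 0) else 0)"
        using k wv[of k] df by (auto simp: le_less)
    qed
    ultimately have "sm (lead_coeff f) (munit 0 0 :: 'a fmat) = 0" using df by simp
    moreover have "(munit 0 0 :: 'a fmat) ~= 0"
    proof
      assume "munit 0 0 = (0 :: 'a fmat)"
      then have "ent (munit 0 0 :: 'a fmat) 0 0 = 0" by (simp only: zero_fmat.rep_eq)
      then show False by (simp add: munit.rep_eq)
    qed
    ultimately show False using \<open>f ~= 0\<close> by (simp add: sm_eq_0_iff)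
  qed
  have "L * J \<in> MM ?r ?r" using hu.M_mult[OF LM JM] by (simp add: hu_M)
  then obtain G where "G \<in> MM ?r ?r" "G * (L * J) = eid ?r" by (rule left_inverse_ex[OF _ inj])
  with that LM JM AJ LA show ?thesis by (simp add: hu_M)
qed

text \<open>\<open>A\<close> is similar to the block sum of \<open>K\<close>, of size
  \<open>r\<close>, and \<open>B\<close>: \<open>J\<close> and \<open>N\<close> are the block
  columns of the base change, \<open>E\<close> and \<open>P\<close> the block rows of its
  inverse.\<close>

definition simd :: "nat => nat => 'a fmat => 'a fmat => 'a fmat => bool" where
  "simd n r A K B \<longleftrightarrow> r \<le> n \<and> A \<in> hu.M n n \<and> K \<in> hu.M r r \<and> B \<in> hu.M (n - r) (n - r) \<and>
     (\<exists>J\<in>hu.M n r. \<exists>E\<in>hu.M r n. \<exists>N\<in>hu.M n (n - r). \<exists>P\<in>hu.M (n - r) n.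
       E * J = eid r \<and> P * N = eid (n - r) \<and> J * E + N * P = eid n \<and> E * N = 0 \<and> P * J = 0 \<and>
       A * J = J * K \<and> A * N = N * B \<and> E * A = K * E \<and> P * A = B * P)"

lemma simdI:
  assumes M: "r \<le> n" "A \<in> hu.M n n" "K \<in> hu.M r r" "J \<in> hu.M n r" "E \<in> hu.M r n" "N \<in> hu.M n (n - r)" "P \<in> hu.M (n - r) n"
    and EJ: "E * J = eid r" "P * N = eid (n - r)" "J * E + N * P = eid n"
    and AJ: "A * J = J * K" "E * A = K * E"
  shows "simd n r A K (P * A * N)"
proof -
  have "E * (J * E + N * P) = E" using M EJ by (simp add: hu.M_r)
  then have "E * N * P = 0" using EJ(1) M by (simp add: distrib_left mult.assoc[symmetric] hu.M_l)
  then have "E * N * (P * N) = 0" by (metis mult.assoc mult_zero_left)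
  then have EN: "E * N = 0" using EJ(2) M by (simp add: mult.assoc hu.M_r)
  have "(J * E + N * P) * J = J" using M EJ by (simp add: hu.M_l)
  then have "N * (P * J) = 0" using EJ(1) M by (simp add: distrib_right mult.assoc hu.M_r)
  then have "P * N * (P * J) = 0" by (simp add: mult.assoc)
  then have PJ: "P * J = 0" using EJ(2) M by (simp add: hu.M_l'[OF M(7)])
  have "A * N = (J * E + N * P) * (A * N)" using M EJ by (simp add: hu.M_l'[OF M(2)])
  also have "... = J * (E * A) * N + N * (P * A * N)" by (simp add: distrib_right mult.assoc)
  also have "J * (E * A) * N = 0" unfolding AJ(2) by (simp add: mult.assoc EN)
  finally have AN: "A * N = N * (P * A * N)" by simp
  have "P * A = P * A * (J * E + N * P)" using M EJ by (simp add: mult.assoc hu.M_r)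
  also have "... = P * (A * J) * E + P * A * N * P" by (simp add: distrib_left mult.assoc)
  also have "P * (A * J) * E = 0" unfolding AJ(1) by (simp add: mult.assoc[symmetric] PJ)
  finally have PA: "P * A = P * A * N * P" by simp
  show ?thesis unfolding simd_def using M EJ EN PJ AJ AN PA by (auto intro!: hu.M_mult)
qed

text \<open>Let \<open>v\<close> have the annihilator of the whole matrix, and let \<open>w\<close>
  be a functional that reads the coefficient of \<open>A ^ (r - 1) * v\<close> on the cyclic
  subspace of \<open>v\<close>. The common kernel of all \<open>w * A ^ j\<close> is invariant, and
  invertibility of the Hankel matrix makes it a complement of the cyclic subspace.\<close>

lemma cyclic_split:
  assumes A: "A \<in> hu.M n n" and n: "n > 0"
  obtains d B where "lead_coeff d = 1" "degree d > 0" "\<And>f. pev f A * eid n = 0 \<longleftrightarrow> d dvd f"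
    "simd n (degree d) A (companion d) B"
proof -
  obtain v where v: "v \<in> hu.M n 1" "\<And>f. pev f A * v = 0 \<longleftrightarrow> pev f A * eid n = 0" using maximal_order_vector[OF A] by blast
  obtain d where d: "lead_coeff d = 1" "\<And>f. pev f A * eid n = 0 \<longleftrightarrow> d dvd f"
    by (rule order_ex[OF A hu.e_in_M[of n n n]]) auto
  let ?r = "degree d"
  have dn: "pev d A * eid n = 0" by (simp add: d)
  have r0: "?r > 0"
  proof (rule ccontr)
    assume "\<not> ?r > 0"
    then have "d dvd 1" using d(1) by (metis is_unit_iff_degree leading_coeff_0_iff neq0_conv zero_neq_one)
    then have "pev 1 A * eid n = 0" using d(2) by blast
    then show False using n hu.e_eq_0_iff[of n] by simp
  qed
  define J where "J = kry A v ?r"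
  have JM: "J \<in> hu.M n ?r" unfolding J_def by (rule kry_M[OF A v(1)])
  have inj: "x = 0" if x: "x \<in> MM ?r 1" and z: "J * x = 0" for x
  proof -
    define f where "f = (\<Sum>k<?r. monom (ent x k 0) k)"
    have xM: "x \<in> hu.M ?r 1" using x by (simp add: hu_M)
    note f = kry_eval[OF v(1) xM, folded f_def]
    have "d dvd f" using z f(1)[of A] v(2) d(2) by (simp add: J_def)
    moreover have "degree f < ?r"
    proof (rule degree_lessI)
      show "f ~= 0 \<or> 0 < ?r" using r0 by simp
      show "\<forall>k\<ge>?r. coeff f k = 0" unfolding f(2) using x by (auto simp: MM_iff) (metis leD)
    qed
    ultimately have "f = 0" using dvd_imp_degree_le[of d f] by force
    then have "ent x k 0 = 0" for k using f(2)[of k] by simp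
    then show "x = 0" using x by (rule col_eq_0I)
  qed
  obtain L0 where L0: "L0 \<in> MM ?r n" "L0 * J = eid ?r" by (rule left_inverse_ex[OF JM[unfolded hu_M] inj])
  \<comment> \<open>The last row of a left inverse of the Krylov matrix.\<close>
  define w where "w = munit 0 (?r - 1) * L0"
  have w: "w \<in> hu.M 1 n" unfolding w_def using r0 L0 by (intro hu.M_mult[where m = ?r] munit_M) (auto simp: hu_M)
  have wv: "w * (A ^ k * v) = (if Suc k = ?r then munit 0 0 else 0)" if "k < ?r" for k
  proof -
    have "w * (A ^ k * v) = munit 0 (?r - 1) * (L0 * J) * munit k 0"
      using kry_col[OF v(1) that, of A] by (simp add: w_def J_def mult.assoc)
    also have "... = munit 0 (?r - 1) * munit k 0"
      using munit_M[of 0 1 "?r - 1" ?r] r0 by (simp add: L0(2) hu.M_r)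
    finally show ?thesis using that by (auto simp: munit_munit)
  qed
  obtain L G where L: "L \<in> hu.M ?r n" and AJ: "A * J = J * companion d" and LA: "L * A = tp (companion d) * L"
    and G: "G \<in> hu.M ?r ?r" "G * (L * J) = eid ?r"
    using kry_pairing[OF A v(1) w d(1) dn wv, folded J_def] by metis
  define E where "E = G * L"
  have E: "E \<in> hu.M ?r n" "E * J = eid ?r" using G L by (auto simp: E_def mult.assoc intro: hu.M_mult)
  have G2: "L * J * G = eid ?r" by (rule hu.inverse_commute[OF hu.M_mult[OF L JM] G])
  have "tp (companion d) * L * J = L * J * companion d" unfolding LA[symmetric] by (simp add: mult.assoc AJ)
  then have "G * (tp (companion d) * L * J) * G = G * (L * J) * companion d * G" by (simp add: mult.assoc)
  then have *: "G * tp (companion d) = companion d * G"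
  proof -
    assume h: "G * (tp (companion d) * L * J) * G = G * (L * J) * companion d * G"
    have tM: "tp (companion d) \<in> hu.M ?r ?r" using companion_M[of d] by (simp add: hu_M MM_tp)
    have "G * (tp (companion d) * L * J) * G = G * tp (companion d) * (L * J * G)" by (simp add: mult.assoc)
    also have "... = G * tp (companion d)" unfolding G2 by (rule hu.M_r[OF hu.M_mult[OF G(1) tM]])
    finally show ?thesis using h G(2) hu.M_l[OF companion_M[of d]] by simp
  qed
  have EA: "E * A = companion d * E" unfolding E_def by (simp add: mult.assoc LA) (simp add: mult.assoc[symmetric] *)
  obtain N P where NP: "?r \<le> n" "N \<in> MM n (n - ?r)" "P \<in> MM (n - ?r) n" "N * P = eid n - J * E" "P * N = eid (n - ?r)"
    using fmat_compl[of J n ?r E] JM E by (auto simp: hu_M)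
  have "simd n ?r A (companion d) (P * A * N)"
    by (rule simdI[OF NP(1) A companion_M JM E(1) _ _ E(2) NP(5) _ AJ EA]) (use NP in \<open>auto simp: hu_M\<close>)
  with that d r0 show ?thesis by blast
qed

section \<open>Kernel sizes as a complete similarity invariant\<close>

definition kd :: "nat => 'a fmat => 'a poly => nat" where
  "kd n A f = card {v \<in> hu.M n 1. pev f A * v = 0}"

lemma kd_pos: "kd n A f > 0"
proof -
  have "0 \<in> {v \<in> hu.M n 1. pev f A * v = 0}" using hu.M_0[of n 1] by auto
  moreover have "finite {v \<in> hu.M n 1. pev f A * v = 0}" by simp
  ultimately show ?thesis unfolding kd_def by (metis card_gt_0_iff empty_iff)
qed

lemma kd_full:
  shows "kd n A f = card (hu.M n 1) \<longleftrightarrow> pev f A * eid n = 0"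
proof
  assume "pev f A * eid n = 0"
  moreover have "pev f A * v = pev f A * eid n * v" if "v \<in> hu.M n 1" for v
    using that by (simp add: mult.assoc hu.M_l)
  ultimately have "{v \<in> hu.M n 1. pev f A * v = 0} = hu.M n 1" by auto
  then show "kd n A f = card (hu.M n 1)" by (simp add: kd_def)
next
  assume "kd n A f = card (hu.M n 1)"
  then have e: "{v \<in> hu.M n 1. pev f A * v = 0} = hu.M n 1"
    unfolding kd_def by (intro card_subset_eq) auto
  have z: "pev f A * munit k 0 = 0" if "k < n" for k
  proof -
    have "munit k 0 \<in> {v \<in> hu.M n 1. pev f A * v = 0}" unfolding e using that by (auto intro: munit_M)
    then show ?thesis by blast
  qed
  show "pev f A * eid n = 0"
  proof (rule fmat_eqI)
    fix i j
    show "ent (pev f A * eid n) i j = ent 0 i j"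
      using arg_cong[OF z[of j], of "\<lambda>X. ent X i 0"] by (simp add: ent_mult_eid sum_mult_munit)
  qed
qed

lemma kd_split:
  assumes "simd n r A K B"
  shows "kd n A f = kd r K f * kd (n - r) B f"
proof -
  obtain J E N P where M: "J \<in> hu.M n r" "E \<in> hu.M r n" "N \<in> hu.M n (n - r)" "P \<in> hu.M (n - r) n"
    and h: "E * J = eid r" "P * N = eid (n - r)" "J * E + N * P = eid n" "E * N = 0" "P * J = 0"
    and i: "A * J = J * K" "A * N = N * B" "E * A = K * E" "P * A = B * P"
    using assms unfolding simd_def by blast
  let ?S = "\<lambda>n A. {v \<in> hu.M n 1. pev f A * v = 0}"
  have "bij_betw (\<lambda>v. (E * v, P * v)) (?S n A) (?S r K \<times> ?S (n - r) B)"
  proof (rule bij_betw_byWitness[where f' = "\<lambda>(x, y). J * x + N * y"])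
    show "\<forall>a\<in>?S n A. (case (E * a, P * a) of (x, y) => J * x + N * y) = a"
    proof
      fix a assume "a \<in> ?S n A"
      then have "a \<in> hu.M n 1" by simp
      then have "(J * E + N * P) * a = a" unfolding h(3) by (rule hu.M_l)
      then show "(case (E * a, P * a) of (x, y) => J * x + N * y) = a" by (simp add: distrib_right mult.assoc)
    qed
    show "\<forall>a\<in>?S r K \<times> ?S (n - r) B. (\<lambda>v. (E * v, P * v)) (case a of (x, y) => J * x + N * y) = a"
      by (auto simp: distrib_left mult.assoc[symmetric] h hu.M_l[of _ r 1, unfolded One_nat_def] hu.M_l[of _ "n - r" 1, unfolded One_nat_def])
    show "(\<lambda>v. (E * v, P * v)) ` ?S n A \<subseteq> ?S r K \<times> ?S (n - r) B"
    proof (rule image_subsetI)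
      fix a assume a: "a \<in> ?S n A"
      have "pev f K * (E * a) = E * (pev f A * a)" using pev_intertwine[OF i(3)[symmetric], of f] by (simp add: mult.assoc[symmetric])
      moreover have "pev f B * (P * a) = P * (pev f A * a)" using pev_intertwine[OF i(4)[symmetric], of f] by (simp add: mult.assoc[symmetric])
      ultimately show "(E * a, P * a) \<in> ?S r K \<times> ?S (n - r) B" using a M by (auto intro: hu.M_mult)
    qed
    show "(\<lambda>(x, y). J * x + N * y) ` (?S r K \<times> ?S (n - r) B) \<subseteq> ?S n A"
    proof (rule image_subsetI)
      fix a assume "a \<in> ?S r K \<times> ?S (n - r) B"
      then obtain x y where a: "a = (x, y)" "x \<in> hu.M r 1" "y \<in> hu.M (n - r) 1" "pev f K * x = 0" "pev f B * y = 0" by auto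
      have "pev f A * (J * x + N * y) = J * (pev f K * x) + N * (pev f B * y)"
        using pev_intertwine[OF i(1), of f] pev_intertwine[OF i(2), of f] by (simp add: distrib_left mult.assoc[symmetric])
      then show "(case a of (x, y) => J * x + N * y) \<in> ?S n A"
        using a M by (auto intro!: hu.M_add hu.M_mult)
    qed
  qed
  then have "card (?S n A) = card (?S r K \<times> ?S (n - r) B)" by (rule bij_betw_same_card)
  then show ?thesis by (simp add: kd_def card_cartesian_product)
qed

definition sim :: "nat => 'a fmat => 'a fmat => bool" where
  "sim n A1 A2 \<longleftrightarrow> (\<exists>S\<in>hu.M n n. \<exists>T\<in>hu.M n n. T * S = eid n \<and> S * T = eid n \<and> A2 * S = S * A1)"

lemma sim_split:
  assumes "simd n r A1 K1 B1" "simd n r A2 K2 B2" "sim r K1 K2" "sim (n - r) B1 B2"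
  shows "sim n A1 A2"
proof -
  obtain J E N P where M: "J \<in> hu.M n r" "E \<in> hu.M r n" "N \<in> hu.M n (n - r)" "P \<in> hu.M (n - r) n"
    and h: "E * J = eid r" "P * N = eid (n - r)" "J * E + N * P = eid n" "E * N = 0" "P * J = 0"
    and i: "A1 * J = J * K1" "A1 * N = N * B1" "E * A1 = K1 * E" "P * A1 = B1 * P"
    using assms(1) unfolding simd_def by blast
  obtain J' E' N' P' where M': "J' \<in> hu.M n r" "E' \<in> hu.M r n" "N' \<in> hu.M n (n - r)" "P' \<in> hu.M (n - r) n"
    and h': "E' * J' = eid r" "P' * N' = eid (n - r)" "J' * E' + N' * P' = eid n" "E' * N' = 0" "P' * J' = 0"
    and i': "A2 * J' = J' * K2" "A2 * N' = N' * B2" "E' * A2 = K2 * E'" "P' * A2 = B2 * P'"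
    using assms(2) unfolding simd_def by blast
  obtain S T where S: "S \<in> hu.M r r" "T \<in> hu.M r r" "T * S = eid r" "S * T = eid r" "K2 * S = S * K1"
    using assms(3) unfolding sim_def by blast
  obtain U V where U: "U \<in> hu.M (n - r) (n - r)" "V \<in> hu.M (n - r) (n - r)" "V * U = eid (n - r)" "U * V = eid (n - r)" "B2 * U = U * B1"
    using assms(4) unfolding sim_def by blast
  define Q where "Q = J' * S * E + N' * U * P"
  define R where "R = J * T * E' + N * V * P'"
  have QM: "Q \<in> hu.M n n" "R \<in> hu.M n n"
    unfolding Q_def R_def
    by (rule hu.M_add[OF hu.M_mult[OF hu.M_mult[OF M'(1) S(1)] M(2)] hu.M_mult[OF hu.M_mult[OF M'(3) U(1)] M(4)]],
      rule hu.M_add[OF hu.M_mult[OF hu.M_mult[OF M(1) S(2)] M'(2)] hu.M_mult[OF hu.M_mult[OF M(3) U(2)] M'(4)]])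
  have "R * Q = J * T * (E' * J') * S * E + J * T * (E' * N') * U * P + N * V * (P' * J') * S * E + N * V * (P' * N') * U * P"
    by (simp add: Q_def R_def distrib_left distrib_right mult.assoc)
  also have "... = J * (T * S) * E + N * (V * U) * P"
    unfolding h' using S(2) U(2) by (simp add: mult.assoc hu.M_l'[OF S(1)] hu.M_l'[OF U(1)])
  also have "... = eid n" unfolding S(3) U(3) hu.M_r[OF M(1)] hu.M_r[OF M(3)] by (rule h(3))
  finally have RQ: "R * Q = eid n" .
  have "A2 * Q = (A2 * J') * S * E + (A2 * N') * U * P" by (simp add: Q_def distrib_left mult.assoc)
  also have "... = J' * (K2 * S) * E + N' * (B2 * U) * P" unfolding i' by (simp add: mult.assoc)
  also have "... = J' * S * (K1 * E) + N' * U * (B1 * P)" unfolding S(5) U(5) by (simp add: mult.assoc)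
  also have "... = Q * A1" unfolding i[symmetric] by (simp add: Q_def distrib_right mult.assoc)
  finally have "A2 * Q = Q * A1" .
  then show ?thesis unfolding sim_def using QM RQ hu.inverse_commute[OF QM RQ] by blast
qed

lemma sim_refl: "A \<in> hu.M n n ==> sim n A A"
  unfolding sim_def by (intro bexI[of _ "eid n"] conjI hu.e_in_M) (auto simp: eid_mult hu.M_l hu.M_r)

text \<open>The kernel of \<open>f(A)\<close> is everything exactly for the multiples of the minimal
  polynomial \<open>d\<close>, so the kernel sizes determine \<open>d\<close>. Both matrices split
  off the companion block of \<open>d\<close>; kernel sizes are multiplicative over block sums and
  positive, so those of the remaining blocks agree, and induction applies.\<close>

lemma sim_if_kd_eq:
  assumes "A1 \<in> hu.M n n" "A2 \<in> hu.M n n" "kd n A1 = kd n A2"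
  shows "sim n A1 A2"
  using assms
proof (induction n arbitrary: A1 A2 rule: less_induct)
  case (less n)
  show ?case
  proof (cases "n = 0")
    case True
    have "X = 0" if "X \<in> hu.M 0 0" for X using that by (intro fmat_eqI) (auto simp: hu_M MM_iff)
    then have "A1 = A2" using less.prems True by metis
    then show ?thesis using less.prems sim_refl by simp
  next
    case False
    then have n: "n > 0" by simp
    obtain d B1 where d: "lead_coeff d = 1" "degree d > 0" "\<And>f. pev f A1 * eid n = 0 \<longleftrightarrow> d dvd f"
      and s1: "simd n (degree d) A1 (companion d) B1" using cyclic_split[OF less.prems(1) n] by blast
    obtain d' B2 where d': "lead_coeff d' = 1" "degree d' > 0" "\<And>f. pev f A2 * eid n = 0 \<longleftrightarrow> d' dvd f"
      and s2: "simd n (degree d') A2 (companion d') B2" using cyclic_split[OF less.prems(2) n] by blast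
    have dv: "d dvd f \<longleftrightarrow> d' dvd f" for f
      unfolding d(3)[symmetric] d'(3)[symmetric] kd_full[symmetric] less.prems(3) ..
    have dd: "d' = d" by (rule monic_dvd_antisym[OF d'(1) d(1)]) (simp_all add: dv[symmetric], simp add: dv)
    note s2 = s2[unfolded dd]
    have le: "degree d \<le> n" "B1 \<in> hu.M (n - degree d) (n - degree d)" "B2 \<in> hu.M (n - degree d) (n - degree d)"
      using s1 s2 by (auto simp: simd_def)
    have "kd (n - degree d) B1 f = kd (n - degree d) B2 f" for f
      using kd_split[OF s1, of f] kd_split[OF s2, of f] less.prems(3) kd_pos[of "degree d" "companion d" f] by simp
    then have "sim (n - degree d) B1 B2" using less.IH[of "n - degree d" B1 B2] le d(2) n by auto
    then show ?thesis by (intro sim_split[OF s1 s2 sim_refl[OF companion_M]])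
  qed
qed

end

section \<open>Hilbert 90 and unitary similarity\<close>

text \<open>Let \<open>K\<close> be the kernel of the norm and \<open>P\<close> the group of fixed
  points of \<open>st\<close>. The order of \<open>G\<close> is \<open>card K\<close> times the
  number of norms. By \<open>h90\<close> the map \<open>w / st w\<close> is onto \<open>K\<close>,
  with cosets of \<open>P\<close> as fibres, so the order is also \<open>card P * card K\<close>.
  Hence there are \<open>card P\<close> norms, all in \<open>P\<close>, and every fixed element is a
  norm.\<close>

lemma norm_surj_if_hilbert90:
  fixes G :: "'b::semigroup_mult set"
  assumes fin: "finite G" and cl: "\<And>a b. a \<in> G ==> b \<in> G ==> a * b \<in> G"
    and comm: "\<And>a b. a \<in> G ==> b \<in> G ==> a * b = b * a"
    and u: "u \<in> G" "\<And>a. a \<in> G ==> u * a = a"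
    and iv: "\<And>a. a \<in> G ==> iv a \<in> G" "\<And>a. a \<in> G ==> iv a * a = u"
    and st: "\<And>a. a \<in> G ==> st a \<in> G" "\<And>a. a \<in> G ==> st (st a) = a"
      "\<And>a b. a \<in> G ==> b \<in> G ==> st (a * b) = st a * st b"
    and h90: "\<And>a. a \<in> G ==> a * st a = u ==> \<exists>w\<in>G. w = a * st w"
    and h: "h \<in> G" "st h = h"
  shows "\<exists>z\<in>G. z * st z = h"
proof -
  define N where "N a = a * st a" for a
  define K where "K = {a \<in> G. N a = u}"
  define P where "P = {a \<in> G. st a = a}"
  have ur: "a * u = a" if "a \<in> G" for a using comm[OF that u(1)] u(2)[OF that] by simp
  have stu: "st u = u"
  proof -
    have "st u = u * st u" using u st(1) by simp
    then have "st (st u) = st (u * st u)" by simp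
    then have "u = st u * u" using st(2,3) st(1) u(1) by simp
    then show ?thesis using ur st(1) u(1) by simp
  qed
  have sw: "(a * b) * (c * d) = (a * c) * (b * d)" if "a \<in> G" "b \<in> G" "c \<in> G" "d \<in> G" for a b c d
  proof -
    have "(a * b) * (c * d) = a * (b * c) * d" by (simp add: mult.assoc)
    also have "b * c = c * b" using that comm by blast
    finally show ?thesis by (simp add: mult.assoc)
  qed
  have NM: "N (a * b) = N a * N b" if "a \<in> G" "b \<in> G" for a b
    unfolding N_def st(3)[OF that] by (rule sw) (use that st in auto)
  have NG: "N a \<in> G" if "a \<in> G" for a using that cl st by (simp add: N_def)
  have Nu: "N u = u" using u by (simp add: N_def stu)
  have canc: "iv a * (a * x) = x" "a * (iv a * x) = x" if "a \<in> G" "x \<in> G" for a x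
    using that iv[OF that(1)] comm[OF that(1) iv(1)[OF that(1)]] u(2) by (simp_all add: mult.assoc[symmetric])
  have KG: "K \<subseteq> G" "P \<subseteq> G" by (auto simp: K_def P_def)
  have fib1: "card {a \<in> G. N a = b} = card K" if "b \<in> N ` G" for b
  proof -
    from that obtain c where c: "c \<in> G" "b = N c" by blast
    have "bij_betw (\<lambda>k. c * k) K {a \<in> G. N a = b}"
    proof (rule bij_betw_byWitness[where f' = "\<lambda>a. iv c * a"])
      show "\<forall>a\<in>K. iv c * (c * a) = a" "\<forall>a\<in>{a \<in> G. N a = b}. c * (iv c * a) = a"
        using canc[OF c(1)] KG by auto
      show "(\<lambda>k. c * k) ` K \<subseteq> {a \<in> G. N a = b}"
        using c cl NM ur NG by (auto simp: K_def)
      have "N (iv c * a) = u" if "a \<in> G" "N a = b" for a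
        using NM[OF iv(1)[OF c(1)] that(1)] NM[OF iv(1)[OF c(1)] c(1)] that c Nu iv(2) by simp
      then show "(\<lambda>a. iv c * a) ` {a \<in> G. N a = b} \<subseteq> K"
        using c cl iv by (auto simp: K_def)
    qed
    then show ?thesis using bij_betw_same_card by metis
  qed
  have c1: "card G = card K * card (N ` G)" using fin by (intro card_fibres[where f = N] fib1) auto
  define ph where "ph w = w * iv (st w)" for w
  have phi: "ph w = a \<longleftrightarrow> w = a * st w" if "w \<in> G" "a \<in> G" for w a
  proof
    assume "ph w = a"
    moreover have "ph w * st w = w * (iv (st w) * st w)" by (simp add: ph_def mult.assoc)
    ultimately have "a * st w = w * (iv (st w) * st w)" by simp
    then show "w = a * st w" using that st iv ur by simp
  next
    assume w: "w = a * st w"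
    have "ph w = a * st w * iv (st w)" using w by (simp add: ph_def)
    also have "... = a * (st w * iv (st w))" by (simp add: mult.assoc)
    also have "... = a * u" using comm st(1) iv that by metis
    finally show "ph w = a" using that ur by simp
  qed
  have phG: "ph w \<in> G" if "w \<in> G" for w using that cl st iv by (simp add: ph_def)
  have Nst: "N (st w) = N w" if "w \<in> G" for w using that st comm by (simp add: N_def)
  have phK: "ph w \<in> K" if w: "w \<in> G" for w
  proof -
    have "w = ph w * st w" using phi[OF w phG[OF w]] by simp
    then have "N w = N (ph w) * N w" using NM[OF phG[OF w] st(1)[OF w]] Nst[OF w] by metis
    then have "N w * iv (N w) = N (ph w) * (N w * iv (N w))" by (metis mult.assoc)
    moreover have "N w * iv (N w) = u" using comm NG iv w by metis
    ultimately have "N (ph w) = u" using ur NG phG w by metis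
    then show ?thesis using phG w by (simp add: K_def)
  qed
  have fib2: "card {w \<in> G. ph w = a} = card P" if a: "a \<in> K" for a
  proof -
    have aG: "a \<in> G" "a * st a = u" using a by (auto simp: K_def N_def)
    obtain w0 where w0: "w0 \<in> G" "w0 = a * st w0" using h90[OF aG] by blast
    have "bij_betw (\<lambda>p. w0 * p) P {w \<in> G. ph w = a}"
    proof (rule bij_betw_byWitness[where f' = "\<lambda>w. iv w0 * w"])
      show "\<forall>p\<in>P. iv w0 * (w0 * p) = p" "\<forall>w\<in>{w \<in> G. ph w = a}. w0 * (iv w0 * w) = w"
        using canc[OF w0(1)] KG by auto
      have "ph (w0 * p) = a" if "p \<in> P" for p
      proof -
        have p: "p \<in> G" "st p = p" using that by (auto simp: P_def)
        have "a * st (w0 * p) = (a * st w0) * p" using st(3)[OF w0(1) p(1)] p(2) by (simp add: mult.assoc)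
        then have "w0 * p = a * st (w0 * p)" using w0(2) by simp
        then show ?thesis using phi[OF cl[OF w0(1) p(1)] aG(1)] by blast
      qed
      then show "(\<lambda>p. w0 * p) ` P \<subseteq> {w \<in> G. ph w = a}" using KG cl w0 by auto
      have "iv w0 * w \<in> P" if w: "w \<in> G" "ph w = a" for w
      proof -
        define p where "p = iv w0 * w"
        have pG: "p \<in> G" using w w0 cl iv by (simp add: p_def)
        have wp: "w = w0 * p" using canc[OF w0(1) w(1)] by (simp add: p_def)
        have "w = a * st w" using phi[OF w(1) aG(1)] w(2) by blast
        then have "w0 * p = a * st (w0 * p)" using wp by simp
        also have "... = (a * st w0) * st p" using st(3)[OF w0(1) pG] by (simp add: mult.assoc)
        also have "... = w0 * st p" using w0(2) by simp
        finally have "iv w0 * (w0 * p) = iv w0 * (w0 * st p)" by simp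
        then have "st p = p" using canc[OF w0(1)] pG st by simp
        then show ?thesis using pG by (simp add: P_def p_def)
      qed
      then show "(\<lambda>w. iv w0 * w) ` {w \<in> G. ph w = a} \<subseteq> P" by auto
    qed
    then show ?thesis using bij_betw_same_card by metis
  qed
  have c2: "card G = card P * card K"
    using fin KG by (intro card_fibres[where f = ph] fib2 phK) (auto intro: finite_subset)
  have "u \<in> K" using u Nu by (simp add: K_def)
  then have "card K > 0" using fin KG by (auto simp: card_gt_0_iff intro: finite_subset)
  then have "card (N ` G) = card P" using c1 c2 by simp
  moreover have "N ` G \<subseteq> P" using NG st comm by (auto simp: P_def N_def)
  ultimately have "N ` G = P" using fin KG by (intro card_subset_eq) (auto intro: finite_subset)
  moreover have "h \<in> P" using h by (simp add: P_def)
  ultimately show ?thesis by (auto simp: N_def)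
qed

lemma power_mult_commuting: "x * y = y * x ==> (x * y) ^ j = x ^ j * y ^ j" for x y :: "'b::monoid_mult"
proof (induction j)
  case (Suc j)
  have c: "y * x ^ j = x ^ j * y"
    using Suc.prems by (induction j) (simp_all add: mult.assoc, metis mult.assoc)
  have "(x * y) ^ Suc j = x * (y * x ^ j) * y ^ j" by (simp add: mult.assoc Suc.IH[OF Suc.prems])
  also have "... = x ^ Suc j * y ^ Suc j" unfolding c by (simp add: mult.assoc)
  finally show ?case .
qed simp

context quad_field begin

text \<open>The element \<open>w\<close> is sought in the form \<open>a + z * star a\<close>; it is invertible as soon as the idempotent
  among its powers is as large as possible.\<close>

lemma hilbert90:
  fixes Z :: "'a fmat set"
  assumes ZM: "Z \<subseteq> hu.M n n" and comm: "\<And>x y. x \<in> Z ==> y \<in> Z ==> x * y = y * x"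
    and cl: "\<And>x y. x \<in> Z ==> y \<in> Z ==> x + y \<in> Z" "\<And>x y. x \<in> Z ==> y \<in> Z ==> x * y \<in> Z"
      "\<And>x. x \<in> Z ==> star x \<in> Z" "\<And>x c. x \<in> Z ==> sm c x \<in> Z" "eid n \<in> Z"
    and z: "z \<in> Z" "z * star z = eid n"
  shows "\<exists>w\<in>Z. w = z * star w \<and> (\<exists>y\<in>hu.M n n. y * w = eid n)"
proof -
  let ?u = "eid n :: 'a fmat"
  define W where "W a = a + z * star a" for a
  have zM: "z \<in> hu.M n n" using z ZM by auto
  have szz: "star z * z = ?u" unfolding z(2)[symmetric] by (rule comm[OF cl(3)[OF z(1)] z(1)])
  have cl_diff: "x - y \<in> Z" if "x \<in> Z" "y \<in> Z" for x y
    using cl(1)[OF that(1) cl(4)[OF that(2), of "- 1"]] by (simp add: sm_left_minus)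
  have WZ: "W a \<in> Z" if "a \<in> Z" for a using that z cl by (simp add: W_def)
  have W: "W a = z * star (W a)" if a: "a \<in> Z" for a
  proof -
    have "z * star (W a) = z * star a + z * (a * star z)" by (simp add: W_def star_add star_mult distrib_left)
    also have "a * star z = star z * a" by (rule comm[OF a cl(3)[OF z(1)]])
    also have "z * (star z * a) = a" using a ZM by (simp add: mult.assoc[symmetric] z(2) hu.M_l[of a n n] subset_iff)
    finally show ?thesis by (simp add: W_def add.commute)
  qed
  have uM: "x * ?u = x" "?u * x = x" if "x \<in> Z" for x using that ZM by (auto simp: hu.M_l hu.M_r)
  have pZ: "x ^ j * y \<in> Z" if "x \<in> Z" "y \<in> Z" for x y j
    using that by (induction j) (auto simp: mult.assoc cl)
  have pZ': "x ^ j \<in> Z" if "x \<in> Z" "j > 0" for x j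
    using pZ[OF that(1) that(1), of "j - 1"] that(2) by (cases j) (simp_all add: power_commutes)
  \<comment> \<open>For \<open>w = z * star w\<close> an idempotent power \<open>e\<close> satisfies
    \<open>e = z ^ j * star e\<close>, hence \<open>e * star e = e\<close>, and the left side is
    Hermitian.\<close>
  have self: "star e = e" if w: "w \<in> Z" "w = z * star w" and e: "e = w ^ j" "e * e = e" for w e j
  proof -
    have se: "star e = star w ^ j" by (simp add: e(1) hu.st_power)
    have 1: "e = z ^ j * star e"
    proof -
      have "w ^ j = (z * star w) ^ j" using w(2) by simp
      also have "... = z ^ j * star w ^ j" by (rule power_mult_commuting[OF comm[OF z(1) cl(3)[OF w(1)]]])
      finally show ?thesis unfolding e(1)[symmetric] se[symmetric] .
    qed
    have sese: "star e * star e = star e" using arg_cong[OF e(2), of star] by (simp add: star_mult)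
    have e1: "e * star e = e"
    proof -
      have "e * star e = z ^ j * (star e * star e)" using 1 by (metis mult.assoc)
      then show ?thesis using 1 sese by simp
    qed
    have "star (e * star e) = e * star e" by (simp add: star_mult)
    then show ?thesis unfolding e1 .
  qed
  define E where "E = {e \<in> Z. e * e = e \<and> (\<exists>a\<in>Z. \<exists>N>0. W a ^ N = e)}"
  have sE: "star e = e" if "e \<in> E" for e
  proof -
    from that have ee: "e * e = e" and "\<exists>a\<in>Z. \<exists>N>0. W a ^ N = e" unfolding E_def by simp_all
    then obtain a N where a: "a \<in> Z" "W a ^ N = e" by auto
    show ?thesis by (rule self[OF WZ[OF a(1)] W[OF a(1)] a(2)[symmetric] ee])
  qed
  have "E \<subseteq> hu.M n n" using ZM by (auto simp: E_def)
  then have finE: "finite E" by (rule finite_subset) simp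
  \<comment> \<open>The size of an idempotent, measured by the number of matrices that it fixes from
    the right; it grows when a nonzero orthogonal idempotent is added.\<close>
  define sz where "sz e = card {x \<in> hu.M n n. x * e = x}" for e
  have Ex: "\<exists>g\<in>E. \<exists>M>0. W b ^ M = g" if b: "b \<in> Z" for b
  proof -
    obtain M where M: "M > 0" "W b ^ M * W b ^ M = W b ^ M"
      using hu.power_idem[of "W b" n] WZ[OF b] ZM by blast
    then have "W b ^ M \<in> E" using b pZ'[OF WZ[OF b]] unfolding E_def by blast
    with M show ?thesis by blast
  qed
  then have "E ~= {}" using cl(5) by blast
  then obtain e where e: "e \<in> E" "\<And>e'. e' \<in> E ==> sz e' \<le> sz e"
  proof -
    have "Max (sz ` E) \<in> sz ` E" using finE \<open>E ~= {}\<close> by (intro Max_in) auto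
    then obtain e where "e \<in> E" "sz e = Max (sz ` E)" by auto
    moreover from this have "sz e' \<le> sz e" if "e' \<in> E" for e' using finE that by simp
    ultimately show ?thesis using that by blast
  qed
  obtain a N where a: "a \<in> Z" "N > 0" "W a ^ N = e" and ee: "e * e = e" and eZ: "e \<in> Z" using e(1) by (auto simp: E_def)
  have "e = ?u"
  proof (rule ccontr)
    assume ne: "e ~= ?u"
    define f where "f = ?u - e"
    have f0: "f ~= 0" using ne by (simp add: f_def)
    have fZ: "f \<in> Z" unfolding f_def by (rule cl_diff[OF cl(5) eZ])
    have ef: "e * f = 0" "f * e = 0" "f * f = f" "e + f = ?u"
      using uM[OF eZ] ee by (simp_all add: f_def left_diff_distrib right_diff_distrib eid_mult)
    have sf: "star f = f" using sE[OF e(1)] by (simp add: f_def hu.st_diff)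
    \<comment> \<open>If no power of \<open>W b\<close> kills \<open>f\<close>, use \<open>a\<close>
      on the part of \<open>e\<close> and \<open>b\<close> on the part of \<open>f\<close>. The
      combined element has the idempotent power \<open>e + g * f\<close> with
      \<open>g * f ~= 0\<close>, against the maximality of \<open>e\<close>.\<close>
    have main: False if b: "b \<in> Z" and nn: "\<And>M. W b ^ M * f ~= 0" for b
    proof -
      obtain g M where g: "g \<in> E" "M > 0" "W b ^ M = g" using Ex[OF b] by blast
      have gg: "g * g = g" "g \<in> Z" using g by (auto simp: E_def)
      define a' where "a' = a * e + b * f"
      have a'Z: "a' \<in> Z" unfolding a'_def using a b eZ fZ cl by simp
      have "W a' = W a * e + W b * f"
      proof -
        have "star a' = star a * e + star b * f"
          using comm[OF eZ cl(3)[OF a(1)]] comm[OF fZ cl(3)[OF b]] by (simp add: a'_def star_add star_mult sE[OF e(1)] sf)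
        then show ?thesis by (simp add: W_def a'_def distrib_left distrib_right mult.assoc)
      qed
      moreover have "(p * e + r * f) ^ j * ?u = p ^ j * e + r ^ j * f" if p: "p \<in> Z" "r \<in> Z" for p r j
      proof (induction j)
        case 0
        then show ?case by (simp add: ef)
      next
        case (Suc j)
        have 1: "e * p ^ j = p ^ j * e" "f * p ^ j = p ^ j * f" "e * r ^ j = r ^ j * e" "f * r ^ j = r ^ j * f"
          using hu.commute_power[OF comm[OF p(1) eZ], of j] hu.commute_power[OF comm[OF p(1) fZ], of j]
            hu.commute_power[OF comm[OF p(2) eZ], of j] hu.commute_power[OF comm[OF p(2) fZ], of j] by simp_all
        have "(p * e + r * f) ^ Suc j * ?u = (p * e + r * f) * (p ^ j * e + r ^ j * f)" using Suc by (simp add: mult.assoc)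
        also have "... = p * (e * p ^ j) * e + p * (e * r ^ j) * f + r * (f * p ^ j) * e + r * (f * r ^ j) * f"
          by (simp add: distrib_left distrib_right mult.assoc)
        also have "... = p ^ Suc j * e + r ^ Suc j * f"
          unfolding 1 by (simp add: mult.assoc ee ef)
        finally show ?case .
      qed
      ultimately have "W a' ^ (N * M) * ?u = W a ^ (N * M) * e + W b ^ (N * M) * f"
        using WZ a(1) b by simp
      moreover have "W a ^ (N * M) = e" unfolding power_mult a(3) using g(2) ee by (induction M rule: nat_induct_non_zero) auto
      moreover have "W b ^ (N * M) = g"
      proof -
        have "g ^ N = g" using a(2) gg(1) by (induction N rule: nat_induct_non_zero) auto
        then show ?thesis unfolding mult.commute[of N] power_mult g(3) .
      qed
      moreover have NM: "N * M > 0" using a(2) g(2) by simp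
      ultimately have We: "W a' ^ (N * M) = e + g * f" using uM(1)[OF pZ'[OF WZ[OF a'Z] NM]] ee by simp
      have gf: "g * f = f * g" "g * e = e * g" by (rule comm[OF gg(2) fZ], rule comm[OF gg(2) eZ])
      have efg: "e * (g * f) = 0" "g * f * e = 0" "g * f * (g * f) = g * f"
      proof -
        show "e * (g * f) = 0" unfolding gf(1) by (simp add: mult.assoc[symmetric] ef)
        show "g * f * e = 0" by (simp add: mult.assoc ef)
        have "g * f * (g * f) = g * (f * g) * f" by (simp add: mult.assoc)
        also have "... = g * g * (f * f)" unfolding gf(1)[symmetric] by (simp add: mult.assoc)
        finally show "g * f * (g * f) = g * f" by (simp add: gg ef)
      qed
      have id: "(e + g * f) * (e + g * f) = e + g * f" by (simp add: distrib_left distrib_right ee efg)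
      have "e + g * f \<in> E" unfolding E_def using id We NM a'Z cl eZ fZ gg by blast
      then have "sz (e + g * f) \<le> sz e" by (rule e(2))
      moreover have "sz e < sz (e + g * f)"
        unfolding sz_def
      proof (rule psubset_card_mono)
        show "finite {x \<in> hu.M n n. x * (e + g * f) = x}" by simp
        have "x * (e + g * f) = x" if "x * e = x" for x
        proof -
          have "x * (g * f) = x * (e * (g * f))" using that by (simp add: mult.assoc[symmetric])
          then show ?thesis using that by (simp add: distrib_left efg)
        qed
        moreover have "g * f \<in> {x \<in> hu.M n n. x * (e + g * f) = x}" using cl(2)[OF gg(2) fZ] ZM efg by (auto simp: distrib_left)
        moreover have "g * f * e ~= g * f" unfolding efg using nn[of M] g(3) by simp
        ultimately show "{x \<in> hu.M n n. x * e = x} \<subset> {x \<in> hu.M n n. x * (e + g * f) = x}" by blast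
      qed
      ultimately show False by simp
    qed
    show False
    proof (cases "\<exists>M. W ?u ^ M * f = 0")
      case False
      then show False using main[OF cl(5)] by blast
    next
      case True
      define P where "P M \<longleftrightarrow> W ?u ^ M * f = 0" for M
      define m where "m = (LEAST M. P M)"
      have "\<exists>M. P M" using True by (simp add: P_def)
      then have "P m" unfolding m_def by (rule LeastI_ex)
      then have m: "W ?u ^ m * f = 0" by (simp only: P_def)
      have "m ~= 0" using m f0 by (cases m) auto
      define f1 where "f1 = W ?u ^ (m - 1) * f"
      have "m - 1 < (LEAST M. P M)" unfolding m_def[symmetric] using \<open>m ~= 0\<close> by simp
      then have "\<not> P (m - 1)" by (rule not_less_Least)
      then have f1: "f1 ~= 0" unfolding P_def f1_def .
      have f1Z: "f1 \<in> Z" unfolding f1_def by (rule pZ[OF WZ[OF cl(5)] fZ])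
      have Wf1: "W ?u * f1 = 0" using m \<open>m ~= 0\<close> by (cases m) (simp_all add: f1_def mult.assoc)
      \<comment> \<open>Since \<open>W (eid n)\<close> is nilpotent on the part of \<open>f\<close>,
        there is a nonzero \<open>f1\<close> on which \<open>z\<close> is -1. On it \<open>W\<close>
        of the scalar \<open>\<epsilon>\<close> acts as \<open>\<epsilon> - \<epsilon> ^ q\<close>,
        which is not 0 for \<open>\<epsilon>\<close> outside \<open>F0\<close>.\<close>
      then have zf: "z * f1 = - f1" using uM[OF f1Z] zM by (simp add: W_def distrib_right hu.M_r eq_neg_iff_add_eq_0 add.commute)
      obtain \<epsilon> :: 'a where \<epsilon>: "\<epsilon> ^ q ~= \<epsilon>" by (rule nonreal_ex)
      define b where "b = sm \<epsilon> ?u"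
      have bZ: "b \<in> Z" unfolding b_def by (intro cl)
      have "W b * f1 = sm \<epsilon> f1 + sm (\<epsilon> ^ q) (z * f1)"
        using uM[OF f1Z] hu.M_r[OF zM] by (simp add: W_def b_def distrib_right star_sm sm_simps)
      then have "W b * f1 = sm (\<epsilon> - \<epsilon> ^ q) f1" by (simp add: zf sm_minus sm_left_diff)
      then have pw: "W b ^ j * f1 = sm ((\<epsilon> - \<epsilon> ^ q) ^ j) f1" for j
        by (induction j) (simp_all add: mult.assoc sm_simps mult.commute)
      have "W b ^ j * f ~= 0" for j
      proof
        assume "W b ^ j * f = 0"
        then have "W ?u ^ (m - 1) * (W b ^ j * f) = 0" by simp
        moreover have "W ?u ^ (m - 1) * W b ^ j = W b ^ j * W ?u ^ (m - 1)"
          by (rule hu.commute_power[OF hu.commute_power[OF comm[OF WZ[OF bZ] WZ[OF cl(5)]], symmetric]])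
        ultimately have "W b ^ j * f1 = 0" unfolding f1_def by (simp add: mult.assoc[symmetric])
        then show False unfolding pw using f1 \<epsilon> by (simp add: sm_eq_0_iff)
      qed
      then show False using main[OF bZ] by blast
    qed
  qed
  then have "W a ^ (N - 1) * ?u * W a = ?u"
    using a(2,3) uM[OF WZ[OF a(1)]] by (cases N) (simp_all add: mult.assoc power_commutes)
  moreover have "W a ^ (N - 1) * ?u \<in> hu.M n n" using pZ[OF WZ[OF a(1)] cl(5)] ZM by blast
  ultimately show ?thesis using WZ[OF a(1)] W[OF a(1)] by blast
qed

lemma herm_norm:
  assumes h: "h \<in> hu.H n" and t: "t \<in> hu.M n n" "t * h = eid n"
  obtains z where "z \<in> hu.M n n" "z * star z = h" "star z * z = h"
    "\<And>y. y \<in> hu.M n n ==> y * h = h * y ==> y * z = z * y"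
proof -
  have hM: "h \<in> hu.M n n" "star h = h" using h by (auto simp: hu.H_def)
  \<comment> \<open>The bicommutant of \<open>h\<close>. It is commutative: \<open>h\<close>
    commutes with itself, so the elements of \<open>Z\<close> commute with \<open>h\<close> and
    therefore with each other.\<close>
  define Z where "Z = {z \<in> hu.M n n. \<forall>y\<in>hu.M n n. y * h = h * y \<longrightarrow> y * z = z * y}"
  have ZM: "Z \<subseteq> hu.M n n" by (auto simp: Z_def)
  have hZ: "h \<in> Z" using hM by (simp add: Z_def)
  have Zc: "y * x = x * y" if "x \<in> Z" "y \<in> hu.M n n" "y * h = h * y" for x y using that by (simp add: Z_def)
  have ZI: "x \<in> Z" if "x \<in> hu.M n n" "\<And>y. y \<in> hu.M n n ==> y * h = h * y ==> y * x = x * y" for x using that by (simp add: Z_def)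
  have comm: "x * y = y * x" if "x \<in> Z" "y \<in> Z" for x y
  proof -
    have "h * y = y * h" using Zc[OF that(2) hM(1) refl] .
    then show ?thesis using Zc[OF that(1), of y] that ZM by auto
  qed
  have add: "x + y \<in> Z" if "x \<in> Z" "y \<in> Z" for x y
  proof (rule ZI)
    show "x + y \<in> hu.M n n" using that ZM by (auto intro: hu.M_add)
    fix k assume k: "k \<in> hu.M n n" "k * h = h * k"
    show "k * (x + y) = (x + y) * k" using Zc[OF that(1) k] Zc[OF that(2) k] by (simp add: distrib_left distrib_right)
  qed
  have mult: "x * y \<in> Z" if "x \<in> Z" "y \<in> Z" for x y
  proof (rule ZI)
    show "x * y \<in> hu.M n n" using that ZM by (auto intro: hu.M_mult)
    fix k assume k: "k \<in> hu.M n n" "k * h = h * k"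
    have "k * (x * y) = (k * x) * y" by (simp add: mult.assoc)
    also have "... = x * (k * y)" using Zc[OF that(1) k] by (simp add: mult.assoc)
    also have "... = x * y * k" using Zc[OF that(2) k] by (simp add: mult.assoc)
    finally show "k * (x * y) = x * y * k" .
  qed
  have star: "star x \<in> Z" if "x \<in> Z" for x
  proof (rule ZI)
    show "star x \<in> hu.M n n" using that ZM by (auto intro: hu.M_st)
    fix k assume k: "k \<in> hu.M n n" "k * h = h * k"
    have "star k * h = h * star k" using arg_cong[OF k(2), of star] by (simp add: star_mult hM)
    then have "star k * x = x * star k" using Zc[OF that] hu.M_st[OF k(1)] by blast
    from arg_cong[OF this, of star] show "k * star x = star x * k" by (simp add: star_mult)
  qed
  have smZ: "sm c x \<in> Z" if "x \<in> Z" for c x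
  proof (rule ZI)
    show "sm c x \<in> hu.M n n" using that ZM by (auto intro: M_sm)
    fix k assume k: "k \<in> hu.M n n" "k * h = h * k"
    show "k * sm c x = sm c x * k" using Zc[OF that k] by (simp add: sm_simps)
  qed
  have eZ: "eid n \<in> Z" by (rule ZI) (auto simp: hu.M_l hu.M_r hu.e_in_M)
  define G where "G = {x \<in> Z. \<exists>y\<in>hu.M n n. y * x = eid n}"
  define iv where "iv x = (SOME y. y \<in> hu.M n n \<and> y * x = eid n)" for x
  have iv: "iv x \<in> hu.M n n" "iv x * x = eid n" "x * iv x = eid n" if "x \<in> G" for x
  proof -
    have "\<exists>y. y \<in> hu.M n n \<and> y * x = eid n" using that by (auto simp: G_def)
    from someI_ex[OF this] show *: "iv x \<in> hu.M n n" "iv x * x = eid n" by (auto simp: iv_def)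
    show "x * iv x = eid n" by (rule hu.inverse_commute[OF _ *]) (use that ZM in \<open>auto simp: G_def\<close>)
  qed
  have GZ: "x \<in> Z" "x \<in> hu.M n n" if "x \<in> G" for x using that ZM by (auto simp: G_def)
  have ivG: "iv x \<in> G" if "x \<in> G" for x
  proof -
    note i = iv[OF that]
    have "iv x \<in> Z"
    proof (rule ZI[OF i(1)])
      fix k assume k: "k \<in> hu.M n n" "k * h = h * k"
      have "iv x * (k * x) * iv x = iv x * (x * k) * iv x" using Zc[OF GZ(1)[OF that] k] by simp
      then have "iv x * k * (x * iv x) = (iv x * x) * k * iv x" by (simp add: mult.assoc)
      then show "k * iv x = iv x * k" unfolding i(2,3) using k(1) i(1) by (simp add: hu.M_l hu.M_r mult.assoc)
    qed
    then show ?thesis using i GZ[OF that] by (auto simp: G_def)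
  qed
  have Gm: "x * y \<in> G" if "x \<in> G" "y \<in> G" for x y
  proof -
    have "iv y * iv x * (x * y) = iv y * (iv x * x) * y" by (simp add: mult.assoc)
    also have "... = eid n" using iv that by (simp add: mult.assoc hu.M_l[OF GZ(2)[OF that(2)]])
    finally have e: "iv y * iv x * (x * y) = eid n" .
    show ?thesis unfolding G_def
      using mult[OF GZ(1)[OF that(1)] GZ(1)[OF that(2)]] e hu.M_mult[OF iv(1)[OF that(2)] iv(1)[OF that(1)]] by blast
  qed
  have Gs: "star x \<in> G" if "x \<in> G" for x
  proof -
    have "star (iv x) * star x = eid n" using arg_cong[OF iv(3)[OF that], of star] by (simp add: star_mult)
    then show ?thesis unfolding G_def using star[OF GZ(1)[OF that]] hu.M_st[OF iv(1)[OF that]] by blast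
  qed
  have "\<exists>z\<in>G. z * star z = h"
  proof (rule norm_surj_if_hilbert90[where u = "eid n" and iv = iv])
    show "finite G" by (rule finite_subset[of _ "hu.M n n"]) (use GZ in auto)
    show "\<exists>w\<in>G. w = a * star w" if a: "a \<in> G" "a * star a = eid n" for a
    proof -
      have "\<exists>w\<in>Z. w = a * star w \<and> (\<exists>y\<in>hu.M n n. y * w = eid n)"
        by (rule hilbert90[OF ZM comm add mult star smZ eZ GZ(1)[OF a(1)] a(2)])
      then show ?thesis by (auto simp: G_def)
    qed
    show "h \<in> G" using hZ t by (auto simp: G_def)
    show "star (a * b) = star a * star b" if "a \<in> G" "b \<in> G" for a b
      unfolding star_mult using comm star GZ that by blast
    show "eid n \<in> G" unfolding G_def using eZ hu.e_in_M[of n n n] hu.M_l[OF hu.e_in_M[of n n n]] by blast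
    show "a * b = b * a" if "a \<in> G" "b \<in> G" for a b using comm GZ that by blast
    show "eid n * a = a" if "a \<in> G" for a by (rule hu.M_l[OF GZ(2)[OF that]])
    show "iv a * a = eid n" if "a \<in> G" for a by (rule iv(2)[OF that])
    show "star h = h" by (rule hM(2))
    show "star (star a) = a" for a by simp
  qed (fact Gm ivG Gs)+
  then obtain z where z: "z \<in> G" "z * star z = h" by blast
  have "star z * z = h" using comm star GZ z by metis
  with that z GZ Zc show ?thesis by blast
qed

lemma unitary_if_sim:
  assumes A: "A1 \<in> hu.H n" "A2 \<in> hu.H n" and s: "sim n A1 A2"
  obtains Q where "Q \<in> hu.U n" "A2 * Q = Q * A1"
proof -
  obtain S T where S: "S \<in> hu.M n n" "T \<in> hu.M n n" "T * S = eid n" "S * T = eid n" "A2 * S = S * A1"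
    using s by (auto simp: sim_def)
  have AM: "A1 \<in> hu.M n n" "star A1 = A1" "star A2 = A2" using A by (auto simp: hu.H_def)
  define h where "h = star S * S"
  have h: "h \<in> hu.H n" using S by (auto simp: h_def hu.H_def star_mult intro!: hu.M_intros)
  have sTS: "star T * star S = eid n" using arg_cong[OF S(4), of star] by (simp add: star_mult)
  have th: "T * star T * h = eid n" using S sTS by (simp add: h_def mult.assoc assoc_l[OF sTS] hu.M_l)
  have tM: "T * star T \<in> hu.M n n" using S by (intro hu.M_intros)
  obtain z where z: "z \<in> hu.M n n" "star z * z = h" "\<And>y. y \<in> hu.M n n ==> y * h = h * y ==> y * z = z * y"
    using herm_norm[OF h tM th] by blast
  have sA: "star S * A2 = A1 * star S" using arg_cong[OF S(5), of star] by (simp add: star_mult AM)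
  have "A1 * h = star S * (A2 * S)" by (simp add: h_def mult.assoc[symmetric] sA)
  also have "... = h * A1" by (simp add: h_def S(5) mult.assoc)
  finally have Az: "A1 * z = z * A1" using z(3) AM by blast
  define zi where "zi = T * star T * star z"
  have zi: "zi \<in> hu.M n n" "zi * z = eid n" unfolding zi_def using tM z th by (auto simp: mult.assoc intro!: hu.M_mult hu.M_st S)
  have zzi: "z * zi = eid n" by (rule hu.inverse_commute[OF z(1) zi])
  have "zi * (A1 * z) * zi = zi * (z * A1) * zi" using Az by simp
  then have "zi * A1 * (z * zi) = (zi * z) * A1 * zi" by (simp add: mult.assoc)
  then have Azi: "zi * A1 = A1 * zi" unfolding zzi zi using AM zi by (simp add: mult.assoc hu.M_l hu.M_r)
  define Q where "Q = S * zi"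
  have "star Q * Q = star zi * (star z * z) * zi" by (simp add: Q_def star_mult mult.assoc z(2) h_def)
  also have "... = star (z * zi) * (z * zi)" by (simp add: star_mult mult.assoc)
  also have "... = eid n" unfolding zzi by (simp add: eid_mult)
  finally have "Q \<in> hu.U n" using S zi by (intro hu.in_U_I) (auto simp: Q_def intro: hu.M_mult)
  moreover have "A2 * Q = Q * A1" unfolding Q_def mult.assoc Azi by (simp add: mult.assoc[symmetric] S(5))
  ultimately show ?thesis using that by blast
qed

end

section \<open>Companion matrices of polynomials over the small field\<close>

context quad_field begin

abbreviation cjp :: "'a poly => 'a poly" where "cjp \<equiv> map_poly (\<lambda>x. x ^ q)"

lemma coeff_cjp: "coeff (cjp f) i = coeff f i ^ q"
  by (rule coeff_map_poly) (rule cj_0)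

lemma star_pev: "star (pev f A) = pev (cjp f) (star A)"
proof (induction f)
  case (pCons a f)
  have "cjp (pCons a f) = pCons (a ^ q) (cjp f)" using pCons(1) by (intro map_poly_pCons) auto
  moreover have "star (1 :: 'a fmat) = 1" using hu.st_power[of _ 0] by simp
  ultimately show ?case
    using pCons pev_intertwine[of "star A" "star A" "star A" "cjp f", OF refl] by (simp add: star_add star_sm star_mult)
qed simp

text \<open>The monic polynomials of degree \<open>r\<close> with coefficients in
  \<open>F0\<close>.\<close>

definition RM :: "nat => 'a poly set" where
  "RM r = {d. lead_coeff d = 1 \<and> degree d = r \<and> cjp d = d}"

lemma card_RM: "card (RM r) = q ^ r"
proof (induction r)
  case 0
  have "RM 0 = {1}"
  proof (intro equalityI subsetI)
    fix d assume "d \<in> RM 0"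
    then show "d \<in> {1}" by (auto simp: RM_def elim!: degree_eq_zeroE)
  qed (simp add: RM_def)
  then show ?case by simp
next
  case (Suc r)
  have "bij_betw (\<lambda>(a, f). pCons a f) (F0 \<times> RM r) (RM (Suc r))"
  proof (rule bij_betwI')
    show "(case x of (a, f) => pCons a f) \<in> RM (Suc r)" if "x \<in> F0 \<times> RM r" for x
    proof -
      obtain a f where x: "x = (a, f)" "a \<in> F0" "f \<in> RM r" using \<open>x \<in> F0 \<times> RM r\<close> by auto
      then have "f ~= 0" by (auto simp: RM_def)
      moreover from this have "cjp (pCons a f) = pCons (a ^ q) (cjp f)" by (intro map_poly_pCons) auto
      ultimately show ?thesis using x by (auto simp: RM_def F0_def)
    qed
    show "\<exists>x\<in>F0 \<times> RM r. y = (case x of (a, f) => pCons a f)" if y: "y \<in> RM (Suc r)" for y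
    proof -
      obtain a f where af: "y = pCons a f" by (rule pCons_cases)
      then have f0: "f ~= 0" using y by (auto simp: RM_def)
      then have "cjp (pCons a f) = pCons (a ^ q) (cjp f)" by (intro map_poly_pCons) auto
      then have "(a, f) \<in> F0 \<times> RM r" using y f0 by (auto simp: RM_def F0_def af)
      then show ?thesis using af by force
    qed
  qed auto
  then have "card (RM (Suc r)) = card (F0 \<times> RM r)" by (metis bij_betw_same_card)
  then show ?case using Suc by (simp add: card_cartesian_product card_F0)
qed

lemma companion_power: "k < degree d ==> companion d ^ k * munit 0 0 = munit k 0"
proof (induction k)
  case (Suc k)
  then show ?case using companion_col(1)[of k d] by (simp add: mult.assoc)
qed simp

lemma companion_annihil:
  fixes d :: "'a poly"
  assumes d: "lead_coeff d = 1" "degree d > 0"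
  shows "pev d (companion d) * eid (degree d) = 0"
proof (rule fmat_col_eqI[of _ "degree d" "degree d"])
  let ?r = "degree d" let ?K = "companion d"
  have "pev d ?K * eid ?r \<in> hu.M ?r ?r" by (rule pev_mult_M[OF companion_M hu.e_in_M]) auto
  then show "pev d ?K * eid ?r \<in> MM ?r ?r" by (simp add: hu_M)
  show "(0 :: 'a fmat) \<in> MM ?r ?r" by (simp add: MM_0)
  have top: "?K ^ ?r * munit 0 0 = - (\<Sum>i<?r. sm (coeff d i) (munit i 0))"
  proof -
    have "?K ^ ?r * munit 0 0 = ?K * (?K ^ (?r - 1) * munit 0 0)"
      using d(2) by (cases ?r) (simp_all add: mult.assoc)
    also have "... = ?K * munit (?r - 1) 0" using d(2) by (simp add: companion_power)
    finally show ?thesis using d(2) by (simp add: companion_col(2))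
  qed
  have "(\<Sum>k<?r. sm (coeff d k) (?K ^ k)) * munit 0 0 = (\<Sum>k<?r. sm (coeff d k) (munit k 0))"
    unfolding sum_distrib_right by (rule sum.cong) (simp_all add: sm_simps companion_power)
  then have 0: "pev d ?K * munit 0 0 = 0" unfolding pev_annihil_top[OF d(1)] by (simp add: distrib_right top)
  fix k assume k: "k < ?r"
  have "eid ?r * munit k 0 = (munit k 0 :: 'a fmat)" using munit_M[OF k, of 0 1] by (simp add: hu.M_l)
  then have "pev d ?K * eid ?r * munit k 0 = pev d ?K * (?K ^ k * munit 0 0)" using k by (simp add: mult.assoc companion_power)
  also have "... = ?K ^ k * (pev d ?K * munit 0 0)"
    using pev_intertwine[of ?K "?K ^ k" ?K d] by (simp add: mult.assoc[symmetric] power_commutes)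
  finally show "pev d ?K * eid ?r * munit k 0 = 0 * munit k 0" by (simp add: 0)
qed

text \<open>A remainder \<open>g\<close> modulo \<open>d\<close>, applied to the first basis vector,
  gives the vector of coefficients of \<open>g\<close>, so it annihilates only if it is 0.\<close>

lemma companion_order:
  fixes d :: "'a poly"
  assumes d: "lead_coeff d = 1" "degree d > 0"
  shows "pev f (companion d) * eid (degree d) = 0 \<longleftrightarrow> d dvd f"
proof
  let ?r = "degree d" let ?K = "companion d"
  have comm: "pev g ?K * eid ?r = eid ?r * pev g ?K" for g
    by (rule pev_intertwine) (simp add: hu.M_l[OF companion_M] hu.M_r[OF companion_M])
  note z = companion_annihil[OF d]
  assume f: "pev f ?K * eid ?r = 0"
  define g where "g = f mod d"
  have "f = f div d * d + g" by (simp add: g_def)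
  then have "pev f ?K * eid ?r = pev (f div d) ?K * (pev d ?K * eid ?r) + pev g ?K * eid ?r"
    by (metis distrib_right mult.assoc pev_add pev_mult)
  then have g0: "pev g ?K * eid ?r = 0" using f z by simp
  have "g = 0"
  proof (rule ccontr)
    assume "g ~= 0"
    moreover have "d ~= 0" using d by auto
    ultimately have dg: "degree g < ?r" using degree_mod_less[of d f] by (auto simp: g_def)
    have "eid ?r * munit 0 0 = (munit 0 0 :: 'a fmat)" using munit_M[OF d(2), of 0 1] by (simp add: hu.M_l)
    then have "pev g ?K * munit 0 0 = 0" using g0 by (metis mult.assoc mult_zero_left)
    then have "(\<Sum>k<?r. sm (coeff g k) (munit k 0)) = (0 :: 'a fmat)"
      unfolding pev_eq_sum[OF dg] sum_distrib_right by (simp add: sm_simps companion_power)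
    then have "ent (\<Sum>k<?r. sm (coeff g k) (munit k 0)) (degree g) 0 = 0" by simp
    moreover have "ent (\<Sum>k<?r. sm (coeff g k) (munit k 0 :: 'a fmat)) (degree g) 0 = (\<Sum>k<?r. if k = degree g then coeff g k else 0)"
      unfolding ent_sum by (rule sum.cong) (auto simp: sm_def ent_sc_mult munit.rep_eq)
    ultimately show False using dg \<open>g ~= 0\<close> by simp
  qed
  then show "d dvd f" by (simp add: g_def dvd_eq_mod_eq_0)
next
  assume "d dvd f"
  then obtain c where "f = c * d" by (metis dvdE mult.commute)
  then show "pev f (companion d) * eid (degree d) = 0" using companion_annihil[OF d] by (simp add: pev_mult mult.assoc)
qed

text \<open>The companion matrix is self-adjoint for the Hankel form of the linear recurrence given by \<open>d\<close>.\<close>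

lemma companion_herm:
  assumes d: "d \<in> RM r" "r > 0"
  obtains X where "X \<in> hu.H r" "sim r (companion d) X"
proof -
  let ?K = "companion d"
  have d': "lead_coeff d = 1" "degree d = r" "cjp d = d" using d by (auto simp: RM_def)
  have KM: "?K \<in> hu.M r r" using companion_M[of d] d' by simp
  have creal: "coeff d i ^ q = coeff d i" for i using coeff_cjp[of d i] d'(3) by simp
  have sK: "star ?K = tp ?K"
  proof (rule fmat_eqI)
    fix i j
    have "ent ?K j i ^ q = ent ?K j i"
      using q_gt_1 by (auto simp: companion_def creal cj_diff cj_minus)
    then show "ent (star ?K) i j = ent (tp ?K) i j" by (simp add: ent_ctrans)
  qed
  \<comment> \<open>For the first basis vector \<open>v\<close> the Krylov matrix \<open>J\<close>
    is the identity, and with the last coordinate \<open>w\<close> the pairing lemma then makes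
    \<open>L\<close> itself invertible.\<close>
  define v where "v = (munit 0 0 :: 'a fmat)"
  define w where "w = (munit 0 (r - 1) :: 'a fmat)"
  have vM: "v \<in> hu.M r 1" and wM: "w \<in> hu.M 1 r" unfolding v_def w_def using d(2) by (intro munit_M; simp)+
  have Kv: "?K ^ k * v = munit k 0" if "k < r" for k using companion_power[of k d] that d' by (simp add: v_def)
  have wv: "w * (?K ^ k * v) = (if Suc k = degree d then munit 0 0 else 0)" if "k < degree d" for k
    using that d' by (auto simp: Kv w_def munit_munit)
  define L where "L = tp (kry (tp ?K) (tp w) r)"
  define J where "J = kry ?K v r"
  obtain G where L: "L \<in> hu.M r r" and LK: "L * ?K = tp ?K * L" and G: "G \<in> hu.M r r" "G * (L * J) = eid r"
    using kry_pairing[OF KM vM wM d'(1) _ wv] companion_annihil[OF d'(1)] d d' unfolding L_def J_def by (metis d'(2))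
  have "J = eid r"
  proof (rule fmat_col_eqI[of _ r r])
    show "J \<in> MM r r" using kry_M[OF KM vM, of r] by (simp add: J_def hu_M)
    show "(eid r :: 'a fmat) \<in> MM r r" by (rule MM_eid)
    fix k assume k: "k < r"
    have "eid r * munit k 0 = (munit k 0 :: 'a fmat)" using munit_M[OF k, of 0 1] by (simp add: hu.M_l)
    then show "J * munit k 0 = eid r * munit k 0" unfolding J_def kry_col[OF vM k] using Kv[OF k] by simp
  qed
  then have GL: "G * L = eid r" using G L by (simp add: hu.M_r)
  have LG: "L * G = eid r" by (rule hu.inverse_commute[OF L G(1) GL])
  have tp_sum: "tp (\<Sum>i\<in>I. f i) = (\<Sum>i\<in>I. tp (f i :: 'a fmat))" for f and I :: "nat set"
    by (induction I rule: infinite_finite_induct) (simp_all add: tp_add)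
  have Lsum: "L = (\<Sum>k<r. munit k 0 * (w * ?K ^ k))"
    unfolding L_def kry_def tp_sum by (simp add: tp_mult tp_munit tp_power mult.assoc)
  have row: "munit 0 j * L = w * ?K ^ j" if "j < r" for j
  proof -
    have "munit 0 j * L = (\<Sum>k<r. if k = j then munit 0 0 * (w * ?K ^ k) else 0)"
      unfolding Lsum sum_distrib_left by (rule sum.cong) (auto simp: mult.assoc[symmetric] munit_munit)
    also have "... = munit 0 0 * w * ?K ^ j" using that by (simp add: mult.assoc)
    finally show ?thesis by (simp add: w_def munit_munit)
  qed
  \<comment> \<open>The entries depend on \<open>i + j\<close> only, so \<open>L\<close> is
    symmetric; together with \<open>star L = tp L\<close>, which holds because
    \<open>companion d\<close> has entries in \<open>F0\<close>, it is Hermitian.\<close>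
  have entL: "ent L i j = ent (w * ?K ^ (i + j) * v) 0 0" if "i < r" "j < r" for i j
  proof -
    have "ent L i j = ent (munit 0 i * L * munit j 0) 0 0" by (simp add: munit_mult sum_mult_munit)
    also have "munit 0 i * L * munit j 0 = w * ?K ^ i * (?K ^ j * v)" by (simp add: row that Kv)
    finally show ?thesis by (simp add: mult.assoc power_add)
  qed
  have tL: "tp L = L"
  proof (rule fmat_eqI)
    fix i j
    show "ent (tp L) i j = ent L i j"
    proof (cases "i < r \<and> j < r")
      case True
      then show ?thesis by (simp add: ent_ctrans entL add.commute)
    next
      case False
      then have "ent L i j = 0" "ent L j i = 0" using L by (auto simp: hu_M MM_iff)
      then show ?thesis by (simp add: ent_ctrans)
    qed
  qed
  have star_sum: "star (\<Sum>i\<in>I. f i) = (\<Sum>i\<in>I. star (f i))" for f and I :: "nat set"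
    by (induction I rule: infinite_finite_induct) (simp_all add: star_add)
  have "star L = tp L"
    unfolding Lsum star_sum tp_sum
    by (simp add: star_mult tp_mult star_munit tp_munit w_def hu.st_power tp_power sK)
  with tL have sL: "star L = L" by simp
  then have "L \<in> hu.H r" using L by (simp add: hu.H_def)
  \<comment> \<open>Writing the form as \<open>\<iota> * star \<iota>\<close> passes to an
    orthonormal basis, in which a matrix that is self-adjoint for \<open>L\<close> becomes
    Hermitian.\<close>
  then obtain s \<iota> where i: "\<iota> \<in> hu.LI r s" "L = \<iota> * star \<iota>" using hu.herm_fact by blast
  obtain k where iM: "\<iota> \<in> hu.M r s" and k: "k \<in> hu.M s r" "k * \<iota> = eid s" using i by (auto simp: hu.LI_def)
  have "\<iota> * (star \<iota> * G) = eid r" using LG i(2) by (simp add: mult.assoc)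
  moreover from this have "k * (\<iota> * (star \<iota> * G)) = k" using k by (simp add: hu.M_r)
  then have "star \<iota> * G = k" using hu.M_mult[OF hu.M_st[OF iM] G(1)] by (simp add: assoc_l[OF k(2)] hu.M_l)
  ultimately have ik: "\<iota> * k = eid r" by simp
  then have rs: "s = r" using hu.dim_unique[OF iM k(1) ik k(2)] by simp
  note iM = iM[unfolded rs] and k = k[unfolded rs]
  have sk: "star \<iota> * star k = eid r" "star k * star \<iota> = eid r"
    using arg_cong[OF k(2), of star] arg_cong[OF ik, of star] by (simp_all add: star_mult)
  define X where "X = star \<iota> * ?K * star k"
  have XM: "X \<in> hu.M r r" unfolding X_def by (rule hu.M_mult[OF hu.M_mult[OF hu.M_st[OF iM] KM] hu.M_st[OF k(1)]])
  have "k * (L * ?K) * star k = k * (star ?K * L) * star k" using LK sK by simp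
  then have "(k * \<iota>) * star \<iota> * ?K * star k = k * star ?K * \<iota> * (star \<iota> * star k)" unfolding i(2) by (simp add: mult.assoc)
  then have "X = k * star ?K * \<iota>" unfolding k(2) sk X_def using iM hu.M_st[OF iM]
    by (simp add: mult.assoc hu.M_r hu.M_l'[OF hu.M_st[OF iM]])
  moreover have "star X = k * star ?K * \<iota>" by (simp add: X_def star_mult mult.assoc)
  ultimately have "X \<in> hu.H r" using XM by (simp add: hu.H_def)
  moreover have "sim r ?K X"
    unfolding sim_def
    by (intro bexI[of _ "star \<iota>"] bexI[of _ "star k"] conjI sk hu.M_st iM k)
      (simp add: X_def mult.assoc sk(2), metis KM hu.M_r mult.assoc sk(2))
  ultimately show ?thesis using that by blast
qed

lemma simd_herm:
  assumes "r \<le> n" "K \<in> hu.H r" "B \<in> hu.H (n - r)"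
  obtains A where "A \<in> hu.H n" "simd n r A K B"
proof -
  have "card (hu.FF n r) > 0" unfolding hu.card_FF[OF assms(1)] by (rule hu.card_U_pos)
  then have "hu.FF n r ~= {}" by auto
  then obtain J N where JN: "(J, N) \<in> hu.FF n r" by auto
  note h = hu.FF_D[OF JN]
  have KB: "K \<in> hu.M r r" "star K = K" "B \<in> hu.M (n - r) (n - r)" "star B = B" using assms by (auto simp: hu.H_def)
  define A where "A = J * K * star J + N * B * star N"
  have AM: "A \<in> hu.M n n" unfolding A_def by (intro hu.M_add hu.M_mult[OF hu.M_mult[OF h(1) KB(1)] hu.M_st[OF h(1)]] hu.M_mult[OF hu.M_mult[OF h(2) KB(3)] hu.M_st[OF h(2)]])
  have A: "A \<in> hu.H n" using AM by (simp add: hu.H_def A_def star_add star_mult KB mult.assoc)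
  have "simd n r A K (star N * A * N)"
    by (rule simdI[OF assms(1) AM KB(1) h(1) hu.M_st[OF h(1)] h(2) hu.M_st[OF h(2)] h(3,4,5)])
      (simp_all add: A_def distrib_left distrib_right mult.assoc h hu.M_r[OF KB(1)] assoc_l[OF h(3)] assoc_l[OF h(6)] hu.M_l'[OF KB(1)])
  moreover have "star N * A * N = B"
    by (simp add: A_def distrib_left distrib_right mult.assoc h assoc_l[OF h(4)] assoc_l[OF h(7)] hu.M_r[OF KB(3)] hu.M_l[OF KB(3)])
  ultimately show ?thesis using that A by simp
qed

lemma kd_sim:
  assumes A: "A1 \<in> hu.M n n" and s: "sim n A1 A2"
  shows "kd n A1 = kd n A2"
proof
  fix f
  obtain S T where S: "S \<in> hu.M n n" "T \<in> hu.M n n" "T * S = eid n" "S * T = eid n" "A2 * S = S * A1"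
    using s by (auto simp: sim_def)
  note p = pev_intertwine[OF S(5), of f]
  have "bij_betw (\<lambda>v. S * v) {v \<in> hu.M n 1. pev f A1 * v = 0} {v \<in> hu.M n 1. pev f A2 * v = 0}"
  proof (rule bij_betw_byWitness[where f' = "\<lambda>v. T * v"])
    have id: "T * (S * v) = v" "S * (T * v) = v" if "v \<in> hu.M n 1" for v
      using hu.M_l[OF that] by (simp_all add: assoc_l[OF S(3)] assoc_l[OF S(4)])
    show "\<forall>v\<in>{v \<in> hu.M n 1. pev f A1 * v = 0}. T * (S * v) = v" "\<forall>v\<in>{v \<in> hu.M n 1. pev f A2 * v = 0}. S * (T * v) = v"
      using id by auto
    show "(\<lambda>v. S * v) ` {v \<in> hu.M n 1. pev f A1 * v = 0} \<subseteq> {v \<in> hu.M n 1. pev f A2 * v = 0}"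
      using S(1) by (auto simp: mult.assoc[symmetric] p intro: hu.M_mult) (simp add: mult.assoc)
    show "(\<lambda>v. T * v) ` {v \<in> hu.M n 1. pev f A2 * v = 0} \<subseteq> {v \<in> hu.M n 1. pev f A1 * v = 0}"
    proof (rule image_subsetI)
      fix v assume v: "v \<in> {v \<in> hu.M n 1. pev f A2 * v = 0}"
      then have vM: "v \<in> hu.M n 1" and z: "pev f A2 * v = 0" by auto
      have Tv: "T * v \<in> hu.M n 1" using S(2) vM by (rule hu.M_mult)
      have "S * (pev f A1 * (T * v)) = pev f A2 * (S * (T * v))" using p by (simp add: mult.assoc[symmetric])
      also have "... = 0" using id vM z by simp
      finally have "T * (S * (pev f A1 * (T * v))) = 0" by simp
      then have "pev f A1 * (T * v) = 0" using id(1)[OF pev_mult_M[OF A Tv]] by simp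
      then show "T * v \<in> {v \<in> hu.M n 1. pev f A1 * v = 0}" using Tv by simp
    qed
  qed
  then show "kd n A1 f = kd n A2 f" unfolding kd_def by (rule bij_betw_same_card)
qed

end

context quad_field begin

section \<open>Counting orbits\<close>

lemma cj_sum: "(\<Sum>i\<in>I. f i :: 'a) ^ q = (\<Sum>i\<in>I. f i ^ q)"
  by (induction I rule: infinite_finite_induct) (simp_all add: cj_add cj_0)

lemma cjp_mult: "cjp (f * g) = cjp f * cjp g"
  by (rule poly_eqI) (simp add: coeff_cjp coeff_mult cj_sum power_mult_distrib)

lemma degree_cjp: "degree (cjp d) = degree d"
  by (rule degree_map_poly) simp

lemma RM_mult: "d \<in> RM r ==> e \<in> RM s ==> d * e \<in> RM (r + s)"
proof -
  assume d: "d \<in> RM r" and e: "e \<in> RM s"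
  then have "d ~= 0" "e ~= 0" by (auto simp: RM_def)
  then have dg: "degree (d * e) = r + s" using d e by (simp add: degree_mult_eq RM_def)
  have "lead_coeff (d * e) = 1" using d e by (auto simp: RM_def lead_coeff_mult)
  then show ?thesis using dg d e by (simp add: RM_def cjp_mult)
qed

lemma RM_div:
  assumes d: "d * e \<in> RM r" "d \<in> RM j"
  shows "j \<le> r \<and> e \<in> RM (r - j)"
proof -
  have nz: "d ~= 0" "e ~= 0" using d(1) by (auto simp: RM_def)
  have dg: "degree d + degree e = r" using d(1) nz by (simp add: degree_mult_eq RM_def)
  have "lead_coeff d * lead_coeff e = 1" using d(1) by (simp add: RM_def lead_coeff_mult)
  then have "lead_coeff e = 1" using d(2) by (auto simp: RM_def)
  moreover have "d * cjp e = d * e" using d by (simp add: RM_def cjp_mult)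
  then have "cjp e = e" using nz by simp
  ultimately show ?thesis using dg d(2) by (auto simp: RM_def)
qed

text \<open>\<open>X\<close> and \<open>star X\<close> have the same rank: in a rank factorisation
  \<open>X = J * P\<close> the two kernels are those of \<open>P\<close> and of
  \<open>star J\<close>, which both map onto columns of length \<open>r\<close>.\<close>

lemma card_kernel_star:
  assumes X: "X \<in> hu.M n n"
  shows "card {v \<in> hu.M n 1. star X * v = 0} = card {v \<in> hu.M n 1. X * v = 0}"
proof -
  obtain r J P L R where J: "J \<in> MM n r" and P: "P \<in> MM r n" and XJ: "X = J * P"
    and L: "L \<in> MM r n" "L * J = eid r" and R: "R \<in> MM n r" "P * R = eid r" using X[unfolded hu_M] by (rule rank_fact)
  have surj: "card (hu.M n 1) = card {v \<in> hu.M n 1. P * v = 0} * card (hu.M r 1)"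
    if P: "P \<in> hu.M r n" and R: "R \<in> hu.M n r" "P * R = eid r" for P R
  proof (rule card_fibres[where f = "\<lambda>v. P * v"])
    show "P * v \<in> hu.M r 1" if "v \<in> hu.M n 1" for v using P that by (rule hu.M_mult)
    fix b assume b: "b \<in> hu.M r 1"
    have Rb: "R * b \<in> hu.M n 1" "P * (R * b) = b" using hu.M_mult[OF R(1) b] hu.M_l[OF b] by (simp_all add: assoc_l[OF R(2)])
    have "bij_betw (\<lambda>v. v + R * b) {v \<in> hu.M n 1. P * v = 0} {v \<in> hu.M n 1. P * v = b}"
      by (rule bij_betw_byWitness[where f' = "\<lambda>v. v - R * b"])
        (use Rb in \<open>auto simp: distrib_left right_diff_distrib intro: hu.M_add hu.M_diff\<close>)
    then show "card {v \<in> hu.M n 1. P * v = b} = card {v \<in> hu.M n 1. P * v = 0}" by (rule bij_betw_same_card[symmetric])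
  qed auto
  have LJ: "star J * star L = eid r" "star R * star P = eid r" "star X = star P * star J"
    using arg_cong[OF L(2), of star] arg_cong[OF R(2), of star] by (simp_all add: star_mult XJ)
  have J': "star J \<in> hu.M r n" "star L \<in> hu.M n r" using J L by (auto simp: hu_M[symmetric] intro: hu.M_st)
  have 1: "{v \<in> hu.M n 1. star X * v = 0} = {v \<in> hu.M n 1. star J * v = 0}"
  proof (intro Collect_cong conj_cong refl)
    fix v assume v: "v \<in> hu.M n 1"
    show "star X * v = 0 \<longleftrightarrow> star J * v = 0"
    proof
      assume "star X * v = 0"
      then have "star R * (star P * (star J * v)) = 0" by (simp add: LJ(3) mult.assoc)
      then show "star J * v = 0" using hu.M_mult[OF J'(1) v] by (simp add: assoc_l[OF LJ(2)] hu.M_l[of _ r 1, unfolded One_nat_def])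
    qed (simp add: LJ(3) mult.assoc)
  qed
  have 2: "{v \<in> hu.M n 1. X * v = 0} = {v \<in> hu.M n 1. P * v = 0}"
  proof (intro Collect_cong conj_cong refl)
    fix v assume v: "v \<in> hu.M n 1"
    have PM: "P \<in> hu.M r n" using P by (simp add: hu_M)
    show "X * v = 0 \<longleftrightarrow> P * v = 0"
    proof
      assume "X * v = 0"
      then have "L * (J * (P * v)) = 0" by (simp add: XJ mult.assoc)
      then show "P * v = 0" using hu.M_mult[OF PM v] by (simp add: assoc_l[OF L(2)] hu.M_l[of _ r 1, unfolded One_nat_def])
    qed (simp add: XJ mult.assoc)
  qed
  have e: "card {v \<in> hu.M n 1. star J * v = 0} * card (hu.M r 1) = card {v \<in> hu.M n 1. P * v = 0} * card (hu.M r 1)"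
    using surj[OF J' LJ(1)] surj[of P R] P R by (simp add: hu_M)
  have nz: "card (hu.M r 1) ~= 0" using hu.M_0[of r 1] by auto
  show ?thesis unfolding 1 2 by (rule mult_right_cancel[OF nz, THEN iffD1, OF e])
qed

text \<open>What being Hermitian leaves visible in the kernel sizes. The block \<open>B\<close> that
  remains after a cyclic splitting of a Hermitian matrix need not be Hermitian, but it inherits this
  property, and the property suffices for a Hermitian matrix with the same kernel sizes
  (\<open>HW_if_real_type\<close>).\<close>

definition real_type :: "nat => 'a fmat => bool" where
  "real_type n A \<longleftrightarrow> (\<forall>f. kd n A (cjp f) = kd n A f)"

text \<open>The adjoint of \<open>f(A)\<close> is the conjugate polynomial at \<open>A\<close>, and
  a matrix and its adjoint have kernels of equal size.\<close>

lemma real_type_herm: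
  assumes "A \<in> hu.H n"
  shows "real_type n A"
  unfolding real_type_def
proof
  fix f
  have A: "A \<in> hu.M n n" "star A = A" using assms by (auto simp: hu.H_def)
  have k: "kd n A g = card {v \<in> hu.M n 1. pev g A * eid n * v = 0}" for g
    unfolding kd_def by (intro arg_cong[of _ _ card] Collect_cong conj_cong refl) (simp add: mult.assoc hu.M_l[of _ n 1])
  have "star (pev f A * eid n) = eid n * pev (cjp f) A" by (simp add: star_mult star_pev A)
  also have "... = pev (cjp f) A * eid n"
    by (rule pev_intertwine[symmetric]) (simp add: hu.M_l[OF A(1)] hu.M_r[OF A(1)])
  finally show "kd n A (cjp f) = kd n A f"
    unfolding k using card_kernel_star[OF pev_mult_M[OF A(1) hu.e_in_M[of n n n]], of f] by simp
qed

section \<open>Classes of Hermitian matrices and their minimal polynomials\<close>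

definition HW :: "nat => ('a poly => nat) set" where "HW n = kd n ` hu.H n"

text \<open>The minimal polynomial, read off from kernel sizes alone. A function
  \<open>\<phi>\<close> in \<open>HW n\<close> stands for a whole similarity class, so the recursion
  for classes can be set up without choosing representatives.\<close>

definition md :: "nat => ('a poly => nat) => 'a poly => bool" where
  "md n \<phi> d \<longleftrightarrow> lead_coeff d = 1 \<and> (\<forall>f. \<phi> f = card (hu.M n 1) \<longleftrightarrow> d dvd f)"

lemma md_unique: "md n \<phi> d ==> md n \<phi> d' ==> d = d'"
proof (rule monic_dvd_antisym)
  assume a: "md n \<phi> d" "md n \<phi> d'"
  then show "lead_coeff d = 1" "lead_coeff d' = 1" by (simp_all add: md_def)
  have dv: "d dvd f \<longleftrightarrow> d' dvd f" for f using a unfolding md_def by blast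
  show "d dvd d'" "d' dvd d" using dv[of d'] dv[of d] by simp_all
qed

lemma md_ex: "\<phi> \<in> HW n ==> \<exists>d. md n \<phi> d"
proof -
  assume "\<phi> \<in> HW n"
  then obtain A where A: "A \<in> hu.M n n" "\<phi> = kd n A" by (auto simp: HW_def hu.H_def)
  obtain d where "lead_coeff d = 1" "\<And>f. pev f A * eid n = 0 \<longleftrightarrow> d dvd f"
    using order_ex[OF A(1) hu.e_in_M[of n n n]] by blast
  then show ?thesis unfolding md_def A(2) kd_full by blast
qed

lemma kd_le: "kd n A f \<le> card (hu.M n 1)"
  unfolding kd_def by (rule card_mono) auto

lemma card_M_split: "r \<le> n ==> card (hu.M n 1) = card (hu.M r 1) * card (hu.M (n - r) 1)"
  by (simp add: hu.card_M power_add[symmetric] mult_2[symmetric] right_diff_distrib'[symmetric] flip: distrib_left)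

lemma full_product:
  fixes a b A B :: nat
  assumes "a \<le> A" "b \<le> B" "a > 0" "b > 0"
  shows "a * b = A * B \<longleftrightarrow> a = A \<and> b = B"
proof
  assume e: "a * b = A * B"
  have "a = A"
  proof (rule ccontr)
    assume "a ~= A"
    then have "a * b < A * b" using assms by simp
    also have "... \<le> A * B" using assms by simp
    finally show False using e by simp
  qed
  then show "a = A \<and> b = B" using e assms by simp
qed simp

lemma companion_real_type: "d \<in> RM r ==> r > 0 ==> kd r (companion d) (cjp f) = kd r (companion d) f"
proof -
  assume d: "d \<in> RM r" "r > 0"
  obtain X where X: "X \<in> hu.H r" "sim r (companion d) X" by (rule companion_herm[OF d])
  have "companion d \<in> hu.M r r" using companion_M[of d] d by (simp add: RM_def)
  then have "kd r (companion d) = kd r X" using kd_sim X(2) by blast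
  then show ?thesis using real_type_herm[OF X(1)] by (simp add: real_type_def)
qed

text \<open>The minimal polynomial \<open>d\<close> divides its conjugate, which is monic of the
  same degree, so \<open>d\<close> has coefficients in \<open>F0\<close>. The kernel sizes of its
  companion block are then invariant under conjugation of \<open>f\<close>, and dividing by them
  passes the invariance on to \<open>B\<close>. Since \<open>d\<close> annihilates \<open>A\<close>,
  it also annihilates \<open>B\<close>.\<close>

lemma real_type_split:
  assumes A: "A \<in> hu.M n n" "real_type n A" and n: "n > 0"
  obtains r d B where "md n (kd n A) d" "d \<in> RM r" "0 < r" "r \<le> n" "B \<in> hu.M (n - r) (n - r)" "real_type (n - r) B"
    "kd n A = (\<lambda>f. kd r (companion d) f * kd (n - r) B f)" "kd (n - r) B d = card (hu.M (n - r) 1)"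
proof -
  obtain d B where d: "lead_coeff d = 1" "degree d > 0" "\<And>f. pev f A * eid n = 0 \<longleftrightarrow> d dvd f"
    and s: "simd n (degree d) A (companion d) B" using cyclic_split[OF A(1) n] by blast
  let ?r = "degree d"
  have le: "?r \<le> n" "B \<in> hu.M (n - ?r) (n - ?r)" using s by (auto simp: simd_def)
  have fullA: "kd n A f = card (hu.M n 1) \<longleftrightarrow> d dvd f" for f unfolding kd_full by (rule d(3))
  then have md: "md n (kd n A) d" using d(1) by (simp add: md_def)
  have "d dvd cjp d" using fullA[of "cjp d"] fullA[of d] A(2) by (simp add: real_type_def)
  then obtain c where c: "cjp d = d * c" by (rule dvdE)
  have nz: "d ~= 0" "cjp d ~= 0" using d(2) degree_cjp[of d] by auto
  have "degree c = 0" using c nz degree_cjp[of d] by (auto simp: degree_mult_eq)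
  then obtain k where k: "c = [:k:]" by (rule degree_eq_zeroE)
  have "lead_coeff (cjp d) = 1" by (simp add: degree_cjp coeff_cjp d)
  then have "lead_coeff c = 1" unfolding c lead_coeff_mult d(1) by simp
  then have "k = 1" using k by simp
  then have dR: "d \<in> RM ?r" using c k d(1) by (simp add: RM_def)
  note sp = kd_split[OF s]
  have "real_type (n - ?r) B"
    unfolding real_type_def
  proof
    fix f
    have "kd ?r (companion d) f * kd (n - ?r) B (cjp f) = kd ?r (companion d) f * kd (n - ?r) B f"
      using sp[of f] sp[of "cjp f"] A(2) companion_real_type[OF dR d(2), of f] by (auto simp: real_type_def)
    then show "kd (n - ?r) B (cjp f) = kd (n - ?r) B f" using kd_pos[of ?r "companion d" f] by simp
  qed
  moreover have "kd (n - ?r) B d = card (hu.M (n - ?r) 1)"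
  proof -
    have "kd ?r (companion d) d * kd (n - ?r) B d = card (hu.M ?r 1) * card (hu.M (n - ?r) 1)"
      using fullA[of d] sp[of d] card_M_split[OF le(1)] by simp
    then show ?thesis by (simp only: full_product[OF kd_le kd_le kd_pos kd_pos])
  qed
  moreover have "kd n A = (\<lambda>f. kd ?r (companion d) f * kd (n - ?r) B f)" by (rule ext) (rule sp)
  ultimately show ?thesis by (intro that[OF md dR d(2) le(1) le(2)])
qed

text \<open>The converse of the splitting: \<open>companion d\<close> is similar to a Hermitian
  matrix, and its orthogonal sum with a Hermitian matrix annihilated by \<open>d\<close> has minimal
  polynomial \<open>d\<close>.\<close>

lemma HW_join:
  assumes d: "d \<in> RM r" "r > 0" and p: "\<phi> \<in> HW m" "\<phi> d = card (hu.M m 1)"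
  shows "(\<lambda>f. kd r (companion d) f * \<phi> f) \<in> HW (r + m)" "md (r + m) (\<lambda>f. kd r (companion d) f * \<phi> f) d"
proof -
  obtain B where B: "B \<in> hu.H m" "\<phi> = kd m B" using p(1) by (auto simp: HW_def)
  obtain X where X: "X \<in> hu.H r" "sim r (companion d) X" by (rule companion_herm[OF d])
  have CM: "companion d \<in> hu.M r r" using companion_M[of d] d by (simp add: RM_def)
  have kX: "kd r X = kd r (companion d)" using kd_sim[OF CM X(2)] by simp
  obtain A where A: "A \<in> hu.H (r + m)" "simd (r + m) r A X B"
    by (rule simd_herm[of r "r + m" X B]) (use X B in auto)
  have "kd (r + m) A = (\<lambda>f. kd r (companion d) f * \<phi> f)"
    using kd_split[OF A(2)] by (auto simp: kX B(2))
  then show "(\<lambda>f. kd r (companion d) f * \<phi> f) \<in> HW (r + m)" using A(1) unfolding HW_def by (metis imageI)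
  have d': "lead_coeff d = 1" "degree d = r" using d by (auto simp: RM_def)
  have "kd r (companion d) f * \<phi> f = card (hu.M (r + m) 1) \<longleftrightarrow> d dvd f" for f
  proof -
    have "card (hu.M (r + m) 1) = card (hu.M r 1) * card (hu.M m 1)" using card_M_split[of r "r + m"] by simp
    then have "kd r (companion d) f * \<phi> f = card (hu.M (r + m) 1) \<longleftrightarrow>
      kd r (companion d) f = card (hu.M r 1) \<and> kd m B f = card (hu.M m 1)"
      unfolding B(2) by (simp only: full_product[OF kd_le kd_le kd_pos kd_pos])
    also have "... \<longleftrightarrow> d dvd f \<and> pev f B * eid m = 0"
      unfolding kd_full using companion_order[of d f] d' d(2) by simp
    also have "... \<longleftrightarrow> d dvd f"
    proof -
      have "pev d B * eid m = 0" using p(2) unfolding B(2) kd_full .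
      then have "pev f B * eid m = 0" if "d dvd f"
        using that by (auto elim!: dvdE simp: pev_mult_commute mult.assoc)
      then show ?thesis by blast
    qed
    finally show ?thesis .
  qed
  then show "md (r + m) (\<lambda>f. kd r (companion d) f * \<phi> f) d" using d' by (simp add: md_def)
qed

lemma HW_if_real_type: "A \<in> hu.M n n ==> real_type n A ==> kd n A \<in> HW n"
proof (induction n arbitrary: A rule: less_induct)
  case (less n)
  show ?case
  proof (cases "n = 0")
    case True
    then have "A = 0" using less.prems(1) by (intro fmat_eqI) (auto simp: hu_M MM_iff)
    then have "A \<in> hu.H n" using less.prems by (simp add: hu.H_def)
    then show ?thesis by (simp add: HW_def)
  next
    case False
    then have n: "n > 0" by simp
    obtain r d B where "md n (kd n A) d" and s: "d \<in> RM r" "0 < r" "r \<le> n" "B \<in> hu.M (n - r) (n - r)" "real_type (n - r) B"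
      "kd n A = (\<lambda>f. kd r (companion d) f * kd (n - r) B f)" "kd (n - r) B d = card (hu.M (n - r) 1)"
      by (rule real_type_split[OF less.prems n])
    have "kd (n - r) B \<in> HW (n - r)" using less.IH[of "n - r" B] s by simp
    from HW_join(1)[OF s(1,2) this s(7)] show ?thesis using s(3) unfolding s(6) by simp
  qed
qed

lemma HW_split:
  assumes "\<phi> \<in> HW n" "n > 0"
  obtains r d \<phi>' where "md n \<phi> d" "d \<in> RM r" "0 < r" "r \<le> n" "\<phi>' \<in> HW (n - r)"
    "\<phi> = (\<lambda>f. kd r (companion d) f * \<phi>' f)" "\<phi>' d = card (hu.M (n - r) 1)"
proof -
  obtain A where A: "A \<in> hu.H n" "\<phi> = kd n A" using assms(1) by (auto simp: HW_def)
  then have "A \<in> hu.M n n" "real_type n A" by (auto simp: hu.H_def real_type_herm)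
  then obtain r d B where s: "md n (kd n A) d" "d \<in> RM r" "0 < r" "r \<le> n" "B \<in> hu.M (n - r) (n - r)" "real_type (n - r) B"
      "kd n A = (\<lambda>f. kd r (companion d) f * kd (n - r) B f)" "kd (n - r) B d = card (hu.M (n - r) 1)"
    by (rule real_type_split[OF _ _ assms(2)])
  show ?thesis
  proof (rule that[OF _ s(2,3,4) HW_if_real_type[OF s(5,6)] _ s(8)])
    show "md n \<phi> d" using s(1) A(2) by simp
    show "\<phi> = (\<lambda>f. kd r (companion d) f * kd (n - r) B f)" unfolding A(2) by (rule s(7))
  qed
qed

lemma HW_0: "HW 0 = {\<lambda>f. 1}"
proof -
  have e: "hu.M 0 k = {0}" for k by (auto simp: hu_M MM_iff intro!: fmat_eqI)
  have "hu.H 0 = {0}" unfolding hu.H_def e by auto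
  moreover have "kd 0 0 = (\<lambda>f. 1)" unfolding kd_def e by (auto simp: fun_eq_iff cong: conj_cong)
  ultimately show ?thesis by (simp add: HW_def)
qed

lemma md_RM:
  assumes "\<phi> \<in> HW n" "md n \<phi> d"
  shows "d \<in> RM (degree d)" "degree d = 0 \<longleftrightarrow> n = 0"
proof -
  have "d \<in> RM (degree d) \<and> (degree d = 0 \<longleftrightarrow> n = 0)"
  proof (cases "n = 0")
    case True
    have "card (hu.M 0 1) = 1" by (simp add: hu.card_M)
    then have "md n \<phi> 1" using assms(1) True by (simp add: HW_0 md_def)
    then have "d = 1" using md_unique assms(2) by blast
    then show ?thesis using True by (simp add: RM_def)
  next
    case False
    then have "n > 0" by simp
    then obtain r e where "md n \<phi> e" "e \<in> RM r" "0 < r" by (rule HW_split[OF assms(1)])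
    then show ?thesis using md_unique[OF assms(2)] False by (auto simp: RM_def)
  qed
  then show "d \<in> RM (degree d)" "degree d = 0 \<longleftrightarrow> n = 0" by auto
qed

definition mp :: "nat => ('a poly => nat) => 'a poly" where "mp n \<phi> = (THE d. md n \<phi> d)"

lemma mp_eq: "md n \<phi> d ==> mp n \<phi> = d"
  unfolding mp_def by (rule the_equality) (auto intro: md_unique)

lemma md_mp: "\<phi> \<in> HW n ==> md n \<phi> (mp n \<phi>)"
  using md_ex mp_eq by metis

definition WD :: "nat => nat => ('a poly => nat) set" where
  "WD n r = {\<phi> \<in> HW n. degree (mp n \<phi>) = r}"

lemma finite_HW: "finite (HW n)"
proof -
  have "finite (hu.H n)" by (rule finite_subset[of _ "hu.M n n"]) (auto simp: hu.H_def)
  then show ?thesis by (simp add: HW_def)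
qed

lemma finite_RM: "finite (RM r)"
  using card_RM[of r] q_gt_1 by (metis card.infinite less_nat_zero_code not_one_less_zero power_not_zero zero_less_iff_neq_zero)

lemma WD_gt: "n < r ==> WD n r = {}"
proof (rule ccontr)
  assume "n < r" "WD n r ~= {}"
  then obtain \<phi> where p: "\<phi> \<in> HW n" "degree (mp n \<phi>) = r" by (auto simp: WD_def)
  then have "n > 0" using md_RM(2)[OF p(1) md_mp[OF p(1)]] \<open>n < r\<close> by auto
  then obtain s d where "md n \<phi> d" "d \<in> RM s" "s \<le> n" by (rule HW_split[OF p(1)])
  then show False using mp_eq p \<open>n < r\<close> by (auto simp: RM_def)
qed

lemma card_WD_0: "card (WD n 0) = (if n = 0 then 1 else 0)"
proof -
  have "degree (mp n \<phi>) = 0 \<longleftrightarrow> n = 0" if "\<phi> \<in> HW n" for \<phi>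
    by (rule md_RM(2)[OF that md_mp[OF that]])
  then have "WD n 0 = (if n = 0 then HW 0 else {})" by (auto simp: WD_def)
  then show ?thesis by (simp add: HW_0)
qed

text \<open>Removing the companion block of the minimal polynomial, of degree \<open>r\<close>,
  leaves a class of size \<open>n - r\<close> whose minimal polynomial divides the removed one and
  has some degree \<open>j \<le> r\<close>. The quotient \<open>e\<close> is an arbitrary element of
  \<open>RM (r - j)\<close>, which gives the weight \<open>q ^ (r - j)\<close>.\<close>

lemma card_WD:
  assumes r: "0 < r" "r \<le> n"
  shows "card (WD n r) = (\<Sum>j\<le>r. q ^ (r - j) * card (WD (n - r) j))"
proof -
  define g where "g = (\<lambda>(j :: nat, \<phi>, e). (\<lambda>f. kd r (companion (e * mp (n - r) \<phi>)) f * \<phi> f))"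
  define X where "X = (SIGMA j:{..r}. WD (n - r) j \<times> RM (r - j))"
  have gX: "g x \<in> HW n \<and> md n (g x) (e * mp (n - r) \<phi>) \<and> e * mp (n - r) \<phi> \<in> RM r"
    if x: "x = (j, \<phi>, e)" "x \<in> X" for x j \<phi> e
  proof -
    have p: "\<phi> \<in> HW (n - r)" "degree (mp (n - r) \<phi>) = j" "j \<le> r" "e \<in> RM (r - j)" using x by (auto simp: X_def WD_def)
    note m = md_mp[OF p(1)]
    have "mp (n - r) \<phi> \<in> RM j" using md_RM(1)[OF p(1) m] p(2) by simp
    from RM_mult[OF p(4) this] have d: "e * mp (n - r) \<phi> \<in> RM r" using p(3) by simp
    have "\<phi> (e * mp (n - r) \<phi>) = card (hu.M (n - r) 1)" using m by (simp add: md_def)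
    from HW_join[OF d r(1) p(1) this] show ?thesis using r d by (simp add: g_def x)
  qed
  have "bij_betw g X (WD n r)"
    unfolding bij_betw_def
  proof
    show "inj_on g X"
    proof (rule inj_onI)
      fix x y assume xy: "x \<in> X" "y \<in> X" "g x = g y"
      obtain j \<phi> e where x: "x = (j, \<phi>, e)" by (cases x) auto
      obtain j' \<phi>' e' where y: "y = (j', \<phi>', e')" by (cases y) auto
      have d: "e * mp (n - r) \<phi> = e' * mp (n - r) \<phi>'"
        using gX[OF x xy(1)] gX[OF y xy(2)] xy(3) md_unique by metis
      have "\<phi> f = \<phi>' f" for f
        using fun_cong[OF xy(3), of f] kd_pos[of r "companion (e * mp (n - r) \<phi>)" f] by (simp add: g_def x y d)
      then have pp: "\<phi> = \<phi>'" by (rule ext)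
      have p: "\<phi> \<in> HW (n - r)" "degree (mp (n - r) \<phi>) = j" "degree (mp (n - r) \<phi>') = j'" using xy by (auto simp: X_def WD_def x y)
      have "mp (n - r) \<phi> ~= 0" using md_mp[OF p(1)] by (auto simp: md_def)
      then have "e = e'" using d pp by simp
      then show "x = y" using x y pp p by simp
    qed
    show "g ` X = WD n r"
    proof (intro equalityI subsetI)
      fix y assume "y \<in> g ` X"
      then obtain j \<phi> e where x: "(j, \<phi>, e) \<in> X" "y = g (j, \<phi>, e)" by (metis imageE prod_cases3)
      from gX[OF refl x(1)] show "y \<in> WD n r" unfolding x(2) WD_def using mp_eq by (auto simp: RM_def)
    next
      fix \<phi> assume f: "\<phi> \<in> WD n r"
      then have p: "\<phi> \<in> HW n" "degree (mp n \<phi>) = r" by (auto simp: WD_def)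
      have "n > 0" using r by simp
      then obtain s d \<phi>' where s: "md n \<phi> d" "d \<in> RM s" "\<phi>' \<in> HW (n - s)"
        "\<phi> = (\<lambda>f. kd s (companion d) f * \<phi>' f)" "\<phi>' d = card (hu.M (n - s) 1)" by (rule HW_split[OF p(1)])
      have sr: "s = r" using mp_eq[OF s(1)] p(2) s(2) by (auto simp: RM_def)
      note s = s[unfolded sr]
      define d' where "d' = mp (n - r) \<phi>'"
      have m': "md (n - r) \<phi>' d'" unfolding d'_def by (rule md_mp[OF s(3)])
      then have "d' dvd d" using s(5) by (simp add: md_def)
      then obtain e where e: "d = d' * e" by (rule dvdE)
      have "degree d' \<le> r \<and> e \<in> RM (r - degree d')"
        using RM_div[of d' e r] s(2) md_RM(1)[OF s(3) m'] e by simp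
      then have "(degree d', \<phi>', e) \<in> X" using s(3) by (simp add: X_def WD_def d'_def)
      moreover have "g (degree d', \<phi>', e) = \<phi>" unfolding g_def s(4) by (simp add: d'_def[symmetric] e mult.commute)
      ultimately show "\<phi> \<in> g ` X" by (metis imageI)
    qed
  qed
  then have "card (WD n r) = card X" by (metis bij_betw_same_card)
  also have "... = (\<Sum>j\<le>r. card (WD (n - r) j \<times> RM (r - j)))"
    unfolding X_def using finite_HW finite_RM by (subst card_SigmaI) (auto simp: WD_def)
  finally show ?thesis by (simp add: card_cartesian_product card_RM mult.commute)
qed

text \<open>Burnside's lemma, orbit by orbit: the Hermitian matrices with kernel sizes
  \<open>\<phi>\<close> form one unitary orbit. With a unitary \<open>y B\<close> that conjugates a
  base point \<open>B1\<close> to \<open>B\<close>, the pairs over the orbit correspond to unitaries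
  by \<open>Y = X * y B\<close>, and \<open>B\<close> is recovered as
  \<open>Y * B1 * star Y\<close>.\<close>

lemma card_DD: "card (DD n) = card (hu.U n) * card (HW n)"
proof (rule card_fibres[where f = "\<lambda>x. kd n (snd x)"])
  show "finite (DD n)" by (rule finite_subset[of _ "hu.M n n \<times> hu.M n n"]) (auto simp: DD_def hu.U_def hu.H_def)
  show "finite (HW n)" by (rule finite_HW)
  show "kd n (snd x) \<in> HW n" if "x \<in> DD n" for x using that by (auto simp: DD_def HW_def)
  fix \<phi> assume "\<phi> \<in> HW n"
  then obtain B1 where B1: "B1 \<in> hu.H n" "\<phi> = kd n B1" by (auto simp: HW_def)
  have HM: "B \<in> hu.M n n" "star B = B" if "B \<in> hu.H n" for B using that by (auto simp: hu.H_def)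
  have UM: "Q \<in> hu.M n n" "star Q * Q = eid n" "Q * star Q = eid n" if "Q \<in> hu.U n" for Q using that by (auto simp: hu.U_def)
  define y where "y B = (SOME Q. Q \<in> hu.U n \<and> B * Q = Q * B1)" for B
  have y: "y B \<in> hu.U n" "B * y B = y B * B1" if "B \<in> hu.H n" "kd n B = \<phi>" for B
  proof -
    have "sim n B1 B" using that B1 HM by (intro sim_if_kd_eq) auto
    then have "\<exists>Q. Q \<in> hu.U n \<and> B * Q = Q * B1" using unitary_if_sim[OF B1(1) that(1)] by metis
    from someI_ex[OF this] show "y B \<in> hu.U n" "B * y B = y B * B1" by (auto simp: y_def)
  qed
  have Um: "Q * R \<in> hu.U n" if "Q \<in> hu.U n" "R \<in> hu.U n" for Q R
  proof (rule hu.in_U_I)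
    show "Q * R \<in> hu.M n n" using UM that by (auto intro: hu.M_mult)
    show "star (Q * R) * (Q * R) = eid n" using UM that hu.M_l[OF UM(1)[OF that(2)]] by (simp add: star_mult mult.assoc assoc_l[OF UM(2)[OF that(1)]])
  qed
  have Us: "star Q \<in> hu.U n" if "Q \<in> hu.U n" for Q using UM[OF that] by (auto simp: hu.U_def intro: hu.M_st)
  have "bij_betw (\<lambda>(X, B). X * y B) {x \<in> DD n. kd n (snd x) = \<phi>} (hu.U n)"
  proof (rule bij_betw_byWitness[where f' = "\<lambda>Y. (Y * star (y (Y * B1 * star Y)), Y * B1 * star Y)"])
    have fw: "X * y B * B1 * star (X * y B) = B \<and> X * y B * star (y B) = X" if x: "(X, B) \<in> DD n" "kd n B = \<phi>" for X B
    proof -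
      have X: "X \<in> hu.U n" "B \<in> hu.H n" "X * B = B * X" using x by (auto simp: DD_def)
      note yB = y[OF X(2) x(2)]
      have XM: "X * eid n = X" using UM(1)[OF X(1)] by (rule hu.M_r)
      have "X * y B * B1 * star (X * y B) = X * (y B * B1) * star (y B) * star X" by (simp add: star_mult mult.assoc)
      also have "... = X * B * (y B * star (y B)) * star X" unfolding yB(2)[symmetric] by (simp add: mult.assoc)
      also have "... = B * X * star X" unfolding UM(3)[OF yB(1)] X(3) by (simp only: mult.assoc hu.M_l[OF hu.M_st[OF UM(1)[OF X(1)]]])
      also have "... = B" using UM(3)[OF X(1)] HM(1)[OF X(2)] by (simp add: mult.assoc hu.M_r)
      finally show ?thesis by (simp add: mult.assoc UM(3)[OF yB(1)] XM)
    qed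
    then show "\<forall>a\<in>{x \<in> DD n. kd n (snd x) = \<phi>}.
      (\<lambda>Y. (Y * star (y (Y * B1 * star Y)), Y * B1 * star Y)) (case a of (X, B) => X * y B) = a" by auto
    have bw: "Y * B1 * star Y \<in> hu.H n \<and> kd n (Y * B1 * star Y) = \<phi>" if Y: "Y \<in> hu.U n" for Y
    proof
      show H: "Y * B1 * star Y \<in> hu.H n"
        using UM(1)[OF Y] HM[OF B1(1)] by (auto simp: hu.H_def star_mult mult.assoc intro!: hu.M_mult hu.M_st)
      have "sim n B1 (Y * B1 * star Y)"
        unfolding sim_def
        by (rule bexI[OF _ UM(1)[OF Y]], rule bexI[OF _ hu.M_st[OF UM(1)[OF Y]]])
          (use UM[OF Y] hu.M_r[OF HM(1)[OF B1(1)]] in \<open>simp add: mult.assoc\<close>)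
      then show "kd n (Y * B1 * star Y) = \<phi>" using kd_sim[OF HM(1)[OF B1(1)]] B1(2) by simp
    qed
    show "\<forall>Y\<in>hu.U n. (case (Y * star (y (Y * B1 * star Y)), Y * B1 * star Y) of (X, B) => X * y B) = Y"
    proof
      fix Y assume Y: "Y \<in> hu.U n"
      have "Y * eid n = Y" using UM(1)[OF Y] by (rule hu.M_r)
      then show "(case (Y * star (y (Y * B1 * star Y)), Y * B1 * star Y) of (X, B) => X * y B) = Y"
        using y[of "Y * B1 * star Y"] bw[OF Y] UM(2) by (simp add: mult.assoc)
    qed
    show "(\<lambda>(X, B). X * y B) ` {x \<in> DD n. kd n (snd x) = \<phi>} \<subseteq> hu.U n"
      using Um y by (auto simp: DD_def)
    show "(\<lambda>Y. (Y * star (y (Y * B1 * star Y)), Y * B1 * star Y)) ` hu.U n \<subseteq> {x \<in> DD n. kd n (snd x) = \<phi>}"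
    proof (rule image_subsetI)
      fix Y assume Y: "Y \<in> hu.U n"
      define B where "B = Y * B1 * star Y"
      have B: "B \<in> hu.H n" "kd n B = \<phi>" using bw[OF Y] by (auto simp: B_def)
      note yB = y[OF B]
      have sy: "star (y B) * B = B1 * star (y B)" using arg_cong[OF yB(2), of star] by (simp add: star_mult HM B B1)
      have "Y * star (y B) * B = Y * B1 * star (y B)" using sy by (simp add: mult.assoc)
      also have "... = B * (Y * star (y B))"
      proof -
        have "B * (Y * star (y B)) = Y * (B1 * (star Y * Y)) * star (y B)" by (simp add: B_def mult.assoc)
        then show ?thesis using UM(2)[OF Y] hu.M_r[OF HM(1)[OF B1(1)]] by simp
      qed
      finally show "(Y * star (y (Y * B1 * star Y)), Y * B1 * star Y) \<in> {x \<in> DD n. kd n (snd x) = \<phi>}"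
        unfolding B_def[symmetric] using B Um[OF Y Us[OF yB(1)]] by (simp add: DD_def)
    qed
  qed
  then show "card {x \<in> DD n. kd n (snd x) = \<phi>} = card (hu.U n)" by (rule bij_betw_same_card)
qed

text \<open>By \<open>card_DD\<close> the coefficients are numbers of classes. Sorted by the degree
  of the minimal polynomial, \<open>card_WD\<close> turns them into the recursion of
  \<open>iprod_recursion\<close> with weights \<open>q ^ m\<close>.\<close>

lemma ser_DD_eq: "ser DD = iprod (Abs_fps (\<lambda>m. real q ^ m))"
proof -
  define c where "c k = Abs_fps (\<lambda>n. real (card (WD n k)))" for k
  have c0: "c 0 = 1" by (rule fps_ext) (simp add: c_def card_WD_0)
  have "ser DD = c 0 * iprod (Abs_fps (\<lambda>m. real q ^ m))"
  proof (rule iprod_recursion[where c = c])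
    show "(\<lambda>m. real q ^ m) 0 = 1" by simp
    show "c k = fps_X ^ k * (\<Sum>j\<le>k. fps_const (real q ^ (k - j)) * c j)" if "k > 0" for k
    proof (rule fps_ext)
      fix n
      show "fps_nth (c k) n = fps_nth (fps_X ^ k * (\<Sum>j\<le>k. fps_const (real q ^ (k - j)) * c j)) n"
      proof (cases "n < k")
        case True
        then show ?thesis by (simp add: c_def WD_gt fps_X_power_mult_nth)
      next
        case False
        then show ?thesis using card_WD[of k n] that by (simp add: c_def fps_X_power_mult_nth fps_sum_nth)
      qed
    qed
    show "fps_nth (ser DD) N = (\<Sum>k\<le>N. fps_nth (c k) N)" for N
    proof -
      have "card (HW N) = (\<Sum>k\<in>{..N}. card {\<phi> \<in> HW N. degree (mp N \<phi>) = k})"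
      proof (rule card_fibres_sum[OF finite_HW])
        show "degree (mp N \<phi>) \<in> {..N}" if "\<phi> \<in> HW N" for \<phi>
        proof (rule ccontr)
          assume "degree (mp N \<phi>) \<notin> {..N}"
          then have "\<phi> \<in> WD N (degree (mp N \<phi>))" "N < degree (mp N \<phi>)" using that by (auto simp: WD_def)
          then show False using WD_gt by blast
        qed
      qed simp
      moreover have "hu.U N ~= {}" using hu.card_U_pos[of N] by auto
      ultimately show ?thesis by (simp add: ser_def card_DD c_def WD_def)
    qed
  qed
  then show ?thesis by (simp add: c0)
qed

end

section \<open>Convergence of the double product\<close>

text \<open>The l1-norm of the truncation at degree \<open>N\<close>. It is submultiplicative, so
  the usual estimates for products of numbers carry over.\<close>

definition cnorm :: "nat => real fps => real" where
  "cnorm N f = (\<Sum>k\<le>N. \<bar>fps_nth f k\<bar>)"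

lemma cnorm_nonneg: "cnorm N f \<ge> 0"
  by (simp add: cnorm_def sum_nonneg)

lemma abs_nth_le_cnorm: "n \<le> N ==> \<bar>fps_nth f n\<bar> \<le> cnorm N f"
  unfolding cnorm_def by (rule member_le_sum) auto

lemma cnorm_1 [simp]: "cnorm N 1 = 1"
  unfolding cnorm_def by (induction N) auto

lemma cnorm_add: "cnorm N (f + g) \<le> cnorm N f + cnorm N g"
  unfolding cnorm_def sum.distrib[symmetric] by (rule sum_mono) (simp add: abs_triangle_ineq)

lemma cnorm_mult: "cnorm N (f * g) \<le> cnorm N f * cnorm N g"
proof -
  have "cnorm N (f * g) \<le> (\<Sum>k\<le>N. \<Sum>i\<le>k. \<bar>fps_nth f i\<bar> * \<bar>fps_nth g (k - i)\<bar>)"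
    unfolding cnorm_def fps_mult_nth
    by (intro sum_mono order_trans[OF sum_abs]) (simp add: abs_mult atLeast0AtMost)
  also have "... = (\<Sum>(i, j)\<in>{(i, j). i + j \<le> N}. \<bar>fps_nth f i\<bar> * \<bar>fps_nth g j\<bar>)"
    using sum.triangle_reindex_eq[of "\<lambda>i j. \<bar>fps_nth f i\<bar> * \<bar>fps_nth g j\<bar>" N] by simp
  also have "... \<le> (\<Sum>(i, j)\<in>{..N} \<times> {..N}. \<bar>fps_nth f i\<bar> * \<bar>fps_nth g j\<bar>)"
    by (rule sum_mono2) auto
  also have "... = cnorm N f * cnorm N g"
    unfolding cnorm_def by (simp add: sum_product sum.cartesian_product)
  finally show ?thesis .
qed

text \<open>Induction through \<open>f a * P - 1 = (f a - 1) * P + (P - 1)\<close> and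
  \<open>1 + h \<le> exp h\<close>.\<close>

lemma cnorm_prod_le:
  assumes "finite A"
  shows "cnorm N (\<Prod>x\<in>A. f x) \<le> exp (\<Sum>x\<in>A. cnorm N (f x - 1))"
    and "cnorm N ((\<Prod>x\<in>A. f x) - 1) \<le> exp (\<Sum>x\<in>A. cnorm N (f x - 1)) - 1"
proof -
  have "cnorm N (\<Prod>x\<in>A. f x) \<le> exp (\<Sum>x\<in>A. cnorm N (f x - 1)) \<and>
    cnorm N ((\<Prod>x\<in>A. f x) - 1) \<le> exp (\<Sum>x\<in>A. cnorm N (f x - 1)) - 1"
    using assms
  proof (induction A rule: finite_induct)
    case empty
    then show ?case by (simp add: cnorm_def)
  next
    case (insert a A)
    let ?P = "\<Prod>x\<in>A. f x" and ?s = "\<Sum>x\<in>A. cnorm N (f x - 1)" and ?h = "cnorm N (f a - 1)"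
    have "?h \<ge> 0" by (rule cnorm_nonneg)
    have h: "1 + ?h \<le> exp ?h" by (rule exp_ge_add_one_self)
    have "f a * ?P - 1 = (f a - 1) * ?P + (?P - 1)" by (simp add: algebra_simps)
    then have "cnorm N (f a * ?P - 1) \<le> ?h * cnorm N ?P + cnorm N (?P - 1)"
      by (simp only: order_trans[OF cnorm_add add_right_mono[OF cnorm_mult]])
    also have "... \<le> ?h * exp ?s + (exp ?s - 1)"
      using insert.IH \<open>?h \<ge> 0\<close> by (intro add_mono mult_left_mono) auto
    also have "... = (1 + ?h) * exp ?s - 1" by (simp add: algebra_simps)
    also have "... \<le> exp ?h * exp ?s - 1" using h by (intro diff_right_mono mult_right_mono) auto
    finally have 1: "cnorm N (f a * ?P - 1) \<le> exp (?h + ?s) - 1" by (simp add: exp_add)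
    have "cnorm N (f a * ?P) \<le> cnorm N (f a * ?P - 1) + 1"
      using cnorm_add[of N "f a * ?P - 1" 1] by simp
    with 1 show ?case using insert.hyps by simp
  qed
  then show "cnorm N (\<Prod>x\<in>A. f x) \<le> exp (\<Sum>x\<in>A. cnorm N (f x - 1))"
    "cnorm N ((\<Prod>x\<in>A. f x) - 1) \<le> exp (\<Sum>x\<in>A. cnorm N (f x - 1)) - 1" by auto
qed

lemma geometric_compose:
  fixes a :: real
  assumes "i > 0"
  shows "1 / (1 - fps_const a * fps_X ^ i) = Abs_fps (\<lambda>n. a ^ n) oo fps_X ^ i"
proof -
  have 1: "Abs_fps (\<lambda>n. a ^ n) * (1 - fps_const a * fps_X) = 1"
    by (rule fps_ext) (auto simp: fps_mult_linear_nth gr0_conv_Suc split: nat.split)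
  have c: "(1 - fps_const a * fps_X) oo fps_X ^ i = 1 - fps_const a * fps_X ^ i"
    using assms by (simp add: fps_compose_sub_distrib fps_compose_mult_distrib)
  have "(Abs_fps (\<lambda>n. a ^ n) oo fps_X ^ i) * ((1 - fps_const a * fps_X) oo fps_X ^ i) = 1"
    using assms by (simp add: fps_compose_mult_distrib[symmetric] 1)
  then have e: "(Abs_fps (\<lambda>n. a ^ n) oo fps_X ^ i) * (1 - fps_const a * fps_X ^ i) = 1" unfolding c .
  then have "inverse (1 - fps_const a * fps_X ^ i) = Abs_fps (\<lambda>n. a ^ n) oo fps_X ^ i"
    by (intro fps_inverse_unique) (simp add: mult.commute)
  moreover have "fps_nth (1 - fps_const a * fps_X ^ i) 0 ~= 0" using assms by simp
  ultimately show ?thesis by (simp add: fps_divide_unit)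
qed

lemma cnorm_compose_le:
  assumes "i > 0" "fps_nth f 0 = 1"
  shows "cnorm N ((f oo fps_X ^ i) - 1) \<le> cnorm N (f - 1)"
proof -
  have "cnorm N ((f oo fps_X ^ i) - 1) = (\<Sum>k\<le>N. if i dvd k then \<bar>fps_nth (f - 1) (k div i)\<bar> else 0)"
    unfolding cnorm_def using assms
    by (intro sum.cong refl) (auto simp: fps_nth_compose_X_power dvd_div_eq_0_iff)
  also have "... = (\<Sum>k\<in>{k \<in> {..N}. i dvd k}. \<bar>fps_nth (f - 1) (k div i)\<bar>)"
    by (rule sum.inter_filter[symmetric]) simp
  also have "... = (\<Sum>m\<in>(\<lambda>k. k div i) ` {k \<in> {..N}. i dvd k}. \<bar>fps_nth (f - 1) m\<bar>)"
    by (rule sum.reindex[symmetric, unfolded o_def]) (auto simp: inj_on_def elim!: dvdE)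
  also have "... \<le> cnorm N (f - 1)"
    unfolding cnorm_def by (rule sum_mono2) (auto intro: order_trans[OF div_le_dividend])
  finally show ?thesis .
qed

text \<open>Subtracting 1 removes the constant term, and every other coefficient carries a factor
  \<open>c\<close>, so the bound tends to 0 with \<open>c\<close>.\<close>

lemma cnorm_scale_le:
  assumes c: "\<bar>c\<bar> \<le> b" "b \<ge> 1" and f: "fps_nth f 0 = 1"
  shows "cnorm N (fps_scale c f - 1) \<le> \<bar>c\<bar> * (b ^ N * cnorm N f)"
proof -
  have "cnorm N (fps_scale c f - 1) \<le> (\<Sum>k\<le>N. \<bar>c\<bar> * (b ^ N * \<bar>fps_nth f k\<bar>))"
    unfolding cnorm_def
  proof (rule sum_mono)
    fix k assume k: "k \<in> {..N}"
    show "\<bar>fps_nth (fps_scale c f - 1) k\<bar> \<le> \<bar>c\<bar> * (b ^ N * \<bar>fps_nth f k\<bar>)"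
    proof (cases k)
      case 0
      then show ?thesis using f c by simp
    next
      case (Suc m)
      have "\<bar>c\<bar> ^ m \<le> b ^ m" using c by (intro power_mono) auto
      also have "... \<le> b ^ N" using c k Suc by (intro power_increasing) auto
      finally have "\<bar>c\<bar> * (\<bar>c\<bar> ^ m * \<bar>fps_nth f k\<bar>) \<le> \<bar>c\<bar> * (b ^ N * \<bar>fps_nth f k\<bar>)"
        by (intro mult_left_mono mult_right_mono) auto
      then show ?thesis using Suc by (simp add: abs_mult power_abs mult.assoc)
    qed
  qed
  then show ?thesis by (simp add: cnorm_def sum_distrib_left)
qed

lemma sum_geometric_le:
  fixes r :: real
  assumes "0 \<le> r" "r < 1"
  shows "(\<Sum>l\<in>{L..<M}. r ^ l) \<le> r ^ L / (1 - r)"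
proof (cases "L \<le> M")
  case True
  have "(\<Sum>l\<in>{L..<M}. r ^ l) * (1 - r) = r ^ L - r ^ M"
    using True by (induction M rule: dec_induct) (simp_all add: distrib_right, simp add: algebra_simps)
  then have "(\<Sum>l\<in>{L..<M}. r ^ l) = (r ^ L - r ^ M) / (1 - r)" using assms by (simp add: eq_divide_eq)
  then show ?thesis using assms by (simp add: divide_right_mono)
next
  case False
  then show ?thesis using assms by simp
qed

text \<open>Up to degree \<open>N\<close> only \<open>i \<le> N\<close> matters. For fixed
  \<open>i\<close> the first \<open>L\<close> factors telescope by \<open>euler_fps_scale\<close>:
  multiplied by the Euler series at \<open>a L * X ^ i\<close> they give the one at
  \<open>q * X ^ i\<close>, and the multiplier tends to 1. A finite index set containing all pairs
  with \<open>i \<le> N\<close> and \<open>l < L\<close> adds factors whose total norm is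
  geometrically small in \<open>L\<close>.\<close>

lemma euler_double_product:
  fixes q :: nat
  assumes q: "q > 1"
  shows "fps_has_prod (\<lambda>(i, l). 1 / (1 - fps_const ((-1) ^ l / real q powi (int l - 1)) * fps_X ^ i))
    ({1..} \<times> UNIV) (iprod (fps_scale (real q) (euler_fps (- 1 / real q))))"
  unfolding fps_has_prod_def
proof
  fix N
  let ?p = "- 1 / real q" let ?E = "euler_fps ?p"
  define r where "r = 1 / real q"
  \<comment> \<open>The constant of the factor at \<open>l\<close> is \<open>q * p ^ l\<close> for
    \<open>p = - 1 / q\<close>, which makes the product over \<open>l\<close> an Euler
    product.\<close>
  define a where "a l = real q * ?p ^ l" for l
  define f where "f = (\<lambda>(i, l). 1 / (1 - fps_const ((-1) ^ l / real q powi (int l - 1)) * fps_X ^ i :: real fps))"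
  have r: "0 \<le> r" "r < 1" "r \<le> 1" using q by (auto simp: r_def)
  have p1: "\<bar>?p\<bar> < 1" using q by simp
  have al: "(-1) ^ l / real q powi (int l - 1) = a l" for l
    using q by (simp add: a_def power_int_diff power_divide power_minus[of "1 / real q"])
  have absa: "\<bar>a l\<bar> = real q * r ^ l" for l
    by (simp add: a_def r_def abs_mult power_abs power_divide)
  have f: "f (i, l) = Abs_fps (\<lambda>n. a l ^ n) oo fps_X ^ i" if "i > 0" for i l
    unfolding f_def using geometric_compose[OF that, of "a l"] by (simp add: al)
  define B where "B = real q ^ N * cnorm N (Abs_fps (\<lambda>n. 1)) * real q"
  have B: "B \<ge> 0" unfolding B_def by (intro mult_nonneg_nonneg cnorm_nonneg) auto
  have h: "cnorm N (f (i, l) - 1) \<le> (if i \<le> N then B * r ^ l else 0)" if "i > 0" for i l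
  proof (cases "i \<le> N")
    case True
    have "Abs_fps (\<lambda>n. a l ^ n) = fps_scale (a l) (Abs_fps (\<lambda>n. 1))" by (rule fps_ext) simp
    then have "cnorm N (f (i, l) - 1) \<le> cnorm N (fps_scale (a l) (Abs_fps (\<lambda>n. 1)) - 1)"
      unfolding f[OF that] using cnorm_compose_le[OF that, of "fps_scale (a l) (Abs_fps (\<lambda>n. 1))" N] by simp
    also have "... \<le> \<bar>a l\<bar> * (real q ^ N * cnorm N (Abs_fps (\<lambda>n. 1)))"
      using q r power_le_one[OF r(1,3), of l] by (intro cnorm_scale_le) (auto simp: absa mult_left_le)
    finally show ?thesis using True by (simp add: absa B_def mult_ac)
  next
    case False
    have "eqv N (f (i, l)) 1" unfolding f[OF that] by (rule eqv_compose_X_power) (use False in auto)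
    then have "cnorm N (f (i, l) - 1) = 0" by (simp add: cnorm_def eqv_def)
    then show ?thesis using False by simp
  qed
  define box where "box L = {1..N} \<times> {..<L}" for L :: nat
  define S where "S c = fps_scale c ?E" for c
  have S0: "fps_nth (S c) 0 = 1" for c by (simp add: S_def)
  define Q where "Q L = (\<Prod>i=1..N. S (a L) oo fps_X ^ i)" for L
  have box1: "S (a L) * (\<Prod>l<L. Abs_fps (\<lambda>n. a l ^ n)) = S (a 0)" for L
  proof (induction L)
    case (Suc L)
    have "S (a (Suc L)) = S (a L) * (1 - fps_const (a L) * fps_X)"
      unfolding S_def euler_fps_scale[OF p1] by (simp add: a_def mult.commute mult.left_commute)
    moreover have "(1 - fps_const (a L) * fps_X) * Abs_fps (\<lambda>n. a L ^ n) = 1"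
    proof -
      have "Abs_fps (\<lambda>n. a L ^ n) * (1 - fps_const (a L) * fps_X) = 1"
        by (rule fps_ext) (auto simp: fps_mult_linear_nth gr0_conv_Suc split: nat.split)
      then show ?thesis by (simp add: mult.commute)
    qed
    ultimately have "S (a (Suc L)) * Abs_fps (\<lambda>n. a L ^ n) = S (a L)" by (metis mult.assoc mult.right_neutral)
    then show ?case using Suc by (simp add: mult_ac) (metis mult.assoc mult.commute)
  qed simp
  have boxQ: "(\<Prod>x\<in>box L. f x) * Q L = (\<Prod>i=1..N. S (a 0) oo fps_X ^ i)" for L
  proof -
    have "(\<Prod>x\<in>box L. f x) = (\<Prod>i=1..N. \<Prod>l<L. f (i, l))"
      unfolding box_def by (simp add: prod.cartesian_product)
    also have "... = (\<Prod>i=1..N. (\<Prod>l<L. Abs_fps (\<lambda>n. a l ^ n)) oo fps_X ^ i)"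
    proof (rule prod.cong[OF refl])
      fix i assume "i \<in> {1..N}"
      then have i: "i > 0" by simp
      show "(\<Prod>l<L. f (i, l)) = (\<Prod>l<L. Abs_fps (\<lambda>n. a l ^ n)) oo fps_X ^ i"
        using i by (induction L) (simp_all add: f[OF i] fps_compose_mult_distrib)
    qed
    finally have "(\<Prod>x\<in>box L. f x) * Q L = (\<Prod>i=1..N. ((\<Prod>l<L. Abs_fps (\<lambda>n. a l ^ n)) oo fps_X ^ i) * (S (a L) oo fps_X ^ i))"
      by (simp add: Q_def prod.distrib)
    also have "... = (\<Prod>i=1..N. S (a 0) oo fps_X ^ i)"
      by (intro prod.cong refl) (simp add: fps_compose_mult_distrib[symmetric] box1[symmetric, of L] mult.commute)
    finally show ?thesis .
  qed
  have PN: "fps_nth (iprod (fps_scale (real q) ?E)) N = fps_nth (\<Prod>i=1..N. S (a 0) oo fps_X ^ i) N"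
    by (simp add: iprod_def S_def a_def)
  \<comment> \<open>\<open>D L\<close> bounds the total norm of the factors with second index at
    least \<open>L\<close>, and \<open>r ^ L * C\<close> bounds the norm of
    \<open>S (a L) - 1\<close>.\<close>
  define D where "D L = real N * (B * (r ^ L / (1 - r)))" for L
  define C where "C = real q * (real q ^ N * cnorm N ?E)"
  have part: "(\<Sum>x\<in>Y. cnorm N (f x - 1)) \<le> D L" if Y: "finite Y" "Y \<subseteq> {1..} \<times> {L..}" for Y L
  proof -
    define M where "M = Suc (Max (insert 0 (snd ` Y)))"
    have M: "l < M" if "(i, l) \<in> Y" for i l
      unfolding M_def using Y(1) that by (intro le_imp_less_Suc Max_ge) (auto simp: image_iff intro: bexI[of _ "(i, l)"])
    have "(\<Sum>x\<in>Y. cnorm N (f x - 1)) \<le> (\<Sum>(i, l)\<in>Y. if i \<le> N then B * r ^ l else 0)"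
    proof (rule sum_mono)
      fix x assume x: "x \<in> Y"
      obtain i l where il: "x = (i, l)" by (cases x)
      have "i > 0" using x Y(2) by (auto simp: il)
      then show "cnorm N (f x - 1) \<le> (case x of (i, l) => if i \<le> N then B * r ^ l else 0)"
        using h[of i l] by (simp add: il)
    qed
    also have "... = (\<Sum>(i, l)\<in>Y \<inter> {1..N} \<times> {L..<M}. B * r ^ l)"
    proof (rule sum.mono_neutral_cong_right)
      show "\<forall>x\<in>Y - Y \<inter> {1..N} \<times> {L..<M}. (case x of (i, l) => if i \<le> N then B * r ^ l else 0) = 0"
      proof
        fix x assume x: "x \<in> Y - Y \<inter> {1..N} \<times> {L..<M}"
        obtain i l where il: "x = (i, l)" by (cases x)
        have "(i, l) \<in> Y" using x il by simp
        then have "1 \<le> i" "L \<le> l" "l < M" using Y(2) M by auto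
        then have "\<not> i \<le> N" using x by (auto simp: il)
        then show "(case x of (i, l) => if i \<le> N then B * r ^ l else 0) = 0" by (simp add: il)
      qed
    qed (use Y in auto)
    also have "... \<le> (\<Sum>(i, l)\<in>{1..N} \<times> {L..<M}. B * r ^ l)"
      by (rule sum_mono2) (use B r in auto)
    also have "... = real N * (B * (\<Sum>l\<in>{L..<M}. r ^ l))"
      by (simp add: sum.cartesian_product[symmetric] sum_distrib_left)
    also have "... \<le> D L"
      unfolding D_def using sum_geometric_le[OF r(1,2)] B by (intro mult_left_mono) auto
    finally show ?thesis .
  qed
  \<comment> \<open>With \<open>R\<close> the product outside the box, the deviation is the box
    product times \<open>(R - 1) - (Q L - 1)\<close>: the surplus factors, against the part of the
    limit that the box lacks.\<close>
  have key: "\<bar>fps_nth (\<Prod>x\<in>Y. f x) N - fps_nth (iprod (fps_scale (real q) ?E)) N\<bar>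
      \<le> exp (D 0) * (exp (D L) - 1) + exp (D 0) * (exp (real N * (r ^ L * C)) - 1)"
    if Y: "finite Y" "box L \<subseteq> Y" "Y \<subseteq> {1..} \<times> UNIV" for Y L
  proof -
    let ?b = "\<Prod>x\<in>box L. f x" let ?R = "\<Prod>x\<in>Y - box L. f x"
    let ?W = "Y - box L - {N<..} \<times> UNIV"
    have "(\<Prod>x\<in>Y. f x) = ?b * ?R" using Y by (simp add: prod.subset_diff mult.commute)
    moreover have "fps_nth (iprod (fps_scale (real q) ?E)) N = fps_nth (?b * Q L) N" unfolding PN boxQ ..
    ultimately have "fps_nth (\<Prod>x\<in>Y. f x) N - fps_nth (iprod (fps_scale (real q) ?E)) N = fps_nth (?b * (?R - 1) + ?b * (- (Q L - 1))) N"
      by (simp add: algebra_simps)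
    then have "\<bar>fps_nth (\<Prod>x\<in>Y. f x) N - fps_nth (iprod (fps_scale (real q) ?E)) N\<bar>
      \<le> cnorm N (?b * (?R - 1) + ?b * (- (Q L - 1)))" by (simp only: abs_nth_le_cnorm[OF order_refl])
    also have "... \<le> cnorm N ?b * cnorm N (?R - 1) + cnorm N ?b * cnorm N (- (Q L - 1))"
      by (rule order_trans[OF cnorm_add add_mono[OF cnorm_mult cnorm_mult]])
    also have "cnorm N (- (Q L - 1)) = cnorm N (Q L - 1)" by (simp add: cnorm_def abs_minus_commute)
    also have "cnorm N ?b * cnorm N (?R - 1) + cnorm N ?b * cnorm N (Q L - 1)
      \<le> exp (D 0) * (exp (D L) - 1) + exp (D 0) * (exp (real N * (r ^ L * C)) - 1)"
    proof (intro add_mono mult_mono cnorm_nonneg)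
      have fb: "finite (box L)" by (simp add: box_def)
      have "(\<Sum>x\<in>box L. cnorm N (f x - 1)) \<le> D 0" by (rule part) (auto simp: box_def)
      then show "cnorm N ?b \<le> exp (D 0)" using cnorm_prod_le(1)[OF fb, of N f] by (meson exp_le_cancel_iff order_trans)
      then show "cnorm N ?b \<le> exp (D 0)" .
      have "(\<Sum>x\<in>Y - box L. cnorm N (f x - 1)) = (\<Sum>x\<in>?W. cnorm N (f x - 1))"
      proof (rule sum.mono_neutral_right)
        show "\<forall>x\<in>(Y - box L) - ?W. cnorm N (f x - 1) = 0"
        proof
          fix x assume x: "x \<in> (Y - box L) - ?W"
          obtain i l where il: "x = (i, l)" by (cases x)
          have "i > 0" "\<not> i \<le> N" using x Y(3) by (auto simp: il)
          then show "cnorm N (f x - 1) = 0" using h[of i l] cnorm_nonneg[of N "f x - 1"] by (simp add: il)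
        qed
      qed (use Y in auto)
      also have "... \<le> D L" by (rule part) (use Y in \<open>auto simp: box_def\<close>)
      finally show "cnorm N (?R - 1) \<le> exp (D L) - 1"
        using cnorm_prod_le(2)[of "Y - box L" N f] Y(1) by (smt (verit) exp_le_cancel_iff finite_Diff)
      have aL: "\<bar>a L\<bar> \<le> real q" "\<bar>a L\<bar> = real q * r ^ L" using power_le_one[OF r(1,3), of L] by (auto simp: absa mult_left_le)
      have "(\<Sum>i=1..N. cnorm N ((S (a L) oo fps_X ^ i) - 1)) \<le> (\<Sum>i=1..N. r ^ L * C)"
      proof (rule sum_mono)
        fix i assume i: "i \<in> {1..N}"
        have "cnorm N ((S (a L) oo fps_X ^ i) - 1) \<le> cnorm N (S (a L) - 1)"
          by (rule cnorm_compose_le) (use i S0 in auto)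
        also have "... \<le> \<bar>a L\<bar> * (real q ^ N * cnorm N ?E)"
          unfolding S_def by (rule cnorm_scale_le[OF aL(1)]) (use q in auto)
        finally show "cnorm N ((S (a L) oo fps_X ^ i) - 1) \<le> r ^ L * C" by (simp add: aL(2) C_def mult_ac)
      qed
      then have "(\<Sum>i=1..N. cnorm N ((S (a L) oo fps_X ^ i) - 1)) \<le> real N * (r ^ L * C)" by simp
      then show "cnorm N (Q L - 1) \<le> exp (real N * (r ^ L * C)) - 1"
        unfolding Q_def using cnorm_prod_le(2)[of "{1..N}" N "\<lambda>i. S (a L) oo fps_X ^ i"] by (smt (verit) exp_le_cancel_iff finite_atLeastAtMost)
    qed auto
    finally show ?thesis .
  qed
  have rL: "(\<lambda>L. r ^ L) \<longlonglongrightarrow> 0" using r by (intro LIMSEQ_power_zero) auto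
  have "(\<lambda>L. exp (D 0) * (exp (D L) - 1) + exp (D 0) * (exp (real N * (r ^ L * C)) - 1)) \<longlonglongrightarrow>
    exp (D 0) * (exp (real N * (B * (0 / (1 - r)))) - 1) + exp (D 0) * (exp (real N * (0 * C)) - 1)"
    unfolding D_def[of L for L] by (intro tendsto_intros rL) (use r in auto)
  then have lim: "(\<lambda>L. exp (D 0) * (exp (D L) - 1) + exp (D 0) * (exp (real N * (r ^ L * C)) - 1)) \<longlonglongrightarrow> 0" by simp
  have "((\<lambda>F. fps_nth (\<Prod>x\<in>F. f x) N) \<longlongrightarrow> fps_nth (iprod (fps_scale (real q) ?E)) N) (finite_subsets_at_top ({1..} \<times> UNIV))"
  proof (rule tendstoI)
    fix \<epsilon> :: real assume "\<epsilon> > 0"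
    then obtain L where L: "exp (D 0) * (exp (D L) - 1) + exp (D 0) * (exp (real N * (r ^ L * C)) - 1) < \<epsilon>"
      using eventually_happens[OF order_tendstoD(2)[OF lim]] by auto
    show "\<forall>\<^sub>F F in finite_subsets_at_top ({1..} \<times> UNIV). dist (fps_nth (\<Prod>x\<in>F. f x) N) (fps_nth (iprod (fps_scale (real q) ?E)) N) < \<epsilon>"
      unfolding eventually_finite_subsets_at_top
    proof (intro exI[of _ "box L"] conjI allI impI)
      show "finite (box L)" "box L \<subseteq> {1..} \<times> UNIV" by (auto simp: box_def)
      fix Y assume "finite Y \<and> box L \<subseteq> Y \<and> Y \<subseteq> {1..} \<times> UNIV"
      then show "dist (fps_nth (\<Prod>x\<in>Y. f x) N) (fps_nth (iprod (fps_scale (real q) ?E)) N) < \<epsilon>"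
        using key[of Y L] L by (simp add: dist_real_def)
    qed
  qed
  then show "((\<lambda>F. fps_nth (\<Prod>x\<in>F. (\<lambda>(i, l). 1 / (1 - fps_const ((-1) ^ l / real q powi (int l - 1)) * fps_X ^ i)) x) N)
    \<longlongrightarrow> fps_nth (iprod (fps_scale (real q) ?E)) N) (finite_subsets_at_top ({1..} \<times> UNIV))"
    unfolding f_def .
qed

section \<open>Conclusion\<close>

definition of_mat :: "'a::comm_ring_1 mat => 'a fmat" where
  "of_mat A = of_fun (dim_row A) (dim_col A) (\<lambda>i j. A $$ (i, j))"

definition to_mat :: "nat => 'a::comm_ring_1 fmat => 'a mat" where
  "to_mat n X = Matrix.mat n n (\<lambda>(i, j). ent X i j)"

lemma to_mat_carrier [simp]: "to_mat n X \<in> carrier_mat n n"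
  by (simp add: to_mat_def)

lemma to_of_mat: "A \<in> carrier_mat n n ==> to_mat n (of_mat A) = A"
  by (rule eq_matI) (auto simp: to_mat_def of_mat_def)

lemma of_mat_M: "A \<in> carrier_mat n n ==> of_mat A \<in> MM n n"
  by (auto simp: of_mat_def MM_iff)

lemma of_to_mat: "X \<in> MM n n ==> of_mat (to_mat n X) = X"
  by (rule fmat_eqI) (auto simp: to_mat_def of_mat_def MM_iff)

lemma to_mat_mult: "X \<in> MM n n ==> to_mat n (X * Y) = to_mat n X * to_mat n Y"
  by (rule eq_matI) (auto simp: to_mat_def scalar_prod_def ent_times_MM atLeast0LessThan)

lemma to_mat_eq_iff: "X \<in> MM n n ==> Y \<in> MM n n ==> to_mat n X = to_mat n Y \<longleftrightarrow> X = Y"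
  using of_to_mat by metis

lemma bij_betw_to_mat:
  assumes "\<And>X. X \<in> MM n n ==> to_mat n X \<in> B \<longleftrightarrow> X \<in> A" "A \<subseteq> MM n n" "B \<subseteq> carrier_mat n n"
  shows "bij_betw (to_mat n) A B"
proof (rule bij_betw_byWitness[where f' = of_mat])
  show "\<forall>a\<in>A. of_mat (to_mat n a) = a" "\<forall>b\<in>B. to_mat n (of_mat b) = b"
    using assms of_to_mat to_of_mat by blast+
  show "to_mat n ` A \<subseteq> B" using assms by blast
  show "of_mat ` B \<subseteq> A"
  proof (rule image_subsetI)
    fix b assume "b \<in> B"
    then have "b \<in> carrier_mat n n" using assms(3) by blast
    then show "of_mat b \<in> A" using assms(1)[OF of_mat_M] to_of_mat \<open>b \<in> B\<close> by metis
  qed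
qed

context quad_field begin

lemma to_mat_star: "to_mat n (star X) = transpose_mat (mat_conj q (to_mat n X))"
  by (rule eq_matI) (auto simp: to_mat_def mat_conj_def)

lemma card_GU: "card (GU n q :: 'a mat set) = card (hu.U n)"
proof -
  have "to_mat n X \<in> GU n q \<longleftrightarrow> X \<in> hu.U n" if X: "X \<in> MM n n" for X :: "'a fmat"
  proof -
    have XM: "X \<in> hu.M n n" using X by (simp add: hu_M)
    have "to_mat n X \<in> GU n q \<longleftrightarrow> to_mat n (X * star X) = to_mat n (eid n)"
    proof -
      have "to_mat n (eid n :: 'a fmat) = 1\<^sub>m n" by (rule eq_matI) (auto simp: to_mat_def eid.rep_eq)
      then show ?thesis by (simp add: GU_def to_mat_mult[OF X] to_mat_star)
    qed
    also have "... \<longleftrightarrow> X * star X = eid n"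
      by (rule to_mat_eq_iff) (use hu.M_mult[OF XM hu.M_st[OF XM]] in \<open>simp_all add: hu_M MM_eid\<close>)
    also have "... \<longleftrightarrow> X \<in> hu.U n"
      using hu.in_U_I[OF XM] hu.inverse_commute[OF hu.M_st[OF XM] XM] by (auto simp: hu.U_def)
    finally show ?thesis .
  qed
  then have "bij_betw (to_mat n) (hu.U n) (GU n q :: 'a mat set)"
    by (rule bij_betw_to_mat) (auto simp: hu.U_def hu_M GU_def)
  then show ?thesis by (metis bij_betw_same_card)
qed

lemma card_GU_lie_commuting: "card (GU_lie_commuting n q :: ('a mat \<times> 'a mat) set) = card (CC n)"
proof -
  \<comment> \<open>A scalar with \<open>c ^ q = - c\<close> turns Hermitian matrices into elements
    of the Lie algebra. Both orders of a product are scaled by \<open>c * c\<close>, so commuting is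
    preserved.\<close>
  obtain c :: 'a where c: "c ~= 0" "c ^ q = - c" by (rule skew_ex)
  define t where "t = (\<lambda>X :: 'a fmat. to_mat n (sm c X))"
  define s where "s = (\<lambda>A :: 'a mat. sm (inverse c) (of_mat A))"
  have ts: "t (s A) = A" if "A \<in> carrier_mat n n" for A
    using that c by (simp add: t_def s_def sm_sm to_of_mat)
  have st: "s (t X) = X" if "X \<in> MM n n" for X
    using M_sm[of X n n c] that c by (simp add: t_def s_def sm_sm of_to_mat hu_M)
  have sM: "s A \<in> MM n n" if "A \<in> carrier_mat n n" for A
    using M_sm[of "of_mat A" n n "inverse c"] of_mat_M[OF that] by (simp add: s_def hu_M)
  have smM: "sm d X \<in> MM n n" if "X \<in> MM n n" for d and X :: "'a fmat" using M_sm[of X n n d] that by (simp add: hu_M)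
  have lie: "t X \<in> GU_lie n q \<longleftrightarrow> X \<in> hu.H n" if X: "X \<in> MM n n" for X
  proof -
    have XM: "X \<in> hu.M n n" using X by (simp add: hu_M)
    have m: "to_mat n (- sm c X) = - to_mat n (sm c X)" by (rule eq_matI) (auto simp: to_mat_def)
    have "t X \<in> GU_lie n q \<longleftrightarrow> to_mat n (star (sm c X)) = to_mat n (- sm c X)"
      unfolding t_def GU_lie_def m by (simp add: to_mat_star)
    also have "... \<longleftrightarrow> star (sm c X) = - sm c X"
      by (rule to_mat_eq_iff) (use smM[OF X] MM_star[OF smM[OF X]] smM[OF smM[OF X, of c], of "- 1"] in \<open>simp_all add: sm_left_minus\<close>)
    also have "... \<longleftrightarrow> sm c (star X - X) = 0" by (auto simp: star_sm c sm_simps sm_left_minus)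
    also have "... \<longleftrightarrow> X \<in> hu.H n" using c XM by (auto simp: sm_eq_0_iff hu.H_def)
    finally show ?thesis .
  qed
  have com: "t X * t Y = t Y * t X \<longleftrightarrow> X * Y = Y * X" if X: "X \<in> MM n n" and Y: "Y \<in> MM n n" for X Y
  proof -
    have "t X * t Y = t Y * t X \<longleftrightarrow> to_mat n (sm c X * sm c Y) = to_mat n (sm c Y * sm c X)"
      by (simp add: t_def to_mat_mult smM X Y)
    also have "... \<longleftrightarrow> sm c X * sm c Y = sm c Y * sm c X"
      by (rule to_mat_eq_iff) (auto intro!: MM_mult smM X Y)
    also have "... \<longleftrightarrow> sm (c * c) (X * Y - Y * X) = 0" by (simp add: sm_simps)
    finally show ?thesis using c by (simp add: sm_eq_0_iff)
  qed
  have "bij_betw (map_prod t t) (CC n) (GU_lie_commuting n q)"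
  proof (rule bij_betw_byWitness[where f' = "map_prod s s"])
    have HMM: "X \<in> MM n n" if "X \<in> hu.H n" for X using that by (simp add: hu.H_def hu_M)
    have LC: "A \<in> carrier_mat n n" if "A \<in> GU_lie n q" for A :: "'a mat" using that by (simp add: GU_lie_def)
    show "\<forall>a\<in>CC n. map_prod s s (map_prod t t a) = a" using st HMM by (auto simp: CC_def)
    show "\<forall>b\<in>GU_lie_commuting n q. map_prod t t (map_prod s s b) = b" using ts LC by (auto simp: GU_lie_commuting_def)
    show "map_prod t t ` CC n \<subseteq> GU_lie_commuting n q"
      using lie com HMM by (auto simp: CC_def GU_lie_commuting_def)
    show "map_prod s s ` GU_lie_commuting n q \<subseteq> CC n"
    proof (rule image_subsetI)
      fix b :: "'a mat \<times> 'a mat" assume "b \<in> GU_lie_commuting n q"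
      then obtain A B where b: "b = (A, B)" and A: "A \<in> GU_lie n q" and B: "B \<in> GU_lie n q" and AB: "A * B = B * A"
        by (auto simp: GU_lie_commuting_def)
      note AB' = LC[OF A] LC[OF B]
      have "s A \<in> hu.H n" "s B \<in> hu.H n" using lie[OF sM[OF AB'(1)]] lie[OF sM[OF AB'(2)]] ts AB' A B by simp_all
      moreover have "s A * s B = s B * s A" using com[OF sM[OF AB'(1)] sM[OF AB'(2)]] AB ts AB' by simp
      ultimately show "map_prod s s b \<in> CC n" by (simp add: b CC_def)
    qed
  qed
  then show ?thesis by (metis bij_betw_same_card)
qed

text \<open>\<open>ser DI\<close> is eliminated between \<open>ser CC = ser (CN b) * ser DI\<close>
  and \<open>ser DD = ser DN * ser DI\<close>; the factor \<open>ser DN\<close>, of constant term 1,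
  is cancelled at the end.\<close>

lemma ser_CC_eq: "ser CC = iprod (fps_scale (real q) (euler_fps (- 1 / real q)))"
proof -
  obtain b :: 'a where b: "b ^ q ~= b" by (rule nonreal_ex)
  let ?p = "- 1 / real q"
  have sq: "1 / real q ^ 2 = ?p\<^sup>2" by (simp add: power_divide)
  have "ser CC * iprod (euler_fps ?p) = ser (CN b) * (ser DN * ser DI)"
    by (simp add: ser_CC[of b] ser_CI_DI[OF b] ser_DN mult_ac)
  also have "... = (iprod (euler_fps (?p\<^sup>2)) oo fps_X ^ 2) * iprod (Abs_fps (\<lambda>m. real q ^ m))"
    unfolding ser_DD[symmetric] ser_DD_eq ser_CN[OF b] sq ..
  also have "... = iprod (fps_scale (real q) (euler_fps ?p)) * iprod (euler_fps ?p)"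
    using iprod_euler_identity[of "real q" ?p] q_gt_1 by (simp add: mult.commute)
  finally have e: "ser CC * iprod (euler_fps ?p) = iprod (fps_scale (real q) (euler_fps ?p)) * iprod (euler_fps ?p)" .
  have "iprod (euler_fps ?p) ~= 0" using iprod_nth_0[of "euler_fps ?p"] by (metis fps_zero_nth zero_neq_one)
  with e show ?thesis by simp
qed

end

theorem theorem3p7:
  fixes q :: nat
  assumes "primepow q"
    and "card (UNIV :: 'a::{field,finite} set) = q ^ 2"
  shows "fps_has_prod
           (\<lambda>(i, l). 1 / (1 - fps_const ((-1) ^ l / real q powi (int l - 1)) * fps_X ^ i))
           ({1..} \<times> (UNIV :: nat set))
           (Abs_fps (\<lambda>n. real (card (GU_lie_commuting n q :: ('a mat \<times> 'a mat) set))
                         / real (card (GU n q :: 'a mat set))))"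
proof -
  interpret quad_field q "TYPE('a)" using assms by unfold_locales
  have "Abs_fps (\<lambda>n. real (card (GU_lie_commuting n q :: ('a mat \<times> 'a mat) set)) / real (card (GU n q :: 'a mat set))) = ser CC"
    by (simp add: ser_def card_GU card_GU_lie_commuting)
  then show ?thesis using euler_double_product[OF q_gt_1] by (simp add: ser_CC_eq)
qed

end
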